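(* Let $\mathrm{Ricci}$ be the Ricci tensor of the quantum projective space of dimension $r$, defined with the splitting map $s_\wedge$ whose coefficients are $$c_{+-}=\frac{1}{1+q^{(\alpha_s,\alpha_s)}q^{2(\omega_s,2\rho)}},\qquad c_{-+}=\frac{1}{1+q^{-(\alpha_s,\alpha_s)}q^{-2(\omega_s,2\rho)}}.$$ Then the scalar curvature $\mathrm{scal}:=(\cdot,\cdot)(\mathrm{Ricci})\in\mathcal{B}$ is given by $$\mathrm{scal}=-q^{-r+1}\,[r]_q\,[r+1]_q.$$
   Context: **Quantum group data.** Fix an integer $r\ge 1$, a real number $0<q<1$ and $s\in\{1,r\}$. $U_q(\mathfrak{sl}_{r+1})$ is the quantized enveloping algebra with generators $K_i^{\pm1},E_i,F_i$, $1\le i\le r$ (Klimyk–Schmüdgen conventions: $\Delta(K_i)=K_i\otimes K_i$, $\Delta(E_i)=E_i\otimes K_i+1\otimes E_i$, $\Delta(F_i)=F_i\otimes 1+K_i^{-1}\otimes F_i$; $K_i$ acts on a vector of weight $\mu$ by $q^{(\alpha_i,\mu)}$). Here $\alpha_i$ are the simple roots, $\omega_i$ the fundamental weights, $\rho=\sum_i\omega_i$, $w_0$ the longest Weyl group element, $(\cdot,\cdot)$ on weights is the invariant form with $(\alpha_i,\alpha_i)=2$. Put $a=(\alpha_s,\alpha_s)=2$, $w=(\omega_s,\omega_s)$, $m=(\omega_s,2\rho)=r$. $V(\lambda)$ is the simple type 1 module of highest weight $\lambda$, $V=V(\omega_s)$, and $V^*$ is its dual with $(Xf)(v)=f(S(X)v)$,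 $S$ the antipode. $\hat{R}_{X,Y}:X\otimes Y\to Y\otimes X$ is the braiding on finite-dimensional type 1 modules determined by being a module map with $\hat{R}_{V(\lambda),V(\mu)}(v\otimes u)=q^{(\lambda,w_0\mu)}u\otimes v$ for $v$ a highest weight vector of $V(\lambda)$ and $u$ a lowest weight vector of $V(\mu)$. Let $(v_i)$ be a weight basis of $V$ with weights $\lambda_i$ and dual basis $(f^i)$ of $V^*$. Define $\mathsf{E}(f^i\otimes v_j)=\delta_{ij}$, $\mathsf{E}'(v_i\otimes f^j)=q^{(\lambda_i,2\rho)}\delta_{ij}$, $\mathsf{C}=\sum_i v_i\otimes f^i$, $\mathsf{C}'=\sum_i q^{-(\lambda_i,2\rho)}f^i\otimes v_i$. Also $[x]_q=\frac{q^x-q^{-x}}{q-q^{-1}}$. Subscripts indicate the tensor legs on which a map acts ($\mathsf{C}_n,\mathsf{C}'_n$ insert the element at legs $n,n+1$); products of maps are compositions (rightmost first), legs being renumbered after each contraction or insertion. Put $$\mathsf{S}_{123}=(\hat{R}_{V,V^*})_{23}(\hat{R}_{V,V})_{12}(\hat{R}_{V,V^*}^{-1})_{23},\quad \tilde{\mathsf{S}}_{234}=(\hat{R}_{V,V^*})_{23}(\hat{R}_{V^*,V^*}^{-1})_{34}(\hat{R}_{V,V^*}^{-1})_{23},\quad \mathsf{T}_{1234}=\mathsf{S}_{123}\tilde{\mathsf{S}}_{234}=\tilde{\mathsf{S}}_{234}\mathsf{S}_{123}$$ (acting on $V\otimes V^*\otimes V$, $V^*\otimes V\otimes V^*$, $V\otimes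 V^*\otimes V\otimes V^*$ at the indicated legs). **Index-free notation.** A family $x=(x^{ij})_{1\le i,j\le r+1}$ is identified with $\sum_{i,j}v_i\otimes f^j\otimes x^{ij}$; products of families $xy$ (also $x\otimes y$, $x\wedge y$, $(x,y)$) denote $\sum v_i\otimes f^j\otimes v_k\otimes f^l\otimes x^{ij}y^{kl}$ (resp. with $\otimes_{\mathcal{B}}$, $\wedge$, the inverse metric), and similarly for more factors. The maps above act on the $V,V^*$ legs; other maps act on components. Elements such as $g_{+-}$ below carry no legs. **Algebra and first-order calculus.** $\mathcal{B}$ is the unital algebra generated by $p^{ij}$, $1\le i,j\le r+1$, with relations $\mathsf{S}_{123}pp=q^{w}pp$, $\tilde{\mathsf{S}}_{234}pp=q^{-w}pp$, $\mathsf{E}'_{12}p=q^{m}$. The Heckenberger–Kolb first-order differential calculus is $\Omega=\Omega_+\oplus\Omega_-$, with $\Omega_+,\Omega_-$ generated as left $\mathcal{B}$-modules by $\partial p^{ij}$, resp. $\bar\partial p^{ij}$, with relations $$\tilde{\mathsf{S}}_{234}p\,\partial p=q^{-w}p\,\partial p,\quad \mathsf{E}'_{12}\partial p=0,\qquad \mathsf{S}_{123}p\,\bar\partial p=q^{w}p\,\bar\partial p,\quad \mathsf{E}'_{12}\bar\partial p=0,$$ right module structure $\partial p\,p=q^{a}\mathsf{T}_{1234}p\,\partial p$, $\bar\partial p\,p=q^{-a}\mathsf{T}_{1234}p\,\bar\partial p$, and differential $\mathrm{d}=\partial+\bar\partial$, where $\partial,\bar\partial:\mathcal{B}\to\Omega_\pm$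 are the derivations with $p^{ij}\mapsto\partial p^{ij},\bar\partial p^{ij}$. **Universal calculus.** $\Omega^\bullet$ is the quotient of the tensor algebra $T_{\mathcal{B}}(\Omega)$ by the two-sided ideal generated by $\{\sum_i\mathrm{d}a_i\otimes\mathrm{d}b_i:\sum_i a_i\mathrm{d}b_i=0\}\subset\Omega\otimes_{\mathcal{B}}\Omega$; its product is $\wedge$, and $\mathrm{d}(a\,\mathrm{d}b)=\mathrm{d}a\wedge\mathrm{d}b$. **Metric and inverse metric.** $g=g_{+-}+g_{-+}$ with $g_{+-}=\mathsf{E}'_{12}\mathsf{E}_{23}\,\partial p\otimes\bar\partial p$ and $g_{-+}=\mathsf{E}'_{12}\mathsf{E}_{23}\,\bar\partial p\otimes\partial p$ in $\Omega\otimes_{\mathcal{B}}\Omega$ (central elements). The inverse metric is the (well-defined) $\mathcal{B}$-bimodule map $(\cdot,\cdot):\Omega\otimes_{\mathcal{B}}\Omega\to\mathcal{B}$ with $(\partial p,\partial p)=(\bar\partial p,\bar\partial p)=0$, $(\partial p,\bar\partial p)=q^{a}q^{-w-m}\mathsf{S}_{123}\mathsf{C}_3p-q^{a}q^{-m}pp$, $(\bar\partial p,\partial p)=\mathsf{C}'_2p-q^{-m}pp$. **Connection and Riemann tensor.** The quantum Levi-Civita connection is the (well-defined) linear map $\nabla:\Omega\to\Omega\otimes_{\mathcal{B}}\Omega$ with $\nabla(b\omega)=\mathrm{d}b\otimes\omega+b\nabla(\omega)$ and $$\nabla(\partial p)=q^{a}\mathsf{E}_{23}\mathsf{T}_{1234}\,\bar\partial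 p\otimes\partial p-q^{a}q^{-m}\,p\,g_{-+},\qquad \nabla(\bar\partial p)=\mathsf{E}_{23}\,\partial p\otimes\bar\partial p-q^{-m}\,p\,g_{+-}.$$ The Riemann tensor is $R_\nabla:=(\mathrm{d}\otimes\mathrm{id}-(\wedge\otimes\mathrm{id})\circ(\mathrm{id}\otimes\nabla))\circ\nabla:\Omega\to\Omega^2\otimes_{\mathcal{B}}\Omega$. **Generalized braiding.** $\sigma$ is the (well-defined) $\mathcal{B}$-bimodule map $\Omega\otimes_{\mathcal{B}}\Omega\to\Omega\otimes_{\mathcal{B}}\Omega$ given by $$\sigma(\partial p\otimes\partial p)=q^{a}\mathsf{S}_{123}\tilde{\mathsf{S}}_{234}\,\partial p\otimes\partial p,\qquad \sigma(\bar\partial p\otimes\bar\partial p)=q^{-a}\mathsf{S}_{123}\tilde{\mathsf{S}}_{234}\,\bar\partial p\otimes\bar\partial p,$$ $$\sigma(\partial p\otimes\bar\partial p)=q^{2a-2w}\mathsf{S}_{123}\tilde{\mathsf{S}}_{234}^{-1}\,\bar\partial p\otimes\partial p+(1-q^{a})q^{a}q^{-m}\,p\,g_{-+}\,p,$$ $$\sigma(\bar\partial p\otimes\partial p)=q^{2w-2a}\mathsf{S}_{123}^{-1}\tilde{\mathsf{S}}_{234}\,\partial p\otimes\bar\partial p+(1-q^{-a})q^{-m}\,p\,g_{+-}\,p.$$ **Splitting map.** For scalars with $c_{+-}+c_{-+}=1$, the $\mathcal{B}$-bimodule map $s_\wedge:\Omega^2\to\Omega\otimes_{\mathcal{B}}\Omega$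 (satisfying $\wedge\circ s_\wedge=\mathrm{id}$) is induced from $\Omega\otimes_{\mathcal{B}}\Omega$ by: $\frac{1}{1+q^{-a}}(\mathrm{id}-q^{-a}\sigma)$ on $\Omega_+\otimes_{\mathcal{B}}\Omega_+$, $\frac{1}{1+q^{a}}(\mathrm{id}-q^{a}\sigma)$ on $\Omega_-\otimes_{\mathcal{B}}\Omega_-$, $c_{+-}\mathrm{id}-c_{-+}\sigma$ on $\Omega_+\otimes_{\mathcal{B}}\Omega_-$, $c_{-+}\mathrm{id}-c_{+-}\sigma$ on $\Omega_-\otimes_{\mathcal{B}}\Omega_+$. **Ricci tensor.** $\mathrm{Ricci}:=((\cdot,\cdot)\otimes\mathrm{id}\otimes\mathrm{id})\circ(\mathrm{id}\otimes s_\wedge\otimes\mathrm{id})\circ(\mathrm{id}\otimes R_\nabla)(g)\in\Omega\otimes_{\mathcal{B}}\Omega$. *)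

theory Defs
  imports
    "HOL-Analysis.Analysis"
    "HOL-Algebra.QuotRing"
    "HOL-Algebra.Module"
    "HOL-Library.Poly_Mapping"
begin

section \<open>Weights of type A\<close>

text \<open>
  Weights of \<open>sl\<^sub>r\<^sub>+\<^sub>1\<close> are written in the coordinates \<open>1, \<dots>, r + 1\<close> of the hyperplane of vectors
  with coordinate sum zero (coordinates outside this range are zero). The invariant form is the
  standard scalar product, so \<open>(\<alpha>\<^sub>i, \<alpha>\<^sub>i) = 2\<close>, and the Weyl group permutes the coordinates; its
  longest element reverses them.
\<close>

type_synonym weight = "nat \<Rightarrow> real"

definition wform :: "nat \<Rightarrow> weight \<Rightarrow> weight \<Rightarrow> real" where
  "wform r x y = (\<Sum>k = 1..r + 1. x k * y k)"

definition simple_root :: "nat \<Rightarrow> weight" where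
  "simple_root i = (\<lambda>k. if k = i then 1 else if k = i + 1 then - 1 else 0)"

definition fund_weight :: "nat \<Rightarrow> nat \<Rightarrow> weight" where
  "fund_weight r i = (\<lambda>k. if k \<in> {1..r + 1}
     then (if k \<le> i then 1 else 0) - real i / real (r + 1) else 0)"

definition rho :: "nat \<Rightarrow> weight" where
  "rho r = (\<lambda>k. \<Sum>i = 1..r. fund_weight r i k)"

definition two_rho :: "nat \<Rightarrow> weight" where
  "two_rho r = (\<lambda>k. 2 * rho r k)"

definition longest_act :: "nat \<Rightarrow> weight \<Rightarrow> weight" where
  "longest_act r \<mu> = (\<lambda>k. if k \<in> {1..r + 1} then \<mu> (r + 2 - k) else 0)"

definition weight_lattice :: "nat \<Rightarrow> weight set" where
  "weight_lattice r = {\<mu>. \<exists>c :: nat \<Rightarrow> int. \<mu> = (\<lambda>k. \<Sum>i = 1..r. of_int (c i) * fund_weight r i k)}"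

definition qpow :: "real \<Rightarrow> real \<Rightarrow> complex" where
  "qpow q x = complex_of_real (q powr x)"

definition qnumber :: "real \<Rightarrow> real \<Rightarrow> real" where
  "qnumber q x = (q powr x - q powr (- x)) / (q - q powr (- 1))"


section \<open>Modules over \<open>U\<^sub>q(sl\<^sub>r\<^sub>+\<^sub>1)\<close> and the braiding\<close>

text \<open>
  A module with a chosen basis indexed by \<open>'n\<close> is given by the matrices of the generators
  \<open>K\<^sub>i, E\<^sub>i, F\<^sub>i\<close>, \<open>1 \<le> i \<le> r\<close>; the \<open>j\<close>-th basis vector is \<open>axis j 1\<close>. Note that \<open>mat c ** A\<close> is
  the scalar multiple of \<open>A\<close> by \<open>c\<close>.
\<close>

record 'n uq_rep =
  repK :: "nat \<Rightarrow> complex^'n^'n"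
  repE :: "nat \<Rightarrow> complex^'n^'n"
  repF :: "nat \<Rightarrow> complex^'n^'n"

definition uq_module :: "real \<Rightarrow> nat \<Rightarrow> ('n::finite) uq_rep \<Rightarrow> bool" where
  "uq_module q r X \<longleftrightarrow>
    (\<forall>i\<in>{1..r}. invertible (repK X i)) \<and>
    (\<forall>i\<in>{1..r}. \<forall>j\<in>{1..r}.
      repK X i ** repK X j = repK X j ** repK X i \<and>
      repK X i ** repE X j ** matrix_inv (repK X i)
        = mat (qpow q (wform r (simple_root i) (simple_root j))) ** repE X j \<and>
      repK X i ** repF X j ** matrix_inv (repK X i)
        = mat (qpow q (- wform r (simple_root i) (simple_root j))) ** repF X j \<and>
      repE X i ** repF X j - repF X j ** repE X i
        = (if i = j then mat (1 / complex_of_real (q - q powr (- 1))) **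
             (repK X i - matrix_inv (repK X i)) else 0) \<and>
      (j = i + 1 \<or> i = j + 1 \<longrightarrow>
        repE X i ** repE X i ** repE X j
          - mat (complex_of_real (qnumber q 2)) ** (repE X i ** repE X j ** repE X i)
          + repE X j ** repE X i ** repE X i = 0 \<and>
        repF X i ** repF X i ** repF X j
          - mat (complex_of_real (qnumber q 2)) ** (repF X i ** repF X j ** repF X i)
          + repF X j ** repF X i ** repF X i = 0) \<and>
      (i \<noteq> j \<and> j \<noteq> i + 1 \<and> i \<noteq> j + 1 \<longrightarrow>
        repE X i ** repE X j = repE X j ** repE X i \<and>
        repF X i ** repF X j = repF X j ** repF X i))"

definition simple_uq_module :: "real \<Rightarrow> nat \<Rightarrow> ('n::finite) uq_rep \<Rightarrow> bool" where
  "simple_uq_module q r X \<longleftrightarrow> uq_module q r X \<and>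
    (\<forall>W. vec.subspace W \<and>
         (\<forall>i\<in>{1..r}. \<forall>x\<in>W. repK X i *v x \<in> W \<and> repE X i *v x \<in> W \<and> repF X i *v x \<in> W)
       \<longrightarrow> W = {0} \<or> W = UNIV)"

definition weight_vector :: "real \<Rightarrow> nat \<Rightarrow> ('n::finite) uq_rep \<Rightarrow> weight \<Rightarrow> complex^'n \<Rightarrow> bool" where
  "weight_vector q r X \<mu> x \<longleftrightarrow> x \<noteq> 0 \<and>
    (\<forall>i\<in>{1..r}. repK X i *v x = qpow q (wform r (simple_root i) \<mu>) *s x)"

definition highest_weight_vector ::
    "real \<Rightarrow> nat \<Rightarrow> ('n::finite) uq_rep \<Rightarrow> weight \<Rightarrow> complex^'n \<Rightarrow> bool" where
  "highest_weight_vector q r X \<mu> x \<longleftrightarrow>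
    weight_vector q r X \<mu> x \<and> (\<forall>i\<in>{1..r}. repE X i *v x = 0)"

definition lowest_weight_vector ::
    "real \<Rightarrow> nat \<Rightarrow> ('n::finite) uq_rep \<Rightarrow> weight \<Rightarrow> complex^'n \<Rightarrow> bool" where
  "lowest_weight_vector q r X \<mu> x \<longleftrightarrow>
    weight_vector q r X \<mu> x \<and> (\<forall>i\<in>{1..r}. repF X i *v x = 0)"

definition simple_highest_weight_module ::
    "real \<Rightarrow> nat \<Rightarrow> weight \<Rightarrow> ('n::finite) uq_rep \<Rightarrow> bool" where
  "simple_highest_weight_module q r \<mu> X \<longleftrightarrow>
    simple_uq_module q r X \<and> (\<exists>x. highest_weight_vector q r X \<mu> x)"

text \<open>
  The dual module \<open>(X f)(v) = f(S(X) v)\<close> in the dual basis, where \<open>S(K) = K\<inverse>\<close>,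
  \<open>S(E) = - E K\<inverse>\<close> and \<open>S(F) = - K F\<close>.
\<close>

definition dual_rep :: "('n::finite) uq_rep \<Rightarrow> 'n uq_rep" where
  "dual_rep X = \<lparr>
     repK = (\<lambda>i. transpose (matrix_inv (repK X i))),
     repE = (\<lambda>i. transpose (- (repE X i ** matrix_inv (repK X i)))),
     repF = (\<lambda>i. transpose (- (repK X i ** repF X i)))\<rparr>"

definition kron :: "complex^'a::finite^'b::finite \<Rightarrow> complex^'c::finite^'d::finite
    \<Rightarrow> complex^('a \<times> 'c)^('b \<times> 'd)" where
  "kron A B = (\<chi> i j. A $ fst i $ fst j * B $ snd i $ snd j)"

definition vec_tensor :: "complex^'a::finite \<Rightarrow> complex^'b::finite \<Rightarrow> complex^('a \<times> 'b)" where
  "vec_tensor x y = (\<chi> i. x $ fst i * y $ snd i)"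

text \<open>
  The coproduct is \<open>\<Delta>(K) = K \<otimes> K\<close>, \<open>\<Delta>(E) = E \<otimes> K + 1 \<otimes> E\<close>, \<open>\<Delta>(F) = F \<otimes> 1 + K\<inverse> \<otimes> F\<close>.
\<close>

definition tensor_rep :: "('a::finite) uq_rep \<Rightarrow> ('b::finite) uq_rep \<Rightarrow> ('a \<times> 'b) uq_rep" where
  "tensor_rep X Y = \<lparr>
     repK = (\<lambda>i. kron (repK X i) (repK Y i)),
     repE = (\<lambda>i. kron (repE X i) (repK Y i) + kron (mat 1) (repE Y i)),
     repF = (\<lambda>i. kron (repF X i) (mat 1) + kron (matrix_inv (repK X i)) (repF Y i))\<rparr>"

definition uq_hom :: "nat \<Rightarrow> ('a::finite) uq_rep \<Rightarrow> ('b::finite) uq_rep \<Rightarrow> complex^'a^'b \<Rightarrow> bool" where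
  "uq_hom r X Y A \<longleftrightarrow> (\<forall>i\<in>{1..r}.
     A ** repK X i = repK Y i ** A \<and> A ** repE X i = repE Y i ** A \<and> A ** repF X i = repF Y i ** A)"

text \<open>
  The braiding \<open>X \<otimes> Y \<rightarrow> Y \<otimes> X\<close> for \<open>X \<cong> V(\<kappa>)\<close> and \<open>Y \<cong> V(\<mu>)\<close>; the lowest weight of \<open>V(\<mu>)\<close> is
  \<open>w\<^sub>0 \<mu>\<close>.
\<close>

definition braiding :: "real \<Rightarrow> nat \<Rightarrow> weight \<Rightarrow> weight \<Rightarrow> ('a::finite) uq_rep \<Rightarrow> ('b::finite) uq_rep
    \<Rightarrow> complex^('a \<times> 'b)^('b \<times> 'a)" where
  "braiding q r \<kappa> \<mu> X Y = (THE A.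
     uq_hom r (tensor_rep X Y) (tensor_rep Y X) A \<and>
     (\<forall>x y. highest_weight_vector q r X \<kappa> x \<and>
            lowest_weight_vector q r Y (longest_act r \<mu>) y \<longrightarrow>
        A *v vec_tensor x y = qpow q (wform r \<kappa> (longest_act r \<mu>)) *s vec_tensor y x))"


section \<open>Bimodules over complex algebras\<close>

definition complex_field :: "complex ring" where
  "complex_field = \<lparr>carrier = UNIV, mult = (*), one = 1, zero = 0, add = (+)\<rparr>"

text \<open>
  A complex algebra is a record of type \<open>(complex, 'b) module\<close>, whose ring fields are the ring
  structure and whose \<open>smult\<close> is the complex scalar multiplication. In a bimodule, \<open>smult\<close> is again
  the complex scalar multiplication and the ring fields \<open>mult\<close> and \<open>one\<close> play no role.
\<close>

record ('b, 'm) bimod = "(complex, 'm) module" +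
  lact :: "'b \<Rightarrow> 'm \<Rightarrow> 'm"
  ract :: "'m \<Rightarrow> 'b \<Rightarrow> 'm"

locale alg_bimodule =
  fixes B :: "(complex, 'b) module" and M :: "('b, 'm) bimod"
  assumes vector_space: "module complex_field M"
    and closed: "b \<in> carrier B \<Longrightarrow> x \<in> carrier M \<Longrightarrow> lact M b x \<in> carrier M"
      "b \<in> carrier B \<Longrightarrow> x \<in> carrier M \<Longrightarrow> ract M x b \<in> carrier M"
    and add_alg: "b \<in> carrier B \<Longrightarrow> b' \<in> carrier B \<Longrightarrow> x \<in> carrier M \<Longrightarrow>
        lact M (b \<oplus>\<^bsub>B\<^esub> b') x = lact M b x \<oplus>\<^bsub>M\<^esub> lact M b' x"
      "b \<in> carrier B \<Longrightarrow> b' \<in> carrier B \<Longrightarrow> x \<in> carrier M \<Longrightarrow>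
        ract M x (b \<oplus>\<^bsub>B\<^esub> b') = ract M x b \<oplus>\<^bsub>M\<^esub> ract M x b'"
    and add_mod: "b \<in> carrier B \<Longrightarrow> x \<in> carrier M \<Longrightarrow> y \<in> carrier M \<Longrightarrow>
        lact M b (x \<oplus>\<^bsub>M\<^esub> y) = lact M b x \<oplus>\<^bsub>M\<^esub> lact M b y"
      "b \<in> carrier B \<Longrightarrow> x \<in> carrier M \<Longrightarrow> y \<in> carrier M \<Longrightarrow>
        ract M (x \<oplus>\<^bsub>M\<^esub> y) b = ract M x b \<oplus>\<^bsub>M\<^esub> ract M y b"
    and scalar: "x \<in> carrier M \<Longrightarrow> lact M (c \<odot>\<^bsub>B\<^esub> \<one>\<^bsub>B\<^esub>) x = c \<odot>\<^bsub>M\<^esub> x"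
      "x \<in> carrier M \<Longrightarrow> ract M x (c \<odot>\<^bsub>B\<^esub> \<one>\<^bsub>B\<^esub>) = c \<odot>\<^bsub>M\<^esub> x"
    and assoc: "b \<in> carrier B \<Longrightarrow> b' \<in> carrier B \<Longrightarrow> x \<in> carrier M \<Longrightarrow>
        lact M (b \<otimes>\<^bsub>B\<^esub> b') x = lact M b (lact M b' x)"
      "b \<in> carrier B \<Longrightarrow> b' \<in> carrier B \<Longrightarrow> x \<in> carrier M \<Longrightarrow>
        ract M x (b \<otimes>\<^bsub>B\<^esub> b') = ract M (ract M x b) b'"
      "b \<in> carrier B \<Longrightarrow> b' \<in> carrier B \<Longrightarrow> x \<in> carrier M \<Longrightarrow>
        ract M (lact M b x) b' = lact M b (ract M x b')"

definition clinear_map :: "(complex, 'm, 'y) module_scheme \<Rightarrow> (complex, 'n, 'z) module_scheme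
    \<Rightarrow> ('m \<Rightarrow> 'n) \<Rightarrow> bool" where
  "clinear_map M N f \<longleftrightarrow> f \<in> carrier M \<rightarrow> carrier N \<and>
    (\<forall>x\<in>carrier M. \<forall>y\<in>carrier M. f (x \<oplus>\<^bsub>M\<^esub> y) = f x \<oplus>\<^bsub>N\<^esub> f y) \<and>
    (\<forall>c. \<forall>x\<in>carrier M. f (c \<odot>\<^bsub>M\<^esub> x) = c \<odot>\<^bsub>N\<^esub> f x)"

definition bimodule_map :: "(complex, 'b) module \<Rightarrow> ('b, 'm) bimod \<Rightarrow> ('b, 'n) bimod
    \<Rightarrow> ('m \<Rightarrow> 'n) \<Rightarrow> bool" where
  "bimodule_map B M N f \<longleftrightarrow> clinear_map M N f \<and>
    (\<forall>b\<in>carrier B. \<forall>x\<in>carrier M. f (lact M b x) = lact N b (f x) \<and> f (ract M x b) = ract N (f x) b)"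

definition regular_bimod :: "(complex, 'b) module \<Rightarrow> ('b, 'b) bimod" where
  "regular_bimod B = \<lparr>carrier = carrier B, mult = mult B, one = one B, zero = zero B, add = add B,
     smult = smult B, lact = mult B, ract = mult B\<rparr>"

definition direct_sum :: "('b, 'm) bimod \<Rightarrow> ('b, 'n) bimod \<Rightarrow> ('b, 'm \<times> 'n) bimod" where
  "direct_sum M N = \<lparr>carrier = carrier M \<times> carrier N, mult = undefined, one = undefined,
     zero = (\<zero>\<^bsub>M\<^esub>, \<zero>\<^bsub>N\<^esub>),
     add = (\<lambda>u v. (fst u \<oplus>\<^bsub>M\<^esub> fst v, snd u \<oplus>\<^bsub>N\<^esub> snd v)),
     smult = (\<lambda>c u. (c \<odot>\<^bsub>M\<^esub> fst u, c \<odot>\<^bsub>N\<^esub> snd u)),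
     lact = (\<lambda>b u. (lact M b (fst u), lact N b (snd u))),
     ract = (\<lambda>u b. (ract M (fst u) b, ract N (snd u) b))\<rparr>"

definition quot_bimod :: "('b, 'm) bimod \<Rightarrow> 'm set \<Rightarrow> ('b, 'm set) bimod" where
  "quot_bimod M N = \<lparr>carrier = a_rcosets\<^bsub>M\<^esub> N, mult = undefined, one = undefined,
     zero = N, add = set_add M,
     smult = (\<lambda>c X. \<Union>x\<in>X. N +>\<^bsub>M\<^esub> (c \<odot>\<^bsub>M\<^esub> x)),
     lact = (\<lambda>b X. \<Union>x\<in>X. N +>\<^bsub>M\<^esub> lact M b x),
     ract = (\<lambda>X b. \<Union>x\<in>X. N +>\<^bsub>M\<^esub> ract M x b)\<rparr>"

definition cspan :: "(complex, 'm, 'z) module_scheme \<Rightarrow> 'm set \<Rightarrow> 'm set" where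
  "cspan M G = \<Inter>{N. submodule N complex_field M \<and> G \<subseteq> N}"

definition left_span :: "(complex, 'b) module \<Rightarrow> ('b, 'm) bimod \<Rightarrow> 'm set \<Rightarrow> 'm set" where
  "left_span B M G = \<Inter>{N. submodule N complex_field M \<and>
     (\<forall>b\<in>carrier B. \<forall>x\<in>N. lact M b x \<in> N) \<and> G \<subseteq> N}"

definition bimod_span :: "(complex, 'b) module \<Rightarrow> ('b, 'm) bimod \<Rightarrow> 'm set \<Rightarrow> 'm set" where
  "bimod_span B M G = \<Inter>{N. submodule N complex_field M \<and>
     (\<forall>b\<in>carrier B. \<forall>x\<in>N. lact M b x \<in> N \<and> ract M x b \<in> N) \<and> G \<subseteq> N}"

text \<open>The free left module on a finite type of generators; it carries no right action.\<close>

definition free_left_module :: "(complex, 'b) module \<Rightarrow> ('b, 'x::finite \<Rightarrow> 'b) bimod" where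
  "free_left_module B = \<lparr>carrier = {f. \<forall>k. f k \<in> carrier B}, mult = undefined, one = undefined,
     zero = (\<lambda>k. \<zero>\<^bsub>B\<^esub>), add = (\<lambda>f g k. f k \<oplus>\<^bsub>B\<^esub> g k), smult = (\<lambda>c f k. c \<odot>\<^bsub>B\<^esub> f k),
     lact = (\<lambda>b f k. b \<otimes>\<^bsub>B\<^esub> f k), ract = undefined\<rparr>"

definition free_generator :: "(complex, 'b) module \<Rightarrow> 'x \<Rightarrow> 'x \<Rightarrow> 'b" where
  "free_generator B x = (\<lambda>k. if k = x then \<one>\<^bsub>B\<^esub> else \<zero>\<^bsub>B\<^esub>)"


subsection \<open>Tensor product over an algebra\<close>

text \<open>
  \<open>M \<otimes>\<^sub>B N\<close> is the space of formal complex linear combinations of pairs, modulo bilinearity and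
  balancedness.
\<close>

definition formal_sums :: "('b, 'm) bimod \<Rightarrow> ('b, 'n) bimod \<Rightarrow> ('b, ('m \<times> 'n) \<Rightarrow>\<^sub>0 complex) bimod" where
  "formal_sums M N = \<lparr>carrier = {z. Poly_Mapping.keys z \<subseteq> carrier M \<times> carrier N},
     mult = undefined, one = undefined, zero = 0, add = (+),
     smult = (\<lambda>c z. Poly_Mapping.map ((*) c) z),
     lact = (\<lambda>b z. \<Sum>k\<in>Poly_Mapping.keys z.
        Poly_Mapping.single (lact M b (fst k), snd k) (Poly_Mapping.lookup z k)),
     ract = (\<lambda>z b. \<Sum>k\<in>Poly_Mapping.keys z.
        Poly_Mapping.single (fst k, ract N (snd k) b) (Poly_Mapping.lookup z k))\<rparr>"

definition tensor_relations :: "(complex, 'b) module \<Rightarrow> ('b, 'm) bimod \<Rightarrow> ('b, 'n) bimod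
    \<Rightarrow> (('m \<times> 'n) \<Rightarrow>\<^sub>0 complex) set" where
  "tensor_relations B M N = (let e = (\<lambda>x y. Poly_Mapping.single (x, y) (1 :: complex)) in
     {e (x \<oplus>\<^bsub>M\<^esub> x') y - e x y - e x' y | x x' y. x \<in> carrier M \<and> x' \<in> carrier M \<and> y \<in> carrier N} \<union>
     {e x (y \<oplus>\<^bsub>N\<^esub> y') - e x y - e x y' | x y y'. x \<in> carrier M \<and> y \<in> carrier N \<and> y' \<in> carrier N} \<union>
     {e (c \<odot>\<^bsub>M\<^esub> x) y - Poly_Mapping.single (x, y) c | c x y. x \<in> carrier M \<and> y \<in> carrier N} \<union>
     {e x (c \<odot>\<^bsub>N\<^esub> y) - Poly_Mapping.single (x, y) c | c x y. x \<in> carrier M \<and> y \<in> carrier N} \<union>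
     {e (ract M x b) y - e x (lact N b y) | x b y. x \<in> carrier M \<and> b \<in> carrier B \<and> y \<in> carrier N})"

definition tensor :: "(complex, 'b) module \<Rightarrow> ('b, 'm) bimod \<Rightarrow> ('b, 'n) bimod
    \<Rightarrow> ('b, (('m \<times> 'n) \<Rightarrow>\<^sub>0 complex) set) bimod" where
  "tensor B M N = quot_bimod (formal_sums M N) (cspan (formal_sums M N) (tensor_relations B M N))"

definition tens :: "(complex, 'b) module \<Rightarrow> ('b, 'm) bimod \<Rightarrow> ('b, 'n) bimod
    \<Rightarrow> 'm \<Rightarrow> 'n \<Rightarrow> (('m \<times> 'n) \<Rightarrow>\<^sub>0 complex) set" where
  "tens B M N x y =
     cspan (formal_sums M N) (tensor_relations B M N) +>\<^bsub>formal_sums M N\<^esub> Poly_Mapping.single (x, y) 1"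

text \<open>
  The map on a tensor product induced by a balanced bilinear map \<open>f\<close>, i.e. \<open>x \<otimes> y \<mapsto> f x y\<close>,
  evaluated on an arbitrary representing formal sum (the choice is immaterial for such \<open>f\<close>).
\<close>

definition tensor_lift :: "(complex, 'x, 'z) module_scheme \<Rightarrow> ('m \<Rightarrow> 'n \<Rightarrow> 'x)
    \<Rightarrow> (('m \<times> 'n) \<Rightarrow>\<^sub>0 complex) set \<Rightarrow> 'x" where
  "tensor_lift X f t = (let z = (SOME z. z \<in> t) in
     \<Oplus>\<^bsub>X\<^esub>k\<in>Poly_Mapping.keys z. Poly_Mapping.lookup z k \<odot>\<^bsub>X\<^esub> f (fst k) (snd k))"


section \<open>Index-free notation\<close>

text \<open>
  A family with \<open>k\<close> legs in a space \<open>M\<close> is the function assigning to a list of \<open>k\<close> basis indices its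
  component; the legs \<open>V\<close> and \<open>V\<^sup>*\<close> carry the basis and its dual basis, indexed by the same type.
  Leg numbers start at 1. In a matrix \<open>A $ i $ j\<close> the row index \<open>i\<close> is that of the output.
\<close>

definition fam2 :: "('n \<Rightarrow> 'n \<Rightarrow> 'm) \<Rightarrow> 'n list \<Rightarrow> 'm" where
  "fam2 x is = x (is ! 0) (is ! 1)"

text \<open>In a product, the left factor is always a family with two legs.\<close>

definition fam_prod :: "('x \<Rightarrow> 'y \<Rightarrow> 'z) \<Rightarrow> ('n list \<Rightarrow> 'x) \<Rightarrow> ('n list \<Rightarrow> 'y) \<Rightarrow> 'n list \<Rightarrow> 'z" where
  "fam_prod f x y is = f (x (take 2 is)) (y (drop 2 is))"

definition fam_smult :: "(complex, 'm, 'z) module_scheme \<Rightarrow> complex \<Rightarrow> ('n list \<Rightarrow> 'm) \<Rightarrow> 'n list \<Rightarrow> 'm" where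
  "fam_smult M c x is = c \<odot>\<^bsub>M\<^esub> x is"

definition fam_add :: "(complex, 'm, 'z) module_scheme \<Rightarrow> ('n list \<Rightarrow> 'm) \<Rightarrow> ('n list \<Rightarrow> 'm) \<Rightarrow> 'n list \<Rightarrow> 'm" where
  "fam_add M x y is = x is \<oplus>\<^bsub>M\<^esub> y is"

definition fam_diff :: "(complex, 'm, 'z) module_scheme \<Rightarrow> ('n list \<Rightarrow> 'm) \<Rightarrow> ('n list \<Rightarrow> 'm) \<Rightarrow> 'n list \<Rightarrow> 'm" where
  "fam_diff M x y is = x is \<ominus>\<^bsub>M\<^esub> y is"

definition on_legs :: "(complex, 'm, 'z) module_scheme \<Rightarrow> complex^('n::finite \<times> 'n)^('n \<times> 'n) \<Rightarrow> nat
    \<Rightarrow> ('n list \<Rightarrow> 'm) \<Rightarrow> 'n list \<Rightarrow> 'm" where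
  "on_legs M A n x is = (\<Oplus>\<^bsub>M\<^esub>k\<in>UNIV. (A $ (is ! (n - 1), is ! n) $ k) \<odot>\<^bsub>M\<^esub> x (is[n - 1 := fst k, n := snd k]))"

definition contract :: "(complex, 'm, 'z) module_scheme \<Rightarrow> ('n::finite \<Rightarrow> complex) \<Rightarrow> nat
    \<Rightarrow> ('n list \<Rightarrow> 'm) \<Rightarrow> 'n list \<Rightarrow> 'm" where
  "contract M c n x is = (\<Oplus>\<^bsub>M\<^esub>k\<in>UNIV. c k \<odot>\<^bsub>M\<^esub> x (take (n - 1) is @ [k, k] @ drop (n - 1) is))"

definition insert_legs :: "(complex, 'm, 'z) module_scheme \<Rightarrow> ('n::finite \<Rightarrow> complex) \<Rightarrow> nat
    \<Rightarrow> ('n list \<Rightarrow> 'm) \<Rightarrow> 'n list \<Rightarrow> 'm" where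
  "insert_legs M c n x is = (if is ! (n - 1) = is ! n
     then c (is ! n) \<odot>\<^bsub>M\<^esub> x (take (n - 1) is @ drop (n + 1) is) else \<zero>\<^bsub>M\<^esub>)"


section \<open>The free algebra\<close>

datatype 'x word = Word (letters: "'x list")

instantiation word :: (type) monoid_add
begin
definition "0 = Word []"
definition "u + v = Word (letters u @ letters v)"
instance by standard (auto simp: zero_word_def plus_word_def)
end

text \<open>The monoid algebra of the free monoid on \<open>'n \<times> 'n\<close>.\<close>

type_synonym 'n falg = "('n \<times> 'n) word \<Rightarrow>\<^sub>0 complex"

definition free_alg :: "(complex, 'n falg) module" where
  "free_alg = \<lparr>carrier = UNIV, mult = (*), one = 1, zero = 0, add = (+),
     smult = (\<lambda>c x. Poly_Mapping.single 0 c * x)\<rparr>"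

definition free_gen :: "'n \<Rightarrow> 'n \<Rightarrow> 'n falg" where
  "free_gen i j = Poly_Mapping.single (Word [(i, j)]) 1"

definition quotient_alg :: "'n falg set \<Rightarrow> (complex, 'n falg set) module" where
  "quotient_alg I = ring.extend (free_alg Quot I)
     (module.fields (\<lambda>c X. (I +>\<^bsub>free_alg\<^esub> Poly_Mapping.single 0 c) \<otimes>\<^bsub>free_alg Quot I\<^esub> X))"

type_synonym 'n alg = "'n falg set"
type_synonym 'n form1 = "('n \<times> 'n \<Rightarrow> 'n alg) set"
type_synonym 'n form = "'n form1 \<times> 'n form1"
type_synonym 'n form_form = "(('n form \<times> 'n form) \<Rightarrow>\<^sub>0 complex) set"
type_synonym 'n form2 = "'n form_form set"
type_synonym 'n form2_form = "(('n form2 \<times> 'n form) \<Rightarrow>\<^sub>0 complex) set"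


section \<open>Quantum projective space\<close>

text \<open>
  \<open>V\<close> is the simple module \<open>V(\<omega>\<^sub>s)\<close> on which the standard basis is a weight basis, of weights \<open>lam\<close>.
\<close>

locale quantum_projective_space =
  fixes q :: real and r s :: nat and V :: "('n::finite) uq_rep" and lam :: "'n \<Rightarrow> weight"
  assumes r: "1 \<le> r" and q: "0 < q" "q < 1" and s: "s \<in> {1, r}"
    and card_index: "CARD('n) = r + 1"
    and V: "simple_highest_weight_module q r (fund_weight r s) V"
    and lam: "lam j \<in> weight_lattice r"
    and weight_basis: "weight_vector q r V (lam j) (axis j 1)"
begin

definition par_a :: real where "par_a = wform r (simple_root s) (simple_root s)"
definition par_w :: real where "par_w = wform r (fund_weight r s) (fund_weight r s)"
definition par_m :: real where "par_m = wform r (fund_weight r s) (two_rho r)"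

text \<open>The dual of \<open>V(\<lambda>)\<close> is the simple module of highest weight \<open>- w\<^sub>0 \<lambda>\<close>.\<close>

definition dual_weight :: weight where
  "dual_weight = (\<lambda>k. - longest_act r (fund_weight r s) k)"

definition R_VV :: "complex^('n \<times> 'n)^('n \<times> 'n)" where
  "R_VV = braiding q r (fund_weight r s) (fund_weight r s) V V"

definition R_VD :: "complex^('n \<times> 'n)^('n \<times> 'n)" where
  "R_VD = braiding q r (fund_weight r s) dual_weight V (dual_rep V)"

definition R_DD :: "complex^('n \<times> 'n)^('n \<times> 'n)" where
  "R_DD = braiding q r dual_weight dual_weight (dual_rep V) (dual_rep V)"

definition E_ev :: "(complex, 'm, 'z) module_scheme \<Rightarrow> nat \<Rightarrow> ('n list \<Rightarrow> 'm) \<Rightarrow> 'n list \<Rightarrow> 'm" where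
  "E_ev M = contract M (\<lambda>k. 1)"

definition E_ev' :: "(complex, 'm, 'z) module_scheme \<Rightarrow> nat \<Rightarrow> ('n list \<Rightarrow> 'm) \<Rightarrow> 'n list \<Rightarrow> 'm" where
  "E_ev' M = contract M (\<lambda>k. qpow q (wform r (lam k) (two_rho r)))"

definition C_coev :: "(complex, 'm, 'z) module_scheme \<Rightarrow> nat \<Rightarrow> ('n list \<Rightarrow> 'm) \<Rightarrow> 'n list \<Rightarrow> 'm" where
  "C_coev M = insert_legs M (\<lambda>k. 1)"

definition C_coev' :: "(complex, 'm, 'z) module_scheme \<Rightarrow> nat \<Rightarrow> ('n list \<Rightarrow> 'm) \<Rightarrow> 'n list \<Rightarrow> 'm" where
  "C_coev' M = insert_legs M (\<lambda>k. qpow q (- wform r (lam k) (two_rho r)))"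

text \<open>
  \<open>S234'\<close> is the operator usually written \<open>S\<close> with a tilde; the inverses are written out as
  composites of the inverse factors in reverse order.
\<close>

definition S123 :: "(complex, 'm, 'z) module_scheme \<Rightarrow> ('n list \<Rightarrow> 'm) \<Rightarrow> 'n list \<Rightarrow> 'm" where
  "S123 M x = on_legs M R_VD 2 (on_legs M R_VV 1 (on_legs M (matrix_inv R_VD) 2 x))"

definition S234' :: "(complex, 'm, 'z) module_scheme \<Rightarrow> ('n list \<Rightarrow> 'm) \<Rightarrow> 'n list \<Rightarrow> 'm" where
  "S234' M x = on_legs M R_VD 2 (on_legs M (matrix_inv R_DD) 3 (on_legs M (matrix_inv R_VD) 2 x))"

definition S123_inv :: "(complex, 'm, 'z) module_scheme \<Rightarrow> ('n list \<Rightarrow> 'm) \<Rightarrow> 'n list \<Rightarrow> 'm" where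
  "S123_inv M x = on_legs M R_VD 2 (on_legs M (matrix_inv R_VV) 1 (on_legs M (matrix_inv R_VD) 2 x))"

definition S234'_inv :: "(complex, 'm, 'z) module_scheme \<Rightarrow> ('n list \<Rightarrow> 'm) \<Rightarrow> 'n list \<Rightarrow> 'm" where
  "S234'_inv M x = on_legs M R_VD 2 (on_legs M R_DD 3 (on_legs M (matrix_inv R_VD) 2 x))"

definition T1234 :: "(complex, 'm, 'z) module_scheme \<Rightarrow> ('n list \<Rightarrow> 'm) \<Rightarrow> 'n list \<Rightarrow> 'm" where
  "T1234 M x = S123 M (S234' M x)"


subsection \<open>The algebra\<close>

definition alg_relations :: "'n falg set" where
  "alg_relations = (let p = fam2 free_gen; pp = fam_prod (*) p p in
     {fam_diff free_alg (S123 free_alg pp) (fam_smult free_alg (qpow q par_w) pp) is | is. length is = 4} \<union>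
     {fam_diff free_alg (S234' free_alg pp) (fam_smult free_alg (qpow q (- par_w)) pp) is | is. length is = 4} \<union>
     {E_ev' free_alg 1 p [] \<ominus>\<^bsub>free_alg\<^esub> qpow q par_m \<odot>\<^bsub>free_alg\<^esub> \<one>\<^bsub>free_alg\<^esub>})"

definition alg_ideal :: "'n falg set" where
  "alg_ideal = Idl\<^bsub>free_alg\<^esub> alg_relations"

definition alg :: "(complex, 'n alg) module" where
  "alg = quotient_alg alg_ideal"

definition P :: "'n list \<Rightarrow> 'n alg" where
  "P = fam2 (\<lambda>i j. alg_ideal +>\<^bsub>free_alg\<^esub> free_gen i j)"


subsection \<open>The left modules of (1,0)- and (0,1)-forms\<close>

abbreviation free_forms :: "('n alg, 'n \<times> 'n \<Rightarrow> 'n alg) bimod" where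
  "free_forms \<equiv> free_left_module alg"

definition free_dp :: "'n list \<Rightarrow> 'n \<times> 'n \<Rightarrow> 'n alg" where
  "free_dp = fam2 (\<lambda>i j. free_generator alg (i, j))"

definition plus_relations :: "('n \<times> 'n \<Rightarrow> 'n alg) set" where
  "plus_relations = left_span alg free_forms (let pdp = fam_prod (lact free_forms) P free_dp in
     {fam_diff free_forms (S234' free_forms pdp) (fam_smult free_forms (qpow q (- par_w)) pdp) is | is. length is = 4} \<union>
     {E_ev' free_forms 1 free_dp []})"

definition minus_relations :: "('n \<times> 'n \<Rightarrow> 'n alg) set" where
  "minus_relations = left_span alg free_forms (let pdp = fam_prod (lact free_forms) P free_dp in
     {fam_diff free_forms (S123 free_forms pdp) (fam_smult free_forms (qpow q par_w) pdp) is | is. length is = 4} \<union>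
     {E_ev' free_forms 1 free_dp []})"

definition left_plus :: "('n alg, 'n form1) bimod" where
  "left_plus = quot_bimod free_forms plus_relations"

definition left_minus :: "('n alg, 'n form1) bimod" where
  "left_minus = quot_bimod free_forms minus_relations"

definition dP_plus :: "'n list \<Rightarrow> 'n form1" where
  "dP_plus is = plus_relations +>\<^bsub>free_forms\<^esub> free_dp is"

definition dP_minus :: "'n list \<Rightarrow> 'n form1" where
  "dP_minus is = minus_relations +>\<^bsub>free_forms\<^esub> free_dp is"

definition derivation_into :: "('n alg, 'n form1) bimod \<Rightarrow> ('n alg \<Rightarrow> 'n form1) \<Rightarrow> bool" where
  "derivation_into M D \<longleftrightarrow> clinear_map alg M D \<and>
    (\<forall>a\<in>carrier alg. \<forall>b\<in>carrier alg. D (a \<otimes>\<^bsub>alg\<^esub> b) = ract M (D a) b \<oplus>\<^bsub>M\<^esub> lact M a (D b))"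

end


subsection \<open>The Heckenberger--Kolb calculus\<close>

text \<open>
  The right actions \<open>rp\<close>, \<open>rm\<close> and the derivations \<open>del\<close>, \<open>delbar\<close> are determined by their values
  on generators.
\<close>

locale hk_calculus = quantum_projective_space q r s V lam
  for q :: real and r s :: nat and V :: "('n::finite) uq_rep" and lam :: "'n \<Rightarrow> weight" +
  fixes rp rm :: "'n form1 \<Rightarrow> 'n alg \<Rightarrow> 'n form1"
    and del delbar :: "'n alg \<Rightarrow> 'n form1"
  assumes bimodule_plus: "alg_bimodule alg (left_plus\<lparr>ract := rp\<rparr>)"
    and bimodule_minus: "alg_bimodule alg (left_minus\<lparr>ract := rm\<rparr>)"
    and right_plus: "length is = 4 \<Longrightarrow> fam_prod rp dP_plus P is =
      fam_smult left_plus (qpow q par_a) (T1234 left_plus (fam_prod (lact left_plus) P dP_plus)) is"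
    and right_minus: "length is = 4 \<Longrightarrow> fam_prod rm dP_minus P is =
      fam_smult left_minus (qpow q (- par_a)) (T1234 left_minus (fam_prod (lact left_minus) P dP_minus)) is"
    and del: "derivation_into (left_plus\<lparr>ract := rp\<rparr>) del"
      "length is = 2 \<Longrightarrow> del (P is) = dP_plus is"
    and delbar: "derivation_into (left_minus\<lparr>ract := rm\<rparr>) delbar"
      "length is = 2 \<Longrightarrow> delbar (P is) = dP_minus is"
begin

definition Om :: "('n alg, 'n form) bimod" where
  "Om = direct_sum (left_plus\<lparr>ract := rp\<rparr>) (left_minus\<lparr>ract := rm\<rparr>)"

definition Om_plus :: "'n form set" where
  "Om_plus = carrier left_plus \<times> {\<zero>\<^bsub>left_minus\<^esub>}"

definition Om_minus :: "'n form set" where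
  "Om_minus = {\<zero>\<^bsub>left_plus\<^esub>} \<times> carrier left_minus"

definition d0 :: "'n alg \<Rightarrow> 'n form" where
  "d0 b = (del b, delbar b)"

definition dP :: "'n list \<Rightarrow> 'n form" where
  "dP is = (dP_plus is, \<zero>\<^bsub>left_minus\<^esub>)"

definition dbarP :: "'n list \<Rightarrow> 'n form" where
  "dbarP is = (\<zero>\<^bsub>left_plus\<^esub>, dP_minus is)"

definition OmOm :: "('n alg, 'n form_form) bimod" where
  "OmOm = tensor alg Om Om"

definition tt :: "'n form \<Rightarrow> 'n form \<Rightarrow> 'n form_form" where
  "tt = tens alg Om Om"

text \<open>
  The degree two part of the universal calculus: as the ideal is generated in degree two, its part
  of degree two is the generated sub-bimodule of \<open>\<Omega> \<otimes>\<^sub>B \<Omega>\<close>.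
\<close>

definition universal_relations :: "'n form_form set" where
  "universal_relations = bimod_span alg OmOm
     {(\<Oplus>\<^bsub>OmOm\<^esub>i\<in>{..<k}. tt (d0 (u i)) (d0 (v i))) | (k :: nat) u v.
        u \<in> {..<k} \<rightarrow> carrier alg \<and> v \<in> {..<k} \<rightarrow> carrier alg \<and>
        (\<Oplus>\<^bsub>Om\<^esub>i\<in>{..<k}. lact Om (u i) (d0 (v i))) = \<zero>\<^bsub>Om\<^esub>}"

definition Om2 :: "('n alg, 'n form2) bimod" where
  "Om2 = quot_bimod OmOm universal_relations"

definition wedge_proj :: "'n form_form \<Rightarrow> 'n form2" where
  "wedge_proj t = universal_relations +>\<^bsub>OmOm\<^esub> t"

definition wedge :: "'n form \<Rightarrow> 'n form \<Rightarrow> 'n form2" where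
  "wedge x y = wedge_proj (tt x y)"

text \<open>The differential \<open>\<Sum> a\<^sub>i d b\<^sub>i \<mapsto> \<Sum> d a\<^sub>i \<and> d b\<^sub>i\<close> on one-forms.\<close>

definition d1 :: "'n form \<Rightarrow> 'n form2" where
  "d1 \<omega> = (THE y. \<exists>(k :: nat) u v.
     u \<in> {..<k} \<rightarrow> carrier alg \<and> v \<in> {..<k} \<rightarrow> carrier alg \<and>
     \<omega> = (\<Oplus>\<^bsub>Om\<^esub>i\<in>{..<k}. lact Om (u i) (d0 (v i))) \<and>
     y = (\<Oplus>\<^bsub>Om2\<^esub>i\<in>{..<k}. wedge (d0 (u i)) (d0 (v i))))"


subsection \<open>Metric, inverse metric, connection and curvature\<close>

definition g_pm :: "'n form_form" where
  "g_pm = E_ev' OmOm 1 (E_ev OmOm 2 (fam_prod tt dP dbarP)) []"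

definition g_mp :: "'n form_form" where
  "g_mp = E_ev' OmOm 1 (E_ev OmOm 2 (fam_prod tt dbarP dP)) []"

definition metric :: "'n form_form" where
  "metric = g_pm \<oplus>\<^bsub>OmOm\<^esub> g_mp"

definition PP :: "'n list \<Rightarrow> 'n alg" where
  "PP = fam_prod (mult alg) P P"

definition P_g :: "'n form_form \<Rightarrow> 'n list \<Rightarrow> 'n form_form" where
  "P_g x is = lact OmOm (P is) x"

definition P_g_P :: "'n form_form \<Rightarrow> 'n list \<Rightarrow> 'n form_form" where
  "P_g_P x = fam_prod (ract OmOm) (P_g x) P"

text \<open>
  The generators span all forms, so each of the predicates \<open>inverse_metric\<close>, \<open>levi_civita\<close>,
  \<open>generalized_braiding\<close> and \<open>splitting_map\<close> determines its map on the carrier.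
\<close>

definition inverse_metric :: "('n form_form \<Rightarrow> 'n alg) \<Rightarrow> bool" where
  "inverse_metric ip \<longleftrightarrow> bimodule_map alg OmOm (regular_bimod alg) ip \<and>
    (\<forall>is. length is = 4 \<longrightarrow>
      ip (fam_prod tt dP dP is) = \<zero>\<^bsub>alg\<^esub> \<and>
      ip (fam_prod tt dbarP dbarP is) = \<zero>\<^bsub>alg\<^esub> \<and>
      ip (fam_prod tt dP dbarP is) =
        fam_diff alg (fam_smult alg (qpow q par_a * qpow q (- par_w - par_m)) (S123 alg (C_coev alg 3 P)))
          (fam_smult alg (qpow q par_a * qpow q (- par_m)) PP) is \<and>
      ip (fam_prod tt dbarP dP is) =
        fam_diff alg (C_coev' alg 2 P) (fam_smult alg (qpow q (- par_m)) PP) is)"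

definition levi_civita :: "('n form \<Rightarrow> 'n form_form) \<Rightarrow> bool" where
  "levi_civita nabla \<longleftrightarrow> clinear_map Om OmOm nabla \<and>
    (\<forall>b\<in>carrier alg. \<forall>\<omega>\<in>carrier Om. nabla (lact Om b \<omega>) = tt (d0 b) \<omega> \<oplus>\<^bsub>OmOm\<^esub> lact OmOm b (nabla \<omega>)) \<and>
    (\<forall>is. length is = 2 \<longrightarrow>
      nabla (dP is) =
        fam_diff OmOm (fam_smult OmOm (qpow q par_a) (E_ev OmOm 2 (T1234 OmOm (fam_prod tt dbarP dP))))
          (fam_smult OmOm (qpow q par_a * qpow q (- par_m)) (P_g g_mp)) is \<and>
      nabla (dbarP is) =
        fam_diff OmOm (E_ev OmOm 2 (fam_prod tt dP dbarP))
          (fam_smult OmOm (qpow q (- par_m)) (P_g g_pm)) is)"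

definition Om2Om :: "('n alg, 'n form2_form) bimod" where
  "Om2Om = tensor alg Om2 Om"

text \<open>The map \<open>\<wedge> \<otimes> id\<close> applied to \<open>\<omega> \<otimes> t\<close>.\<close>

definition wedge_left :: "'n form \<Rightarrow> 'n form_form \<Rightarrow> 'n form2_form" where
  "wedge_left \<omega> = tensor_lift Om2Om (\<lambda>\<eta> \<zeta>. tens alg Om2 Om (wedge \<omega> \<eta>) \<zeta>)"

text \<open>
  In \<open>d \<otimes> id - (\<wedge> \<otimes> id) \<circ> (id \<otimes> \<nabla>)\<close> only the difference is balanced over the algebra, so
  the difference is taken before passing to the tensor product.
\<close>

definition riemann :: "('n form \<Rightarrow> 'n form_form) \<Rightarrow> 'n form \<Rightarrow> 'n form2_form" where
  "riemann nabla \<omega> =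
     tensor_lift Om2Om (\<lambda>\<eta> \<zeta>. tens alg Om2 Om (d1 \<eta>) \<zeta> \<ominus>\<^bsub>Om2Om\<^esub> wedge_left \<eta> (nabla \<zeta>)) (nabla \<omega>)"

definition generalized_braiding :: "('n form_form \<Rightarrow> 'n form_form) \<Rightarrow> bool" where
  "generalized_braiding \<sigma> \<longleftrightarrow> bimodule_map alg OmOm OmOm \<sigma> \<and>
    (\<forall>is. length is = 4 \<longrightarrow>
      \<sigma> (fam_prod tt dP dP is) =
        fam_smult OmOm (qpow q par_a) (S123 OmOm (S234' OmOm (fam_prod tt dP dP))) is \<and>
      \<sigma> (fam_prod tt dbarP dbarP is) =
        fam_smult OmOm (qpow q (- par_a)) (S123 OmOm (S234' OmOm (fam_prod tt dbarP dbarP))) is \<and>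
      \<sigma> (fam_prod tt dP dbarP is) =
        fam_add OmOm
          (fam_smult OmOm (qpow q (2 * par_a - 2 * par_w)) (S123 OmOm (S234'_inv OmOm (fam_prod tt dbarP dP))))
          (fam_smult OmOm ((1 - qpow q par_a) * qpow q par_a * qpow q (- par_m)) (P_g_P g_mp)) is \<and>
      \<sigma> (fam_prod tt dbarP dP is) =
        fam_add OmOm
          (fam_smult OmOm (qpow q (2 * par_w - 2 * par_a)) (S123_inv OmOm (S234' OmOm (fam_prod tt dP dbarP))))
          (fam_smult OmOm ((1 - qpow q (- par_a)) * qpow q (- par_m)) (P_g_P g_pm)) is)"

definition splitting_map ::
    "('n form_form \<Rightarrow> 'n form_form) \<Rightarrow> complex \<Rightarrow> complex \<Rightarrow> ('n form2 \<Rightarrow> 'n form_form) \<Rightarrow> bool" where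
  "splitting_map \<sigma> cpm cmp sw \<longleftrightarrow> bimodule_map alg Om2 OmOm sw \<and>
    (\<forall>x\<in>Om_plus. \<forall>y\<in>Om_plus. sw (wedge x y) = (1 / (1 + qpow q (- par_a))) \<odot>\<^bsub>OmOm\<^esub>
       (tt x y \<ominus>\<^bsub>OmOm\<^esub> qpow q (- par_a) \<odot>\<^bsub>OmOm\<^esub> \<sigma> (tt x y))) \<and>
    (\<forall>x\<in>Om_minus. \<forall>y\<in>Om_minus. sw (wedge x y) = (1 / (1 + qpow q par_a)) \<odot>\<^bsub>OmOm\<^esub>
       (tt x y \<ominus>\<^bsub>OmOm\<^esub> qpow q par_a \<odot>\<^bsub>OmOm\<^esub> \<sigma> (tt x y))) \<and>
    (\<forall>x\<in>Om_plus. \<forall>y\<in>Om_minus. sw (wedge x y) =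
       cpm \<odot>\<^bsub>OmOm\<^esub> tt x y \<ominus>\<^bsub>OmOm\<^esub> cmp \<odot>\<^bsub>OmOm\<^esub> \<sigma> (tt x y)) \<and>
    (\<forall>x\<in>Om_minus. \<forall>y\<in>Om_plus. sw (wedge x y) =
       cmp \<odot>\<^bsub>OmOm\<^esub> tt x y \<ominus>\<^bsub>OmOm\<^esub> cpm \<odot>\<^bsub>OmOm\<^esub> \<sigma> (tt x y))"

text \<open>
  The three maps composed here are \<open>\<Omega> \<otimes> \<Omega> \<rightarrow> \<Omega> \<otimes> (\<Omega>\<^sup>2 \<otimes> \<Omega>) \<rightarrow> \<Omega> \<otimes> ((\<Omega> \<otimes> \<Omega>) \<otimes> \<Omega>) \<rightarrow> \<Omega> \<otimes> \<Omega>\<close>;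
  the last one is \<open>\<omega> \<otimes> ((\<eta> \<otimes> \<zeta>) \<otimes> \<xi>) \<mapsto> (\<omega>, \<eta>) \<zeta> \<otimes> \<xi>\<close>.
\<close>

definition id_riemann :: "('n form \<Rightarrow> 'n form_form) \<Rightarrow> 'n form_form
    \<Rightarrow> (('n form \<times> 'n form2_form) \<Rightarrow>\<^sub>0 complex) set" where
  "id_riemann nabla =
     tensor_lift (tensor alg Om Om2Om) (\<lambda>\<omega> \<eta>. tens alg Om Om2Om \<omega> (riemann nabla \<eta>))"

definition id_split_id :: "('n form2 \<Rightarrow> 'n form_form)
    \<Rightarrow> (('n form \<times> 'n form2_form) \<Rightarrow>\<^sub>0 complex) set
    \<Rightarrow> (('n form \<times> (('n form_form \<times> 'n form) \<Rightarrow>\<^sub>0 complex) set) \<Rightarrow>\<^sub>0 complex) set" where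
  "id_split_id sw = (let OmOmOm = tensor alg OmOm Om in
     tensor_lift (tensor alg Om OmOmOm) (\<lambda>\<omega> t. tens alg Om OmOmOm \<omega>
       (tensor_lift OmOmOm (\<lambda>x \<xi>. tens alg OmOm Om (sw x) \<xi>) t)))"

definition metric_id_id :: "('n form_form \<Rightarrow> 'n alg)
    \<Rightarrow> (('n form \<times> (('n form_form \<times> 'n form) \<Rightarrow>\<^sub>0 complex) set) \<Rightarrow>\<^sub>0 complex) set
    \<Rightarrow> 'n form_form" where
  "metric_id_id ip =
     tensor_lift OmOm (\<lambda>\<omega>. tensor_lift OmOm (\<lambda>t \<xi>.
       tensor_lift OmOm (\<lambda>\<eta> \<zeta>. lact OmOm (ip (tt \<omega> \<eta>)) (tt \<zeta> \<xi>)) t))"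

definition ricci :: "('n form_form \<Rightarrow> 'n alg) \<Rightarrow> ('n form \<Rightarrow> 'n form_form)
    \<Rightarrow> ('n form2 \<Rightarrow> 'n form_form) \<Rightarrow> 'n form_form" where
  "ricci ip nabla sw = metric_id_id ip (id_split_id sw (id_riemann nabla metric))"

definition scal :: "('n form_form \<Rightarrow> 'n alg) \<Rightarrow> ('n form \<Rightarrow> 'n form_form)
    \<Rightarrow> ('n form2 \<Rightarrow> 'n form_form) \<Rightarrow> 'n alg" where
  "scal ip nabla sw = ip (ricci ip nabla sw)"

end

end

theory Submission
 imports Defs
begin

text \<open>
 Why the curvature has this value. A matrix product of two families, written \<open>x \<cdot> y\<close>, is the contraction
 \<open>E\<^sub>2\<^sub>3 x y\<close>. The relations of the algebra and of the calculus give \<open>p \<cdot> p = p\<close>, \<open>p \<cdot> \<partial>p = 0\<close>,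
 \<open>p \<cdot> \<bar>\<partial>p = \<bar>\<partial>p\<close>, \<open>\<partial>p \<cdot> p = \<partial>p\<close> and \<open>\<bar>\<partial>p \<cdot> p = 0\<close> (lemmas \<open>P_P\<close>, \<open>P_dP\<close>, \<open>P_dbarP\<close>, \<open>dP_P\<close>, \<open>dbarP_P\<close>),
 as for the projection that defines classical projective space. So \<open>d\<bar>\<partial>p\<close> is the product \<open>dp \<cdot> dp\<close> formed with
 \<open>\<and>\<close>, and \<open>d\<partial>p\<close> is its negative. Contracting a form of type \<open>\<Omega>\<^sub>+\<close> or \<open>\<Omega>\<^sub>-\<close> with the curvature then leaves only
 few terms: the inverse metric kills equal types, the braiding preserves the tensors that are killed
 (\<open>contr_sigma_plus\<close>, \<open>contr_sigma_minus\<close>), and \<open>\<partial>p \<cdot> \<partial>p\<close> and \<open>\<bar>\<partial>p \<cdot> \<bar>\<partial>p\<close> vanish. What remains is expressed through the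
 two numbers \<open>(\<cdot>,\<cdot>)(g\<^sub>+\<^sub>-) = q\<^sup>-\<^sup>r [r + 1] - 1\<close> and \<open>(\<cdot>,\<cdot>)(g\<^sub>-\<^sub>+) = q\<^sup>r [r + 1] - 1\<close>, where \<open>[r + 1]\<close> is the quantum dimension of
 \<open>V\<close> (\<open>scalar_plus\<close>, \<open>scalar_minus\<close>); \<open>scalar_identity\<close> is the final simplification.

 The identities above need only few properties of the braidings: they are invertible, \<open>R\<^sub>V\<^sub>V\<close> satisfies a
 Hecke relation, and they slide along the evaluations and coevaluations. These are the assumptions of the
 locale \<open>dual_braiding\<close>. The proof that the braidings of \<open>V\<close> and its dual satisfy them is by explicit matrices.
 Simplicity forces \<open>V\<close> to be a chain of lines joined by the lowering operators (\<open>V_chain\<close>); the matrices below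
 are module maps with the prescribed value on (highest) \<open>\<otimes>\<close> (lowest), and such a map is unique
 (\<open>braiding_eqI\<close>).

 Equations in the various modules are verified by applying an arbitrary linear functional, as functionals
 separate points (\<open>functional_eqI\<close>). A family with values in a module becomes a complex function of its indices,
 and the operators on legs become operators on such functions.
\<close>

section \<open>Complex vector spaces with a carrier\<close>

lemma complex_field_simps [simp]:
 "carrier complex_field = UNIV" "\<one>\<^bsub>complex_field\<^esub> = 1" "\<zero>\<^bsub>complex_field\<^esub> = 0"
 "x \<otimes>\<^bsub>complex_field\<^esub> y = x * y" "x \<oplus>\<^bsub>complex_field\<^esub> y = x + y"
 by (auto simp: complex_field_def)

lemma cring_complex_field: "cring complex_field"
 by (rule cringI, rule abelian_groupI)
  (auto simp: algebra_simps comm_monoid_def comm_monoid_axioms_def monoid_def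
   intro: exI[of _ "- x" for x])

lemma a_inv_complex_field [simp]: "\<ominus>\<^bsub>complex_field\<^esub> x = - x"
proof -
 interpret cring complex_field by (rule cring_complex_field)
 show ?thesis by (rule sum_zero_eq_neg[symmetric]) auto
qed

locale cspace =
 fixes M :: "(complex, 'm, 'z) module_scheme" (structure)
 assumes cmodule: "module complex_field M"

sublocale cspace \<subseteq> module complex_field M by (rule cmodule)

context cspace
begin

lemma sm_closed [simp, intro]: "x \<in> carrier M ==> c \<odot> x \<in> carrier M"
 using smult_closed[of c x] by simp

lemma sm_add: "x \<in> carrier M ==> (c + d) \<odot> x = c \<odot> x \<oplus> d \<odot> x"
 using smult_l_distr[of c d x] by simp

lemma sm_distr: "x \<in> carrier M ==> y \<in> carrier M ==> c \<odot> (x \<oplus> y) = c \<odot> x \<oplus> c \<odot> y"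
 using smult_r_distr[of c x y] by simp

lemma sm_assoc: "x \<in> carrier M ==> c \<odot> (d \<odot> x) = (c * d) \<odot> x"
 using smult_assoc1[of c d x] by simp

lemma sm_one [simp]: "x \<in> carrier M ==> 1 \<odot> x = x"
 using smult_one[of x] by simp

lemma sm_zero [simp]: "x \<in> carrier M ==> 0 \<odot> x = \<zero>"
 using smult_l_null[of x] by simp

lemma sm_zero_right [simp]: "c \<odot> \<zero> = \<zero>"
 using smult_r_null[of c] by simp

lemma sm_minus_one: "x \<in> carrier M ==> (- 1) \<odot> x = \<ominus> x"
 using smult_l_minus[of 1 x] by simp

lemma minus_sm: "x \<in> carrier M ==> y \<in> carrier M ==> x \<ominus> y = x \<oplus> (- 1) \<odot> y"
 by (simp add: a_minus_def sm_minus_one)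

lemma minus_eq_zero:
 assumes "x \<in> carrier M" "y \<in> carrier M"
 shows "x \<ominus> y = \<zero> \<longleftrightarrow> x = y"
proof
 assume "x \<ominus> y = \<zero>"
 then have "(x \<ominus> y) \<oplus> y = y" using assms by simp
 then show "x = y" using assms by (simp add: a_minus_def a_assoc l_neg)
qed (use assms in \<open>simp add: a_minus_def r_neg\<close>)

lemma submoduleI':
 assumes "H \<subseteq> carrier M" "\<zero> \<in> H" "\<And>x y. x \<in> H ==> y \<in> H ==> x \<oplus> y \<in> H"
  "\<And>c x. x \<in> H ==> c \<odot> x \<in> H"
 shows "submodule H complex_field M"
 using assms by (intro submoduleI) (auto simp: sm_minus_one[symmetric] subset_eq)

lemma submoduleD:
 assumes "submodule H complex_field M"
 shows "H \<subseteq> carrier M" "\<zero> \<in> H" "\<And>x y. x \<in> H ==> y \<in> H ==> x \<oplus> y \<in> H"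
  "\<And>c x. x \<in> H ==> c \<odot> x \<in> H" "\<And>x y. x \<in> H ==> y \<in> H ==> x \<ominus> y \<in> H"
  "\<And>x. x \<in> H ==> \<ominus> x \<in> H"
proof -
 note E = submoduleE[OF assms]
 show a: "H \<subseteq> carrier M" by (rule E)
 show b: "\<zero> \<in> H"
  using subgroup.one_closed[OF submodule.axioms(1)[OF assms]] by simp
 show c: "\<And>x y. x \<in> H ==> y \<in> H ==> x \<oplus> y \<in> H" by (rule E)
 show "\<And>c x. x \<in> H ==> c \<odot> x \<in> H" using E(4) by simp
 show d: "\<And>x. x \<in> H ==> \<ominus> x \<in> H" by (rule E)
 show "\<And>x y. x \<in> H ==> y \<in> H ==> x \<ominus> y \<in> H" by (simp add: a_minus_def c d)
qed

end

subsection \<open>Linear functionals\<close>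

definition functional :: "(complex, 'm, 'z) module_scheme \<Rightarrow> ('m \<Rightarrow> complex) \<Rightarrow> bool" where
 "functional M \<phi> \<longleftrightarrow>
  (\<forall>x\<in>carrier M. \<forall>y\<in>carrier M. \<phi> (x \<oplus>\<^bsub>M\<^esub> y) = \<phi> x + \<phi> y) \<and>
  (\<forall>c. \<forall>x\<in>carrier M. \<phi> (c \<odot>\<^bsub>M\<^esub> x) = c * \<phi> x)"

context cspace
begin

text \<open>
 A subspace that is maximal among those that do not contain \<open>x\<^sub>0\<close> has codimension one; \<open>\<phi>\<close> is the coordinate
 along \<open>x\<^sub>0\<close> modulo this subspace.
\<close>

lemma functional_separates_zero:
 assumes x0: "x0 \<in> carrier M" "x0 \<noteq> \<zero>"
 obtains \<phi> where "functional M \<phi>" "\<phi> x0 = 1"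
proof -
 define A where "A = {H. submodule H complex_field M \<and> x0 \<notin> H}"
 have "{\<zero>} \<in> A"
  using x0 by (auto simp: A_def intro!: submoduleI')
 then have "A \<noteq> {}" by auto
 then have "\<exists>H\<in>A. \<forall>X\<in>A. H \<subseteq> X \<longrightarrow> X = H"
 proof (rule subset_Zorn_nonempty)
  fix C assume C: "C \<noteq> {}" "subset.chain A C"
  have CA: "C \<subseteq> A" using C by (auto simp: subset.chain_def)
  have ch: "X \<subseteq> Y \<or> Y \<subseteq> X" if "X \<in> C" "Y \<in> C" for X Y
   using C that by (auto simp: subset.chain_def)
  have sub: "submodule X complex_field M" if "X \<in> C" for X using CA that by (auto simp: A_def)
  have "submodule (\<Union>C) complex_field M"
  proof (rule submoduleI')
   show "\<Union>C \<subseteq> carrier M" using submoduleD(1)[OF sub] by blast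
   show "\<zero> \<in> \<Union>C" using C(1) submoduleD(2)[OF sub] by blast
   show "x \<oplus> y \<in> \<Union>C" if xy: "x \<in> \<Union>C" "y \<in> \<Union>C" for x y
   proof -
    obtain X Y where "X \<in> C" "x \<in> X" "Y \<in> C" "y \<in> Y" using xy by blast
    then show ?thesis using ch[of X Y] submoduleD(3)[OF sub] by blast
   qed
   show "c \<odot> x \<in> \<Union>C" if "x \<in> \<Union>C" for c x
    using that submoduleD(4)[OF sub] by blast
  qed
  moreover have "x0 \<notin> \<Union>C" using CA by (auto simp: A_def)
  ultimately show "\<Union>C \<in> A" by (simp add: A_def)
 qed
 then obtain H where H: "submodule H complex_field M" "x0 \<notin> H"
  and mx: "\<And>X. submodule X complex_field M ==> x0 \<notin> X ==> H \<subseteq> X ==> X = H"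
  by (auto simp: A_def)
 note HD = submoduleD[OF H(1)]
 have Hc: "x \<in> carrier M" if "x \<in> H" for x using HD(1) that by auto
 have ex: "\<exists>c. y \<ominus> c \<odot> x0 \<in> H" if y: "y \<in> carrier M" for y
 proof (cases "y \<in> H")
  case True
  then have "y \<ominus> 0 \<odot> x0 \<in> H" using x0 y by (simp add: minus_sm)
  then show ?thesis by blast
 next
  case False
  define X where "X = {h \<oplus> d \<odot> y | h d. h \<in> H}"
  have memX: "z \<in> X \<longleftrightarrow> (\<exists>h\<in>H. \<exists>d. z = h \<oplus> d \<odot> y)" for z unfolding X_def by blast
  have "submodule X complex_field M"
  proof (rule submoduleI')
   show "X \<subseteq> carrier M" using y Hc by (auto simp: X_def)
   have "\<zero> = \<zero> \<oplus> 0 \<odot> y" using y by simp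
   then show "\<zero> \<in> X" using HD(2) memX by blast
   fix u v assume "u \<in> X" "v \<in> X"
   then obtain h d h' d' where *: "u = h \<oplus> d \<odot> y" "h \<in> H" "v = h' \<oplus> d' \<odot> y" "h' \<in> H"
    using memX by blast
   have "u \<oplus> v = (h \<oplus> h') \<oplus> (d + d') \<odot> y"
    using * y Hc by (simp add: sm_add a_ac)
   then show "u \<oplus> v \<in> X" using *(2,4) HD(3) memX by blast
  next
   fix c u assume "u \<in> X"
   then obtain h d where *: "u = h \<oplus> d \<odot> y" "h \<in> H"
    using memX by blast
   have "c \<odot> u = c \<odot> h \<oplus> (c * d) \<odot> y" using * y Hc by (simp add: sm_distr sm_assoc)
   then show "c \<odot> u \<in> X" using *(2) HD(4) memX by blast
  qed
  moreover have "H \<subseteq> X"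
  proof
   fix h assume h: "h \<in> H"
   then have "h = h \<oplus> 0 \<odot> y" using y Hc by simp
   then show "h \<in> X" using h memX by blast
  qed
  moreover have "y \<in> X"
  proof -
   have "y = \<zero> \<oplus> 1 \<odot> y" using y by simp
   then show ?thesis using HD(2) memX by blast
  qed
  ultimately have "x0 \<in> X" using mx[of X] False by blast
  then obtain h d where hd: "x0 = h \<oplus> d \<odot> y" "h \<in> H" using memX by blast
  have d: "d \<noteq> 0" using hd H(2) y Hc by auto
  have "y \<ominus> (1 / d) \<odot> x0 = (- (1 / d)) \<odot> h"
  proof -
   have "(1 / d) \<odot> x0 = (1 / d) \<odot> h \<oplus> y" using hd y Hc d by (simp add: sm_distr sm_assoc)
   then have "y \<ominus> (1 / d) \<odot> x0 = y \<oplus> ((- (1 / d)) \<odot> h \<oplus> (- 1) \<odot> y)"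
    using y Hc hd x0 by (simp add: minus_sm sm_distr sm_assoc)
   also have "\<dots> = (y \<oplus> (- 1) \<odot> y) \<oplus> (- (1 / d)) \<odot> h"
    using y Hc hd by (simp add: a_ac)
   also have "\<dots> = (- (1 / d)) \<odot> h" using y Hc hd by (simp add: sm_minus_one r_neg)
   finally show ?thesis .
  qed
  then show ?thesis using HD(4)[OF hd(2)] by metis
 qed
 define \<phi> where "\<phi> y = (SOME c. y \<ominus> c \<odot> x0 \<in> H)" for y
 have \<phi>: "y \<ominus> \<phi> y \<odot> x0 \<in> H" if "y \<in> carrier M" for y
  unfolding \<phi>_def using ex[OF that] by (rule someI_ex)
 have uniq: "\<phi> y = c" if y: "y \<in> carrier M" and c: "y \<ominus> c \<odot> x0 \<in> H" for y c
 proof (rule ccontr)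
  assume ne: "\<phi> y \<noteq> c"
  have "(y \<ominus> c \<odot> x0) \<ominus> (y \<ominus> \<phi> y \<odot> x0) \<in> H" using \<phi>[OF y] c HD(5) by blast
  moreover have "(y \<ominus> c \<odot> x0) \<ominus> (y \<ominus> \<phi> y \<odot> x0) = (\<phi> y - c) \<odot> x0"
  proof -
   have "(y \<ominus> c \<odot> x0) \<ominus> (y \<ominus> \<phi> y \<odot> x0) = (y \<oplus> (- 1) \<odot> y) \<oplus> ((- c) \<odot> x0 \<oplus> \<phi> y \<odot> x0)"
    using y x0 by (simp add: minus_sm sm_distr sm_assoc a_ac)
   also have "\<dots> = (- c + \<phi> y) \<odot> x0"
    using y x0 sm_add[of x0 "- c" "\<phi> y"] by (simp add: sm_minus_one r_neg)
   finally show ?thesis by (simp add: algebra_simps)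
  qed
  ultimately have "(1 / (\<phi> y - c)) \<odot> ((\<phi> y - c) \<odot> x0) \<in> H" using HD(4) by simp
  then have "x0 \<in> H" using ne x0 by (simp add: sm_assoc)
  then show False using H by simp
 qed
 have "functional M \<phi>"
  unfolding functional_def
 proof (intro conjI ballI allI)
  fix x y assume xy: "x \<in> carrier M" "y \<in> carrier M"
  have "(x \<oplus> y) \<ominus> (\<phi> x + \<phi> y) \<odot> x0 = (x \<ominus> \<phi> x \<odot> x0) \<oplus> (y \<ominus> \<phi> y \<odot> x0)"
   using xy x0 by (simp add: minus_sm sm_distr sm_assoc sm_add a_ac)
  then show "\<phi> (x \<oplus> y) = \<phi> x + \<phi> y"
   using \<phi>[OF xy(1)] \<phi>[OF xy(2)] HD(3) xy by (intro uniq) auto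
 next
  fix c x assume x: "x \<in> carrier M"
  have "(c \<odot> x) \<ominus> (c * \<phi> x) \<odot> x0 = c \<odot> (x \<ominus> \<phi> x \<odot> x0)"
   using x x0 by (simp add: minus_sm sm_distr sm_assoc)
  then show "\<phi> (c \<odot> x) = c * \<phi> x"
   using \<phi>[OF x] HD(4) x by (intro uniq) auto
 qed
 moreover have "\<phi> x0 = 1"
  using x0 HD(2) by (intro uniq) (auto simp: a_minus_def r_neg)
 ultimately show ?thesis using that by blast
qed

lemma functional_eqI:
 assumes "x \<in> carrier M" "y \<in> carrier M" "\<And>\<phi>. functional M \<phi> ==> \<phi> x = \<phi> y"
 shows "x = y"
proof (rule ccontr)
 assume "x \<noteq> y"
 then have "x \<ominus> y \<noteq> \<zero>" using assms minus_eq_zero by simp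
 then obtain \<phi> where \<phi>: "functional M \<phi>" "\<phi> (x \<ominus> y) = 1"
  using functional_separates_zero[of "x \<ominus> y"] assms by auto
 then have "\<phi> x + (- 1) * \<phi> y = 1"
  using assms(1,2) by (simp add: functional_def minus_sm)
 then show False using assms(3)[OF \<phi>(1)] by simp
qed

lemma functional_add: "functional M \<phi> ==> x \<in> carrier M ==> y \<in> carrier M ==> \<phi> (x \<oplus> y) = \<phi> x + \<phi> y"
 by (simp add: functional_def)

lemma functional_smult: "functional M \<phi> ==> x \<in> carrier M ==> \<phi> (c \<odot> x) = c * \<phi> x"
 by (simp add: functional_def)

lemma functional_zero: "functional M \<phi> ==> \<phi> \<zero> = 0"
 using functional_smult[of \<phi> \<zero> 0] by simp

lemma functional_minus: "functional M \<phi> ==> x \<in> carrier M ==> y \<in> carrier M ==> \<phi> (x \<ominus> y) = \<phi> x - \<phi> y"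
 by (simp add: functional_add functional_smult minus_sm)

lemma functional_finsum:
 assumes "functional M \<phi>" "f \<in> A \<rightarrow> carrier M"
 shows "\<phi> (finsum M f A) = (\<Sum>i\<in>A. \<phi> (f i))"
proof (cases "finite A")
 case True
 then show ?thesis using assms(2)
  by (induction A rule: finite_induct) (simp_all add: functional_zero functional_add assms(1) Pi_def)
next
 case False
 then show ?thesis by (simp add: finsum_infinite functional_zero[OF assms(1)])
qed

end

subsection \<open>Linear maps\<close>

lemma clinear_mapD:
 assumes "clinear_map M N f"
 shows "x \<in> carrier M ==> f x \<in> carrier N"
  "x \<in> carrier M ==> y \<in> carrier M ==> f (x \<oplus>\<^bsub>M\<^esub> y) = f x \<oplus>\<^bsub>N\<^esub> f y"
  "x \<in> carrier M ==> f (c \<odot>\<^bsub>M\<^esub> x) = c \<odot>\<^bsub>N\<^esub> f x"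
 using assms by (auto simp: clinear_map_def)

lemma clinear_zero:
 assumes "cspace M" "cspace N" "clinear_map M N f"
 shows "f \<zero>\<^bsub>M\<^esub> = \<zero>\<^bsub>N\<^esub>"
proof -
 interpret M: cspace M by fact
 interpret N: cspace N by fact
 note D = clinear_mapD[OF assms(3)]
 have "f (0 \<odot>\<^bsub>M\<^esub> \<zero>\<^bsub>M\<^esub>) = 0 \<odot>\<^bsub>N\<^esub> f \<zero>\<^bsub>M\<^esub>" by (rule D) simp
 then show ?thesis using D(1)[of "\<zero>\<^bsub>M\<^esub>"] by simp
qed

lemma clinear_minus:
 assumes "cspace M" "cspace N" "clinear_map M N f" "x \<in> carrier M" "y \<in> carrier M"
 shows "f (x \<ominus>\<^bsub>M\<^esub> y) = f x \<ominus>\<^bsub>N\<^esub> f y"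
proof -
 interpret M: cspace M by fact
 interpret N: cspace N by fact
 note D = clinear_mapD[OF assms(3)]
 show ?thesis using assms(4,5) by (simp add: M.minus_sm N.minus_sm D)
qed

lemma clinear_finsum:
 assumes "cspace M" "cspace N" "clinear_map M N f" "g \<in> A \<rightarrow> carrier M"
 shows "f (finsum M g A) = finsum N (%i. f (g i)) A"
proof (cases "finite A")
 case True
 interpret M: cspace M by fact
 interpret N: cspace N by fact
 note D = clinear_mapD[OF assms(3)]
 show ?thesis using True assms(4)
  by (induction A rule: finite_induct) (simp_all add: clinear_zero[OF assms(1,2,3)] D Pi_def)
next
 case False
 interpret M: cspace M by fact
 interpret N: cspace N by fact
 show ?thesis using False by (simp add: M.finsum_infinite N.finsum_infinite clinear_zero[OF assms(1,2,3)])
qed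

lemma functional_compose:
 assumes "clinear_map M N f" "functional N \<phi>"
 shows "functional M (%x. \<phi> (f x))"
 using assms by (auto simp: functional_def clinear_map_def Pi_iff)

lemma clinear_compose:
 assumes "clinear_map M N f" "clinear_map N K g"
 shows "clinear_map M K (%x. g (f x))"
 using assms by (auto simp: clinear_map_def Pi_iff)

section \<open>Quotients of vector spaces and of bimodules\<close>

locale csubspace = cspace M for M :: "('b, 'm) bimod" (structure) +
 fixes N :: "'m set"
 assumes sub: "submodule N complex_field M"
begin

abbreviation "Qt \<equiv> quot_bimod M N"

lemmas subD = submoduleD[OF sub]

lemma sub_carrier: "x \<in> N ==> x \<in> carrier M"
 using subD(1) by auto

text \<open>
 Elements of a quotient are cosets, i.e. sets. The following lemmas transfer the operations from
 representatives to cosets.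
\<close>

lemma mem_coset: "x \<in> carrier M ==> z \<in> N +> x \<longleftrightarrow> z \<in> carrier M \<and> z \<ominus> x \<in> N"
proof -
 assume x: "x \<in> carrier M"
 have "z \<in> N +> x \<longleftrightarrow> (\<exists>n\<in>N. z = n \<oplus> x)" by (auto simp: a_r_coset_def r_coset_def)
 also have "\<dots> \<longleftrightarrow> z \<in> carrier M \<and> z \<ominus> x \<in> N"
 proof
  assume "\<exists>n\<in>N. z = n \<oplus> x"
  then obtain n where n: "n \<in> N" "z = n \<oplus> x" by blast
  then show "z \<in> carrier M \<and> z \<ominus> x \<in> N"
   using x sub_carrier[of n] by (simp add: a_minus_def a_assoc r_neg)
 next
  assume a: "z \<in> carrier M \<and> z \<ominus> x \<in> N"
  then have "z = (z \<ominus> x) \<oplus> x" using x by (simp add: a_minus_def a_assoc l_neg)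
  then show "\<exists>n\<in>N. z = n \<oplus> x" using a by blast
 qed
 finally show ?thesis .
qed

lemma coset_self: "x \<in> carrier M ==> x \<in> N +> x"
 using subD(2) by (simp add: mem_coset a_minus_def r_neg)

lemma coset_eq_iff:
 assumes "x \<in> carrier M" "y \<in> carrier M"
 shows "N +> x = N +> y \<longleftrightarrow> x \<ominus> y \<in> N"
proof
 assume "N +> x = N +> y"
 then show "x \<ominus> y \<in> N" using coset_self[OF assms(1)] assms by (auto simp: mem_coset)
next
 assume xy: "x \<ominus> y \<in> N"
 have 1: "z \<ominus> y = (z \<ominus> x) \<oplus> (x \<ominus> y)" if "z \<in> carrier M" for z
 proof -
  have "(z \<ominus> x) \<oplus> (x \<ominus> y) = z \<oplus> (\<ominus> x \<oplus> (x \<oplus> \<ominus> y))"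
   using that assms by (simp add: a_minus_def a_assoc)
  also have "\<ominus> x \<oplus> (x \<oplus> \<ominus> y) = \<ominus> y" using assms by (simp add: a_assoc[symmetric] l_neg)
  finally show ?thesis by (simp add: a_minus_def)
 qed
 have 2: "z \<ominus> x = (z \<ominus> y) \<ominus> (x \<ominus> y)" if "z \<in> carrier M" for z
 proof -
  have "(u \<oplus> v) \<ominus> v = u" if "u \<in> carrier M" "v \<in> carrier M" for u v
   using that by (simp add: a_minus_def a_assoc r_neg)
  then show ?thesis using that assms by (simp add: 1[OF that])
 qed
 show "N +> x = N +> y"
 proof (rule Set.set_eqI)
  fix z
  show "z \<in> N +> x \<longleftrightarrow> z \<in> N +> y"
   using 1[of z] 2[of z] xy subD(3)[of "z \<ominus> x" "x \<ominus> y"] subD(5)[of "z \<ominus> y" "x \<ominus> y"] assms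
   by (auto simp: mem_coset)
 qed
qed

lemma quot_carrier: "carrier Qt = (%x. N +> x) ` carrier M"
 by (auto simp: quot_bimod_def A_RCOSETS_def' )

lemma quot_zero: "\<zero>\<^bsub>Qt\<^esub> = N +> \<zero>"
proof -
 have "N +> \<zero> = N"
  using subD(1) by (auto simp: mem_coset a_minus_def)
 then show ?thesis by (simp add: quot_bimod_def)
qed

lemma quot_add:
 assumes "x \<in> carrier M" "y \<in> carrier M"
 shows "(N +> x) \<oplus>\<^bsub>Qt\<^esub> (N +> y) = N +> (x \<oplus> y)"
proof -
 have "z \<in> set_add M (N +> x) (N +> y) \<longleftrightarrow> z \<in> N +> (x \<oplus> y)" for z
 proof
  assume "z \<in> set_add M (N +> x) (N +> y)"
  then obtain a b where ab: "a \<in> N +> x" "b \<in> N +> y" "z = a \<oplus> b"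
   by (auto simp: set_add_def set_mult_def)
  then have "a \<in> carrier M" "b \<in> carrier M" "(a \<ominus> x) \<oplus> (b \<ominus> y) \<in> N"
   using assms subD(3) by (auto simp: mem_coset)
  moreover from this have "(a \<ominus> x) \<oplus> (b \<ominus> y) = z \<ominus> (x \<oplus> y)"
   using assms ab(3) by (simp add: minus_sm sm_distr a_ac)
  ultimately show "z \<in> N +> (x \<oplus> y)" using assms ab(3) by (simp add: mem_coset)
 next
  assume z: "z \<in> N +> (x \<oplus> y)"
  then have zc: "z \<in> carrier M" "z \<ominus> (x \<oplus> y) \<in> N" using assms by (auto simp: mem_coset)
  have eq: "(z \<ominus> y) \<ominus> x = z \<ominus> (x \<oplus> y)"
   using assms zc by (simp add: minus_sm sm_distr a_ac)
  have "z \<ominus> y \<in> N +> x" using zc assms eq by (simp add: mem_coset)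
  moreover have "z = (z \<ominus> y) \<oplus> y" using zc assms by (simp add: a_minus_def a_assoc l_neg)
  ultimately show "z \<in> set_add M (N +> x) (N +> y)"
   using coset_self[OF assms(2)] by (auto simp: set_add_def set_mult_def)
 qed
 then show ?thesis by (auto simp: quot_bimod_def)
qed

lemma quot_map:
 assumes "f \<in> carrier M \<rightarrow> carrier M" "\<And>x y. x \<in> carrier M ==> y \<in> carrier M ==> f (x \<oplus> y) = f x \<oplus> f y"
  and "\<And>x. x \<in> N ==> f x \<in> N" and x: "x \<in> carrier M"
 shows "(\<Union>z\<in>N +> x. N +> f z) = N +> f x"
proof -
 have "N +> f z = N +> f x" if z: "z \<in> N +> x" for z
 proof -
  have zc: "z \<in> carrier M" "z \<ominus> x \<in> N" using z x by (auto simp: mem_coset)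
  have "z = (z \<ominus> x) \<oplus> x" using zc x by (simp add: a_minus_def a_assoc l_neg)
  then have "f z = f (z \<ominus> x) \<oplus> f x" using assms(2)[of "z \<ominus> x" x] zc x by simp
  moreover have "f (z \<ominus> x) \<in> N" using assms(3) zc by blast
  ultimately have "f z \<ominus> f x \<in> N"
   using assms(1) x zc by (simp add: a_minus_def a_assoc r_neg Pi_iff sub_carrier)
  then show ?thesis using assms(1) zc x by (subst coset_eq_iff) auto
 qed
 then show ?thesis using coset_self[OF x] by (intro SUP_eq_const) blast+
qed

lemma quot_smult:
 assumes "x \<in> carrier M"
 shows "c \<odot>\<^bsub>Qt\<^esub> (N +> x) = N +> (c \<odot> x)"
proof -
 have "(\<Union>z\<in>N +> x. N +> (c \<odot> z)) = N +> (c \<odot> x)"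
  using assms subD(4) by (intro quot_map) (auto simp: sm_distr)
 then show ?thesis by (simp add: quot_bimod_def)
qed

lemma quot_lact:
 assumes "lact M b \<in> carrier M \<rightarrow> carrier M"
  "\<And>x y. x \<in> carrier M ==> y \<in> carrier M ==> lact M b (x \<oplus> y) = lact M b x \<oplus> lact M b y"
  "\<And>x. x \<in> N ==> lact M b x \<in> N" "x \<in> carrier M"
 shows "lact Qt b (N +> x) = N +> lact M b x"
 using quot_map[OF assms] by (simp add: quot_bimod_def)

lemma quot_ract:
 assumes "(%x. ract M x b) \<in> carrier M \<rightarrow> carrier M"
  "\<And>x y. x \<in> carrier M ==> y \<in> carrier M ==> ract M (x \<oplus> y) b = ract M x b \<oplus> ract M y b"
  "\<And>x. x \<in> N ==> ract M x b \<in> N" "x \<in> carrier M"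
 shows "ract Qt (N +> x) b = N +> ract M x b"
 using quot_map[OF assms] by (simp add: quot_bimod_def)

lemma quot_closed: "x \<in> carrier M ==> N +> x \<in> carrier Qt"
 by (simp add: quot_carrier)

lemma quot_cspace: "cspace Qt"
proof (rule cspace.intro, rule moduleI)
 have ab: "abelian_group Qt"
 proof (rule abelian_groupI)
  fix X assume "X \<in> carrier Qt"
  then obtain x where x: "x \<in> carrier M" "X = N +> x" by (auto simp: quot_carrier)
  then show "\<exists>y\<in>carrier Qt. y \<oplus>\<^bsub>Qt\<^esub> X = \<zero>\<^bsub>Qt\<^esub>"
   by (intro bexI[of _ "N +> (\<ominus> x)"]) (auto simp: quot_add quot_zero quot_closed l_neg)
 qed (auto simp: quot_carrier quot_add quot_zero a_ac)
 show "abelian_group Qt" by (fact ab)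
qed (auto simp: cring_complex_field quot_carrier quot_add quot_smult sm_add sm_distr sm_assoc)

lemma quot_linear: "clinear_map M Qt (%x. N +> x)"
 by (auto simp: clinear_map_def quot_add quot_smult quot_closed)

end

lemma cspan_submodule:
 assumes "cspace M" "G \<subseteq> carrier M"
 shows "submodule (cspan M G) complex_field M" "G \<subseteq> cspan M G" "cspan M G \<subseteq> carrier M"
  "submodule H complex_field M ==> G \<subseteq> H ==> cspan M G \<subseteq> H"
proof -
 interpret cspace M by fact
 have c: "submodule (carrier M) complex_field M" by (rule carrier_is_submodule)
 show "G \<subseteq> cspan M G" by (auto simp: cspan_def)
 show s: "cspan M G \<subseteq> carrier M" using c assms(2) by (auto simp: cspan_def)
 show "submodule (cspan M G) complex_field M"
 proof (rule submoduleI')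
  show "cspan M G \<subseteq> carrier M" by fact
 qed (auto simp: cspan_def dest: submoduleD)
 show "submodule H complex_field M ==> G \<subseteq> H ==> cspan M G \<subseteq> H" by (auto simp: cspan_def)
qed

section \<open>Bimodules over a complex algebra\<close>

locale calgebra =
 fixes B :: "(complex, 'b) module" (structure)
 assumes ring_alg: "ring B" and module_alg: "module complex_field B"
  and smult_left: "x \<in> carrier B ==> (c \<odot> \<one>) \<otimes> x = c \<odot> x"
  and smult_right: "x \<in> carrier B ==> x \<otimes> (c \<odot> \<one>) = c \<odot> x"

sublocale calgebra \<subseteq> Bv: cspace B by (rule cspace.intro) (rule module_alg)
sublocale calgebra \<subseteq> B: ring B by (rule ring_alg)

context calgebra
begin

lemma smult_mult_left: "x \<in> carrier B ==> y \<in> carrier B ==> (c \<odot> x) \<otimes> y = c \<odot> (x \<otimes> y)"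
proof -
 assume a: "x \<in> carrier B" "y \<in> carrier B"
 have "(c \<odot> \<one>) \<otimes> x \<otimes> y = (c \<odot> \<one>) \<otimes> (x \<otimes> y)" using a by (intro B.m_assoc) auto
 then show ?thesis using a by (simp only: smult_left B.m_closed)
qed

lemma smult_mult_right: "x \<in> carrier B ==> y \<in> carrier B ==> x \<otimes> (c \<odot> y) = c \<odot> (x \<otimes> y)"
proof -
 assume a: "x \<in> carrier B" "y \<in> carrier B"
 have "x \<otimes> y \<otimes> (c \<odot> \<one>) = x \<otimes> (y \<otimes> (c \<odot> \<one>))" using a by (intro B.m_assoc) auto
 then show ?thesis using a by (simp only: smult_right B.m_closed)
qed

end

locale bimodule = calgebra B + alg_bimodule B M
 for B :: "(complex, 'b) module" and M :: "('b, 'm) bimod"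

sublocale bimodule \<subseteq> M: cspace M by (rule cspace.intro) (rule vector_space)

context bimodule
begin

lemmas l_closed [simp, intro] = closed(1) and r_closed [simp, intro] = closed(2)

lemma l_smult: 
 assumes "b \<in> carrier B" "x \<in> carrier M"
 shows "lact M (c \<odot>\<^bsub>B\<^esub> b) x = c \<odot>\<^bsub>M\<^esub> lact M b x" "lact M b (c \<odot>\<^bsub>M\<^esub> x) = c \<odot>\<^bsub>M\<^esub> lact M b x"
proof -
 show 1: "lact M (c \<odot>\<^bsub>B\<^esub> b) x = c \<odot>\<^bsub>M\<^esub> lact M b x"
  using assms assoc(1)[of "c \<odot>\<^bsub>B\<^esub> \<one>\<^bsub>B\<^esub>" b x] by (simp add: smult_left scalar)
 have "lact M b (c \<odot>\<^bsub>M\<^esub> x) = lact M b (lact M (c \<odot>\<^bsub>B\<^esub> \<one>\<^bsub>B\<^esub>) x)"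
  using assms by (simp add: scalar)
 also have "\<dots> = c \<odot>\<^bsub>M\<^esub> lact M b x"
  using assms assoc(1)[of b "c \<odot>\<^bsub>B\<^esub> \<one>\<^bsub>B\<^esub>" x] 1 by (simp add: smult_right)
 finally show "lact M b (c \<odot>\<^bsub>M\<^esub> x) = c \<odot>\<^bsub>M\<^esub> lact M b x" .
qed

lemma r_smult: 
 assumes "b \<in> carrier B" "x \<in> carrier M"
 shows "ract M x (c \<odot>\<^bsub>B\<^esub> b) = c \<odot>\<^bsub>M\<^esub> ract M x b" "ract M (c \<odot>\<^bsub>M\<^esub> x) b = c \<odot>\<^bsub>M\<^esub> ract M x b"
proof -
 show 1: "ract M x (c \<odot>\<^bsub>B\<^esub> b) = c \<odot>\<^bsub>M\<^esub> ract M x b"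
  using assms assoc(2)[of b "c \<odot>\<^bsub>B\<^esub> \<one>\<^bsub>B\<^esub>" x] by (simp add: smult_right scalar)
 have "ract M (c \<odot>\<^bsub>M\<^esub> x) b = ract M (ract M x (c \<odot>\<^bsub>B\<^esub> \<one>\<^bsub>B\<^esub>)) b"
  using assms by (simp add: scalar)
 also have "\<dots> = c \<odot>\<^bsub>M\<^esub> ract M x b"
  using assms assoc(2)[of "c \<odot>\<^bsub>B\<^esub> \<one>\<^bsub>B\<^esub>" b x] 1 by (simp add: smult_left)
 finally show "ract M (c \<odot>\<^bsub>M\<^esub> x) b = c \<odot>\<^bsub>M\<^esub> ract M x b" .
qed

lemma l_one [simp]: "x \<in> carrier M ==> lact M \<one>\<^bsub>B\<^esub> x = x"
 using scalar(1)[of x 1] by simp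

lemma r_one [simp]: "x \<in> carrier M ==> ract M x \<one>\<^bsub>B\<^esub> = x"
 using scalar(2)[of x 1] by simp

lemma l_linear: "b \<in> carrier B ==> clinear_map M M (lact M b)"
 by (auto simp: clinear_map_def add_mod l_smult)

lemma r_linear: "b \<in> carrier B ==> clinear_map M M (%x. ract M x b)"
 by (auto simp: clinear_map_def add_mod r_smult)

lemma l_linear': "x \<in> carrier M ==> clinear_map B M (%b. lact M b x)"
 by (auto simp: clinear_map_def add_alg l_smult)

lemma r_linear': "x \<in> carrier M ==> clinear_map B M (%b. ract M x b)"
 by (auto simp: clinear_map_def add_alg r_smult)

lemma l_zero [simp]: "b \<in> carrier B ==> lact M b \<zero>\<^bsub>M\<^esub> = \<zero>\<^bsub>M\<^esub>"
 using clinear_zero[OF M.cspace_axioms M.cspace_axioms l_linear] .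

lemma r_zero [simp]: "b \<in> carrier B ==> ract M \<zero>\<^bsub>M\<^esub> b = \<zero>\<^bsub>M\<^esub>"
 using clinear_zero[OF M.cspace_axioms M.cspace_axioms r_linear] .

end

locale subbimodule = bimodule B M for B :: "(complex, 'b) module" and M :: "('b, 'm) bimod" +
 fixes N :: "'m set"
 assumes sub: "submodule N complex_field M"
  and l_stable: "b \<in> carrier B ==> x \<in> N ==> lact M b x \<in> N"
  and r_stable: "b \<in> carrier B ==> x \<in> N ==> ract M x b \<in> N"

sublocale subbimodule \<subseteq> csubspace M N
 by (intro csubspace.intro csubspace_axioms.intro M.cspace_axioms sub)

context subbimodule
begin

lemma quot_l: "b \<in> carrier B ==> x \<in> carrier M ==> lact (quot_bimod M N) b (N +>\<^bsub>M\<^esub> x) = N +>\<^bsub>M\<^esub> lact M b x"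
 by (rule quot_lact) (auto simp: add_mod l_stable)

lemma quot_r: "b \<in> carrier B ==> x \<in> carrier M ==> ract (quot_bimod M N) (N +>\<^bsub>M\<^esub> x) b = N +>\<^bsub>M\<^esub> ract M x b"
 by (rule quot_ract) (auto simp: add_mod r_stable)

lemma quot_alg_bimodule: "alg_bimodule B (quot_bimod M N)"
proof -
 have "module complex_field (quot_bimod M N)"
  using quot_cspace by (simp add: cspace_def)
 then show ?thesis
  by (intro alg_bimodule.intro)
   (auto simp: quot_carrier quot_l quot_r quot_add quot_smult add_alg add_mod scalar assoc)
qed

end

section \<open>Tensor products over a complex algebra\<close>

lemma lookup_map_times: "Poly_Mapping.lookup (Poly_Mapping.map ((*) c) z) k = c * Poly_Mapping.lookup z k"
 for c :: complex
 by (simp add: map.rep_eq when_def)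

lemma keys_map_times: "Poly_Mapping.keys (Poly_Mapping.map ((*) c) z) \<subseteq> Poly_Mapping.keys z"
 for c :: complex
 by (auto simp: in_keys_iff lookup_map_times)

lemma sum_keys_extend:
 fixes z :: "'k \<Rightarrow>\<^sub>0 complex" and g :: "'k \<Rightarrow> complex \<Rightarrow> 'a::comm_monoid_add"
 assumes "finite A" "Poly_Mapping.keys z \<subseteq> A" "\<And>k. g k 0 = 0"
 shows "(\<Sum>k\<in>Poly_Mapping.keys z. g k (Poly_Mapping.lookup z k)) = (\<Sum>k\<in>A. g k (Poly_Mapping.lookup z k))"
 using assms by (intro sum.mono_neutral_left) (auto simp: in_keys_iff)

lemma sum_keys_add:
 fixes z w :: "'k \<Rightarrow>\<^sub>0 complex" and g :: "'k \<Rightarrow> complex \<Rightarrow> 'a::comm_monoid_add"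
 assumes g: "\<And>k. g k 0 = 0" "\<And>k a b. g k (a + b) = g k a + g k b"
 shows "(\<Sum>k\<in>Poly_Mapping.keys (z + w). g k (Poly_Mapping.lookup (z + w) k)) =
  (\<Sum>k\<in>Poly_Mapping.keys z. g k (Poly_Mapping.lookup z k)) +
  (\<Sum>k\<in>Poly_Mapping.keys w. g k (Poly_Mapping.lookup w k))"
proof -
 let ?A = "Poly_Mapping.keys z \<union> Poly_Mapping.keys w"
 have "finite ?A" by simp
 moreover have "Poly_Mapping.keys (z + w) \<subseteq> ?A" by (rule Poly_Mapping.keys_add)
 ultimately show ?thesis
  using sum_keys_extend[of ?A z g] sum_keys_extend[of ?A w g] sum_keys_extend[of ?A "z + w" g] g
  by (simp add: lookup_add sum.distrib)
qed

lemma sum_keys_single: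
 fixes g :: "'k \<Rightarrow> complex \<Rightarrow> 'a::comm_monoid_add"
 assumes "\<And>k. g k 0 = 0"
 shows "(\<Sum>k\<in>Poly_Mapping.keys (Poly_Mapping.single x c). g k (Poly_Mapping.lookup (Poly_Mapping.single x c) k)) = g x c"
 using assms by (cases "c = 0") auto

lemma poly_mapping_as_sum: "(\<Sum>k\<in>Poly_Mapping.keys z. Poly_Mapping.single k (Poly_Mapping.lookup z k)) = z"
 for z :: "'k \<Rightarrow>\<^sub>0 complex"
 by (rule poly_mapping_eqI) (simp add: lookup_sum lookup_single when_def in_keys_iff cong: if_cong)

lemma map_times_single:
 "Poly_Mapping.map ((*) c) (Poly_Mapping.single k d) = Poly_Mapping.single k (c * d)" for c :: complex
 by (rule poly_mapping_eqI) (simp add: lookup_map_times lookup_single when_def)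

definition extend_linear :: "('k \<Rightarrow> 'l) \<Rightarrow> ('k \<Rightarrow>\<^sub>0 complex) \<Rightarrow> ('l \<Rightarrow>\<^sub>0 complex)" where
 "extend_linear f z = (\<Sum>k\<in>Poly_Mapping.keys z. Poly_Mapping.single (f k) (Poly_Mapping.lookup z k))"

lemma extend_linear_add: "extend_linear f (z + w) = extend_linear f z + extend_linear f w"
 unfolding extend_linear_def
 by (rule sum_keys_add[where g = "%k. Poly_Mapping.single (f k)"]) (auto simp: single_add)

lemma extend_linear_single: "extend_linear f (Poly_Mapping.single k c) = Poly_Mapping.single (f k) c"
 unfolding extend_linear_def
 by (rule sum_keys_single[where g = "%k. Poly_Mapping.single (f k)"]) auto

lemma extend_linear_smult:
 "extend_linear f (Poly_Mapping.map ((*) c) z) = Poly_Mapping.map ((*) c) (extend_linear f z)"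
proof -
 have "extend_linear f (Poly_Mapping.map ((*) c) z) =
   (\<Sum>k\<in>Poly_Mapping.keys z. Poly_Mapping.single (f k) (c * Poly_Mapping.lookup z k))"
  unfolding extend_linear_def
  using sum_keys_extend[of "Poly_Mapping.keys z" "Poly_Mapping.map ((*) c) z" "%k. Poly_Mapping.single (f k)"]
  by (simp add: keys_map_times lookup_map_times)
 also have "\<dots> = Poly_Mapping.map ((*) c) (extend_linear f z)"
  unfolding extend_linear_def
  by (rule poly_mapping_eqI)
   (simp add: lookup_map_times lookup_sum lookup_single when_def sum_distrib_left if_distrib cong: if_cong)
 finally show ?thesis .
qed

lemma extend_linear_diff: "extend_linear f (z - w) = extend_linear f z - extend_linear f w"
 using extend_linear_add[of f "z - w" w] by simp

lemma keys_extend_linear: "Poly_Mapping.keys (extend_linear f z) \<subseteq> f ` Poly_Mapping.keys z"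
proof -
 have "Poly_Mapping.keys (extend_linear f z) \<subseteq>
   (\<Union>k\<in>Poly_Mapping.keys z. Poly_Mapping.keys (Poly_Mapping.single (f k) (Poly_Mapping.lookup z k)))"
  unfolding extend_linear_def by (rule Poly_Mapping.keys_sum)
 also have "\<dots> \<subseteq> f ` Poly_Mapping.keys z" by (auto split: if_splits)
 finally show ?thesis .
qed

locale bimodule_pair = M: bimodule B M + N: bimodule B N
 for B :: "(complex, 'b) module" and M :: "('b, 'm) bimod" and N :: "('b, 'n) bimod"
begin

abbreviation "F \<equiv> formal_sums M N"
abbreviation "K \<equiv> cspan F (tensor_relations B M N)"
abbreviation "MN \<equiv> tensor B M N"
abbreviation "ten \<equiv> tens B M N"

lemma F_simps:
 "carrier F = {z. Poly_Mapping.keys z \<subseteq> carrier M \<times> carrier N}" "\<zero>\<^bsub>F\<^esub> = 0" "x \<oplus>\<^bsub>F\<^esub> y = x + y"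
 "c \<odot>\<^bsub>F\<^esub> x = Poly_Mapping.map ((*) c) x"
 "lact F b z = extend_linear (%k. (lact M b (fst k), snd k)) z"
 "ract F z b = extend_linear (%k. (fst k, ract N (snd k) b)) z"
 by (simp_all add: formal_sums_def extend_linear_def)

lemma F_cspace: "cspace F"
proof (rule cspace.intro, rule moduleI)
 show "abelian_group F"
 proof (rule abelian_groupI)
  fix x y assume "x \<in> carrier F" "y \<in> carrier F"
  then show "x \<oplus>\<^bsub>F\<^esub> y \<in> carrier F"
   using Poly_Mapping.keys_add[of x y] by (auto simp: F_simps)
 next
  fix x assume "x \<in> carrier F"
  then show "\<exists>y\<in>carrier F. y \<oplus>\<^bsub>F\<^esub> x = \<zero>\<^bsub>F\<^esub>"
   by (intro bexI[of _ "- x"]) (auto simp: F_simps)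
 qed (auto simp: F_simps)
 show "c \<odot>\<^bsub>F\<^esub> x \<in> carrier F" if "x \<in> carrier F" for c x
  using that keys_map_times[of c x] by (auto simp: F_simps)
qed (auto simp: cring_complex_field F_simps intro!: poly_mapping_eqI
  simp: lookup_map_times lookup_add algebra_simps)

sublocale F: cspace F by (rule F_cspace)

lemma F_minus:
 assumes "x \<in> carrier F" "y \<in> carrier F"
 shows "x \<ominus>\<^bsub>F\<^esub> y = x - y"
proof -
 have "Poly_Mapping.map ((*) (- 1)) y = - y"
  by (rule poly_mapping_eqI) (simp add: lookup_map_times)
 then show ?thesis using assms by (simp add: F.minus_sm) (simp add: F_simps)
qed

lemma single_F: "x \<in> carrier M ==> y \<in> carrier N ==> Poly_Mapping.single (x, y) c \<in> carrier F"
 by (auto simp: F_simps split: if_splits)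

lemma minus_F: "x \<in> carrier F ==> y \<in> carrier F ==> x - y \<in> carrier F"
 using F_minus[of x y] F.minus_closed[of x y] by simp

lemma relations_F: "tensor_relations B M N \<subseteq> carrier F"
 unfolding tensor_relations_def Let_def by (auto intro!: minus_F single_F)

sublocale FK: csubspace F K
 by (intro csubspace.intro F_cspace csubspace_axioms.intro cspan_submodule(1) relations_F)

lemma tensor_eq: "MN = quot_bimod F K" by (simp add: tensor_def)

lemma ten_eq: "ten x y = K +>\<^bsub>F\<^esub> Poly_Mapping.single (x, y) 1" by (simp add: tens_def)

sublocale MN: cspace MN unfolding tensor_eq by (rule FK.quot_cspace)

lemma relations_K: "z \<in> tensor_relations B M N ==> z \<in> K"
 using cspan_submodule(2)[OF F_cspace relations_F] by blast

lemma coset_eqI: "x \<in> carrier F ==> y \<in> carrier F ==> x - y \<in> K ==> K +>\<^bsub>F\<^esub> x = K +>\<^bsub>F\<^esub> y"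
 by (simp add: FK.coset_eq_iff F_minus)

lemma ten_closed [simp, intro]: "x \<in> carrier M ==> y \<in> carrier N ==> ten x y \<in> carrier MN"
 unfolding tensor_eq ten_eq by (intro FK.quot_closed single_F)

lemma ten_smult_coset:
 "x \<in> carrier M ==> y \<in> carrier N ==> c \<odot>\<^bsub>MN\<^esub> ten x y = K +>\<^bsub>F\<^esub> Poly_Mapping.single (x, y) c"
 unfolding tensor_eq ten_eq by (simp add: FK.quot_smult single_F) (simp add: F_simps map_times_single)

lemma ten_add_left:
 assumes "x \<in> carrier M" "x' \<in> carrier M" "y \<in> carrier N"
 shows "ten (x \<oplus>\<^bsub>M\<^esub> x') y = ten x y \<oplus>\<^bsub>MN\<^esub> ten x' y"
proof -
 have "Poly_Mapping.single (x \<oplus>\<^bsub>M\<^esub> x', y) 1 - Poly_Mapping.single (x, y) 1 - Poly_Mapping.single (x', y) (1 :: complex) \<in> K"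
  by (rule relations_K) (unfold tensor_relations_def Let_def, use assms in blast)
 then have "K +>\<^bsub>F\<^esub> Poly_Mapping.single (x \<oplus>\<^bsub>M\<^esub> x', y) 1 =
   K +>\<^bsub>F\<^esub> (Poly_Mapping.single (x, y) 1 \<oplus>\<^bsub>F\<^esub> Poly_Mapping.single (x', y) 1)"
  using assms by (intro coset_eqI F.a_closed single_F) (auto simp: F_simps algebra_simps)
 then show ?thesis
  unfolding tensor_eq ten_eq using assms by (simp add: FK.quot_add single_F)
qed

lemma ten_add_right:
 assumes "x \<in> carrier M" "y \<in> carrier N" "y' \<in> carrier N"
 shows "ten x (y \<oplus>\<^bsub>N\<^esub> y') = ten x y \<oplus>\<^bsub>MN\<^esub> ten x y'"
proof -
 have "Poly_Mapping.single (x, y \<oplus>\<^bsub>N\<^esub> y') 1 - Poly_Mapping.single (x, y) 1 - Poly_Mapping.single (x, y') (1 :: complex) \<in> K"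
  by (rule relations_K) (unfold tensor_relations_def Let_def, use assms in blast)
 then have "K +>\<^bsub>F\<^esub> Poly_Mapping.single (x, y \<oplus>\<^bsub>N\<^esub> y') 1 =
   K +>\<^bsub>F\<^esub> (Poly_Mapping.single (x, y) 1 \<oplus>\<^bsub>F\<^esub> Poly_Mapping.single (x, y') 1)"
  using assms by (intro coset_eqI F.a_closed single_F) (auto simp: F_simps algebra_simps)
 then show ?thesis
  unfolding tensor_eq ten_eq using assms by (simp add: FK.quot_add single_F)
qed

lemma ten_smult_left:
 assumes "x \<in> carrier M" "y \<in> carrier N"
 shows "ten (c \<odot>\<^bsub>M\<^esub> x) y = c \<odot>\<^bsub>MN\<^esub> ten x y"
proof -
 have "Poly_Mapping.single (c \<odot>\<^bsub>M\<^esub> x, y) 1 - Poly_Mapping.single (x, y) (c :: complex) \<in> K"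
  by (rule relations_K) (unfold tensor_relations_def Let_def, use assms in blast)
 then show ?thesis unfolding ten_smult_coset[OF assms]
  unfolding ten_eq using assms by (intro coset_eqI single_F) auto
qed

lemma ten_smult_right:
 assumes "x \<in> carrier M" "y \<in> carrier N"
 shows "ten x (c \<odot>\<^bsub>N\<^esub> y) = c \<odot>\<^bsub>MN\<^esub> ten x y"
proof -
 have "Poly_Mapping.single (x, c \<odot>\<^bsub>N\<^esub> y) 1 - Poly_Mapping.single (x, y) (c :: complex) \<in> K"
  by (rule relations_K) (unfold tensor_relations_def Let_def, use assms in blast)
 then show ?thesis unfolding ten_smult_coset[OF assms]
  unfolding ten_eq using assms by (intro coset_eqI single_F) auto
qed

lemma ten_balanced:
 assumes "x \<in> carrier M" "y \<in> carrier N" "b \<in> carrier B"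
 shows "ten (ract M x b) y = ten x (lact N b y)"
proof -
 have "Poly_Mapping.single (ract M x b, y) 1 - Poly_Mapping.single (x, lact N b y) (1::complex) \<in> K"
  by (rule relations_K) (unfold tensor_relations_def Let_def, use assms in blast)
 then show ?thesis
  unfolding ten_eq using assms by (intro coset_eqI single_F) auto
qed

lemma ten_linear_left: "y \<in> carrier N ==> clinear_map M MN (%x. ten x y)"
 by (auto simp: clinear_map_def ten_add_left ten_smult_left)

lemma ten_linear_right: "x \<in> carrier M ==> clinear_map N MN (%y. ten x y)"
 by (auto simp: clinear_map_def ten_add_right ten_smult_right)

lemma ten_zero [simp]: "y \<in> carrier N ==> ten \<zero>\<^bsub>M\<^esub> y = \<zero>\<^bsub>MN\<^esub>" "x \<in> carrier M ==> ten x \<zero>\<^bsub>N\<^esub> = \<zero>\<^bsub>MN\<^esub>"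
 using clinear_zero[OF M.M.cspace_axioms MN.cspace_axioms ten_linear_left]
  clinear_zero[OF N.M.cspace_axioms MN.cspace_axioms ten_linear_right] by auto

text \<open>The elementary tensors span, so additive statements need only be checked on them.\<close>

lemma tensor_induct [consumes 1, case_names ten add]:
 assumes t: "t \<in> carrier MN"
  and gen: "\<And>x y. x \<in> carrier M ==> y \<in> carrier N ==> Q (ten x y)"
  and add: "\<And>u v. u \<in> carrier MN ==> v \<in> carrier MN ==> Q u ==> Q v ==> Q (u \<oplus>\<^bsub>MN\<^esub> v)"
 shows "Q t"
proof -
 have "(\<Sum>k\<in>A. Poly_Mapping.single k (c k)) \<in> carrier F \<and>
   Q (K +>\<^bsub>F\<^esub> (\<Sum>k\<in>A. Poly_Mapping.single k (c k)))"
  if "finite A" "A \<subseteq> carrier M \<times> carrier N" for A :: "('m \<times> 'n) set" and c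
  using that
 proof (induction A rule: finite_induct)
  case empty
  have "K +>\<^bsub>F\<^esub> 0 = ten \<zero>\<^bsub>M\<^esub> \<zero>\<^bsub>N\<^esub>"
   using FK.quot_zero by (simp add: F_simps tensor_eq[symmetric])
  then show ?case using gen[of "\<zero>\<^bsub>M\<^esub>" "\<zero>\<^bsub>N\<^esub>"] F.zero_closed by (simp add: F_simps)
 next
  case (insert p A)
  obtain x y where p: "p = (x, y)" "x \<in> carrier M" "y \<in> carrier N" using insert.prems by auto
  have 1: "(\<Sum>k\<in>A. Poly_Mapping.single k (c k)) \<in> carrier F"
   "Q (K +>\<^bsub>F\<^esub> (\<Sum>k\<in>A. Poly_Mapping.single k (c k)))"
   using insert by auto
  have 2: "Poly_Mapping.single p (c p) \<in> carrier F" using p single_F by simp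
  have 3: "K +>\<^bsub>F\<^esub> Poly_Mapping.single p (c p) = ten (c p \<odot>\<^bsub>M\<^esub> x) y"
   using p by (simp add: ten_smult_left ten_smult_coset)
  have "K +>\<^bsub>F\<^esub> (Poly_Mapping.single p (c p) \<oplus>\<^bsub>F\<^esub> (\<Sum>k\<in>A. Poly_Mapping.single k (c k))) =
    ten (c p \<odot>\<^bsub>M\<^esub> x) y \<oplus>\<^bsub>MN\<^esub> (K +>\<^bsub>F\<^esub> (\<Sum>k\<in>A. Poly_Mapping.single k (c k)))"
   unfolding 3[symmetric] tensor_eq by (rule FK.quot_add[OF 2 1(1), symmetric])
  moreover have "Q (ten (c p \<odot>\<^bsub>M\<^esub> x) y \<oplus>\<^bsub>MN\<^esub> (K +>\<^bsub>F\<^esub> (\<Sum>k\<in>A. Poly_Mapping.single k (c k))))"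
  proof (intro add gen)
   show "K +>\<^bsub>F\<^esub> (\<Sum>k\<in>A. Poly_Mapping.single k (c k)) \<in> carrier MN"
    unfolding tensor_eq by (rule FK.quot_closed) (rule 1)
  qed (use p 1 in auto)
  ultimately show ?case
   using insert.hyps F.a_closed[OF 2 1(1)] by (simp add: F_simps)
 qed
 note * = this
 obtain z where z: "z \<in> carrier F" "t = K +>\<^bsub>F\<^esub> z" using t unfolding tensor_eq FK.quot_carrier by auto
 show ?thesis
  using *[of "Poly_Mapping.keys z" "Poly_Mapping.lookup z"] z by (auto simp: poly_mapping_as_sum F_simps)
qed

lemma K_stable:
 assumes g: "\<And>x y. x \<in> carrier M ==> y \<in> carrier N ==> g (x, y) \<in> carrier M \<times> carrier N"
  and rel: "\<And>z. z \<in> tensor_relations B M N ==> extend_linear g z \<in> K"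
 shows "extend_linear g \<in> carrier F \<rightarrow> carrier F" "z \<in> K ==> extend_linear g z \<in> K"
proof -
 show c: "extend_linear g \<in> carrier F \<rightarrow> carrier F"
 proof
  fix z assume "z \<in> carrier F"
  then have "Poly_Mapping.keys z \<subseteq> carrier M \<times> carrier N" by (simp add: F_simps)
  moreover have "g k \<in> carrier M \<times> carrier N" if "k \<in> carrier M \<times> carrier N" for k
   using that g[of "fst k" "snd k"] by auto
  ultimately have "g ` Poly_Mapping.keys z \<subseteq> carrier M \<times> carrier N" by blast
  then show "extend_linear g z \<in> carrier F"
   using keys_extend_linear[of g z] by (simp add: F_simps)
 qed
 have "submodule {z \<in> carrier F. extend_linear g z \<in> K} complex_field F"
 proof (rule F.submoduleI')
  have "extend_linear g \<zero>\<^bsub>F\<^esub> = \<zero>\<^bsub>F\<^esub>" by (simp add: F_simps extend_linear_def)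
  then show "\<zero>\<^bsub>F\<^esub> \<in> {z \<in> carrier F. extend_linear g z \<in> K}" using FK.subD(2) by simp
 next
  fix x y assume xy: "x \<in> {z \<in> carrier F. extend_linear g z \<in> K}" "y \<in> {z \<in> carrier F. extend_linear g z \<in> K}"
  have "extend_linear g (x \<oplus>\<^bsub>F\<^esub> y) = extend_linear g x \<oplus>\<^bsub>F\<^esub> extend_linear g y"
   by (simp add: F_simps extend_linear_add)
  then show "x \<oplus>\<^bsub>F\<^esub> y \<in> {z \<in> carrier F. extend_linear g z \<in> K}" using FK.subD(3) xy by auto
 next
  fix a x assume x: "x \<in> {z \<in> carrier F. extend_linear g z \<in> K}"
  have "extend_linear g (a \<odot>\<^bsub>F\<^esub> x) = a \<odot>\<^bsub>F\<^esub> extend_linear g x"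
   by (simp add: F_simps extend_linear_smult)
  then show "a \<odot>\<^bsub>F\<^esub> x \<in> {z \<in> carrier F. extend_linear g z \<in> K}" using FK.subD(4) x by auto
 qed blast
 then have "K \<subseteq> {z \<in> carrier F. extend_linear g z \<in> K}"
  using rel relations_F by (intro cspan_submodule(4)[OF F_cspace relations_F]) auto
 then show "z \<in> K ==> extend_linear g z \<in> K" by blast
qed

end

context bimodule_pair
begin

lemma relationsE:
 assumes "z \<in> tensor_relations B M N"
 obtains
  (add_left) x x' y where "z = Poly_Mapping.single (x \<oplus>\<^bsub>M\<^esub> x', y) 1 - Poly_Mapping.single (x, y) 1 - Poly_Mapping.single (x', y) 1"
   "x \<in> carrier M" "x' \<in> carrier M" "y \<in> carrier N"
 | (add_right) x y y' where "z = Poly_Mapping.single (x, y \<oplus>\<^bsub>N\<^esub> y') 1 - Poly_Mapping.single (x, y) 1 - Poly_Mapping.single (x, y') 1"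
   "x \<in> carrier M" "y \<in> carrier N" "y' \<in> carrier N"
 | (smult_left) c x y where "z = Poly_Mapping.single (c \<odot>\<^bsub>M\<^esub> x, y) 1 - Poly_Mapping.single (x, y) c"
   "x \<in> carrier M" "y \<in> carrier N"
 | (smult_right) c x y where "z = Poly_Mapping.single (x, c \<odot>\<^bsub>N\<^esub> y) 1 - Poly_Mapping.single (x, y) c"
   "x \<in> carrier M" "y \<in> carrier N"
 | (balance) x b y where "z = Poly_Mapping.single (ract M x b, y) 1 - Poly_Mapping.single (x, lact N b y) 1"
   "x \<in> carrier M" "b \<in> carrier B" "y \<in> carrier N"
 using assms unfolding tensor_relations_def Let_def by blast

lemma relationsI1:
 assumes "x \<in> carrier M" "x' \<in> carrier M" "y \<in> carrier N"
 shows "Poly_Mapping.single (x \<oplus>\<^bsub>M\<^esub> x', y) 1 - Poly_Mapping.single (x, y) 1 - Poly_Mapping.single (x', y) (1 :: complex) \<in> K"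
 by (rule relations_K) (unfold tensor_relations_def Let_def, use assms in blast)

lemma relationsI2:
 assumes "x \<in> carrier M" "y \<in> carrier N" "y' \<in> carrier N"
 shows "Poly_Mapping.single (x, y \<oplus>\<^bsub>N\<^esub> y') 1 - Poly_Mapping.single (x, y) 1 - Poly_Mapping.single (x, y') (1 :: complex) \<in> K"
 by (rule relations_K) (unfold tensor_relations_def Let_def, use assms in blast)

lemma relationsI3:
 assumes "x \<in> carrier M" "y \<in> carrier N"
 shows "Poly_Mapping.single (c \<odot>\<^bsub>M\<^esub> x, y) 1 - Poly_Mapping.single (x, y) (c :: complex) \<in> K"
 by (rule relations_K) (unfold tensor_relations_def Let_def, use assms in blast)

lemma relationsI4:
 assumes "x \<in> carrier M" "y \<in> carrier N"
 shows "Poly_Mapping.single (x, c \<odot>\<^bsub>N\<^esub> y) 1 - Poly_Mapping.single (x, y) (c :: complex) \<in> K"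
 by (rule relations_K) (unfold tensor_relations_def Let_def, use assms in blast)

lemma relationsI5:
 assumes "x \<in> carrier M" "b \<in> carrier B" "y \<in> carrier N"
 shows "Poly_Mapping.single (ract M x b, y) 1 - Poly_Mapping.single (x, lact N b y) (1 :: complex) \<in> K"
 by (rule relations_K) (unfold tensor_relations_def Let_def, use assms in blast)

lemmas relationsI = relationsI1 relationsI2 relationsI3 relationsI4 relationsI5

lemma lact_F:
 assumes b: "b \<in> carrier B"
 shows "lact F b \<in> carrier F \<rightarrow> carrier F" "z \<in> K ==> lact F b z \<in> K"
  "lact F b (x \<oplus>\<^bsub>F\<^esub> y) = lact F b x \<oplus>\<^bsub>F\<^esub> lact F b y"
proof -
 let ?g = "%k. (lact M b (fst k), snd k)"
 have rel: "extend_linear ?g z \<in> K" if "z \<in> tensor_relations B M N" for z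
  using that
 proof (cases rule: relationsE)
  case (add_left x x' y)
  then show ?thesis using b relationsI(1)[of "lact M b x" "lact M b x'" y]
   by (simp add: extend_linear_diff extend_linear_single M.add_mod)
 next
  case (add_right x y y')
  then show ?thesis using b relationsI(2)[of "lact M b x" y y']
   by (simp add: extend_linear_diff extend_linear_single)
 next
  case (smult_left c x y)
  then show ?thesis using b relationsI(3)[of "lact M b x" y c]
   by (simp add: extend_linear_diff extend_linear_single M.l_smult)
 next
  case (smult_right c x y)
  then show ?thesis using b relationsI(4)[of "lact M b x" y c]
   by (simp add: extend_linear_diff extend_linear_single)
 next
  case (balance x b' y)
  then show ?thesis using b relationsI(5)[of "lact M b x" b' y]
   by (simp add: extend_linear_diff extend_linear_single M.assoc)
 qed
 have cl: "?g (x, y) \<in> carrier M \<times> carrier N" if "x \<in> carrier M" "y \<in> carrier N" for x y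
  using that b by simp
 have eq: "lact F b = extend_linear ?g" by (rule ext) (simp add: F_simps)
 show "lact F b \<in> carrier F \<rightarrow> carrier F" "z \<in> K ==> lact F b z \<in> K"
  unfolding eq by (rule K_stable; use cl rel in blast)+
 show "lact F b (x \<oplus>\<^bsub>F\<^esub> y) = lact F b x \<oplus>\<^bsub>F\<^esub> lact F b y"
  by (simp add: F_simps extend_linear_add)
qed

lemma ract_F:
 assumes b: "b \<in> carrier B"
 shows "(%z. ract F z b) \<in> carrier F \<rightarrow> carrier F" "z \<in> K ==> ract F z b \<in> K"
  "ract F (x \<oplus>\<^bsub>F\<^esub> y) b = ract F x b \<oplus>\<^bsub>F\<^esub> ract F y b"
proof -
 let ?g = "%k. (fst k, ract N (snd k) b)"
 have rel: "extend_linear ?g z \<in> K" if "z \<in> tensor_relations B M N" for z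
  using that
 proof (cases rule: relationsE)
  case (add_left x x' y)
  then show ?thesis using b relationsI(1)[of x x' "ract N y b"]
   by (simp add: extend_linear_diff extend_linear_single)
 next
  case (add_right x y y')
  then show ?thesis using b relationsI(2)[of x "ract N y b" "ract N y' b"]
   by (simp add: extend_linear_diff extend_linear_single N.add_mod)
 next
  case (smult_left c x y)
  then show ?thesis using b relationsI(3)[of x "ract N y b" c]
   by (simp add: extend_linear_diff extend_linear_single)
 next
  case (smult_right c x y)
  then show ?thesis using b relationsI(4)[of x "ract N y b" c]
   by (simp add: extend_linear_diff extend_linear_single N.r_smult)
 next
  case (balance x b' y)
  then show ?thesis using b relationsI(5)[of x b' "ract N y b"]
   by (simp add: extend_linear_diff extend_linear_single N.assoc)
 qed
 have cl: "?g (x, y) \<in> carrier M \<times> carrier N" if "x \<in> carrier M" "y \<in> carrier N" for x y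
  using that b by simp
 have eq: "(%z. ract F z b) = extend_linear ?g" by (rule ext) (simp add: F_simps)
 have eq': "ract F z b = extend_linear ?g z" for z by (simp add: F_simps)
 show "(%z. ract F z b) \<in> carrier F \<rightarrow> carrier F" "z \<in> K ==> ract F z b \<in> K"
  unfolding eq eq' by (rule K_stable; use cl rel in blast)+
 show "ract F (x \<oplus>\<^bsub>F\<^esub> y) b = ract F x b \<oplus>\<^bsub>F\<^esub> ract F y b"
  by (simp add: F_simps extend_linear_add)
qed

lemma tensor_lact_coset: "b \<in> carrier B ==> z \<in> carrier F ==> lact MN b (K +>\<^bsub>F\<^esub> z) = K +>\<^bsub>F\<^esub> lact F b z"
 unfolding tensor_eq by (rule FK.quot_lact) (auto simp: lact_F)

lemma tensor_ract_coset: "b \<in> carrier B ==> z \<in> carrier F ==> ract MN (K +>\<^bsub>F\<^esub> z) b = K +>\<^bsub>F\<^esub> ract F z b"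
 unfolding tensor_eq by (rule FK.quot_ract) (auto simp: ract_F)

lemma lact_ten: "b \<in> carrier B ==> x \<in> carrier M ==> y \<in> carrier N ==> lact MN b (ten x y) = ten (lact M b x) y"
 unfolding ten_eq by (simp add: tensor_lact_coset single_F) (simp add: F_simps extend_linear_single)

lemma ract_ten: "b \<in> carrier B ==> x \<in> carrier M ==> y \<in> carrier N ==> ract MN (ten x y) b = ten x (ract N y b)"
 unfolding ten_eq by (simp add: tensor_ract_coset single_F) (simp add: F_simps extend_linear_single)

lemma tensor_cosetE:
 assumes "t \<in> carrier MN"
 obtains z where "z \<in> carrier F" "t = K +>\<^bsub>F\<^esub> z"
 using assms unfolding tensor_eq FK.quot_carrier by auto

lemma coset_closed: "z \<in> carrier F ==> K +>\<^bsub>F\<^esub> z \<in> carrier MN"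
 unfolding tensor_eq by (rule FK.quot_closed)

lemma tensor_lact_linear:
 assumes "b \<in> carrier B"
 shows "t \<in> carrier MN ==> lact MN b t \<in> carrier MN"
  "t \<in> carrier MN ==> u \<in> carrier MN ==> lact MN b (t \<oplus>\<^bsub>MN\<^esub> u) = lact MN b t \<oplus>\<^bsub>MN\<^esub> lact MN b u"
proof -
 note L = lact_F[OF assms]
 show "lact MN b t \<in> carrier MN" if "t \<in> carrier MN"
  using that L(1) by (elim tensor_cosetE) (auto simp: tensor_lact_coset assms intro!: coset_closed)
 assume "t \<in> carrier MN" "u \<in> carrier MN"
 then obtain z w where zw: "z \<in> carrier F" "t = K +>\<^bsub>F\<^esub> z" "w \<in> carrier F" "u = K +>\<^bsub>F\<^esub> w"
  by (metis tensor_cosetE)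
 have add: "(K +>\<^bsub>F\<^esub> x) \<oplus>\<^bsub>MN\<^esub> (K +>\<^bsub>F\<^esub> y) = K +>\<^bsub>F\<^esub> (x \<oplus>\<^bsub>F\<^esub> y)" if "x \<in> carrier F" "y \<in> carrier F" for x y
  unfolding tensor_eq by (rule FK.quot_add[OF that])
 have c: "lact F b z \<in> carrier F" "lact F b w \<in> carrier F" using L(1) zw by auto
 show "lact MN b (t \<oplus>\<^bsub>MN\<^esub> u) = lact MN b t \<oplus>\<^bsub>MN\<^esub> lact MN b u"
  unfolding zw(2,4) add[OF zw(1,3)] tensor_lact_coset[OF assms zw(1)] tensor_lact_coset[OF assms zw(3)]
   add[OF c] L(3)[symmetric]
  by (rule tensor_lact_coset[OF assms F.a_closed[OF zw(1,3)]])
qed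

lemma tensor_ract_linear:
 assumes "b \<in> carrier B"
 shows "t \<in> carrier MN ==> ract MN t b \<in> carrier MN"
  "t \<in> carrier MN ==> u \<in> carrier MN ==> ract MN (t \<oplus>\<^bsub>MN\<^esub> u) b = ract MN t b \<oplus>\<^bsub>MN\<^esub> ract MN u b"
proof -
 note L = ract_F[OF assms]
 show "ract MN t b \<in> carrier MN" if "t \<in> carrier MN"
  using that L(1) by (elim tensor_cosetE) (auto simp: tensor_ract_coset assms intro!: coset_closed)
 assume "t \<in> carrier MN" "u \<in> carrier MN"
 then obtain z w where zw: "z \<in> carrier F" "t = K +>\<^bsub>F\<^esub> z" "w \<in> carrier F" "u = K +>\<^bsub>F\<^esub> w"
  by (metis tensor_cosetE)
 have add: "(K +>\<^bsub>F\<^esub> x) \<oplus>\<^bsub>MN\<^esub> (K +>\<^bsub>F\<^esub> y) = K +>\<^bsub>F\<^esub> (x \<oplus>\<^bsub>F\<^esub> y)" if "x \<in> carrier F" "y \<in> carrier F" for x y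
  unfolding tensor_eq by (rule FK.quot_add[OF that])
 have c: "ract F z b \<in> carrier F" "ract F w b \<in> carrier F" using L(1) zw by auto
 show "ract MN (t \<oplus>\<^bsub>MN\<^esub> u) b = ract MN t b \<oplus>\<^bsub>MN\<^esub> ract MN u b"
  unfolding zw(2,4) add[OF zw(1,3)] tensor_ract_coset[OF assms zw(1)] tensor_ract_coset[OF assms zw(3)]
   add[OF c] L(3)[symmetric]
  by (rule tensor_ract_coset[OF assms F.a_closed[OF zw(1,3)]])
qed

theorem tensor_alg_bimodule: "alg_bimodule B MN"
proof (rule alg_bimodule.intro)
 show "Module.module complex_field MN" by (rule MN.cmodule)
 note [simp] = tensor_lact_linear tensor_ract_linear lact_ten ract_ten
 fix b b' t u
 show "b \<in> carrier B ==> t \<in> carrier MN ==> lact MN b t \<in> carrier MN"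
  "b \<in> carrier B ==> t \<in> carrier MN ==> ract MN t b \<in> carrier MN"
  "b \<in> carrier B ==> t \<in> carrier MN ==> u \<in> carrier MN ==>
   lact MN b (t \<oplus>\<^bsub>MN\<^esub> u) = lact MN b t \<oplus>\<^bsub>MN\<^esub> lact MN b u"
  "b \<in> carrier B ==> t \<in> carrier MN ==> u \<in> carrier MN ==>
   ract MN (t \<oplus>\<^bsub>MN\<^esub> u) b = ract MN t b \<oplus>\<^bsub>MN\<^esub> ract MN u b"
  by simp_all
 show "lact MN (b \<oplus>\<^bsub>B\<^esub> b') t = lact MN b t \<oplus>\<^bsub>MN\<^esub> lact MN b' t"
  if "b \<in> carrier B" "b' \<in> carrier B" "t \<in> carrier MN"
  using that(3,1,2) by (induction rule: tensor_induct) (simp_all add: M.add_alg ten_add_left MN.a_ac)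
 show "ract MN t (b \<oplus>\<^bsub>B\<^esub> b') = ract MN t b \<oplus>\<^bsub>MN\<^esub> ract MN t b'"
  if "b \<in> carrier B" "b' \<in> carrier B" "t \<in> carrier MN"
  using that(3,1,2) by (induction rule: tensor_induct) (simp_all add: N.add_alg ten_add_right MN.a_ac)
 show "lact MN (c \<odot>\<^bsub>B\<^esub> \<one>\<^bsub>B\<^esub>) t = c \<odot>\<^bsub>MN\<^esub> t" if "t \<in> carrier MN" for c
  using that by (induction rule: tensor_induct) (simp_all add: M.scalar ten_smult_left MN.sm_distr)
 show "ract MN t (c \<odot>\<^bsub>B\<^esub> \<one>\<^bsub>B\<^esub>) = c \<odot>\<^bsub>MN\<^esub> t" if "t \<in> carrier MN" for c
  using that by (induction rule: tensor_induct) (simp_all add: N.scalar ten_smult_right MN.sm_distr)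
 show "lact MN (b \<otimes>\<^bsub>B\<^esub> b') t = lact MN b (lact MN b' t)"
  if "b \<in> carrier B" "b' \<in> carrier B" "t \<in> carrier MN"
  using that(3,1,2) by (induction rule: tensor_induct) (simp_all add: M.assoc)
 show "ract MN t (b \<otimes>\<^bsub>B\<^esub> b') = ract MN (ract MN t b) b'"
  if "b \<in> carrier B" "b' \<in> carrier B" "t \<in> carrier MN"
  using that(3,1,2) by (induction rule: tensor_induct) (simp_all add: N.assoc)
 show "ract MN (lact MN b t) b' = lact MN b (ract MN t b')"
  if "b \<in> carrier B" "b' \<in> carrier B" "t \<in> carrier MN"
  using that(3,1,2) by (induction rule: tensor_induct) simp_all
qed

lemma tensor_bimodule: "bimodule B MN"
 by (intro bimodule.intro M.calgebra_axioms tensor_alg_bimodule)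

end

subsection \<open>Maps out of a tensor product\<close>

text \<open>
 The induced map is evaluated on an arbitrarily chosen representing formal sum, so that balancedness is what
 makes its value the expected one.
\<close>

locale balanced_map = bimodule_pair B M N + X: cspace X
 for B :: "(complex, 'b) module" and M :: "('b, 'm) bimod" and N :: "('b, 'n) bimod"
  and X :: "(complex, 'x, 'z) module_scheme" +
 fixes f :: "'m \<Rightarrow> 'n \<Rightarrow> 'x"
 assumes f_left: "y \<in> carrier N ==> clinear_map M X (%x. f x y)"
  and f_right: "x \<in> carrier M ==> clinear_map N X (f x)"
  and f_balanced: "x \<in> carrier M ==> b \<in> carrier B ==> y \<in> carrier N ==> f (ract M x b) y = f x (lact N b y)"
begin

definition eval :: "('m \<times> 'n \<Rightarrow>\<^sub>0 complex) \<Rightarrow> 'x" where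
 "eval z = (\<Oplus>\<^bsub>X\<^esub>k\<in>Poly_Mapping.keys z. Poly_Mapping.lookup z k \<odot>\<^bsub>X\<^esub> f (fst k) (snd k))"

lemma f_closed [simp]: "x \<in> carrier M ==> y \<in> carrier N ==> f x y \<in> carrier X"
 using clinear_mapD(1)[OF f_left] .

lemma eval_functional:
 assumes "z \<in> carrier F" "functional X \<phi>"
 shows "\<phi> (eval z) = (\<Sum>k\<in>Poly_Mapping.keys z. Poly_Mapping.lookup z k * \<phi> (f (fst k) (snd k)))"
proof -
 have c: "f (fst k) (snd k) \<in> carrier X" if "k \<in> Poly_Mapping.keys z" for k
  using assms(1) that by (auto simp: F_simps)
 have "\<phi> (eval z) = (\<Sum>k\<in>Poly_Mapping.keys z. \<phi> (Poly_Mapping.lookup z k \<odot>\<^bsub>X\<^esub> f (fst k) (snd k)))"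
  unfolding eval_def by (rule X.functional_finsum) (use assms c in auto)
 also have "\<dots> = (\<Sum>k\<in>Poly_Mapping.keys z. Poly_Mapping.lookup z k * \<phi> (f (fst k) (snd k)))"
  using c by (intro sum.cong) (auto simp: X.functional_smult[OF assms(2)])
 finally show ?thesis .
qed

lemma eval_closed: "z \<in> carrier F ==> eval z \<in> carrier X"
 unfolding eval_def by (rule X.finsum_closed) (auto simp: F_simps)

lemma eval_single: "x \<in> carrier M ==> y \<in> carrier N ==> eval (Poly_Mapping.single (x, y) c) = c \<odot>\<^bsub>X\<^esub> f x y"
 unfolding eval_def by (cases "c = 0") auto

lemma eval_linear: "clinear_map F X eval"
proof -
 have "eval (z \<oplus>\<^bsub>F\<^esub> w) = eval z \<oplus>\<^bsub>X\<^esub> eval w" if "z \<in> carrier F" "w \<in> carrier F" for z w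
 proof (rule X.functional_eqI)
  fix \<phi> assume p: "functional X \<phi>"
  show "\<phi> (eval (z \<oplus>\<^bsub>F\<^esub> w)) = \<phi> (eval z \<oplus>\<^bsub>X\<^esub> eval w)"
   using sum_keys_add[of "%k c. c * \<phi> (f (fst k) (snd k))" z w] that F.a_closed[OF that]
   by (simp add: eval_functional[OF _ p] X.functional_add[OF p] eval_closed) (simp add: F_simps algebra_simps)
 qed (use that in \<open>auto intro: eval_closed\<close>)
 moreover have "eval (c \<odot>\<^bsub>F\<^esub> z) = c \<odot>\<^bsub>X\<^esub> eval z" if "z \<in> carrier F" for z c
 proof (rule X.functional_eqI)
  fix \<phi> assume p: "functional X \<phi>"
  have "(\<Sum>k\<in>Poly_Mapping.keys (Poly_Mapping.map ((*) c) z).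
    Poly_Mapping.lookup (Poly_Mapping.map ((*) c) z) k * \<phi> (f (fst k) (snd k))) =
   (\<Sum>k\<in>Poly_Mapping.keys z. Poly_Mapping.lookup (Poly_Mapping.map ((*) c) z) k * \<phi> (f (fst k) (snd k)))"
   by (rule sum_keys_extend[where g = "%k c. c * \<phi> (f (fst k) (snd k))"]) (auto simp: keys_map_times)
  then show "\<phi> (eval (c \<odot>\<^bsub>F\<^esub> z)) = \<phi> (c \<odot>\<^bsub>X\<^esub> eval z)"
   using that F.sm_closed[OF that, of c]
   by (simp add: eval_functional[OF _ p] X.functional_smult[OF p] eval_closed)
    (simp add: F_simps lookup_map_times sum_distrib_left mult.assoc)
 qed (use that in \<open>auto intro: eval_closed\<close>)
 ultimately show ?thesis by (auto simp: clinear_map_def eval_closed)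
qed

lemma eval_K: "z \<in> K ==> eval z = \<zero>\<^bsub>X\<^esub>"
proof -
 note L = clinear_mapD[OF eval_linear]
 have diff: "eval (u - v) = eval u \<ominus>\<^bsub>X\<^esub> eval v" if "u \<in> carrier F" "v \<in> carrier F" for u v
  using clinear_minus[OF F.cspace_axioms X.cspace_axioms eval_linear that] by (simp add: F_minus that)
 note fl = clinear_mapD[OF f_left] and fr = clinear_mapD[OF f_right]
 have cancel: "u \<oplus>\<^bsub>X\<^esub> (v \<oplus>\<^bsub>X\<^esub> (\<ominus>\<^bsub>X\<^esub> u \<oplus>\<^bsub>X\<^esub> \<ominus>\<^bsub>X\<^esub> v)) = \<zero>\<^bsub>X\<^esub>"
  if "u \<in> carrier X" "v \<in> carrier X" for u v
  using X.r_neg[of "u \<oplus>\<^bsub>X\<^esub> v"] that by (simp add: X.minus_add X.a_assoc)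
 have rel: "eval z = \<zero>\<^bsub>X\<^esub>" if "z \<in> tensor_relations B M N" for z
  using that
  by (cases rule: relationsE)
   (simp_all add: diff single_F minus_F eval_single fl(2,3) fr(2,3) f_balanced X.minus_eq_zero
    X.minus_sm X.sm_distr X.r_neg X.sm_minus_one X.a_ac cancel)
 have "submodule {z \<in> carrier F. eval z = \<zero>\<^bsub>X\<^esub>} complex_field F"
  by (rule F.submoduleI') (auto simp: L clinear_zero[OF F.cspace_axioms X.cspace_axioms eval_linear])
 then have "K \<subseteq> {z \<in> carrier F. eval z = \<zero>\<^bsub>X\<^esub>}"
  using rel relations_F by (intro cspan_submodule(4)[OF F_cspace relations_F]) auto
 then show "z \<in> K ==> eval z = \<zero>\<^bsub>X\<^esub>" by blast
qed

abbreviation "lift \<equiv> tensor_lift X f"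

lemma lift_coset:
 assumes z: "z \<in> carrier F"
 shows "lift (K +>\<^bsub>F\<^esub> z) = eval z"
proof -
 define w where "w = (SOME w. w \<in> K +>\<^bsub>F\<^esub> z)"
 have "w \<in> K +>\<^bsub>F\<^esub> z" unfolding w_def by (rule someI) (rule FK.coset_self[OF z])
 then have w: "w \<in> carrier F" "w \<ominus>\<^bsub>F\<^esub> z \<in> K" using z by (auto simp: FK.mem_coset)
 have "eval w \<ominus>\<^bsub>X\<^esub> eval z = \<zero>\<^bsub>X\<^esub>"
  using clinear_minus[OF F.cspace_axioms X.cspace_axioms eval_linear w(1) z] eval_K[OF w(2)] by simp
 then have "eval w = eval z" using w z by (simp add: X.minus_eq_zero eval_closed)
 then show ?thesis by (simp add: tensor_lift_def w_def[symmetric] eval_def Let_def)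
qed

lemma lift_ten: "x \<in> carrier M ==> y \<in> carrier N ==> lift (ten x y) = f x y"
 unfolding ten_eq by (simp add: lift_coset single_F eval_single)

lemma lift_linear: "clinear_map MN X lift"
proof -
 note L = clinear_mapD[OF eval_linear]
 have "lift (t \<oplus>\<^bsub>MN\<^esub> u) = lift t \<oplus>\<^bsub>X\<^esub> lift u" if "t \<in> carrier MN" "u \<in> carrier MN" for t u
 proof -
  obtain z w where zw: "z \<in> carrier F" "t = K +>\<^bsub>F\<^esub> z" "w \<in> carrier F" "u = K +>\<^bsub>F\<^esub> w"
   using \<open>t \<in> carrier MN\<close> \<open>u \<in> carrier MN\<close> by (metis tensor_cosetE)
  have "t \<oplus>\<^bsub>MN\<^esub> u = K +>\<^bsub>F\<^esub> (z \<oplus>\<^bsub>F\<^esub> w)" unfolding zw tensor_eq by (rule FK.quot_add[OF zw(1,3)])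
  then show ?thesis using zw F.a_closed[OF zw(1,3)] by (simp add: lift_coset L)
 qed
 moreover have "lift (c \<odot>\<^bsub>MN\<^esub> t) = c \<odot>\<^bsub>X\<^esub> lift t" if t: "t \<in> carrier MN" for t c
 proof -
  obtain z where z: "z \<in> carrier F" "t = K +>\<^bsub>F\<^esub> z" using t by (rule tensor_cosetE)
  have "c \<odot>\<^bsub>MN\<^esub> t = K +>\<^bsub>F\<^esub> (c \<odot>\<^bsub>F\<^esub> z)" unfolding z tensor_eq by (rule FK.quot_smult[OF z(1)])
  then show ?thesis using z by (simp add: lift_coset L)
 qed
 moreover have "lift t \<in> carrier X" if "t \<in> carrier MN" for t
  using that by (elim tensor_cosetE) (simp add: lift_coset eval_closed)
 ultimately show ?thesis by (auto simp: clinear_map_def)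
qed

end

section \<open>Operators on tensor legs\<close>

type_synonym 'n legs = "nat \<Rightarrow> 'n"

definition leg_op :: "complex^('n::finite \<times> 'n)^('n \<times> 'n) \<Rightarrow> nat \<Rightarrow> ('n legs \<Rightarrow> complex) \<Rightarrow> 'n legs \<Rightarrow> complex" where
 "leg_op A n f e = (\<Sum>k\<in>UNIV. A $ (e n, e (Suc n)) $ k * f (e(n := fst k, Suc n := snd k)))"

definition double_leg :: "'n legs \<Rightarrow> nat \<Rightarrow> 'n \<Rightarrow> 'n legs" where
 "double_leg e n k = (%i. if i < n then e i else if i < n + 2 then k else e (i - 2))"

definition drop_legs :: "'n legs \<Rightarrow> nat \<Rightarrow> 'n legs" where
 "drop_legs e n = (%i. if i < n then e i else e (i + 2))"

definition leg_contract :: "('n::finite \<Rightarrow> complex) \<Rightarrow> nat \<Rightarrow> ('n legs \<Rightarrow> complex) \<Rightarrow> 'n legs \<Rightarrow> complex" where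
 "leg_contract c n f e = (\<Sum>k\<in>UNIV. c k * f (double_leg e n k))"

definition leg_insert :: "('n \<Rightarrow> complex) \<Rightarrow> nat \<Rightarrow> ('n legs \<Rightarrow> complex) \<Rightarrow> 'n legs \<Rightarrow> complex" where
 "leg_insert c n f e = (if e n = e (Suc n) then c (e n) * f (drop_legs e n) else 0)"

lemma sum_UNIV_pair: "(\<Sum>p\<in>UNIV. h p) = (\<Sum>x\<in>UNIV. \<Sum>y\<in>UNIV. h (x, y))"
 for h :: "'a::finite \<times> 'b::finite \<Rightarrow> 'c::comm_monoid_add"
 by (simp add: UNIV_Times_UNIV[symmetric] sum.cartesian_product del: UNIV_Times_UNIV)

lemma sum_rotate:
 "(\<Sum>a\<in>A. \<Sum>k\<in>B. \<Sum>l\<in>C. F a k l) = (\<Sum>l\<in>C. \<Sum>a\<in>A. \<Sum>k\<in>B. F a k l)"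
 for F :: "'a \<Rightarrow> 'b \<Rightarrow> 'c \<Rightarrow> 'd::comm_monoid_add"
proof -
 have "(\<Sum>a\<in>A. \<Sum>k\<in>B. \<Sum>l\<in>C. F a k l) = (\<Sum>a\<in>A. \<Sum>l\<in>C. \<Sum>k\<in>B. F a k l)"
  by (intro sum.cong refl sum.swap)
 also have "\<dots> = (\<Sum>l\<in>C. \<Sum>a\<in>A. \<Sum>k\<in>B. F a k l)" by (rule sum.swap)
 finally show ?thesis .
qed

subsection \<open>Composition and commutation\<close>

lemma leg_op_comp: "leg_op A n (leg_op B n f) = leg_op (A ** B) n f"
proof
 fix e :: "nat \<Rightarrow> 'a"
 have "leg_op A n (leg_op B n f) e =
   (\<Sum>k\<in>UNIV. \<Sum>l\<in>UNIV. A $ (e n, e (Suc n)) $ k * B $ k $ l * f (e(n := fst l, Suc n := snd l)))"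
  by (simp add: leg_op_def sum_distrib_left mult.assoc fun_upd_twist)
 also have "\<dots> = leg_op (A ** B) n f e"
  by (subst sum.swap) (simp add: leg_op_def matrix_matrix_mult_def sum_distrib_right)
 finally show "leg_op A n (leg_op B n f) e = leg_op (A ** B) n f e" .
qed

lemma leg_op_mat: "leg_op (mat c) n f = (%e. c * f e)"
proof
 fix e :: "nat \<Rightarrow> 'a"
 have "leg_op (mat c) n f e =
   (\<Sum>k\<in>UNIV. if k = (e n, e (Suc n)) then c * f (e(n := fst k, Suc n := snd k)) else 0)"
  unfolding leg_op_def by (intro sum.cong) (auto simp: mat_def)
 also have "\<dots> = c * f e" by simp
 finally show "leg_op (mat c) n f e = c * f e" .
qed

lemma leg_op_one [simp]: "leg_op (mat 1) n f = f"
 by (simp add: leg_op_mat)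

lemma leg_op_smult: "leg_op A n (%e. c * f e) = (%e. c * leg_op A n f e)"
 by (rule ext) (simp add: leg_op_def sum_distrib_left mult.left_commute)

lemma leg_op_add: "leg_op A n (%e. f e + g e) = (%e. leg_op A n f e + leg_op A n g e)"
 by (rule ext) (simp add: leg_op_def distrib_left sum.distrib)

lemma leg_op_diff: "leg_op A n (%e. f e - g e) = (%e. leg_op A n f e - leg_op A n g e)"
 by (rule ext) (simp add: leg_op_def right_diff_distrib sum_subtractf)

lemma leg_op_matrix_add: "leg_op (A + B) n f = (%e. leg_op A n f e + leg_op B n f e)"
 by (rule ext) (simp add: leg_op_def distrib_right sum.distrib)

lemma leg_op_matrix_smult: "leg_op (mat c ** A) n f = (%e. c * leg_op A n f e)"
 by (simp add: leg_op_comp[symmetric] leg_op_mat)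

lemma leg_contract_smult: "leg_contract c n (%e. d * f e) = (%e. d * leg_contract c n f e)"
 by (rule ext) (simp add: leg_contract_def sum_distrib_left mult.left_commute)

lemma leg_contract_add: "leg_contract c n (%e. f e + g e) = (%e. leg_contract c n f e + leg_contract c n g e)"
 by (rule ext) (simp add: leg_contract_def distrib_left sum.distrib)

lemma leg_contract_diff: "leg_contract c n (%e. f e - g e) = (%e. leg_contract c n f e - leg_contract c n g e)"
 by (rule ext) (simp add: leg_contract_def right_diff_distrib sum_subtractf)

lemma leg_op_commute:
 assumes "n + 2 \<le> m"
 shows "leg_op A n (leg_op B m f) = leg_op B m (leg_op A n f)"
proof
 fix e :: "nat \<Rightarrow> 'a"
 have upd: "e(n := a, Suc n := b, m := c, Suc m := d) = e(m := c, Suc m := d, n := a, Suc n := b)" for a b c d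
  using assms by (auto simp: fun_eq_iff)
 have "leg_op A n (leg_op B m f) e = (\<Sum>k\<in>UNIV. \<Sum>l\<in>UNIV. A $ (e n, e (Suc n)) $ k *
   (B $ (e m, e (Suc m)) $ l * f (e(n := fst k, Suc n := snd k, m := fst l, Suc m := snd l))))"
  using assms by (simp add: leg_op_def sum_distrib_left)
 also have "\<dots> = (\<Sum>l\<in>UNIV. \<Sum>k\<in>UNIV. B $ (e m, e (Suc m)) $ l *
   (A $ (e n, e (Suc n)) $ k * f (e(m := fst l, Suc m := snd l, n := fst k, Suc n := snd k))))"
  by (subst sum.swap) (simp add: upd mult.left_commute)
 also have "\<dots> = leg_op B m (leg_op A n f) e"
  using assms by (simp add: leg_op_def sum_distrib_left)
 finally show "leg_op A n (leg_op B m f) e = leg_op B m (leg_op A n f) e" .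
qed

lemma contract_op_right:
 assumes "n \<le> m"
 shows "leg_contract c n (leg_op A (m + 2) f) = leg_op A m (leg_contract c n f)"
proof
 fix e :: "nat \<Rightarrow> 'a"
 have upd: "(double_leg e n k)(m + 2 := a, Suc (m + 2) := b) = double_leg (e(m := a, Suc m := b)) n k" for a b k
  using assms by (auto simp: double_leg_def fun_eq_iff)
 have val: "double_leg e n k (m + 2) = e m" "double_leg e n k (Suc (m + 2)) = e (Suc m)" for k
  using assms by (auto simp: double_leg_def)
 show "leg_contract c n (leg_op A (m + 2) f) e = leg_op A m (leg_contract c n f) e"
  unfolding leg_contract_def leg_op_def sum_distrib_left val upd
  by (subst sum.swap) (simp add: mult.left_commute)
qed

lemma contract_op_left:
 assumes "m + 2 \<le> n"
 shows "leg_contract c n (leg_op A m f) = leg_op A m (leg_contract c n f)"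
proof
 fix e :: "nat \<Rightarrow> 'a"
 have upd: "(double_leg e n k)(m := a, Suc m := b) = double_leg (e(m := a, Suc m := b)) n k" for a b k
  using assms by (auto simp: double_leg_def fun_eq_iff)
 have val: "double_leg e n k m = e m" "double_leg e n k (Suc m) = e (Suc m)" for k
  using assms by (auto simp: double_leg_def)
 show "leg_contract c n (leg_op A m f) e = leg_op A m (leg_contract c n f) e"
  unfolding leg_contract_def leg_op_def sum_distrib_left val upd
  by (subst sum.swap) (simp add: mult.left_commute)
qed

lemma contract_contract:
 assumes "n \<le> m"
 shows "leg_contract c n (leg_contract d (m + 2) f) = leg_contract d m (leg_contract c n f)"
proof
 fix e :: "nat \<Rightarrow> 'a"
 have upd: "double_leg (double_leg e n k) (m + 2) l = double_leg (double_leg e m l) n k" for k l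
  using assms by (auto simp: double_leg_def fun_eq_iff)
 show "leg_contract c n (leg_contract d (m + 2) f) e = leg_contract d m (leg_contract c n f) e"
  unfolding leg_contract_def sum_distrib_left upd
  by (subst sum.swap) (simp add: mult.left_commute)
qed

lemma op_insert:
 assumes "n \<le> m"
 shows "leg_op A (m + 2) (leg_insert c n f) = leg_insert c n (leg_op A m f)"
proof
 fix e :: "nat \<Rightarrow> 'a"
 have upd: "drop_legs (e(m + 2 := a, Suc (m + 2) := b)) n = (drop_legs e n)(m := a, Suc m := b)" for a b
  using assms by (auto simp: drop_legs_def fun_eq_iff)
 have val: "drop_legs e n m = e (m + 2)" "drop_legs e n (Suc m) = e (Suc (m + 2))"
  using assms by (auto simp: drop_legs_def)
 show "leg_op A (m + 2) (leg_insert c n f) e = leg_insert c n (leg_op A m f) e"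
  using assms unfolding leg_op_def leg_insert_def val upd by (auto simp: sum_distrib_left mult.left_commute)
qed

lemma contract_insert_right:
 assumes "n \<le> m"
 shows "leg_contract c (m + 2) (leg_insert d n f) = leg_insert d n (leg_contract c m f)"
proof
 fix e :: "nat \<Rightarrow> 'a"
 have shift: "Suc (Suc (x - 2)) = x" if "\<not> x < Suc (Suc m)" for x using that by simp
 have val: "double_leg e (m + 2) k n = e n" "double_leg e (m + 2) k (Suc n) = e (Suc n)"
  "drop_legs (double_leg e (m + 2) k) n = double_leg (drop_legs e n) m k" for k
  using assms by (auto simp: double_leg_def drop_legs_def fun_eq_iff shift)
 show "leg_contract c (m + 2) (leg_insert d n f) e = leg_insert d n (leg_contract c m f) e"
  unfolding leg_contract_def leg_insert_def val by (auto simp: sum_distrib_left mult.left_commute)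
qed

lemma contract_insert_zigzag:
 "leg_contract c (Suc n) (leg_insert d n f) = (%e. c (e n) * d (e n) * f e)"
proof
 fix e :: "nat \<Rightarrow> 'a"
 have val: "double_leg e (Suc n) k n = e n" "double_leg e (Suc n) k (Suc n) = k" for k
  by (auto simp: double_leg_def)
 have d: "drop_legs (double_leg e (Suc n) (e n)) n = e"
  by (auto simp: double_leg_def drop_legs_def fun_eq_iff le_Suc_eq less_Suc_eq_le)
   (metis Suc_leI le_antisym not_less_eq_eq)?
 show "leg_contract c (Suc n) (leg_insert d n f) e = c (e n) * d (e n) * f e"
  unfolding leg_contract_def leg_insert_def val
  by (simp add: d if_distrib[of "(*) _"] cong: if_cong)
qed

subsection \<open>Evaluating families on functionals\<close>

definition legs_list :: "nat \<Rightarrow> 'n legs \<Rightarrow> 'n list" where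
 "legs_list L e = map e [0..<L]"

lemma length_legs_list [simp]: "length (legs_list L e) = L"
 by (simp add: legs_list_def)

lemma nth_legs_list [simp]: "i < L ==> legs_list L e ! i = e i"
 by (simp add: legs_list_def)

context cspace
begin

lemma finsum_UNIV_functional:
 assumes "functional M \<phi>" "\<And>k. g k \<in> carrier M"
 shows "\<phi> (\<Oplus>k\<in>UNIV. a k \<odot> g k) = (\<Sum>k\<in>UNIV. a k * \<phi> (g k))"
 using assms by (simp add: functional_finsum functional_smult)

lemma on_legs_functional:
 assumes "functional M \<phi>" "\<And>js. length js = L ==> x js \<in> carrier M" "Suc n < L"
 shows "\<phi> (on_legs M A (Suc n) x (legs_list L e)) = leg_op A n (%e. \<phi> (x (legs_list L e))) e"
proof -
 have upd: "(legs_list L e)[n := a, Suc n := b] = legs_list L (e(n := a, Suc n := b))" for a b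
  using assms(3) by (intro nth_equalityI) (auto simp: nth_list_update)
 have c: "x (legs_list L (e(n := fst k, Suc n := snd k))) \<in> carrier M" for k by (rule assms) simp
 show ?thesis
  using assms(3) finsum_UNIV_functional[OF assms(1) c] by (simp add: on_legs_def leg_op_def upd)
qed

lemma on_legs_closed:
 assumes "\<And>js. length js = length is ==> x js \<in> carrier M"
 shows "on_legs M A n x is \<in> carrier M"
 unfolding on_legs_def using assms by (intro finsum_closed) auto

lemma contract_functional:
 assumes "functional M \<phi>" "\<And>js. length js = L + 2 ==> x js \<in> carrier M" "n \<le> L"
 shows "\<phi> (contract M c (Suc n) x (legs_list L e)) = leg_contract c n (%e. \<phi> (x (legs_list (L + 2) e))) e"
proof -
 have upd: "take n (legs_list L e) @ [k, k] @ drop n (legs_list L e) = legs_list (L + 2) (double_leg e n k)" for k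
  using assms(3) by (intro nth_equalityI) (auto simp: nth_append double_leg_def nth_Cons')
 have c: "x (legs_list (L + 2) (double_leg e n k)) \<in> carrier M" for k by (rule assms) simp
 show ?thesis
  unfolding contract_def leg_contract_def diff_Suc_1 upd
  by (rule finsum_UNIV_functional[OF assms(1) c])
qed

lemma contract_closed:
 assumes "\<And>js. length js = length is + 2 ==> x js \<in> carrier M" "n \<le> length is + 1"
 shows "contract M c n x is \<in> carrier M"
 unfolding contract_def using assms by (intro finsum_closed) auto

lemma insert_functional:
 assumes "functional M \<phi>" "\<And>js. length js = L ==> x js \<in> carrier M" "n \<le> L"
 shows "\<phi> (insert_legs M c (Suc n) x (legs_list (L + 2) e)) = leg_insert c n (%e. \<phi> (x (legs_list L e))) e"
proof -
 have upd: "take n (legs_list (L + 2) e) @ drop (n + 2) (legs_list (L + 2) e) = legs_list L (drop_legs e n)"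
  using assms(3) by (intro nth_equalityI) (auto simp: nth_append drop_legs_def)
 show ?thesis
  unfolding insert_legs_def leg_insert_def using assms upd
  by (auto simp: functional_smult functional_zero)
qed

lemma insert_closed:
 assumes "\<And>js. length js + 2 = length is ==> x js \<in> carrier M" "1 \<le> n" "n < length is"
 shows "insert_legs M c n x is \<in> carrier M"
 unfolding insert_legs_def using assms by auto

end

section \<open>Identities of the braiding on tensor legs\<close>

lemma kernel_sum:
 fixes A :: "'a::finite \<Rightarrow> 'b::finite \<Rightarrow> 'c::finite \<Rightarrow> complex" and C :: "'a \<Rightarrow> 'b \<Rightarrow> 'd::finite \<Rightarrow> complex"
 shows "(\<Sum>a\<in>UNIV. \<Sum>b\<in>UNIV. \<Sum>c\<in>UNIV. A a b c * (\<Sum>d\<in>UNIV. C a b d * g c d)) =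
  (\<Sum>c\<in>UNIV. \<Sum>d\<in>UNIV. (\<Sum>a\<in>UNIV. \<Sum>b\<in>UNIV. A a b c * C a b d) * g c d)"
proof -
 have "(\<Sum>a\<in>UNIV. \<Sum>b\<in>UNIV. \<Sum>c\<in>UNIV. A a b c * (\<Sum>d\<in>UNIV. C a b d * g c d)) =
   (\<Sum>a\<in>UNIV. \<Sum>b\<in>UNIV. \<Sum>p\<in>UNIV. A a b (fst p) * C a b (snd p) * g (fst p) (snd p))"
  by (simp add: sum_UNIV_pair sum_distrib_left mult.assoc)
 also have "\<dots> = (\<Sum>p\<in>UNIV. \<Sum>a\<in>UNIV. \<Sum>b\<in>UNIV. A a b (fst p) * C a b (snd p) * g (fst p) (snd p))"
  by (rule sum_rotate)
 also have "\<dots> = (\<Sum>c\<in>UNIV. \<Sum>d\<in>UNIV. (\<Sum>a\<in>UNIV. \<Sum>b\<in>UNIV. A a b c * C a b d) * g c d)"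
  by (simp add: sum_UNIV_pair sum_distrib_right)
 finally show ?thesis .
qed

text \<open>
 The coordinates of the compatibility between the braidings and the (co)evaluations; \<open>w\<close> are the
 weights of the second evaluation and \<open>\<kappa>\<close> the scalar by which the twist acts.
\<close>

locale dual_braiding =
 fixes VV VD DD VDi VVi DDi :: "complex^('n::finite \<times> 'n)^('n \<times> 'n)" and w :: "'n \<Rightarrow> complex"
  and \<kappa> qw qm z1 :: complex
 assumes inverses: "VD ** VDi = mat 1" "VDi ** VD = mat 1" "VV ** VVi = mat 1" "VVi ** VV = mat 1"
   "DD ** DDi = mat 1" "DDi ** DD = mat 1"
  and slide_VV: "(\<Sum>a\<in>UNIV. \<Sum>k\<in>UNIV. w a * VD $ (a, o1) $ (k, z) * VV $ (a, k) $ (x, y)) =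
    (if y = z \<and> x = o1 then w y else 0)"
  and slide_DD: "(\<Sum>a\<in>UNIV. \<Sum>l\<in>UNIV. w a * VD $ (o1, a) $ (k, l) * DD $ (l, a) $ (x, y)) =
    (if k = x \<and> y = o1 then w k else 0)"
  and eval_VD: "\<kappa> * (\<Sum>k\<in>UNIV. VD $ (k, k) $ (x, y)) = (if x = y then w x else 0)"
  and coev_VDi: "(\<Sum>k\<in>UNIV. VDi $ (x, y) $ (k, k) / w k) = (if x = y then \<kappa> else 0)"
  and rotate: "(\<Sum>a\<in>UNIV. \<Sum>k\<in>UNIV. VV $ (a, o1) $ (k, l) * VD $ (a, k) $ (x, y)) =
    (if x = o1 \<and> y = l then 1 else 0)"
  and slide_coev: "(\<Sum>k\<in>UNIV. \<Sum>l\<in>UNIV. VD $ (b, c) $ (k, l) * VV $ (a, k) $ (x, l)) =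
    (if a = b \<and> x = c then 1 else 0)"
  and hecke: "VV ** VV = mat z1 ** VV + mat (qw * qw - z1 * qw)"
  and nonzero: "w k \<noteq> 0" "qw \<noteq> 0" "qm \<noteq> 0" "qw \<noteq> z1" and \<kappa>: "\<kappa> = qw * qm"
begin

lemma \<kappa>_nonzero: "\<kappa> \<noteq> 0" using nonzero \<kappa> by simp

abbreviation "ev \<equiv> leg_contract (%_. 1)"
abbreviation "ev' \<equiv> leg_contract w"
abbreviation "coev \<equiv> leg_insert (%_. 1)"
abbreviation "coev' \<equiv> leg_insert (%k. 1 / w k)"

lemma inv_ops [simp]:
 "leg_op VD n (leg_op VDi n f) = f" "leg_op VDi n (leg_op VD n f) = f"
 "leg_op VV n (leg_op VVi n f) = f" "leg_op VVi n (leg_op VV n f) = f"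
 "leg_op DD n (leg_op DDi n f) = f" "leg_op DDi n (leg_op DD n f) = f"
 by (simp_all add: leg_op_comp inverses)

lemma ev'_VD_VV: "ev' n (leg_op VD (Suc n) (leg_op VV n f)) = ev' (Suc n) f"
proof
 fix e :: "nat \<Rightarrow> 'n"
 define g where "g x y l = f (%i. if i < n then e i else if i = n then x else if i = Suc n then y
  else if i = Suc (Suc n) then l else e (i - 2))" for x y l
 have upd: "(double_leg e n a)(Suc n := k, Suc (Suc n) := l, n := x, Suc n := y) =
  (%i. if i < n then e i else if i = n then x else if i = Suc n then y
  else if i = Suc (Suc n) then l else e (i - 2))" for a k l x y
  by (auto simp: double_leg_def fun_eq_iff)
 have val: "double_leg e n a (Suc n) = a" "double_leg e n a n = a" "double_leg e n a (Suc (Suc n)) = e n" for a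
  by (simp_all add: double_leg_def)
 have "ev' n (leg_op VD (Suc n) (leg_op VV n f)) e =
   (\<Sum>a\<in>UNIV. w a * (\<Sum>b\<in>UNIV. VD $ (a, e n) $ b * (\<Sum>p\<in>UNIV. VV $ (a, fst b) $ p * g (fst p) (snd p) (snd b))))"
  by (simp add: leg_contract_def leg_op_def val upd g_def[symmetric])
 also have "\<dots> = (\<Sum>a\<in>UNIV. w a * (\<Sum>k\<in>UNIV. \<Sum>l\<in>UNIV. VD $ (a, e n) $ (k, l) *
    (\<Sum>p\<in>UNIV. VV $ (a, k) $ p * g (fst p) (snd p) l)))"
  by (intro sum.cong refl arg_cong2[where f = "(*)"]) (subst sum_UNIV_pair, simp)
 also have "\<dots> = (\<Sum>a\<in>UNIV. \<Sum>k\<in>UNIV. \<Sum>l\<in>UNIV. w a * VD $ (a, e n) $ (k, l) *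
    (\<Sum>p\<in>UNIV. VV $ (a, k) $ p * g (fst p) (snd p) l))"
  by (simp add: sum_distrib_left mult.assoc)
 also have "\<dots> = (\<Sum>l\<in>UNIV. \<Sum>p\<in>UNIV. (if snd p = l \<and> fst p = e n then w (snd p) else 0) * g (fst p) (snd p) l)"
  by (subst kernel_sum) (simp add: sum_UNIV_pair slide_VV cong: if_cong)
 also have "\<dots> = (\<Sum>l\<in>UNIV. w l * g (e n) l l)"
 proof (intro sum.cong refl)
  fix l
  have "(\<Sum>p\<in>UNIV. (if snd p = l \<and> fst p = e n then w (snd p) else 0) * g (fst p) (snd p) l) =
    (\<Sum>p\<in>UNIV. if p = (e n, l) then w l * g (e n) l l else 0)"
   by (intro sum.cong) auto
  then show "(\<Sum>p\<in>UNIV. (if snd p = l \<and> fst p = e n then w (snd p) else 0) * g (fst p) (snd p) l) = w l * g (e n) l l"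
   by simp
 qed
 also have "\<dots> = ev' (Suc n) f e"
  unfolding leg_contract_def g_def
  by (intro sum.cong refl arg_cong2[where f = "(*)"] arg_cong[where f = f])
   (auto simp: double_leg_def fun_eq_iff less_Suc_eq)
 finally show "ev' n (leg_op VD (Suc n) (leg_op VV n f)) e = ev' (Suc n) f e" .
qed

lemma ev'_VD_DD: "ev' (Suc n) (leg_op VD n (leg_op DD (Suc n) f)) = ev' n f"
proof
 fix e :: "nat \<Rightarrow> 'n"
 define g where "g k x y = f (%i. if i < n then e i else if i = n then k else if i = Suc n then x
  else if i = Suc (Suc n) then y else e (i - 2))" for k x y
 have upd: "(double_leg e (Suc n) a)(n := k, Suc n := x, Suc (Suc n) := y) =
  (%i. if i < n then e i else if i = n then k else if i = Suc n then x
  else if i = Suc (Suc n) then y else e (i - 2))" for a k x y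
  by (auto simp: double_leg_def fun_eq_iff)
 have val: "double_leg e (Suc n) a (Suc n) = a" "double_leg e (Suc n) a n = e n"
  "double_leg e (Suc n) a (Suc (Suc n)) = a" for a
  by (simp_all add: double_leg_def)
 have "ev' (Suc n) (leg_op VD n (leg_op DD (Suc n) f)) e =
   (\<Sum>a\<in>UNIV. w a * (\<Sum>b\<in>UNIV. VD $ (e n, a) $ b * (\<Sum>p\<in>UNIV. DD $ (snd b, a) $ p * g (fst b) (fst p) (snd p))))"
  by (simp add: leg_contract_def leg_op_def val upd g_def[symmetric])
 also have "\<dots> = (\<Sum>a\<in>UNIV. w a * (\<Sum>k\<in>UNIV. \<Sum>l\<in>UNIV. VD $ (e n, a) $ (k, l) *
    (\<Sum>p\<in>UNIV. DD $ (l, a) $ p * g k (fst p) (snd p))))"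
  by (intro sum.cong refl arg_cong2[where f = "(*)"]) (subst sum_UNIV_pair, simp)
 also have "\<dots> = (\<Sum>a\<in>UNIV. \<Sum>k\<in>UNIV. \<Sum>l\<in>UNIV. w a * VD $ (e n, a) $ (k, l) *
    (\<Sum>p\<in>UNIV. DD $ (l, a) $ p * g k (fst p) (snd p)))"
  by (simp add: sum_distrib_left mult.assoc)
 also have "\<dots> = (\<Sum>a\<in>UNIV. \<Sum>l\<in>UNIV. \<Sum>k\<in>UNIV. w a * VD $ (e n, a) $ (k, l) *
    (\<Sum>p\<in>UNIV. DD $ (l, a) $ p * g k (fst p) (snd p)))"
  by (intro sum.cong refl sum.swap)
 also have "\<dots> = (\<Sum>k\<in>UNIV. \<Sum>p\<in>UNIV. (if k = fst p \<and> snd p = e n then w k else 0) * g k (fst p) (snd p))"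
  by (subst kernel_sum) (simp add: sum_UNIV_pair slide_DD cong: if_cong)
 also have "\<dots> = (\<Sum>k\<in>UNIV. w k * g k k (e n))"
 proof (intro sum.cong refl)
  fix k
  have "(\<Sum>p\<in>UNIV. (if k = fst p \<and> snd p = e n then w k else 0) * g k (fst p) (snd p)) =
    (\<Sum>p\<in>UNIV. if p = (k, e n) then w k * g k k (e n) else 0)"
   by (intro sum.cong) auto
  then show "(\<Sum>p\<in>UNIV. (if k = fst p \<and> snd p = e n then w k else 0) * g k (fst p) (snd p)) = w k * g k k (e n)"
   by simp
 qed
 also have "\<dots> = ev' n f e"
  unfolding leg_contract_def g_def
  by (intro sum.cong refl arg_cong2[where f = "(*)"] arg_cong[where f = f])
   (auto simp: double_leg_def fun_eq_iff less_Suc_eq)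
 finally show "ev' (Suc n) (leg_op VD n (leg_op DD (Suc n) f)) e = ev' n f e" .
qed

lemma ev_VV_VD: "ev n (leg_op VV (Suc n) (leg_op VD n f)) = ev (Suc n) f"
proof
 fix e :: "nat \<Rightarrow> 'n"
 define g where "g x y l = f (%i. if i < n then e i else if i = n then x else if i = Suc n then y
  else if i = Suc (Suc n) then l else e (i - 2))" for x y l
 have upd: "(double_leg e n a)(Suc n := k, Suc (Suc n) := l, n := x, Suc n := y) =
  (%i. if i < n then e i else if i = n then x else if i = Suc n then y
  else if i = Suc (Suc n) then l else e (i - 2))" for a k l x y
  by (auto simp: double_leg_def fun_eq_iff)
 have val: "double_leg e n a (Suc n) = a" "double_leg e n a n = a" "double_leg e n a (Suc (Suc n)) = e n" for a
  by (simp_all add: double_leg_def)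
 have "ev n (leg_op VV (Suc n) (leg_op VD n f)) e =
   (\<Sum>a\<in>UNIV. \<Sum>k\<in>UNIV. \<Sum>l\<in>UNIV. VV $ (a, e n) $ (k, l) *
    (\<Sum>p\<in>UNIV. VD $ (a, k) $ p * g (fst p) (snd p) l))"
  by (simp add: leg_contract_def leg_op_def val upd g_def[symmetric] sum_UNIV_pair[where h = "%p. VV $ _ $ p * _ p"])
 also have "\<dots> = (\<Sum>l\<in>UNIV. \<Sum>p\<in>UNIV. (if fst p = e n \<and> snd p = l then 1 else 0) * g (fst p) (snd p) l)"
  by (subst kernel_sum) (simp add: sum_UNIV_pair rotate cong: if_cong)
 also have "\<dots> = (\<Sum>l\<in>UNIV. g (e n) l l)"
 proof (intro sum.cong refl)
  fix l
  have "(\<Sum>p\<in>UNIV. (if fst p = e n \<and> snd p = l then 1 else 0) * g (fst p) (snd p) l) =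
    (\<Sum>p\<in>UNIV. if p = (e n, l) then g (e n) l l else 0)"
   by (intro sum.cong) auto
  then show "(\<Sum>p\<in>UNIV. (if fst p = e n \<and> snd p = l then 1 else 0) * g (fst p) (snd p) l) = g (e n) l l"
   by simp
 qed
 also have "\<dots> = ev (Suc n) f e"
  unfolding leg_contract_def g_def
  by (simp, intro sum.cong refl arg_cong[where f = f])
   (auto simp: double_leg_def fun_eq_iff less_Suc_eq)
 finally show "ev n (leg_op VV (Suc n) (leg_op VD n f)) e = ev (Suc n) f e" .
qed

lemma VD_VV_coev: "leg_op VD (Suc n) (leg_op VV n (coev (Suc n) f)) = coev n f"
proof
 fix e :: "nat \<Rightarrow> 'n"
 define g where "g x = f (%i. if i < n then e i else if i = n then x else e (i + 2))" for x
 have upd: "drop_legs (e(Suc (Suc n) := l, n := x, Suc n := y)) (Suc n) =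
  (%i. if i < n then e i else if i = n then x else e (i + 2))" for l x y
  by (auto simp: drop_legs_def fun_eq_iff less_Suc_eq)
 have "leg_op VD (Suc n) (leg_op VV n (coev (Suc n) f)) e =
   (\<Sum>k\<in>UNIV. \<Sum>l\<in>UNIV. VD $ (e (Suc n), e (Suc (Suc n))) $ (k, l) *
    (\<Sum>x\<in>UNIV. \<Sum>y\<in>UNIV. VV $ (e n, k) $ (x, y) * (if y = l then g x else 0)))"
  by (simp add: leg_insert_def leg_op_def upd g_def sum_UNIV_pair cong: if_cong)
 also have "\<dots> = (\<Sum>k\<in>UNIV. \<Sum>l\<in>UNIV. VD $ (e (Suc n), e (Suc (Suc n))) $ (k, l) *
    (\<Sum>x\<in>UNIV. VV $ (e n, k) $ (x, l) * g x))"
  by (simp add: if_distrib[of "(*) _"] cong: if_cong)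
 also have "\<dots> = (\<Sum>x\<in>UNIV. \<Sum>k\<in>UNIV. \<Sum>l\<in>UNIV. VD $ (e (Suc n), e (Suc (Suc n))) $ (k, l) * VV $ (e n, k) $ (x, l) * g x)"
  by (subst sum_rotate[symmetric]) (simp add: sum_distrib_left mult.assoc)
 also have "\<dots> = (\<Sum>x\<in>UNIV. (if e n = e (Suc n) \<and> x = e (Suc (Suc n)) then 1 else 0) * g x)"
  by (simp add: slide_coev[symmetric] sum_distrib_right)
 also have "\<dots> = (\<Sum>x\<in>UNIV. if x = e (Suc (Suc n)) then (if e n = e (Suc n) then g x else 0) else 0)"
  by (intro sum.cong) auto
 also have "\<dots> = (if e n = e (Suc n) then g (e (Suc (Suc n))) else 0)"
  by simp
 also have "g (e (Suc (Suc n))) = f (drop_legs e n)"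
  unfolding g_def by (intro arg_cong[where f = f]) (auto simp: drop_legs_def fun_eq_iff)
 finally show "leg_op VD (Suc n) (leg_op VV n (coev (Suc n) f)) e = coev n f e"
  by (simp only: leg_insert_def[of "%_. 1" n f e] mult_1_left)
qed

lemma ev_VD: "ev n (leg_op VD n f) = (%e. ev' n f e / \<kappa>)"
proof
 fix e :: "nat \<Rightarrow> 'n"
 have upd: "(double_leg e n a)(n := k, Suc n := l) = (double_leg e n k)(Suc n := l)" for a k l
  by (auto simp: double_leg_def fun_eq_iff)
 have val: "double_leg e n a (Suc n) = a" "double_leg e n a n = a" for a
  by (simp_all add: double_leg_def)
 have dk: "(double_leg e n k)(Suc n := k) = double_leg e n k" for k
  by (auto simp: double_leg_def fun_eq_iff)
 have "ev n (leg_op VD n f) e = (\<Sum>a\<in>UNIV. \<Sum>p\<in>UNIV. VD $ (a, a) $ p * f ((double_leg e n (fst p))(Suc n := snd p)))"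
  by (simp add: leg_contract_def leg_op_def val upd)
 also have "\<dots> = (\<Sum>p\<in>UNIV. (\<Sum>a\<in>UNIV. VD $ (a, a) $ p) * f ((double_leg e n (fst p))(Suc n := snd p)))"
  by (subst sum.swap) (simp add: sum_distrib_right)
 also have "\<dots> = (\<Sum>x\<in>UNIV. \<Sum>y\<in>UNIV. (if x = y then w x / \<kappa> else 0) * f ((double_leg e n x)(Suc n := y)))"
 proof -
  have "(\<Sum>a\<in>UNIV. VD $ (a, a) $ (x, y)) = (if x = y then w x / \<kappa> else 0)" for x y
   using eval_VD[of x y] \<kappa>_nonzero by (auto simp: field_simps split: if_splits)
  then show ?thesis by (simp add: sum_UNIV_pair)
 qed
 also have "\<dots> = (\<Sum>x\<in>UNIV. w x / \<kappa> * f (double_leg e n x))"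
  by (simp add: if_distrib[of "%c. c * _"] dk cong: if_cong)
 also have "\<dots> = ev' n f e / \<kappa>"
  by (simp add: leg_contract_def sum_divide_distrib)
 finally show "ev n (leg_op VD n f) e = ev' n f e / \<kappa>" .
qed

lemma VDi_coev': "leg_op VDi n (coev' n f) = (%e. \<kappa> * coev n f e)"
proof
 fix e :: "nat \<Rightarrow> 'n"
 have upd: "drop_legs (e(n := k, Suc n := l)) n = drop_legs e n" for k l
  by (auto simp: drop_legs_def fun_eq_iff)
 have "leg_op VDi n (coev' n f) e = (\<Sum>k\<in>UNIV. VDi $ (e n, e (Suc n)) $ (k, k) / w k * f (drop_legs e n))"
  by (simp add: leg_op_def leg_insert_def upd sum_UNIV_pair if_distrib[of "(*) _"] cong: if_cong)
 also have "\<dots> = (if e n = e (Suc n) then \<kappa> else 0) * f (drop_legs e n)"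
  by (simp only: sum_distrib_right[symmetric] coev_VDi)
 finally show "leg_op VDi n (coev' n f) e = \<kappa> * coev n f e"
  by (simp add: leg_insert_def)
qed

lemma ev'_VDi: "ev' n (leg_op VDi n f) = (%e. \<kappa> * ev n f e)"
 using ev_VD[of n "leg_op VDi n f"] \<kappa>_nonzero by (simp add: fun_eq_iff field_simps)

subsection \<open>The operators \<open>S\<close> and \<open>\<tilde>S\<close>\<close>

definition S :: "nat \<Rightarrow> ('n legs \<Rightarrow> complex) \<Rightarrow> 'n legs \<Rightarrow> complex" where
 "S n f = leg_op VD (Suc n) (leg_op VV n (leg_op VDi (Suc n) f))"

definition S_inv :: "nat \<Rightarrow> ('n legs \<Rightarrow> complex) \<Rightarrow> 'n legs \<Rightarrow> complex" where
 "S_inv n f = leg_op VD (Suc n) (leg_op VVi n (leg_op VDi (Suc n) f))"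

definition St :: "nat \<Rightarrow> ('n legs \<Rightarrow> complex) \<Rightarrow> 'n legs \<Rightarrow> complex" where
 "St n f = leg_op VD (Suc n) (leg_op DDi (Suc (Suc n)) (leg_op VDi (Suc n) f))"

lemma S_smult: "S n (%e. c * f e) = (%e. c * S n f e)"
 by (simp add: S_def leg_op_smult)

lemma St_smult: "St n (%e. c * f e) = (%e. c * St n f e)"
 by (simp add: St_def leg_op_smult)

lemma ev'_S: "ev' n (S n f) = (%e. \<kappa> * ev (Suc n) f e)"
 by (simp add: S_def ev'_VD_VV ev'_VDi)

lemma ev_St: "ev (Suc n) (St n f) = (%e. ev' (Suc (Suc n)) f e / \<kappa>)"
proof -
 have "ev' (Suc n) g = ev' (Suc (Suc n)) (leg_op VD (Suc n) (leg_op DD (Suc (Suc n)) g))" for g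
  by (rule ev'_VD_DD[symmetric])
 then show ?thesis by (simp add: St_def ev_VD)
qed

lemma S_St: "S n (St n f) = St n (S n f)"
 by (simp add: S_def St_def leg_op_commute[of n "Suc (Suc n)"])

lemma S_hecke: "S n (S n f) = (%e. z1 * S n f e + (qw * qw - z1 * qw) * f e)"
proof -
 have "leg_op VV n (leg_op VV n g) = (%e. z1 * leg_op VV n g e + (qw * qw - z1 * qw) * g e)" for g
  by (simp add: leg_op_comp hecke leg_op_matrix_add leg_op_matrix_smult leg_op_mat)
 then show ?thesis by (simp add: S_def leg_op_add leg_op_smult)
qed

lemma S_inv_left [simp]: "S_inv n (S n f) = f" "S n (S_inv n f) = f"
 by (simp_all add: S_def S_inv_def)

lemma S_inv_eq: "(qw * qw - z1 * qw) * S_inv n f e = S n f e - z1 * f e"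
 using fun_cong[OF S_hecke[of n "S_inv n f"], of e] by simp

lemma S_inv_St: "S_inv n (St n f) = St n (S_inv n f)"
 by (metis S_St S_inv_left)

lemma ev_S_coev': "ev n (S (Suc n) (coev' n f)) = (%e. \<kappa> * f e)"
proof -
 have *: "ev n (leg_op VV (Suc n) h) = ev (Suc n) (leg_op VDi n h)" for h
  using ev_VV_VD[of n "leg_op VDi n h"] by simp
 have "S (Suc n) (coev' n f) = leg_op VD (n + 2) (leg_op VV (Suc n) (coev' n (leg_op VDi n f)))"
  using op_insert[of n n VDi "%k. 1 / w k" f] by (simp add: S_def)
 then have "ev n (S (Suc n) (coev' n f)) =
   leg_op VD n (ev (Suc n) (leg_op VDi n (coev' n (leg_op VDi n f))))"
  by (simp add: contract_op_right * del: add_2_eq_Suc')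
 also have "\<dots> = (%e. \<kappa> * f e)"
  by (simp add: VDi_coev' leg_contract_smult contract_insert_zigzag leg_op_smult)
 finally show ?thesis .
qed

lemma ev'_S_coev': "ev' (n + 2) (S n (coev' (Suc n) f)) = (%e. \<kappa> * coev n (ev' n f) e)"
 by (simp add: S_def VDi_coev' leg_op_smult VD_VV_coev leg_contract_smult contract_insert_right del: add_2_eq_Suc')

text \<open>
 If \<open>Y\<close> is symmetric in its first two \<open>V\<close>-legs, the trace over its first and the fourth leg after
 \<open>S\<close> agrees with the matrix product; this replaces the braid relation.
\<close>

lemma trace_eq_product:
 assumes "S 0 Y = (%e. qw * Y e)"
 shows "ev' 0 (ev 1 (S 2 Y)) e = qm * ev 1 (ev 1 (S 2 Y)) e"
proof -
 define h where "h = leg_op VDi 1 (leg_op VDi 3 Y)"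
 have *: "ev 1 (leg_op VV 2 g) = ev 2 (leg_op VDi 1 g)" for g
  using ev_VV_VD[of 1 "leg_op VDi 1 g"] by (simp add: numeral_2_eq_2)
 have ev_S: "ev 1 (S 2 Y) = leg_op VD 1 (ev 2 h)"
  using *[of "leg_op VDi 3 Y"] contract_op_right[of 1 1 "%_. 1" VD "leg_op VV 2 (leg_op VDi 3 Y)"]
  by (simp add: S_def h_def numeral_3_eq_3 numeral_2_eq_2)
 have "leg_op VV 0 (leg_op VDi 1 Y) = (%e. qw * leg_op VDi 1 Y e)"
  using arg_cong[OF assms, of "leg_op VDi 1"] by (simp add: S_def leg_op_smult)
 from arg_cong[OF this, of "leg_op VVi 0"] have VVi: "leg_op VVi 0 (leg_op VDi 1 Y) = (%e. leg_op VDi 1 Y e / qw)"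
  using nonzero by (simp add: leg_op_smult fun_eq_iff field_simps)
 have h': "h = leg_op VDi 3 (leg_op VDi 1 Y)"
  unfolding h_def by (rule leg_op_commute) simp
 have "leg_op VVi 0 h = leg_op VDi 3 (leg_op VVi 0 (leg_op VDi 1 Y))"
  unfolding h' by (rule leg_op_commute) simp
 also have "\<dots> = (%e. (1 / qw) * h e)"
  unfolding VVi h' using leg_op_smult[of VDi 3 "1 / qw"] by simp
 finally have VVh: "leg_op VVi 0 h = (%e. (1 / qw) * h e)" .
 have "ev' 0 (leg_op VD 1 (ev 2 h)) = ev' 1 (leg_op VVi 0 (ev 2 h))"
  using ev'_VD_VV[of 0 "leg_op VVi 0 (ev 2 h)"] by simp
 also have "leg_op VVi 0 (ev 2 h) = ev 2 (leg_op VVi 0 h)"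
  by (rule contract_op_left[symmetric]) simp
 also have "ev' 1 (ev 2 (leg_op VVi 0 h)) = (%e. (1 / qw) * ev' 1 (ev 2 h) e)"
  unfolding VVh by (simp only: leg_contract_smult)
 finally have 1: "ev' 0 (ev 1 (S 2 Y)) e = ev' 1 (ev 2 h) e / qw"
  unfolding ev_S by simp
 have 2: "ev 1 (ev 1 (S 2 Y)) e = ev' 1 (ev 2 h) e / \<kappa>"
  by (simp only: ev_S ev_VD)
 show ?thesis unfolding 1 2 using nonzero(2,3) by (simp add: \<kappa>)
qed

end

section \<open>Braidings of the vector module and its dual\<close>

lemma matrix_inv_eqI:
 fixes A :: "complex^'n^'n"
 assumes "A ** B = mat 1"
 shows "matrix_inv A = B" "invertible A" "B ** A = mat 1"
proof -
 show 1: "B ** A = mat 1" using assms by (simp add: matrix_left_right_inverse)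
 show "invertible A" using assms 1 by (auto simp: invertible_def)
 have "A ** matrix_inv A = mat 1 \<and> matrix_inv A ** A = mat 1"
  unfolding matrix_inv_def by (rule someI[of _ B]) (use assms 1 in auto)
 then have "matrix_inv A ** A = mat 1" by blast
 then have "matrix_inv A = matrix_inv A ** (A ** B)" by (simp add: assms)
 also have "\<dots> = B" using \<open>matrix_inv A ** A = mat 1\<close> by (simp add: matrix_mul_assoc)
 finally show "matrix_inv A = B" .
qed

definition diag_matrix :: "('n::finite \<Rightarrow> complex) \<Rightarrow> complex^'n^'n" where
 "diag_matrix c = (\<chi> i j. if i = j then c i else 0)"

definition unit_matrix :: "'n::finite \<Rightarrow> 'n \<Rightarrow> complex \<Rightarrow> complex^'n^'n" where
 "unit_matrix u d a = (\<chi> i j. if i = u \<and> j = d then a else 0)"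

lemma diag_matrix_inv:
 assumes "\<And>i. c i \<noteq> 0"
 shows "matrix_inv (diag_matrix c) = diag_matrix (%i. 1 / c i)" "invertible (diag_matrix c)"
proof -
 have "diag_matrix c ** diag_matrix (%i. 1 / c i) = mat 1"
  using assms by (simp add: diag_matrix_def matrix_matrix_mult_def mat_def vec_eq_iff
    if_distrib[of "%x. x * _"] if_distrib[of "(*) _"] cong: if_cong)
 then show "matrix_inv (diag_matrix c) = diag_matrix (%i. 1 / c i)" "invertible (diag_matrix c)"
  by (rule matrix_inv_eqI)+
qed

text \<open>
 A generator triple that acts on the basis as in the two-dimensional module on \<open>u, d\<close>, and trivially
 otherwise.
\<close>

definition unit_gens :: "('n::finite) uq_rep \<Rightarrow> nat \<Rightarrow> ('n \<Rightarrow> complex) \<Rightarrow> 'n \<Rightarrow> 'n \<Rightarrow> complex \<Rightarrow> bool" where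
 "unit_gens X i c u d a \<longleftrightarrow> repK X i = diag_matrix c \<and> repE X i = unit_matrix u d a \<and>
  repF X i = unit_matrix d u (1 / a) \<and> (\<forall>j. c j \<noteq> 0) \<and> a \<noteq> 0 \<and> u \<noteq> d"

definition hom_at :: "nat \<Rightarrow> ('a::finite) uq_rep \<Rightarrow> ('b::finite) uq_rep \<Rightarrow> complex^'a^'b \<Rightarrow> bool" where
 "hom_at i X Y A \<longleftrightarrow>
  A ** repK X i = repK Y i ** A \<and> A ** repE X i = repE Y i ** A \<and> A ** repF X i = repF Y i ** A"

lemma uq_hom_eq: "uq_hom r X Y A \<longleftrightarrow> (\<forall>i\<in>{1..r}. hom_at i X Y A)"
 by (auto simp: uq_hom_def hom_at_def)

lemma hom_at_tensor_entries:
 fixes A :: "complex^('a::finite \<times> 'b::finite)^('b \<times> 'a)"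
 assumes "unit_gens X i c1 u1 d1 a1" "unit_gens Y i c2 u2 d2 a2"
 shows "hom_at i (tensor_rep X Y) (tensor_rep Y X) A \<longleftrightarrow>
  (\<forall>p s x y. A $ (p, s) $ (x, y) * (c1 x * c2 y) = c2 p * c1 s * A $ (p, s) $ (x, y)) \<and>
  (\<forall>p s x y. (if x = d1 then A $ (p, s) $ (u1, y) * (a1 * c2 y) else 0) + (if y = d2 then A $ (p, s) $ (x, u2) * a2 else 0) =
   (if p = u2 then a2 * c1 s * A $ (d2, s) $ (x, y) else 0) + (if s = u1 then a1 * A $ (p, d1) $ (x, y) else 0)) \<and>
  (\<forall>p s x y. (if x = u1 then A $ (p, s) $ (d1, y) * (1 / a1) else 0) + (if y = u2 then A $ (p, s) $ (x, d2) * (1 / c1 x * (1 / a2)) else 0) =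
   (if p = d2 then 1 / a2 * A $ (u2, s) $ (x, y) else 0) + (if s = d1 then 1 / c2 p * (1 / a1) * A $ (p, u1) $ (x, y) else 0))"
proof -
 have X: "repK X i = diag_matrix c1" "repE X i = unit_matrix u1 d1 a1" "repF X i = unit_matrix d1 u1 (1 / a1)"
  "matrix_inv (diag_matrix c1) = diag_matrix (%j. 1 / c1 j)"
  and Y: "repK Y i = diag_matrix c2" "repE Y i = unit_matrix u2 d2 a2" "repF Y i = unit_matrix d2 u2 (1 / a2)"
  "matrix_inv (diag_matrix c2) = diag_matrix (%j. 1 / c2 j)"
  using assms by (auto simp: unit_gens_def diag_matrix_inv)
 have d: "(\<Sum>x\<in>UNIV. \<Sum>y\<in>UNIV. if x = a then if y = b then f x y else 0 else 0) = f a b"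
  for f :: "'k::finite \<Rightarrow> 'l::finite \<Rightarrow> complex" and a b
 proof -
  have "(\<Sum>x\<in>UNIV. \<Sum>y\<in>UNIV. if x = a then if y = b then f x y else 0 else 0) =
    (\<Sum>x\<in>UNIV. if x = a then (\<Sum>y\<in>UNIV. if y = b then f x y else 0) else 0)"
   by (intro sum.cong) auto
  then show ?thesis by simp
 qed
 have entry: "(\<forall>p s x y. (M ** L) $ (p, s) $ (x, y) = (M' ** L') $ (p, s) $ (x, y)) \<longleftrightarrow> M ** L = M' ** L'"
  for M :: "complex^'k^('b \<times> 'a)" and L :: "complex^('a \<times> 'b)^'k" and M' :: "complex^'l^('b \<times> 'a)" and L' :: "complex^('a \<times> 'b)^'l"
  by (auto simp: vec_eq_iff)
 have K: "(A ** repK (tensor_rep X Y) i) $ (p, s) $ (x, y) = A $ (p, s) $ (x, y) * (c1 x * c2 y)"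
  "(repK (tensor_rep Y X) i ** A) $ (p, s) $ (x, y) = c2 p * c1 s * A $ (p, s) $ (x, y)" for p s x y
 proof -
  have "(A ** repK (tensor_rep X Y) i) $ (p, s) $ (x, y) =
    (\<Sum>k\<in>UNIV. \<Sum>l\<in>UNIV. if k = x then if l = y then A $ (p, s) $ (k, l) * (c1 k * c2 l) else 0 else 0)"
   unfolding matrix_matrix_mult_def tensor_rep_def uq_rep.simps kron_def X Y
   unfolding diag_matrix_def
   by (simp add: sum_UNIV_pair) (intro sum.cong refl; simp)
  then show "(A ** repK (tensor_rep X Y) i) $ (p, s) $ (x, y) = A $ (p, s) $ (x, y) * (c1 x * c2 y)"
   unfolding d .
  have "(repK (tensor_rep Y X) i ** A) $ (p, s) $ (x, y) =
    (\<Sum>k\<in>UNIV. \<Sum>l\<in>UNIV. if k = p then if l = s then c2 k * c1 l * A $ (k, l) $ (x, y) else 0 else 0)"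
   unfolding matrix_matrix_mult_def tensor_rep_def uq_rep.simps kron_def X Y
   unfolding diag_matrix_def
   by (simp add: sum_UNIV_pair) (intro sum.cong refl; simp)
  then show "(repK (tensor_rep Y X) i ** A) $ (p, s) $ (x, y) = c2 p * c1 s * A $ (p, s) $ (x, y)"
   unfolding d .
 qed
 have E: "(A ** repE (tensor_rep X Y) i) $ (p, s) $ (x, y) =
   (if x = d1 then A $ (p, s) $ (u1, y) * (a1 * c2 y) else 0) + (if y = d2 then A $ (p, s) $ (x, u2) * a2 else 0)"
  "(repE (tensor_rep Y X) i ** A) $ (p, s) $ (x, y) =
   (if p = u2 then a2 * c1 s * A $ (d2, s) $ (x, y) else 0) + (if s = u1 then a1 * A $ (p, d1) $ (x, y) else 0)" for p s x y
 proof -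
  have "(A ** repE (tensor_rep X Y) i) $ (p, s) $ (x, y) =
    (\<Sum>k\<in>UNIV. \<Sum>l\<in>UNIV. if k = u1 then if l = y then (if x = d1 then A $ (p, s) $ (k, l) * (a1 * c2 l) else 0) else 0 else 0) +
    (\<Sum>k\<in>UNIV. \<Sum>l\<in>UNIV. if k = x then if l = u2 then (if y = d2 then A $ (p, s) $ (k, l) * a2 else 0) else 0 else 0)"
   unfolding matrix_matrix_mult_def tensor_rep_def uq_rep.simps kron_def X Y
   unfolding diag_matrix_def unit_matrix_def
   by (simp add: sum_UNIV_pair sum.distrib[symmetric] mat_def) (intro sum.cong refl; auto simp: algebra_simps)
  then show "(A ** repE (tensor_rep X Y) i) $ (p, s) $ (x, y) =
   (if x = d1 then A $ (p, s) $ (u1, y) * (a1 * c2 y) else 0) + (if y = d2 then A $ (p, s) $ (x, u2) * a2 else 0)"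
   unfolding d .
  have "(repE (tensor_rep Y X) i ** A) $ (p, s) $ (x, y) =
    (\<Sum>k\<in>UNIV. \<Sum>l\<in>UNIV. if k = d2 then if l = s then (if p = u2 then a2 * c1 l * A $ (k, l) $ (x, y) else 0) else 0 else 0) +
    (\<Sum>k\<in>UNIV. \<Sum>l\<in>UNIV. if k = p then if l = d1 then (if s = u1 then a1 * A $ (k, l) $ (x, y) else 0) else 0 else 0)"
   unfolding matrix_matrix_mult_def tensor_rep_def uq_rep.simps kron_def X Y
   unfolding diag_matrix_def unit_matrix_def
   by (simp add: sum_UNIV_pair sum.distrib[symmetric] mat_def) (intro sum.cong refl; auto simp: algebra_simps)
  then show "(repE (tensor_rep Y X) i ** A) $ (p, s) $ (x, y) =
   (if p = u2 then a2 * c1 s * A $ (d2, s) $ (x, y) else 0) + (if s = u1 then a1 * A $ (p, d1) $ (x, y) else 0)"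
   unfolding d .
 qed
 have F: "(A ** repF (tensor_rep X Y) i) $ (p, s) $ (x, y) =
   (if x = u1 then A $ (p, s) $ (d1, y) * (1 / a1) else 0) + (if y = u2 then A $ (p, s) $ (x, d2) * (1 / c1 x * (1 / a2)) else 0)"
  "(repF (tensor_rep Y X) i ** A) $ (p, s) $ (x, y) =
   (if p = d2 then 1 / a2 * A $ (u2, s) $ (x, y) else 0) + (if s = d1 then 1 / c2 p * (1 / a1) * A $ (p, u1) $ (x, y) else 0)" for p s x y
 proof -
  have "(A ** repF (tensor_rep X Y) i) $ (p, s) $ (x, y) =
    (\<Sum>k\<in>UNIV. \<Sum>l\<in>UNIV. if k = d1 then if l = y then (if x = u1 then A $ (p, s) $ (k, l) * (1 / a1) else 0) else 0 else 0) +
    (\<Sum>k\<in>UNIV. \<Sum>l\<in>UNIV. if k = x then if l = d2 then (if y = u2 then A $ (p, s) $ (k, l) * (1 / c1 k * (1 / a2)) else 0) else 0 else 0)"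
   unfolding matrix_matrix_mult_def tensor_rep_def uq_rep.simps kron_def X Y
   unfolding diag_matrix_def unit_matrix_def
   by (simp add: sum_UNIV_pair sum.distrib[symmetric] mat_def) (intro sum.cong refl; auto simp: algebra_simps)
  then show "(A ** repF (tensor_rep X Y) i) $ (p, s) $ (x, y) =
   (if x = u1 then A $ (p, s) $ (d1, y) * (1 / a1) else 0) + (if y = u2 then A $ (p, s) $ (x, d2) * (1 / c1 x * (1 / a2)) else 0)"
   unfolding d .
  have "(repF (tensor_rep Y X) i ** A) $ (p, s) $ (x, y) =
    (\<Sum>k\<in>UNIV. \<Sum>l\<in>UNIV. if k = u2 then if l = s then (if p = d2 then 1 / a2 * A $ (k, l) $ (x, y) else 0) else 0 else 0) +
    (\<Sum>k\<in>UNIV. \<Sum>l\<in>UNIV. if k = p then if l = u1 then (if s = d1 then 1 / c2 k * (1 / a1) * A $ (k, l) $ (x, y) else 0) else 0 else 0)"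
   unfolding matrix_matrix_mult_def tensor_rep_def uq_rep.simps kron_def X Y
   unfolding diag_matrix_def unit_matrix_def
   by (simp add: sum_UNIV_pair sum.distrib[symmetric] mat_def) (intro sum.cong refl; auto simp: algebra_simps)
  then show "(repF (tensor_rep Y X) i ** A) $ (p, s) $ (x, y) =
   (if p = d2 then 1 / a2 * A $ (u2, s) $ (x, y) else 0) + (if s = d1 then 1 / c2 p * (1 / a1) * A $ (p, u1) $ (x, y) else 0)"
   unfolding d .
 qed
 show ?thesis
  unfolding hom_at_def entry[symmetric] K E F by blast
qed

definition chain_module :: "complex \<Rightarrow> nat \<Rightarrow> (nat \<Rightarrow> nat) \<Rightarrow> ('n::finite \<Rightarrow> nat) \<Rightarrow> (nat \<Rightarrow> complex) \<Rightarrow> 'n uq_rep \<Rightarrow> bool" where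
 "chain_module Q r node pos a X \<longleftrightarrow> bij_betw pos UNIV {1..r + 1} \<and> bij_betw node {1..r} {1..r} \<and>
  (\<forall>u d. pos d = Suc (pos u) \<longrightarrow> unit_gens X (node (pos u)) (%j. if j = u then Q else if j = d then 1 / Q else 1) u d (a (pos u)))"

lemma chain_posE:
 assumes "bij_betw pos UNIV {1..r + 1}" "k \<in> {1..r}"
 obtains u d where "pos u = k" "pos d = Suc k"
proof -
 have "k \<in> pos ` UNIV" "Suc k \<in> pos ` UNIV" using assms by (auto simp: bij_betw_def)
 then show ?thesis using that by auto
qed

lemma chain_bij: "chain_module Q r node pos a X ==> bij_betw pos UNIV {1..r + 1}"
 by (simp add: chain_module_def)

lemma chain_gens: "chain_module Q r node pos a X ==> pos d = Suc (pos u) ==>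
  unit_gens X (node (pos u)) (%j. if j = u then Q else if j = d then 1 / Q else 1) u d (a (pos u))"
 by (simp add: chain_module_def)

lemma chain_inj: "chain_module Q r node pos a X ==> pos x = pos y ==> x = y"
 unfolding chain_module_def bij_betw_def by (meson inj_eq)

lemma chain_module_hom:
 assumes X: "chain_module Q r node pos a X" and X': "bij_betw node {1..r} {1..r}"
  and "\<And>u d. pos d = Suc (pos u) ==> hom_at (node (pos u)) M N A"
 shows "uq_hom r M N A"
 unfolding uq_hom_eq
proof
 fix i assume "i \<in> {1..r}"
 then have "i \<in> node ` {1..r}" using X' by (simp add: bij_betw_def)
 then obtain k where k: "k \<in> {1..r}" "i = node k" by blast
 obtain u d where "pos u = k" "pos d = Suc k" by (rule chain_posE[OF chain_bij[OF X] k(1)])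
 then show "hom_at i M N A" using assms(3)[of d u] k by simp
qed

text \<open>A module map on a tensor product is determined on (highest) \<open>\<otimes>\<close> (lowest).\<close>

lemma chain_hom_unique:
 fixes A A' :: "complex^('a::finite \<times> 'b::finite)^('b \<times> 'a)"
 assumes X: "chain_module Q r nodeX posX aX X" and Y: "chain_module Q r nodeY posY aY Y"
  and hom: "uq_hom r (tensor_rep X Y) (tensor_rep Y X) A" "uq_hom r (tensor_rep X Y) (tensor_rep Y X) A'"
  and x1: "posX x1 = 1" and yN: "posY yN = r + 1"
  and eq: "\<And>p. A $ p $ (x1, yN) = A' $ p $ (x1, yN)"
 shows "A = A'"
proof -
 have rX: "posX x \<in> {1..r + 1}" for x using X by (auto simp: chain_module_def bij_betw_def)
 have rY: "posY y \<in> {1..r + 1}" for y using Y by (auto simp: chain_module_def bij_betw_def)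
 have gX: "\<exists>k\<in>{1..r}. i = nodeX k" if "i \<in> {1..r}" for i
  using X that unfolding chain_module_def bij_betw_def by blast
 have gY: "\<exists>k\<in>{1..r}. i = nodeY k" if "i \<in> {1..r}" for i
  using Y that unfolding chain_module_def bij_betw_def by blast
 have nX: "nodeX k \<in> {1..r}" if "k \<in> {1..r}" for k using X that by (auto simp: chain_module_def bij_betw_def)
 have nY: "nodeY k \<in> {1..r}" if "k \<in> {1..r}" for k using Y that by (auto simp: chain_module_def bij_betw_def)
 note injX = chain_inj[OF X]
 note injY = chain_inj[OF Y]
 have gensX: "\<exists>c u d a. unit_gens X i c u d a \<and> posX d = Suc (posX u)" if i: "i \<in> {1..r}" for i
 proof -
  obtain k where k: "k \<in> {1..r}" "i = nodeX k" using gX[OF i] by blast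
  obtain u d where ud: "posX u = k" "posX d = Suc k"
   by (rule chain_posE[OF chain_bij[OF X] k(1)])
  then have "posX d = Suc (posX u)" by simp
  from this chain_gens[OF X this] show ?thesis using k(2) ud(1) by blast
 qed
 have gensY: "\<exists>c u d a. unit_gens Y i c u d a \<and> posY d = Suc (posY u)" if i: "i \<in> {1..r}" for i
 proof -
  obtain k where k: "k \<in> {1..r}" "i = nodeY k" using gY[OF i] by blast
  obtain u d where ud: "posY u = k" "posY d = Suc k"
   by (rule chain_posE[OF chain_bij[OF Y] k(1)])
  then have "posY d = Suc (posY u)" by simp
  from this chain_gens[OF Y this] show ?thesis using k(2) ud(1) by blast
 qed
 have step_low: "\<forall>p. A $ p $ (x1, y) = A' $ p $ (x1, y)" if "posY y + n = r + 1" for y n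
  using that
 proof (induction n arbitrary: y)
  case 0
  then have "y = yN" using yN injY by auto
  then show ?case using eq by simp
 next
  case (Suc n)
  have k: "posY y \<in> {1..r}" using Suc.prems rY[of y] by auto
  obtain d where d: "posY d = Suc (posY y)" by (rule chain_posE[OF chain_bij[OF Y] k])
  have IH: "\<forall>p. A $ p $ (x1, d) = A' $ p $ (x1, d)" using Suc d by auto
  define c2 where "c2 = (%j. if j = y then Q else if j = d then 1 / Q else 1)"
  have gy: "unit_gens Y (nodeY (posY y)) c2 y d (aY (posY y))"
   unfolding c2_def by (rule chain_gens[OF Y d])
  obtain c1 u1 d1 a1 where gx: "unit_gens X (nodeY (posY y)) c1 u1 d1 a1" "posX d1 = Suc (posX u1)"
   using gensX[OF nY[OF k]] by blast
  have ne: "x1 \<noteq> d1" using gx(2) x1 rX[of u1] by auto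
  have a2: "aY (posY y) \<noteq> 0" using gy by (simp add: unit_gens_def)
  have *: "hom_at (nodeY (posY y)) (tensor_rep X Y) (tensor_rep Y X) A"
   "hom_at (nodeY (posY y)) (tensor_rep X Y) (tensor_rep Y X) A'"
   using hom nY[OF k] by (auto simp: uq_hom_eq)
  note ** = *[unfolded hom_at_tensor_entries[OF gx(1) gy], THEN conjunct2, THEN conjunct1, rule_format, where x = x1 and y = d]
  have "A $ (p, s) $ (x1, y) * aY (posY y) = A' $ (p, s) $ (x1, y) * aY (posY y)" for p s
   using **[where p = p and s = s] ne IH by simp
  then show ?case using a2 by auto
 qed
 have base: "A $ p $ (x1, y) = A' $ p $ (x1, y)" for p y
  using step_low[of y "r + 1 - posY y"] rY[of y] by (cases p) auto
 have "\<forall>y p. A $ p $ (x, y) = A' $ p $ (x, y)" if "posX x = Suc n" for x n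
  using that
 proof (induction n arbitrary: x)
  case 0
  then have "x = x1" using x1 injX by auto
  then show ?case using base by simp
 next
  case (Suc n)
  have k: "Suc n \<in> {1..r}" using Suc.prems rX[of x] by auto
  obtain u where u: "posX u = Suc n" by (rule chain_posE[OF chain_bij[OF X] k])
  have IH: "\<forall>y p. A $ p $ (u, y) = A' $ p $ (u, y)" using Suc u by auto
  define c1 where "c1 = (%j. if j = u then Q else if j = x then 1 / Q else 1)"
  have gx: "unit_gens X (nodeX (Suc n)) c1 u x (aX (Suc n))"
   using chain_gens[OF X, of x u] u Suc.prems unfolding c1_def by simp
  obtain c2 u2 d2 a2 where gy: "unit_gens Y (nodeX (Suc n)) c2 u2 d2 a2"
   using gensY[OF nX[OF k]] by blast
  have a1: "aX (Suc n) \<noteq> 0" using gx by (simp add: unit_gens_def)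
  have *: "hom_at (nodeX (Suc n)) (tensor_rep X Y) (tensor_rep Y X) A"
   "hom_at (nodeX (Suc n)) (tensor_rep X Y) (tensor_rep Y X) A'"
   using hom nX[OF k] by (auto simp: uq_hom_eq)
  note ** = *[unfolded hom_at_tensor_entries[OF gx gy], THEN conjunct2, THEN conjunct2, rule_format, where x = u]
  have "A $ (p, s) $ (x, y) * (1 / aX (Suc n)) = A' $ (p, s) $ (x, y) * (1 / aX (Suc n))" for p s y
  proof -
   have IH': "A $ p $ (u, y) = A' $ p $ (u, y)" for p y using IH by blast
   from trans[OF **(1)[where p = p and s = s and y = y, unfolded IH'] **(2)[where p = p and s = s and y = y, symmetric]]
   show ?thesis by (simp only: add_right_cancel if_True simp_thms)
  qed
  then show ?case using a1 by auto
 qed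
 then have "A $ p $ (x, y) = A' $ p $ (x, y)" for p x y
  using rX[of x] by (metis atLeastAtMost_iff not0_implies_Suc not_one_le_zero)
 then show ?thesis by (auto simp: vec_eq_iff)
qed

lemma mult_vec_unit: "unit_matrix u d a *v x = (\<chi> j. if j = u then a * x $ d else 0)"
 by (auto simp: unit_matrix_def matrix_vector_mult_def vec_eq_iff if_distrib[of "%c. c * _"] cong: if_cong)

lemma mult_vec_diag: "diag_matrix c *v x = (\<chi> j. c j * x $ j)"
 by (auto simp: diag_matrix_def matrix_vector_mult_def vec_eq_iff if_distrib[of "%c. c * _"] cong: if_cong)

lemma chain_highest_vector:
 assumes X: "chain_module Q r node pos a X" and hw: "highest_weight_vector q r X \<kappa> x" and x1: "pos x1 = 1" and j: "j \<noteq> x1"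
 shows "x $ j = 0"
proof -
 have pj: "pos j \<in> {1..r + 1}" using X by (auto simp: chain_module_def bij_betw_def)
 have "pos j \<noteq> 1" using chain_inj[OF X, of j x1] j x1 by auto
 then have k: "pos j - 1 \<in> {1..r}" using pj by auto
 obtain u where "pos u = pos j - 1" by (rule chain_posE[OF chain_bij[OF X] k])
 then have u: "pos j = Suc (pos u)" using pj by simp
 have g: "unit_gens X (node (pos u)) (%i. if i = u then Q else if i = j then 1 / Q else 1) u j (a (pos u))"
  by (rule chain_gens[OF X u])
 have "node (pos u) \<in> {1..r}" using X u k by (auto simp: chain_module_def bij_betw_def)
 then have "repE X (node (pos u)) *v x = 0" using hw by (simp add: highest_weight_vector_def)
 then have "(unit_matrix u j (a (pos u)) *v x) $ u = 0"
  using g by (simp add: unit_gens_def)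
 then have "a (pos u) * x $ j = 0" by (simp add: mult_vec_unit)
 then show ?thesis using g by (simp add: unit_gens_def)
qed

lemma chain_lowest_vector:
 assumes X: "chain_module Q r node pos a X" and lw: "lowest_weight_vector q r X \<kappa> x" and xN: "pos xN = r + 1" and j: "j \<noteq> xN"
 shows "x $ j = 0"
proof -
 have pj: "pos j \<in> {1..r + 1}" using X by (auto simp: chain_module_def bij_betw_def)
 have "pos j \<noteq> r + 1" using chain_inj[OF X, of j xN] j xN by auto
 then have k: "pos j \<in> {1..r}" using pj by auto
 obtain d where d: "pos d = Suc (pos j)" by (rule chain_posE[OF chain_bij[OF X] k])
 have g: "unit_gens X (node (pos j)) (%i. if i = j then Q else if i = d then 1 / Q else 1) j d (a (pos j))"
  by (rule chain_gens[OF X d])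
 have "node (pos j) \<in> {1..r}" using X k by (auto simp: chain_module_def bij_betw_def)
 then have "repF X (node (pos j)) *v x = 0" using lw by (simp add: lowest_weight_vector_def)
 then have "(unit_matrix d j (1 / a (pos j)) *v x) $ d = 0"
  using g by (simp add: unit_gens_def)
 then have "1 / a (pos j) * x $ j = 0" by (simp add: mult_vec_unit)
 then show ?thesis using g by (simp add: unit_gens_def)
qed

lemma braiding_eqI:
 fixes A :: "complex^('a::finite \<times> 'b::finite)^('b \<times> 'a)"
 assumes X: "chain_module Q r nodeX posX aX X" and Y: "chain_module Q r nodeY posY aY Y"
  and hom: "uq_hom r (tensor_rep X Y) (tensor_rep Y X) A"
  and x1: "posX x1 = 1" and yN: "posY yN = r + 1"
  and hw: "highest_weight_vector q r X \<kappa> (axis x1 1)"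
  and lw: "lowest_weight_vector q r Y (longest_act r \<mu>) (axis yN 1)"
  and col: "\<And>p. A $ p $ (x1, yN) = (if p = (yN, x1) then qpow q (wform r \<kappa> (longest_act r \<mu>)) else 0)"
 shows "braiding q r \<kappa> \<mu> X Y = A"
 unfolding braiding_def
proof (rule the_equality)
 let ?c = "qpow q (wform r \<kappa> (longest_act r \<mu>))"
 have val: "(M *v vec_tensor x y) $ p = M $ p $ (x1, yN) * (x $ x1 * y $ yN)"
  if "\<And>j. j \<noteq> x1 ==> x $ j = 0" "\<And>j. j \<noteq> yN ==> y $ j = 0" for M :: "complex^('a \<times> 'b)^('b \<times> 'a)" and x y p
 proof -
  have "(M *v vec_tensor x y) $ p = (\<Sum>k\<in>UNIV. M $ p $ k * (x $ fst k * y $ snd k))"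
   by (simp add: matrix_vector_mult_def vec_tensor_def)
  also have "\<dots> = (\<Sum>k\<in>UNIV. if k = (x1, yN) then M $ p $ k * (x $ x1 * y $ yN) else 0)"
  proof (intro sum.cong refl)
   fix k show "M $ p $ k * (x $ fst k * y $ snd k) = (if k = (x1, yN) then M $ p $ k * (x $ x1 * y $ yN) else 0)"
    by (cases k) (auto simp: that)
  qed
  finally have "(M *v vec_tensor x y) $ p = (\<Sum>k\<in>UNIV. if k = (x1, yN) then M $ p $ k * (x $ x1 * y $ yN) else 0)" .
  then show ?thesis by simp
 qed
 show "uq_hom r (tensor_rep X Y) (tensor_rep Y X) A \<and>
  (\<forall>x y. highest_weight_vector q r X \<kappa> x \<and> lowest_weight_vector q r Y (longest_act r \<mu>) y \<longrightarrow>
   A *v vec_tensor x y = ?c *s vec_tensor y x)"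
 proof (intro conjI hom allI impI)
  fix x y assume xy: "highest_weight_vector q r X \<kappa> x \<and> lowest_weight_vector q r Y (longest_act r \<mu>) y"
  have zx: "x $ j = 0" if "j \<noteq> x1" for j using chain_highest_vector[OF X _ x1 that] xy by blast
  have zy: "y $ j = 0" if "j \<noteq> yN" for j using chain_lowest_vector[OF Y _ yN that] xy by blast
  show "A *v vec_tensor x y = ?c *s vec_tensor y x"
   unfolding vec_eq_iff
  proof
   fix p
   have v: "(A *v vec_tensor x y) $ p = A $ p $ (x1, yN) * (x $ x1 * y $ yN)"
    by (rule val) (use zx zy in auto)
   show "(A *v vec_tensor x y) $ p = (?c *s vec_tensor y x) $ p"
    unfolding v col using zx[of "snd p"] zy[of "fst p"]
    by (cases p) (auto simp: vec_tensor_def)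
  qed
 qed
 fix M
 assume M: "uq_hom r (tensor_rep X Y) (tensor_rep Y X) M \<and>
  (\<forall>x y. highest_weight_vector q r X \<kappa> x \<and> lowest_weight_vector q r Y (longest_act r \<mu>) y \<longrightarrow>
   M *v vec_tensor x y = ?c *s vec_tensor y x)"
 have "M *v vec_tensor (axis x1 1) (axis yN 1) = ?c *s vec_tensor (axis yN 1) (axis x1 1)"
  using M hw lw by blast
 then have "M $ p $ (x1, yN) = (if p = (yN, x1) then ?c else 0)" for p
  using val[of "axis x1 1" "axis yN 1" M p] by (cases p) (auto simp: axis_def vec_tensor_def)
 then show "M = A" using M col by (intro chain_hom_unique[OF X Y _ hom x1 yN]) auto
qed

definition braid_same :: "complex \<Rightarrow> complex \<Rightarrow> ('n::finite \<Rightarrow> nat) \<Rightarrow> complex^('n \<times> 'n)^('n \<times> 'n)" where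
 "braid_same t Q pos = (\<chi> p i. t * (if fst i = snd i then (if p = i then Q else 0)
  else (if p = (snd i, fst i) then 1 else 0) + (if p = i \<and> pos (snd i) < pos (fst i) then Q - 1 / Q else 0)))"

definition braid_dual :: "complex \<Rightarrow> complex \<Rightarrow> ('n::finite \<Rightarrow> nat) \<Rightarrow> complex^('n \<times> 'n)^('n \<times> 'n)" where
 "braid_dual t Q pos = (\<chi> p i. 1 / t * (if fst i \<noteq> snd i then (if p = (snd i, fst i) then 1 else 0)
  else if fst p \<noteq> snd p then 0 else if p = i then 1 / Q
  else if pos (fst p) < pos (fst i) then (1 / Q - Q) * Q ^ (2 * pos (fst p)) / Q ^ (2 * pos (fst i)) else 0))"

lemma braid_same_entry:
 "braid_same t Q pos $ (a, k) $ (x, y) = t * (if x = y then (if a = x \<and> k = x then Q else 0)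
  else (if a = y \<and> k = x then 1 else 0) + (if a = x \<and> k = y \<and> pos y < pos x then Q - 1 / Q else 0))"
 by (auto simp: braid_same_def)

lemma braid_dual_entry:
 "braid_dual t Q pos $ (b, a) $ (x, y) = 1 / t * (if x \<noteq> y then (if b = y \<and> a = x then 1 else 0)
  else if b \<noteq> a then 0 else if b = x then 1 / Q
  else if pos b < pos x then (1 / Q - Q) * Q ^ (2 * pos b) / Q ^ (2 * pos x) else 0)"
 by (auto simp: braid_dual_def)

lemma adjacent_positions:
 assumes "chain_module Q r node pos a X" "pos d = Suc (pos u)"
 shows "u \<noteq> d" "x \<noteq> u ==> x \<noteq> d ==> pos x < pos d \<longleftrightarrow> pos x < pos u"
  "x \<noteq> u ==> x \<noteq> d ==> pos d < pos x \<longleftrightarrow> pos u < pos x"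
 using chain_inj[OF assms(1), of x u] chain_inj[OF assms(1), of x d] assms(2)
 by (auto simp: less_Suc_eq intro: Suc_lessI)

lemma braid_same_hom:
 assumes X: "chain_module Q r node pos a X" and Q: "Q \<noteq> 0"
 shows "uq_hom r (tensor_rep X X) (tensor_rep X X) (braid_same t Q pos)"
proof (rule chain_module_hom[OF X])
 show "bij_betw node {1..r} {1..r}" using X by (simp add: chain_module_def)
 fix u d assume ud: "pos d = Suc (pos u)"
 note g = chain_gens[OF X ud]
 have a: "a (pos u) \<noteq> 0" using g by (simp add: unit_gens_def)
 note adj = adjacent_positions[OF X ud]
 have [simp]: "u \<noteq> d" "d \<noteq> u" "pos u < pos d" "\<not> pos d < pos u" using adj(1) ud by auto
 show "hom_at (node (pos u)) (tensor_rep X X) (tensor_rep X X) (braid_same t Q pos)"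
  unfolding hom_at_tensor_entries[OF g g]
 proof (intro conjI allI, goal_cases)
  case (1 p s x y)
  have "braid_same t Q pos $ (p, s) $ (x, y) = 0" if "\<not> (p = y \<and> s = x)" "\<not> (p = x \<and> s = y)"
   using that unfolding braid_same_entry
   by (cases "p = y"; cases "s = x"; cases "p = x"; cases "s = y"; simp)
  then consider "braid_same t Q pos $ (p, s) $ (x, y) = 0" | "p = y \<and> s = x" | "p = x \<and> s = y" by blast
  then show ?case by cases (simp_all add: mult.commute mult.left_commute del: if_split)
 next
  case (2 p s x y)
  show ?case using Q a
   by (cases "x = u"; cases "x = d"; cases "y = u"; cases "y = d"; cases "p = u"; cases "p = d"; cases "s = u"; cases "s = d";
     simp add: braid_same_entry adj(2,3) field_simps)
 next
  case (3 p s x y)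
  show ?case using Q a
   by (cases "x = u"; cases "x = d"; cases "y = u"; cases "y = d"; cases "p = u"; cases "p = d"; cases "s = u"; cases "s = d";
     simp add: braid_same_entry adj(2,3) field_simps)
 qed
qed

lemma dual_gens:
 assumes g: "unit_gens X i (%j. if j = u then Q else if j = d then 1 / Q else 1) u d a" and Q: "Q \<noteq> 0"
 shows "unit_gens (dual_rep X) i (%j. if j = d then Q else if j = u then 1 / Q else 1) d u (- (a * Q))"
proof -
 let ?c = "%j. if j = u then Q else if j = d then 1 / Q else 1"
 have ud: "u \<noteq> d" and a: "a \<noteq> 0" using g by (auto simp: unit_gens_def)
 have gens: "repK X i = diag_matrix ?c" "repE X i = unit_matrix u d a" "repF X i = unit_matrix d u (1 / a)"
  using g by (auto simp: unit_gens_def)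
 have inv: "matrix_inv (diag_matrix ?c) = diag_matrix (%j. 1 / ?c j)"
  by (rule diag_matrix_inv) (use Q in auto)
 have K: "repK (dual_rep X) i = diag_matrix (%j. if j = d then Q else if j = u then 1 / Q else 1)"
  unfolding dual_rep_def uq_rep.simps gens inv using ud
  by (auto simp: diag_matrix_def transpose_def vec_eq_iff)
 have E: "repE (dual_rep X) i = unit_matrix d u (- (a * Q))"
  unfolding dual_rep_def uq_rep.simps gens inv using ud Q
  by (auto simp: diag_matrix_def unit_matrix_def transpose_def vec_eq_iff matrix_matrix_mult_def
    if_distrib[of "%c. c * _"] if_distrib[of "(*) _"] cong: if_cong)
 have F: "repF (dual_rep X) i = unit_matrix u d (1 / (- (a * Q)))"
  unfolding dual_rep_def uq_rep.simps gens inv using ud Q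
  by (auto simp: diag_matrix_def unit_matrix_def transpose_def vec_eq_iff matrix_matrix_mult_def
    if_distrib[of "%c. c * _"] if_distrib[of "(*) _"] cong: if_cong)
 show ?thesis using K E F ud a Q by (auto simp: unit_gens_def)
qed

lemma dual_chain:
 assumes X: "chain_module Q r node pos a X" and Q: "Q \<noteq> 0"
 shows "chain_module Q r (%k. node (r + 1 - k)) (%j. r + 2 - pos j) (%k. - (a (r + 1 - k) * Q)) (dual_rep X)"
 unfolding chain_module_def
proof (intro conjI allI impI)
 have rng: "pos j \<in> {1..r + 1}" for j using chain_bij[OF X] by (auto simp: bij_betw_def)
 have "bij_betw (%n. r + 2 - n) {1..r + 1} {1..r + 1}"
  by (rule bij_betw_byWitness[where f' = "%n. r + 2 - n"]) auto
 from bij_betw_trans[OF chain_bij[OF X] this]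
 show "bij_betw (%j. r + 2 - pos j) UNIV {1..r + 1}" by (simp add: comp_def)
 have "bij_betw (%n. r + 1 - n) {1..r} {1..r}"
  by (rule bij_betw_byWitness[where f' = "%n. r + 1 - n"]) auto
 from bij_betw_trans[OF this, of node "{1..r}"] X
 show "bij_betw (%k. node (r + 1 - k)) {1..r} {1..r}" by (simp add: comp_def chain_module_def)
 fix u d assume "r + 2 - pos d = Suc (r + 2 - pos u)"
 then have ud: "pos u = Suc (pos d)" using rng[of u] rng[of d] by auto
 then have "r + 1 - (r + 2 - pos u) = pos d" using rng[of u] by auto
 then show "unit_gens (dual_rep X) (node (r + 1 - (r + 2 - pos u))) (%j. if j = u then Q else if j = d then 1 / Q else 1)
   u d (- (a (r + 1 - (r + 2 - pos u)) * Q))"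
  using dual_gens[OF chain_gens[OF X ud] Q] by simp
qed

lemma braid_dual_hom:
 assumes X: "chain_module Q r node pos a X" and Q: "Q \<noteq> 0" and t: "t \<noteq> 0"
 shows "uq_hom r (tensor_rep X (dual_rep X)) (tensor_rep (dual_rep X) X) (braid_dual t Q pos)"
proof (rule chain_module_hom[OF X])
 show "bij_betw node {1..r} {1..r}" using X by (simp add: chain_module_def)
 fix u d assume ud: "pos d = Suc (pos u)"
 note g = chain_gens[OF X ud]
 note g' = dual_gens[OF g Q]
 have a: "a (pos u) \<noteq> 0" using g by (simp add: unit_gens_def)
 note adj = adjacent_positions[OF X ud]
 have [simp]: "u \<noteq> d" "d \<noteq> u" "pos u < pos d" "\<not> pos d < pos u" using adj(1) ud by auto
 have pw: "Q ^ (2 * pos d) = Q ^ (2 * pos u) * Q * Q" "Q ^ (pos d * 2) = Q ^ (pos u * 2) * Q * Q"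
  using ud by simp_all
 have nz: "Q ^ n \<noteq> 0" for n using Q by simp
 show "hom_at (node (pos u)) (tensor_rep X (dual_rep X)) (tensor_rep (dual_rep X) X) (braid_dual t Q pos)"
  unfolding hom_at_tensor_entries[OF g g']
 proof (intro conjI allI, goal_cases)
  case (1 p s x y)
  have "braid_dual t Q pos $ (p, s) $ (x, y) = 0" if "\<not> (p = y \<and> s = x)" "\<not> (p = s \<and> x = y)"
   using that unfolding braid_dual_entry
   by (cases "p = y"; cases "s = x"; cases "p = s"; cases "x = y"; simp)
  then consider "braid_dual t Q pos $ (p, s) $ (x, y) = 0" | "p = y \<and> s = x" | "p = s \<and> x = y" by blast
  then show ?case
  proof cases
   case 3
   have *: "(if j = u then Q else if j = d then 1 / Q else 1) * (if j = d then Q else if j = u then 1 / Q else 1) = 1"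
    "(if j = d then Q else if j = u then 1 / Q else 1) * (if j = u then Q else if j = d then 1 / Q else 1) = 1" for j
    using Q by simp_all
   have "p = s" "x = y" using 3 by auto
   then show ?thesis by (simp only: * mult_1_left mult_1_right)
  qed (simp_all add: mult.commute mult.left_commute del: if_split)
 next
  case (2 p s x y)
  show ?case using Q a nz t
   by (cases "x = u"; cases "x = d"; cases "y = u"; cases "y = d"; cases "p = u"; cases "p = d"; cases "s = u"; cases "s = d";
     simp add: braid_dual_entry adj(2,3) pw field_simps)
 next
  case (3 p s x y)
  show ?case using Q a nz t
   by (cases "x = u"; cases "x = d"; cases "y = u"; cases "y = d"; cases "p = u"; cases "p = d"; cases "s = u"; cases "s = d";
     simp add: braid_dual_entry adj(2,3) pw field_simps)
 qed
qed

lemma sum_pos_filter: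
 fixes f :: "nat \<Rightarrow> complex" and pos :: "'n::finite \<Rightarrow> nat"
 assumes "bij_betw pos UNIV {1..N}" "m \<ge> 1" "n \<le> N + 1"
 shows "(\<Sum>a\<in>UNIV. if m \<le> pos a \<and> pos a < n then f (pos a) else 0) = (\<Sum>k = m..<n. f k)"
proof -
 have "(\<Sum>a\<in>UNIV. if m \<le> pos a \<and> pos a < n then f (pos a) else 0) =
   (\<Sum>k\<in>{1..N}. if m \<le> k \<and> k < n then f k else 0)"
  by (rule sum.reindex_bij_betw[OF assms(1), where g = "%k. if m \<le> k \<and> k < n then f k else 0"])
 also have "\<dots> = (\<Sum>k\<in>{m..<n}. f k)"
  using assms(2,3) by (intro sum.mono_neutral_cong_right) auto
 finally show ?thesis .
qed

lemma sum_pos_telescope: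
 fixes h :: "nat \<Rightarrow> complex" and pos :: "'n::finite \<Rightarrow> nat"
 assumes "bij_betw pos UNIV {1..N}" "m \<ge> 1" "n \<le> N + 1" "m \<le> n"
  and "\<And>a. m \<le> pos a ==> pos a < n ==> F a = h (Suc (pos a)) - h (pos a)"
  and "\<And>a. \<not> (m \<le> pos a \<and> pos a < n) ==> F a = 0"
 shows "(\<Sum>a\<in>UNIV. F a) = h n - h m"
proof -
 have "(\<Sum>a\<in>UNIV. F a) = (\<Sum>a\<in>UNIV. if m \<le> pos a \<and> pos a < n then h (Suc (pos a)) - h (pos a) else 0)"
  using assms(5,6) by (intro sum.cong) auto
 also have "\<dots> = (\<Sum>k = m..<n. h (Suc k) - h k)"
  by (rule sum_pos_filter[OF assms(1-3)])
 also have "\<dots> = h n - h m" by (rule sum_Suc_diff'[OF assms(4)])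
 finally show ?thesis .
qed

text \<open>
 The explicit braidings. They depend only on the order of the basis given by \<open>pos\<close>, the parameter \<open>Q\<close> and the
 normalisation \<open>t\<close>, which stands for \<open>q\<close> to the power \<open>-1/(r + 1)\<close>.
\<close>

locale ordered_basis =
 fixes pos :: "'n::finite \<Rightarrow> nat" and r :: nat and Q t :: complex
 assumes pos: "bij_betw pos UNIV {1..r + 1}" and Q: "Q \<noteq> 0" and t: "t \<noteq> 0"
begin

lemma pos_range: "1 \<le> pos x" "pos x \<le> r + 1"
 using pos by (auto simp: bij_betw_def)

lemma pos_eq [simp]: "pos x = pos y \<longleftrightarrow> x = y"
 using pos by (auto simp: bij_betw_def inj_eq)

lemma pos_less_or: "x \<noteq> y ==> pos x < pos y \<or> pos y < pos x"
 using pos_eq[of x y] by linarith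

definition wt :: "'n \<Rightarrow> complex" where
 "wt k = Q ^ (r + 2) / Q ^ (2 * pos k)"

abbreviation "rev_pos \<equiv> %j. r + 2 - pos j"

lemma rev_pos: "bij_betw rev_pos UNIV {1..r + 1}" "rev_pos x < rev_pos y \<longleftrightarrow> pos y < pos x"
proof -
 have "bij_betw (%n. r + 2 - n) {1..r + 1} {1..r + 1}"
  by (rule bij_betw_byWitness[where f' = "%n. r + 2 - n"]) auto
 from bij_betw_trans[OF pos this] show "bij_betw rev_pos UNIV {1..r + 1}" by (simp add: comp_def)
 show "rev_pos x < rev_pos y \<longleftrightarrow> pos y < pos x" using pos_range[of x] pos_range[of y] by auto
qed

abbreviation "VV \<equiv> braid_same t Q pos"
abbreviation "DD \<equiv> braid_same t Q rev_pos"
abbreviation "VD \<equiv> braid_dual t Q pos"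

definition VDi :: "complex^('n \<times> 'n)^('n \<times> 'n)" where
 "VDi = (\<chi> p i. VV $ (fst i, fst p) $ (snd i, snd p))"

lemma VDi_entry: "VDi $ (x, y) $ (a, k) = VV $ (a, x) $ (k, y)"
 by (simp add: VDi_def)

definition VVi :: "complex^('n \<times> 'n)^('n \<times> 'n)" where
 "VVi = mat (1 / t^2) ** (VV + mat (- (t * (Q - 1 / Q))))"

definition DDi :: "complex^('n \<times> 'n)^('n \<times> 'n)" where
 "DDi = mat (1 / t^2) ** (DD + mat (- (t * (Q - 1 / Q))))"

lemma braid_same_sum:
 "(\<Sum>a\<in>UNIV. \<Sum>k\<in>UNIV. g a k * braid_same t Q ps $ (a, k) $ (x, y)) =
  (if x = y then g x x * (t * Q) else g y x * t + (if ps y < ps x then g x y * (t * (Q - 1 / Q)) else 0))"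
proof -
 have d: "(\<Sum>x\<in>UNIV. \<Sum>y\<in>UNIV. if x = a then if y = b then f x y else 0 else 0) = f a b"
  for f :: "'k::finite \<Rightarrow> 'l::finite \<Rightarrow> complex" and a b
 proof -
  have "(\<Sum>x\<in>UNIV. \<Sum>y\<in>UNIV. if x = a then if y = b then f x y else 0 else 0) =
    (\<Sum>x\<in>UNIV. if x = a then (\<Sum>y\<in>UNIV. if y = b then f x y else 0) else 0)"
   by (intro sum.cong) auto
  then show ?thesis by simp
 qed
 have "(\<Sum>a\<in>UNIV. \<Sum>k\<in>UNIV. g a k * braid_same t Q ps $ (a, k) $ (x, y)) =
   (\<Sum>a\<in>UNIV. \<Sum>k\<in>UNIV. if a = y then if k = x then g a k * (t * (if x = y then Q else 1)) else 0 else 0) +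
   (\<Sum>a\<in>UNIV. \<Sum>k\<in>UNIV. if a = x then if k = y then g a k * (t * (if x \<noteq> y \<and> ps y < ps x then Q - 1 / Q else 0)) else 0 else 0)"
  unfolding sum.distrib[symmetric]
 proof (intro sum.cong refl)
  fix a k
  show "g a k * braid_same t Q ps $ (a, k) $ (x, y) =
   (if a = y then if k = x then g a k * (t * (if x = y then Q else 1)) else 0 else 0) +
   (if a = x then if k = y then g a k * (t * (if x \<noteq> y \<and> ps y < ps x then Q - 1 / Q else 0)) else 0 else 0)"
   unfolding braid_same_entry
   by (cases "x = y"; cases "a = y"; cases "k = x"; cases "a = x"; cases "k = y"; simp add: algebra_simps)
 qed
 then show ?thesis unfolding d by simp
qed

lemma hecke_same: "braid_same t Q ps ** braid_same t Q ps = mat (t * (Q - 1 / Q)) ** braid_same t Q ps + mat (t^2)"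
 if inj: "inj (ps :: 'n \<Rightarrow> nat)"
proof -
 have scal: "(mat c ** M) $ i $ j = c * M $ i $ j" for c and M :: "complex^('n \<times> 'n)^('n \<times> 'n)" and i j
  by (simp add: matrix_matrix_mult_def mat_def if_distrib[of "%c. c * _"] cong: if_cong)
 have "(braid_same t Q ps ** braid_same t Q ps) $ (p, s) $ (x, y) =
   (mat (t * (Q - 1 / Q)) ** braid_same t Q ps + mat (t^2)) $ (p, s) $ (x, y)" for p s x y
 proof -
  have "(braid_same t Q ps ** braid_same t Q ps) $ (p, s) $ (x, y) =
   (\<Sum>a\<in>UNIV. \<Sum>k\<in>UNIV. braid_same t Q ps $ (p, s) $ (a, k) * braid_same t Q ps $ (a, k) $ (x, y))"
   by (simp add: matrix_matrix_mult_def sum_UNIV_pair)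
  also have "\<dots> = (mat (t * (Q - 1 / Q)) ** braid_same t Q ps + mat (t^2)) $ (p, s) $ (x, y)"
  proof -
   have ne: "ps x \<noteq> ps y" if "x \<noteq> y" using inj that by (auto dest: injD)
   have m: "mat c $ (p, s) $ (x, y) = (if p = x \<and> s = y then c else 0)" for c :: complex
    by (simp add: mat_def)
   define z where "z = Q - 1 / Q"
   have e: "t * Q * (t * Q) = t * z * (t * Q) + t^2"
    unfolding z_def using Q by (simp add: field_simps power2_eq_square)
   note ent = vector_add_component scal braid_same_entry m z_def[symmetric]
   consider "x = y" | "x \<noteq> y" "ps x < ps y" | "x \<noteq> y" "ps y < ps x" using ne by (metis linorder_neqE_nat)
   then show ?thesis
   proof cases
    case 1
    then show ?thesis unfolding braid_same_sum unfolding ent using e by (cases "p = x"; cases "s = y"; simp)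
   next
    case 2
    then show ?thesis unfolding braid_same_sum unfolding ent
     by (cases "p = x"; cases "s = y"; cases "p = y"; cases "s = x"; simp add: power2_eq_square algebra_simps)
   next
    case 3
    then show ?thesis unfolding braid_same_sum unfolding ent
     by (cases "p = x"; cases "s = y"; cases "p = y"; cases "s = x"; simp add: power2_eq_square algebra_simps)
   qed
  qed
  finally show ?thesis .
 qed
 then show ?thesis by (auto simp: vec_eq_iff)
qed

lemma inverse_same:
 assumes "inj (ps :: 'n \<Rightarrow> nat)"
 shows "braid_same t Q ps ** (mat (1 / t^2) ** (braid_same t Q ps + mat (- (t * (Q - 1 / Q))))) = mat 1"
proof -
 have comm: "A ** mat c = mat c ** A" for c and A :: "complex^('n \<times> 'n)^('n \<times> 'n)"
  by (simp add: matrix_matrix_mult_def mat_def vec_eq_iff if_distrib[of "%c. c * _"] if_distrib[of "(*) _"]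
    mult.commute cong: if_cong)
 have mm: "mat c ** mat d = (mat (c * d) :: complex^('n \<times> 'n)^('n \<times> 'n))" for c d
  by (auto simp: matrix_matrix_mult_def mat_def vec_eq_iff if_distrib[of "%c. c * _"] if_distrib[of "(*) _"] cong: if_cong)
 have neg: "mat (- c) ** A = - (mat c ** A)" for c and A :: "complex^('n \<times> 'n)^('n \<times> 'n)"
  by (simp add: matrix_matrix_mult_def mat_def vec_eq_iff if_distrib[of "%c. c * _"] cong: if_cong)
 let ?A = "braid_same t Q ps"
 have "?A ** (mat (1 / t^2) ** (?A + mat (- (t * (Q - 1 / Q))))) =
   mat (1 / t^2) ** (?A ** ?A + mat (- (t * (Q - 1 / Q))) ** ?A)"
 proof -
  have "?A ** (mat (1 / t^2) ** (?A + mat (- (t * (Q - 1 / Q))))) = mat (1 / t^2) ** (?A ** (?A + mat (- (t * (Q - 1 / Q)))))"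
   by (simp only: matrix_mul_assoc comm[of ?A])
  then show ?thesis by (simp only: matrix_add_ldistrib comm[of ?A])
 qed
 also have "\<dots> = mat (1 / t^2) ** mat (t^2)"
  unfolding hecke_same[OF assms] neg by simp
 also have "\<dots> = mat 1" using t by (simp add: mm)
 finally show ?thesis .
qed

lemma inj_pos: "inj pos" "inj rev_pos"
 using pos rev_pos(1) by (auto simp: bij_betw_def)

lemma VV_inverse: "VV ** VVi = mat 1" "VVi ** VV = mat 1" "DD ** DDi = mat 1" "DDi ** DD = mat 1"
 using inverse_same[OF inj_pos(1)] inverse_same[OF inj_pos(2)]
 by (simp_all add: VVi_def DDi_def matrix_left_right_inverse)

lemma rotate_kernel:
 "(\<Sum>a\<in>UNIV. \<Sum>k\<in>UNIV. VV $ (a, o1) $ (k, l) * VD $ (a, k) $ (x, y)) = (if x = o1 \<and> y = l then 1 else 0)"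
proof (cases "x = y")
 case False
 have "(\<Sum>a\<in>UNIV. \<Sum>k\<in>UNIV. VV $ (a, o1) $ (k, l) * VD $ (a, k) $ (x, y)) =
   (\<Sum>a\<in>UNIV. \<Sum>k\<in>UNIV. if k = x then if a = y then VV $ (a, o1) $ (k, l) / t else 0 else 0)"
  unfolding braid_dual_entry using False by (intro sum.cong refl) auto
 also have "\<dots> = VV $ (y, o1) $ (x, l) / t" by simp
 also have "\<dots> = (if x = o1 \<and> y = l then 1 else 0)"
  unfolding braid_same_entry using False t
  by (cases "x = l"; cases "y = l"; cases "o1 = x"; cases "y = x"; cases "o1 = l"; simp)
 finally show ?thesis .
next
 case True
 have "(\<Sum>a\<in>UNIV. \<Sum>k\<in>UNIV. VV $ (a, o1) $ (k, l) * VD $ (a, k) $ (x, y)) =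
   (\<Sum>a\<in>UNIV. \<Sum>k\<in>UNIV. if k = a then VV $ (a, o1) $ (k, l) * VD $ (a, k) $ (x, y) else 0)"
  unfolding braid_dual_entry using True by (intro sum.cong refl) simp
 also have "\<dots> = (\<Sum>a\<in>UNIV. VV $ (a, o1) $ (a, l) * VD $ (a, a) $ (x, x))"
  using True by simp
 also have "\<dots> = (if x = o1 \<and> x = l then 1 else 0)"
 proof (cases "o1 = l")
  case False
  have "VV $ (a, o1) $ (a, l) = 0" for a
   unfolding braid_same_entry using False by (cases "a = l"; cases "o1 = a"; simp)
  then show ?thesis using False by auto
 next
  case eq: True
  have "(\<Sum>a\<in>UNIV. VV $ (a, l) $ (a, l) * VD $ (a, a) $ (x, x)) = (if x = l then 1 else 0)"
  proof -
   have v: "VV $ (a, l) $ (a, l) = t * (if a = l then Q else if pos l < pos a then Q - 1 / Q else 0)" for a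
    unfolding braid_same_entry by simp
   have d: "VD $ (a, a) $ (x, x) = 1 / t * (if a = x then 1 / Q else if pos a < pos x then (1 / Q - Q) * Q ^ (2 * pos a) / Q ^ (2 * pos x) else 0)" for a
    unfolding braid_dual_entry by simp
   consider "x = l" | "x \<noteq> l" "pos x < pos l" | "x \<noteq> l" "pos l < pos x" using pos_less_or by blast
   then show ?thesis
   proof cases
    case 1
    have "(\<Sum>a\<in>UNIV. VV $ (a, l) $ (a, l) * VD $ (a, a) $ (x, x)) = (\<Sum>a\<in>UNIV. if a = l then 1 else 0)"
     unfolding v d using 1 t Q by (intro sum.cong refl) auto
    then show ?thesis using 1 by simp
   next
    case 2
    have "(\<Sum>a\<in>UNIV. VV $ (a, l) $ (a, l) * VD $ (a, a) $ (x, x)) = 0"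
     unfolding v d using 2 by (intro sum.neutral ballI) auto
    then show ?thesis using 2 by simp
   next
    case 3
    define h where "h n = - ((Q - 1 / Q) * Q ^ (2 * n) / (Q * Q ^ (2 * pos x)))" for n
    have "(\<Sum>a\<in>UNIV. VV $ (a, l) $ (a, l) * VD $ (a, a) $ (x, x)) =
      (\<Sum>a\<in>UNIV. (if a = l then Q * ((1 / Q - Q) * Q ^ (2 * pos a) / Q ^ (2 * pos x)) else 0) +
       (if a = x then (Q - 1 / Q) / Q else 0) +
       (if Suc (pos l) \<le> pos a \<and> pos a < pos x then h (Suc (pos a)) - h (pos a) else 0))"
    proof (intro sum.cong refl)
     fix a
     consider "a = l" | "a = x" "a \<noteq> l" | "pos a < pos l" "a \<noteq> l" "a \<noteq> x" | "pos l < pos a" "pos a < pos x" "a \<noteq> l" "a \<noteq> x" | "pos x < pos a" "a \<noteq> l" "a \<noteq> x"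
      using pos_less_or by metis
     then show "VV $ (a, l) $ (a, l) * VD $ (a, a) $ (x, x) =
       (if a = l then Q * ((1 / Q - Q) * Q ^ (2 * pos a) / Q ^ (2 * pos x)) else 0) +
       (if a = x then (Q - 1 / Q) / Q else 0) +
       (if Suc (pos l) \<le> pos a \<and> pos a < pos x then h (Suc (pos a)) - h (pos a) else 0)"
      unfolding v d using 3 t Q
      by cases (simp_all add: h_def field_simps)
    qed
    also have "\<dots> = Q * ((1 / Q - Q) * Q ^ (2 * pos l) / Q ^ (2 * pos x)) + (Q - 1 / Q) / Q + (h (pos x) - h (Suc (pos l)))"
    proof -
     have "(\<Sum>a\<in>UNIV. if Suc (pos l) \<le> pos a \<and> pos a < pos x then h (Suc (pos a)) - h (pos a) else 0) = h (pos x) - h (Suc (pos l))"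
      by (rule sum_pos_telescope[OF pos]) (use 3 pos_range[of x] in auto)
     then show ?thesis by (simp add: sum.distrib)
    qed
    also have "\<dots> = 0" using Q by (simp add: h_def field_simps)
    finally show ?thesis using 3 by simp
   qed
  qed
  then show ?thesis using eq by auto
 qed
 finally show ?thesis using True by auto
qed

lemma VD_inverse: "VDi ** VD = mat 1" "VD ** VDi = mat 1"
proof -
 have "(VDi ** VD) $ p $ q = mat 1 $ p $ q" for p q
  using rotate_kernel[of "fst p" "snd p" "fst q" "snd q"]
  by (cases p; cases q) (auto simp: matrix_matrix_mult_def sum_UNIV_pair VDi_entry mat_def)
 then show "VDi ** VD = mat 1" by (simp add: vec_eq_iff)
 then show "VD ** VDi = mat 1" by (simp add: matrix_left_right_inverse)
qed

lemma slide_VV_kernel: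
 "(\<Sum>a\<in>UNIV. \<Sum>k\<in>UNIV. wt a * VD $ (a, o1) $ (k, z) * VV $ (a, k) $ (x, y)) =
  (if y = z \<and> x = o1 then wt y else 0)"
 unfolding braid_same_sum
proof -
 consider "x = y" | "x \<noteq> y" "pos x < pos y" | "x \<noteq> y" "pos y < pos x" using pos_less_or by blast
 then show "(if x = y then wt x * VD $ (x, o1) $ (x, z) * (t * Q) else wt y * VD $ (y, o1) $ (x, z) * t +
   (if pos y < pos x then wt x * VD $ (x, o1) $ (y, z) * (t * (Q - 1 / Q)) else 0)) = (if y = z \<and> x = o1 then wt y else 0)"
  unfolding braid_dual_entry wt_def using t Q
  by cases (cases "x = z"; cases "y = z"; cases "o1 = x"; cases "o1 = y"; cases "o1 = z"; simp add: field_simps)+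
qed

lemma slide_DD_kernel:
 "(\<Sum>a\<in>UNIV. \<Sum>l\<in>UNIV. wt a * VD $ (o1, a) $ (k, l) * DD $ (l, a) $ (x, y)) =
  (if k = x \<and> y = o1 then wt k else 0)"
 unfolding sum.swap[of "%a l. wt a * VD $ (o1, a) $ (k, l) * DD $ (l, a) $ (x, y)"] braid_same_sum rev_pos(2)
proof -
 consider "x = y" | "x \<noteq> y" "pos x < pos y" | "x \<noteq> y" "pos y < pos x" using pos_less_or by blast
 then show "(if x = y then wt x * VD $ (o1, x) $ (k, x) * (t * Q) else wt x * VD $ (o1, x) $ (k, y) * t +
   (if pos x < pos y then wt y * VD $ (o1, y) $ (k, x) * (t * (Q - 1 / Q)) else 0)) = (if k = x \<and> y = o1 then wt k else 0)"
  unfolding braid_dual_entry wt_def using t Q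
  by cases (cases "k = x"; cases "k = y"; cases "o1 = x"; cases "o1 = y"; cases "o1 = k"; simp add: field_simps)+
qed

lemma eval_VD_kernel:
 "t * Q * Q ^ r * (\<Sum>k\<in>UNIV. VD $ (k, k) $ (x, y)) = (if x = y then wt x else 0)"
proof (cases "x = y")
 case False
 then have "VD $ (k, k) $ (x, y) = 0" for k unfolding braid_dual_entry by auto
 then show ?thesis using False by simp
next
 case True
 define h where "h n = - (Q ^ (2 * n) / (Q * Q ^ (2 * pos x)))" for n
 have "(\<Sum>k\<in>UNIV. VD $ (k, k) $ (x, x)) = (\<Sum>k\<in>UNIV. (if k = x then 1 / (t * Q) else 0) +
   1 / t * (if 1 \<le> pos k \<and> pos k < pos x then h (Suc (pos k)) - h (pos k) else 0))"
 proof (intro sum.cong refl)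
  fix k
  show "VD $ (k, k) $ (x, x) = (if k = x then 1 / (t * Q) else 0) +
   1 / t * (if 1 \<le> pos k \<and> pos k < pos x then h (Suc (pos k)) - h (pos k) else 0)"
   unfolding braid_dual_entry using t Q pos_range(1)[of k]
   by (cases "k = x"; cases "pos k < pos x"; simp add: h_def field_simps)
 qed
 also have "\<dots> = 1 / (t * Q) + 1 / t * (h (pos x) - h 1)"
 proof -
  have "(\<Sum>k\<in>UNIV. if 1 \<le> pos k \<and> pos k < pos x then h (Suc (pos k)) - h (pos k) else 0) = h (pos x) - h 1"
   by (rule sum_pos_telescope[OF pos]) (use pos_range[of x] in auto)
  then show ?thesis unfolding sum.distrib sum_distrib_left[symmetric] by simp
 qed
 finally have e: "(\<Sum>k\<in>UNIV. VD $ (k, k) $ (x, y)) = 1 / (t * Q) + 1 / t * (h (pos x) - h 1)" using True by simp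
 show ?thesis unfolding e using True t Q by (simp add: h_def wt_def field_simps power_add)
qed

lemma coev_VDi_kernel:
 "(\<Sum>k\<in>UNIV. VDi $ (x, y) $ (k, k) / wt k) = (if x = y then t * Q * Q ^ r else 0)"
proof (cases "x = y")
 case False
 then have "VDi $ (x, y) $ (k, k) = 0" for k
  unfolding VDi_entry braid_same_entry by (cases "k = y"; cases "x = k"; simp)
 then show ?thesis using False by simp
next
 case True
 define h where "h n = t * Q ^ (2 * n) / (Q * Q ^ (r + 2))" for n
 have "(\<Sum>k\<in>UNIV. VDi $ (x, x) $ (k, k) / wt k) = (\<Sum>k\<in>UNIV. (if k = x then t * Q / wt k else 0) +
   (if Suc (pos x) \<le> pos k \<and> pos k < r + 2 then h (Suc (pos k)) - h (pos k) else 0))"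
 proof (intro sum.cong refl)
  fix k
  show "VDi $ (x, x) $ (k, k) / wt k = (if k = x then t * Q / wt k else 0) +
   (if Suc (pos x) \<le> pos k \<and> pos k < r + 2 then h (Suc (pos k)) - h (pos k) else 0)"
   unfolding VDi_entry braid_same_entry using t Q pos_range(2)[of k]
   by (cases "k = x"; cases "pos x < pos k"; simp add: h_def wt_def field_simps)
 qed
 also have "\<dots> = t * Q / wt x + (h (r + 2) - h (Suc (pos x)))"
 proof -
  have "(\<Sum>k\<in>UNIV. if Suc (pos x) \<le> pos k \<and> pos k < r + 2 then h (Suc (pos k)) - h (pos k) else 0) = h (r + 2) - h (Suc (pos x))"
   by (rule sum_pos_telescope[OF pos]) (use pos_range[of x] in auto)
  then show ?thesis unfolding sum.distrib by simp
 qed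
 also have "\<dots> = t * Q * Q ^ r"
  using t Q by (simp add: h_def wt_def field_simps power_add power_mult power2_eq_square)
 finally show ?thesis using True by simp
qed

lemma slide_coev_kernel:
 "(\<Sum>k\<in>UNIV. \<Sum>l\<in>UNIV. VD $ (b, c) $ (k, l) * VV $ (a, k) $ (x, l)) = (if a = b \<and> x = c then 1 else 0)"
proof (cases "a = x")
 case False
 have "(\<Sum>k\<in>UNIV. \<Sum>l\<in>UNIV. VD $ (b, c) $ (k, l) * VV $ (a, k) $ (x, l)) =
   (\<Sum>k\<in>UNIV. \<Sum>l\<in>UNIV. if l = a then if k = x then VD $ (b, c) $ (k, l) * t else 0 else 0)"
  unfolding braid_same_entry using False by (intro sum.cong refl) simp
 also have "\<dots> = VD $ (b, c) $ (x, a) * t" by simp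
 also have "\<dots> = (if a = b \<and> x = c then 1 else 0)"
  unfolding braid_dual_entry using False t by auto
 finally show ?thesis .
next
 case True
 have "(\<Sum>k\<in>UNIV. \<Sum>l\<in>UNIV. VD $ (b, c) $ (k, l) * VV $ (a, k) $ (x, l)) =
   (\<Sum>k\<in>UNIV. \<Sum>l\<in>UNIV. if k = l then VD $ (b, c) $ (k, l) * VV $ (a, k) $ (x, l) else 0)"
  unfolding braid_same_entry using True by (intro sum.cong refl) auto
 also have "\<dots> = (\<Sum>k\<in>UNIV. VD $ (b, c) $ (k, k) * VV $ (x, k) $ (x, k))"
  using True by simp
 also have "\<dots> = (if x = b \<and> x = c then 1 else 0)"
 proof (cases "b = c")
  case False
  have "VD $ (b, c) $ (k, k) = 0" for k unfolding braid_dual_entry using False by simp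
  then show ?thesis using False by auto
 next
  case bc: True
  have v: "VV $ (x, k) $ (x, k) = t * (if k = x then Q else if pos k < pos x then Q - 1 / Q else 0)" for k
   unfolding braid_same_entry by auto
  have d: "VD $ (b, b) $ (k, k) = 1 / t * (if b = k then 1 / Q else if pos b < pos k then (1 / Q - Q) * Q ^ (2 * pos b) / Q ^ (2 * pos k) else 0)" for k
   unfolding braid_dual_entry by simp
  have "(\<Sum>k\<in>UNIV. VD $ (b, b) $ (k, k) * VV $ (x, k) $ (x, k)) = (if x = b then 1 else 0)"
  proof -
   consider "x = b" | "x \<noteq> b" "pos x < pos b" | "x \<noteq> b" "pos b < pos x" using pos_less_or by blast
   then show ?thesis
   proof cases
    case 1
    have "(\<Sum>k\<in>UNIV. VD $ (b, b) $ (k, k) * VV $ (x, k) $ (x, k)) = (\<Sum>k\<in>UNIV. if k = x then 1 else 0)"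
     unfolding v d using 1 t Q by (intro sum.cong refl) auto
    then show ?thesis using 1 by simp
   next
    case 2
    have "(\<Sum>k\<in>UNIV. VD $ (b, b) $ (k, k) * VV $ (x, k) $ (x, k)) = 0"
     unfolding v d using 2 by (intro sum.neutral ballI) auto
    then show ?thesis using 2 by simp
   next
    case 3
    define h where "h n = (Q - 1 / Q) * Q * Q ^ (2 * pos b) / Q ^ (2 * n)" for n
    have "(\<Sum>k\<in>UNIV. VD $ (b, b) $ (k, k) * VV $ (x, k) $ (x, k)) =
      (\<Sum>k\<in>UNIV. (if k = x then Q * ((1 / Q - Q) * Q ^ (2 * pos b) / Q ^ (2 * pos k)) else 0) +
       (if k = b then (Q - 1 / Q) / Q else 0) +
       (if Suc (pos b) \<le> pos k \<and> pos k < pos x then h (Suc (pos k)) - h (pos k) else 0))"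
    proof (intro sum.cong refl)
     fix k
     consider "k = x" | "k = b" "k \<noteq> x" | "pos k < pos b" "k \<noteq> x" "k \<noteq> b" | "pos b < pos k" "pos k < pos x" "k \<noteq> x" "k \<noteq> b" | "pos x < pos k" "k \<noteq> x" "k \<noteq> b"
      using pos_less_or by metis
     then show "VD $ (b, b) $ (k, k) * VV $ (x, k) $ (x, k) =
       (if k = x then Q * ((1 / Q - Q) * Q ^ (2 * pos b) / Q ^ (2 * pos k)) else 0) +
       (if k = b then (Q - 1 / Q) / Q else 0) +
       (if Suc (pos b) \<le> pos k \<and> pos k < pos x then h (Suc (pos k)) - h (pos k) else 0)"
      unfolding v d using 3 t Q
      by cases (simp_all add: h_def field_simps)
    qed
    also have "\<dots> = Q * ((1 / Q - Q) * Q ^ (2 * pos b) / Q ^ (2 * pos x)) + (Q - 1 / Q) / Q + (h (pos x) - h (Suc (pos b)))"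
    proof -
     have "(\<Sum>k\<in>UNIV. if Suc (pos b) \<le> pos k \<and> pos k < pos x then h (Suc (pos k)) - h (pos k) else 0) = h (pos x) - h (Suc (pos b))"
      by (rule sum_pos_telescope[OF pos]) (use 3 pos_range[of x] in auto)
     then show ?thesis by (simp add: sum.distrib)
    qed
    also have "\<dots> = 0" using Q by (simp add: h_def field_simps)
    finally show ?thesis using 3 by simp
   qed
  qed
  then show ?thesis using bc by auto
 qed
 finally show ?thesis using True by auto
qed

theorem dual_braiding:
 "dual_braiding VV VD DD VDi VVi DDi wt (t * Q * Q ^ r) (t * Q) (Q ^ r) (t * (Q - 1 / Q))"
proof (rule dual_braiding.intro)
 show "VV ** VV = mat (t * (Q - 1 / Q)) ** VV + mat (t * Q * (t * Q) - t * (Q - 1 / Q) * (t * Q))"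
 proof -
  have "t * Q * (t * Q) - t * (Q - 1 / Q) * (t * Q) = t^2" using Q by (simp add: field_simps power2_eq_square)
  then show ?thesis using hecke_same[OF inj_pos(1)] by simp
 qed
qed ((rule VD_inverse VV_inverse slide_VV_kernel slide_DD_kernel eval_VD_kernel coev_VDi_kernel rotate_kernel
  slide_coev_kernel)+, use t Q in \<open>auto simp: wt_def field_simps\<close>)

lemma weight_sum: "(\<Sum>k\<in>UNIV. 1 / wt k) * (Q * Q - 1) = Q ^ (r + 2) - Q ^ 2 / Q ^ (r + 2)"
proof -
 define h where "h n = Q ^ (2 * n) / Q ^ (r + 2)" for n
 have "(\<Sum>k\<in>UNIV. (Q * Q - 1) / wt k) = (\<Sum>k\<in>UNIV. if 1 \<le> pos k \<and> pos k < r + 2 then h (Suc (pos k)) - h (pos k) else 0)"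
 proof (intro sum.cong refl)
  fix k
  show "(Q * Q - 1) / wt k = (if 1 \<le> pos k \<and> pos k < r + 2 then h (Suc (pos k)) - h (pos k) else 0)"
   using Q pos_range[of k] by (simp add: h_def wt_def field_simps)
 qed
 also have "\<dots> = h (r + 2) - h 1"
  by (rule sum_pos_telescope[OF pos]) auto
 also have "\<dots> = Q ^ (r + 2) - Q ^ 2 / Q ^ (r + 2)"
  using Q by (simp add: h_def field_simps power_mult power2_eq_square power_add)
 finally show ?thesis by (simp add: sum_distrib_right sum_divide_distrib)
qed

end

section \<open>Weights\<close>

lemma wform_simple_root: "i \<in> {1..r} ==> wform r (simple_root i) \<mu> = \<mu> i - \<mu> (i + 1)"
proof -
 assume i: "i \<in> {1..r}"
 have "wform r (simple_root i) \<mu> = (\<Sum>k = 1..r + 1. (if k = i then \<mu> k else 0) - (if k = i + 1 then \<mu> k else 0))"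
  unfolding wform_def simple_root_def by (intro sum.cong) auto
 also have "\<dots> = \<mu> i - \<mu> (i + 1)" using i by (simp add: sum_subtractf)
 finally show ?thesis .
qed

lemma two_rho_eq: "k \<in> {1..r + 1} ==> two_rho r k = real r + 2 - 2 * real k"
proof -
 assume k: "k \<in> {1..r + 1}"
 have "(\<Sum>i = 1..r. if k \<le> i then 1 else 0 :: real) = (\<Sum>i\<in>{k..r}. 1)"
  using k by (intro sum.mono_neutral_cong_right) auto
 also have "\<dots> = real r + 1 - real k" using k by simp
 finally have 1: "(\<Sum>i = 1..r. if k \<le> i then 1 else 0 :: real) = real r + 1 - real k" .
 have 2: "(\<Sum>i = 1..r. real i) = real r * (real r + 1) / 2"
  by (induction r) (auto simp: field_simps)
 have "rho r k = (\<Sum>i = 1..r. (if k \<le> i then 1 else 0) - real i / real (r + 1))"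
  unfolding rho_def fund_weight_def using k by (intro sum.cong) auto
 also have "\<dots> = (real r + 1 - real k) - (real r * (real r + 1) / 2) / real (r + 1)"
  by (simp only: sum_subtractf 1 sum_divide_distrib[symmetric] 2)
 also have "\<dots> = (real r + 2 - 2 * real k) / 2" by (simp add: field_simps)
 finally show ?thesis by (simp add: two_rho_def)
qed

text \<open>Summation by parts: \<open>2\<rho> = \<Sum> i (r + 1 - i) \<alpha>\<^sub>i\<close>.\<close>

lemma wform_two_rho:
 "wform r \<mu> (two_rho r) = (\<Sum>i = 1..r. real i * (real r + 1 - real i) * wform r (simple_root i) \<mu>)"
proof -
 have "(\<Sum>i = 1..n. real i * (real r + 1 - real i) * (\<mu> i - \<mu> (i + 1))) =
   (\<Sum>k = 1..n. \<mu> k * (real r + 2 - 2 * real k)) - real n * (real r + 1 - real n) * \<mu> (n + 1)" for n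
  by (induction n) (simp_all add: algebra_simps)
 from this[of r] have "(\<Sum>i = 1..r. real i * (real r + 1 - real i) * (\<mu> i - \<mu> (i + 1))) =
   (\<Sum>k = 1..r + 1. \<mu> k * (real r + 2 - 2 * real k))"
  by (simp add: algebra_simps)
 also have "\<dots> = wform r \<mu> (two_rho r)"
  unfolding wform_def by (intro sum.cong) (auto simp: two_rho_eq)
 also have "(\<Sum>i = 1..r. real i * (real r + 1 - real i) * (\<mu> i - \<mu> (i + 1))) =
   (\<Sum>i = 1..r. real i * (real r + 1 - real i) * wform r (simple_root i) \<mu>)"
  by (intro sum.cong) (auto simp: wform_simple_root)
 finally show ?thesis by simp
qed

lemma root_fund_weight: "i \<in> {1..r} ==> s \<in> {1..r} ==>
  wform r (simple_root i) (fund_weight r s) = (if i = s then 1 else 0)"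
 by (auto simp: wform_simple_root fund_weight_def)

lemma root_root: "i \<in> {1..r} ==> j \<in> {1..r} ==>
  wform r (simple_root i) (simple_root j) = (if i = j then 2 else if i = j + 1 \<or> j = i + 1 then - 1 else 0)"
 by (subst wform_simple_root) (auto simp: simple_root_def)

lemma root_two_rho:
 assumes "i \<in> {1..r}" shows "wform r (simple_root i) (two_rho r) = 2"
 using assms by (simp add: wform_simple_root two_rho_eq)

lemma wform_diff_left: "wform r (%k. x k - y k) z = wform r x z - wform r y z"
 by (simp add: wform_def sum_subtractf algebra_simps)

lemma wform_diff_right: "wform r z (%k. x k - y k) = wform r z x - wform r z y"
 by (simp add: wform_def sum_subtractf algebra_simps)

lemma fund_two_rho: "s \<in> {1..r} ==> wform r (fund_weight r s) (two_rho r) = real s * (real r + 1 - real s)"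
proof -
 assume s: "s \<in> {1..r}"
 have "wform r (fund_weight r s) (two_rho r) = (\<Sum>i = 1..r. if i = s then real i * (real r + 1 - real i) else 0)"
  unfolding wform_two_rho using s by (intro sum.cong) (auto simp: root_fund_weight)
 then show ?thesis using s by simp
qed

lemma sum_fund_products:
 fixes f g :: "nat \<Rightarrow> real" and c :: real
 shows "(\<Sum>k\<in>A. (f k - c) * (g k - c)) = (\<Sum>k\<in>A. f k * g k) - c * (\<Sum>k\<in>A. f k) - c * (\<Sum>k\<in>A. g k) + c * c * real (card A)"
 by (simp add: algebra_simps sum.distrib sum_subtractf sum_distrib_left)

lemma fund_norm:
 assumes "s \<in> {1, r}" "1 \<le> r"
 shows "wform r (fund_weight r s) (fund_weight r s) = 1 - 1 / real (r + 1)"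
proof -
 have s: "1 \<le> s" "s \<le> r" using assms by auto
 have c: "(\<Sum>k = 1..r + 1. if k \<le> s then 1 else 0 :: real) = real s"
 proof -
  have "(\<Sum>k = 1..r + 1. if k \<le> s then 1 else 0 :: real) = (\<Sum>k\<in>{1..s}. 1)"
   using s by (intro sum.mono_neutral_cong_right) auto
  then show ?thesis by simp
 qed
 have sq: "(if P then 1 else 0) * (if P then 1 else 0) = (if P then 1 else 0 :: real)" for P by simp
 define d where "d = real s / real (r + 1)"
 have dN: "d * real (r + 1) = real s" by (simp add: d_def)
 have "wform r (fund_weight r s) (fund_weight r s) = (\<Sum>k = 1..r + 1. ((if k \<le> s then 1 else 0) - d) * ((if k \<le> s then 1 else 0) - d))"
  unfolding wform_def fund_weight_def by (intro sum.cong) (auto simp: d_def)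
 also have "\<dots> = real s - d * real s - d * real s + d * (d * real (r + 1))"
  unfolding sum_fund_products sq c by simp
 also have "\<dots> = real s - real s / real (r + 1) * real s"
  unfolding dN by (simp add: d_def)
 also have "\<dots> = 1 - 1 / real (r + 1)" using assms by (auto simp: field_simps)
 finally show ?thesis .
qed

lemma fund_longest:
 assumes "s \<in> {1, r}" "1 \<le> r"
 shows "wform r (fund_weight r s) (longest_act r (fund_weight r s)) = - 1 / real (r + 1)"
proof -
 have s: "1 \<le> s" "s \<le> r" using assms by auto
 have c: "(\<Sum>k = 1..r + 1. if k \<le> s then 1 else 0 :: real) = real s"
 proof -
  have "(\<Sum>k = 1..r + 1. if k \<le> s then 1 else 0 :: real) = (\<Sum>k\<in>{1..s}. 1)"
   using s by (intro sum.mono_neutral_cong_right) auto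
  then show ?thesis by simp
 qed
 have c': "(\<Sum>k = 1..r + 1. if r + 2 - k \<le> s then 1 else 0 :: real) = real s"
 proof -
  have "(\<Sum>k = 1..r + 1. if r + 2 - k \<le> s then 1 else 0 :: real) = (\<Sum>k\<in>{r + 2 - s..r + 1}. 1)"
   using s by (intro sum.mono_neutral_cong_right) auto
  then show ?thesis using s by simp
 qed
 have cc: "(\<Sum>k = 1..r + 1. (if k \<le> s then 1 else 0) * (if r + 2 - k \<le> s then 1 else 0) :: real) = real s - 1"
 proof -
  have "(\<Sum>k = 1..r + 1. (if k \<le> s then 1 else 0) * (if r + 2 - k \<le> s then 1 else 0) :: real) = (\<Sum>k\<in>{r + 2 - s..s}. 1)"
   using s by (intro sum.mono_neutral_cong_right) auto
  then show ?thesis using assms s by auto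
 qed
 define d where "d = real s / real (r + 1)"
 have dN: "d * real (r + 1) = real s" by (simp add: d_def)
 have "wform r (fund_weight r s) (longest_act r (fund_weight r s)) = (\<Sum>k = 1..r + 1. ((if k \<le> s then 1 else 0) - d) * ((if r + 2 - k \<le> s then 1 else 0) - d))"
  unfolding wform_def fund_weight_def longest_act_def by (intro sum.cong) (auto simp: d_def)
 also have "\<dots> = (real s - 1) - d * real s - d * real s + d * (d * real (r + 1))"
  unfolding sum_fund_products cc c c' by simp
 also have "\<dots> = (real s - 1) - real s / real (r + 1) * real s"
  unfolding dN by (simp add: d_def)
 also have "\<dots> = - 1 / real (r + 1)" using assms by (auto simp: field_simps)
 finally show ?thesis .
qed

lemma qpow_add: "0 < q ==> qpow q (x + y) = qpow q x * qpow q y"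
 by (simp add: qpow_def powr_add)

lemma qpow_nonzero: "0 < q ==> qpow q x \<noteq> 0"
 by (simp add: qpow_def)

lemma qpow_minus: "0 < q ==> qpow q (- x) = 1 / qpow q x"
 by (simp add: qpow_def powr_minus divide_inverse)

lemma qpow_nat: "0 < q ==> qpow q (real n) = complex_of_real q ^ n"
 by (simp add: qpow_def powr_realpow)

lemma qpow_zero: "0 < q ==> qpow q 0 = 1"
 by (simp add: qpow_def)

lemma qpow_inj: "0 < q ==> q < 1 ==> qpow q x = qpow q y \<longleftrightarrow> x = y"
 by (simp add: qpow_def powr_inj)

section \<open>The structure of the vector module\<close>

inductive lowered :: "nat \<Rightarrow> ('n::finite) uq_rep \<Rightarrow> complex^'n \<Rightarrow> weight \<Rightarrow> complex^'n \<Rightarrow> weight \<Rightarrow> bool"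
 for r X y \<mu> where
 base: "lowered r X y \<mu> y \<mu>"
| step: "lowered r X y \<mu> z \<nu> ==> i \<in> {1..r} ==> lowered r X y \<mu> (repF X i *v z) (%k. \<nu> k - simple_root i k)"

definition K_weight :: "real \<Rightarrow> nat \<Rightarrow> ('n::finite) uq_rep \<Rightarrow> weight \<Rightarrow> complex^'n \<Rightarrow> bool" where
 "K_weight q r X \<mu> x \<longleftrightarrow> (\<forall>i\<in>{1..r}. repK X i *v x = qpow q (wform r (simple_root i) \<mu>) *s x)"

lemma mat_mult_vec: "(mat c ** A) *v x = c *s (A *v x)" for A :: "complex^'n^'m"
proof -
 have "mat c *v v = c *s v" for v :: "complex^'m"
  by (simp add: matrix_vector_mult_def vec_eq_iff mat_def if_distrib[of "%c. c * _"] cong: if_cong)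
 then show ?thesis by (simp only: matrix_vector_mul_assoc[symmetric])
qed

lemma matrix_inv_both:
 fixes A :: "complex^'n^'n"
 assumes "invertible A" shows "A ** matrix_inv A = mat 1" "matrix_inv A ** A = mat 1"
proof -
 have "A ** matrix_inv A = mat 1 \<and> matrix_inv A ** A = mat 1"
  unfolding matrix_inv_def by (rule someI_ex) (use assms in \<open>auto simp: invertible_def\<close>)
 then show "A ** matrix_inv A = mat 1" "matrix_inv A ** A = mat 1" by auto
qed

lemma mult_vec_axis: "(A *v axis j 1) $ i = A $ i $ j" for A :: "complex^'n^'m"
 by (simp add: matrix_vector_mult_def axis_def if_distrib[of "(*) _"] cong: if_cong)

context
 fixes q :: real and r :: nat and X :: "('n::finite) uq_rep"
 assumes q: "0 < q" "q < 1" and X: "uq_module q r X"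
begin

lemma K_F: assumes "i \<in> {1..r}" "j \<in> {1..r}"
 shows "repK X i *v (repF X j *v x) = qpow q (- wform r (simple_root i) (simple_root j)) *s (repF X j *v (repK X i *v x))"
proof -
 have inv: "invertible (repK X i)"
  and rel: "repK X i ** repF X j ** matrix_inv (repK X i) = mat (qpow q (- wform r (simple_root i) (simple_root j))) ** repF X j"
  using X assms by (auto simp: uq_module_def)
 have "repK X i ** repF X j = repK X i ** repF X j ** (matrix_inv (repK X i) ** repK X i)"
  using matrix_inv_both[OF inv] by simp
 also have "\<dots> = mat (qpow q (- wform r (simple_root i) (simple_root j))) ** (repF X j ** repK X i)"
  by (simp only: matrix_mul_assoc rel)
 finally have "(repK X i ** repF X j) *v x = (mat (qpow q (- wform r (simple_root i) (simple_root j))) ** (repF X j ** repK X i)) *v x"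
  by simp
 then show ?thesis unfolding mat_mult_vec by (simp only: matrix_vector_mul_assoc[symmetric])
qed

lemma K_weight_F:
 assumes "K_weight q r X \<mu> x" "j \<in> {1..r}"
 shows "K_weight q r X (%k. \<mu> k - simple_root j k) (repF X j *v x)"
 unfolding K_weight_def
proof
 fix i assume i: "i \<in> {1..r}"
 have "repK X i *v (repF X j *v x) = qpow q (- wform r (simple_root i) (simple_root j)) *s (repF X j *v (qpow q (wform r (simple_root i) \<mu>) *s x))"
  using assms i by (simp add: K_F K_weight_def)
 also have "\<dots> = (qpow q (- wform r (simple_root i) (simple_root j)) * qpow q (wform r (simple_root i) \<mu>)) *s (repF X j *v x)"
  by (simp add: vector_scalar_commute)
 also have "qpow q (- wform r (simple_root i) (simple_root j)) * qpow q (wform r (simple_root i) \<mu>) =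
   qpow q (wform r (simple_root i) (%k. \<mu> k - simple_root j k))"
  using q by (simp add: qpow_add[symmetric] wform_diff_right)
 finally show "repK X i *v (repF X j *v x) = qpow q (wform r (simple_root i) (%k. \<mu> k - simple_root j k)) *s (repF X j *v x)" .
qed

lemma E_F:
 assumes "K_weight q r X \<mu> x" "i \<in> {1..r}" "j \<in> {1..r}"
 shows "repE X i *v (repF X j *v x) = repF X j *v (repE X i *v x) +
  (if i = j then complex_of_real (qnumber q (wform r (simple_root i) \<mu>)) *s x else 0)"
proof -
 let ?n = "wform r (simple_root i) \<mu>"
 have inv: "invertible (repK X i)"
  and rel: "repE X i ** repF X j - repF X j ** repE X i
    = (if i = j then mat (1 / complex_of_real (q - q powr (- 1))) ** (repK X i - matrix_inv (repK X i)) else 0)"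
  using X assms by (auto simp: uq_module_def)
 have Kx: "repK X i *v x = qpow q ?n *s x" using assms by (simp add: K_weight_def)
 have "x = matrix_inv (repK X i) *v (repK X i *v x)"
  using matrix_inv_both(2)[OF inv] by (simp add: matrix_vector_mul_assoc)
 also have "\<dots> = qpow q ?n *s (matrix_inv (repK X i) *v x)" by (simp add: Kx vector_scalar_commute)
 finally have "(1 / qpow q ?n) *s x = (1 / qpow q ?n) *s (qpow q ?n *s (matrix_inv (repK X i) *v x))" by simp
 then have Kix: "matrix_inv (repK X i) *v x = qpow q (- ?n) *s x"
  using q by (simp add: qpow_nonzero qpow_minus)
 have "repE X i *v (repF X j *v x) - repF X j *v (repE X i *v x) = (repE X i ** repF X j - repF X j ** repE X i) *v x"
  by (simp add: matrix_vector_mul_assoc matrix_vector_mult_diff_rdistrib)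
 also have "\<dots> = (if i = j then (1 / complex_of_real (q - q powr (- 1))) *s (qpow q ?n *s x - qpow q (- ?n) *s x) else 0)"
 proof (cases "i = j")
  case True
  show ?thesis unfolding rel if_P[OF True] mat_mult_vec matrix_vector_mult_diff_rdistrib Kx Kix ..
 next
  case False
  then show ?thesis unfolding rel by simp
 qed
 also have "\<dots> = (if i = j then complex_of_real (qnumber q ?n) *s x else 0)"
  by (auto simp: vec_eq_iff qnumber_def qpow_def algebra_simps diff_divide_distrib)
 finally show ?thesis by (simp add: algebra_simps)
qed

lemma lowered_weight:
 assumes "lowered r X y \<mu> z \<nu>" "K_weight q r X \<mu> y"
 shows "K_weight q r X \<nu> z" "wform r \<nu> (two_rho r) \<le> wform r \<mu> (two_rho r)"
proof -
 show "K_weight q r X \<nu> z" using assms by (induction) (auto intro: K_weight_F)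
 show "wform r \<nu> (two_rho r) \<le> wform r \<mu> (two_rho r)"
  using assms by induction (auto simp: wform_diff_left root_two_rho)
qed

lemma subspace_preimage:
 fixes A :: "complex^'n^'n"
 assumes "vec.subspace W" shows "vec.subspace {z. A *v z \<in> W}"
proof (rule vec.subspaceI)
 show "0 \<in> {z. A *v z \<in> W}" using vec.subspace_0[OF assms] by simp
 show "x + y \<in> {z. A *v z \<in> W}" if "x \<in> {z. A *v z \<in> W}" "y \<in> {z. A *v z \<in> W}" for x y
  using that vec.subspace_add[OF assms] by (simp add: matrix_vector_right_distrib)
 show "c *s x \<in> {z. A *v z \<in> W}" if "x \<in> {z. A *v z \<in> W}" for c x
  using that vec.subspace_scale[OF assms] by (simp add: vector_scalar_commute)
qed

text \<open>
 Commuting \<open>E\<^sub>i\<close> past a product of lowering operators yields products of lowering operators again, because \<open>E\<^sub>i\<close> kills \<open>y\<close>.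
 So lowering alone already generates the submodule of \<open>y\<close>, and its weights are at most \<open>\<mu>\<close>.
\<close>

lemma singular_submodule:
 assumes y: "K_weight q r X \<mu> y" "\<And>i. i \<in> {1..r} ==> repE X i *v y = 0"
 defines "W \<equiv> vec.span {z. \<exists>\<nu>. lowered r X y \<mu> z \<nu>}"
 assumes i: "i \<in> {1..r}" and x: "x \<in> W"
 shows "repK X i *v x \<in> W" "repE X i *v x \<in> W" "repF X i *v x \<in> W"
proof -
 have sub: "vec.subspace W" by (simp add: W_def)
 have base: "z \<in> W" if "lowered r X y \<mu> z \<nu>" for z \<nu>
  unfolding W_def by (rule vec.span_base) (use that in blast)
 have ext: "A *v x \<in> W" if "\<And>z \<nu>. lowered r X y \<mu> z \<nu> ==> A *v z \<in> W" for A :: "complex^'n^'n"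
 proof -
  have "W \<subseteq> {z. A *v z \<in> W}"
   unfolding W_def by (rule vec.span_minimal) (use that subspace_preimage[OF sub] in \<open>auto simp: W_def\<close>)
  then show ?thesis using x by blast
 qed
 have F: "repF X j *v z \<in> W" if "z \<in> W" "j \<in> {1..r}" for z j
 proof -
  have "W \<subseteq> {z. repF X j *v z \<in> W}"
   unfolding W_def
  proof (rule vec.span_minimal)
   show "{z. \<exists>\<nu>. lowered r X y \<mu> z \<nu>} \<subseteq> {z. repF X j *v z \<in> vec.span {z. \<exists>\<nu>. lowered r X y \<mu> z \<nu>}}"
    using base[OF lowered.step[OF _ that(2)]] by (auto simp: W_def)
   show "vec.subspace {z. repF X j *v z \<in> vec.span {z. \<exists>\<nu>. lowered r X y \<mu> z \<nu>}}"
    using subspace_preimage[OF sub] by (simp add: W_def)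
  qed
  then show ?thesis using that(1) by blast
 qed
 show "repF X i *v x \<in> W" by (rule F[OF x i])
 show "repK X i *v x \<in> W"
 proof (rule ext)
  fix z \<nu> assume z: "lowered r X y \<mu> z \<nu>"
  have "repK X i *v z = qpow q (wform r (simple_root i) \<nu>) *s z"
   using lowered_weight(1)[OF z y(1)] i by (simp add: K_weight_def)
  then show "repK X i *v z \<in> W" using vec.subspace_scale[OF sub base[OF z]] by simp
 qed
 show "repE X i *v x \<in> W"
 proof (rule ext)
  fix z \<nu> assume "lowered r X y \<mu> z \<nu>"
  then show "repE X i *v z \<in> W"
  proof induction
   case base
   then show ?case using y(2)[OF i] vec.subspace_0[OF sub] by simp
  next
   case (step z \<nu> j)
   have "repF X j *v (repE X i *v z) \<in> W" by (rule F) (use step in auto)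
   moreover have "(if i = j then complex_of_real (qnumber q (wform r (simple_root i) \<nu>)) *s z else 0) \<in> W"
    using vec.subspace_0[OF sub] vec.subspace_scale[OF sub base[OF step.hyps(1)]] by auto
   ultimately show ?case
    using E_F[OF lowered_weight(1)[OF step.hyps(1) y(1)] i step.hyps(2)] vec.subspace_add[OF sub] by simp
  qed
 qed
qed

end

context quantum_projective_space
begin

lemma q_pos: "0 < q" "q < 1" using q by auto

lemma V_module: "uq_module q r V"
 using V by (simp add: simple_highest_weight_module_def simple_uq_module_def)

lemma s_range: "s \<in> {1..r}" using s r by auto

lemma K_diag:
 assumes "i \<in> {1..r}"
 shows "repK V i = diag_matrix (%j. qpow q (wform r (simple_root i) (lam j)))"
proof -
 have "repK V i $ k $ j = (if k = j then qpow q (wform r (simple_root i) (lam k)) else 0)" for k j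
 proof -
  have "repK V i *v axis j 1 = qpow q (wform r (simple_root i) (lam j)) *s axis j 1"
   using weight_basis[of j] assms by (simp add: weight_vector_def)
  from arg_cong[OF this, of "%v. v $ k"] show ?thesis
   by (auto simp: mult_vec_axis) (auto simp: axis_def)
 qed
 then show ?thesis by (simp add: diag_matrix_def vec_eq_iff)
qed

lemma coordinate_weight:
 assumes "K_weight q r V \<mu> x" "x $ j \<noteq> 0" "i \<in> {1..r}"
 shows "wform r (simple_root i) (lam j) = wform r (simple_root i) \<mu>"
proof -
 have "(repK V i *v x) $ j = qpow q (wform r (simple_root i) \<mu>) * x $ j"
  using assms by (simp add: K_weight_def)
 then have "qpow q (wform r (simple_root i) (lam j)) * x $ j = qpow q (wform r (simple_root i) \<mu>) * x $ j"
  by (simp add: K_diag[OF assms(3)] mult_vec_diag)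
 then show ?thesis using assms(2) q_pos by (simp add: qpow_inj)
qed

definition hwv :: "complex^'n" where
 "hwv = (SOME x. highest_weight_vector q r V (fund_weight r s) x)"

lemma hwv: "highest_weight_vector q r V (fund_weight r s) hwv"
proof -
 have "\<exists>x. highest_weight_vector q r V (fund_weight r s) x"
  using V by (simp add: simple_highest_weight_module_def)
 then show ?thesis unfolding hwv_def by (rule someI_ex)
qed

lemma hwv': "K_weight q r V (fund_weight r s) hwv" "hwv \<noteq> 0" "i \<in> {1..r} ==> repE V i *v hwv = 0"
 using hwv by (auto simp: highest_weight_vector_def weight_vector_def K_weight_def)

lemma singular_zero:
 assumes y: "K_weight q r V \<mu> y" "\<And>i. i \<in> {1..r} ==> repE V i *v y = 0"
  and ht: "wform r \<mu> (two_rho r) < wform r (fund_weight r s) (two_rho r)"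
 shows "y = 0"
proof -
 define W where "W = vec.span {z. \<exists>\<nu>. lowered r V y \<mu> z \<nu>}"
 note stable = singular_submodule[OF q_pos V_module y, folded W_def]
 have "vec.subspace W" by (simp add: W_def)
 then have alt: "W = {0} \<or> W = UNIV"
 proof -
  have "vec.subspace W \<and> (\<forall>i\<in>{1..r}. \<forall>x\<in>W. repK V i *v x \<in> W \<and> repE V i *v x \<in> W \<and> repF V i *v x \<in> W)"
   using \<open>vec.subspace W\<close> stable by simp
  moreover have "\<forall>W. vec.subspace W \<and> (\<forall>i\<in>{1..r}. \<forall>x\<in>W. repK V i *v x \<in> W \<and> repE V i *v x \<in> W \<and> repF V i *v x \<in> W) \<longrightarrow>
    W = {0} \<or> W = UNIV"
   using V unfolding simple_highest_weight_module_def simple_uq_module_def by (elim conjE)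
  ultimately show ?thesis by (metis (no_types))
 qed
 obtain j where j: "hwv $ j \<noteq> 0" using hwv'(2) by (auto simp: vec_eq_iff)
 have "z $ j = 0" if "lowered r V y \<mu> z \<nu>" for z \<nu>
 proof (rule ccontr)
  assume z: "z $ j \<noteq> 0"
  note lw = lowered_weight[OF q_pos V_module that y(1)]
  have "wform r (simple_root i) \<nu> = wform r (simple_root i) (fund_weight r s)" if "i \<in> {1..r}" for i
   using coordinate_weight[OF lw(1) z that] coordinate_weight[OF hwv'(1) j that] by simp
  then have "wform r \<nu> (two_rho r) = wform r (fund_weight r s) (two_rho r)"
   unfolding wform_two_rho by simp
  then show False using lw(2) ht by simp
 qed
 moreover have "vec.subspace {z :: complex^'n. z $ j = 0}" by (rule vec.subspaceI) auto
 ultimately have "W \<subseteq> {z. z $ j = 0}" unfolding W_def by (intro vec.span_minimal) auto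
 then have "W \<noteq> UNIV" using j by blast
 then have "W = {0}" using alt by blast
 moreover have "y \<in> W" unfolding W_def by (rule vec.span_base) (use lowered.base in blast)
 ultimately show ?thesis by simp
qed

definition node :: "nat \<Rightarrow> nat" where
 "node k = (if s = 1 then k else r + 1 - k)"

lemma node_range: "k \<in> {1..r} ==> node k \<in> {1..r}"
 by (auto simp: node_def)

lemma node_node: "k \<in> {1..r} ==> node (node k) = k"
 by (auto simp: node_def)

lemma node_bij: "bij_betw node {1..r} {1..r}"
proof (rule bij_betw_byWitness[where f' = node])
 show "\<forall>a\<in>{1..r}. node (node a) = a" "\<forall>a\<in>{1..r}. node (node a) = a"
  by (intro ballI node_node; assumption)+
 show "node ` {1..r} \<subseteq> {1..r}" "node ` {1..r} \<subseteq> {1..r}"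
  by (rule image_subsetI, erule node_range)+
qed

lemma node_roots: "k \<in> {1..r} ==> l \<in> {1..r} ==>
  wform r (simple_root (node k)) (simple_root (node l)) = (if k = l then 2 else if k = l + 1 \<or> l = k + 1 then - 1 else 0)"
proof -
 assume kl: "k \<in> {1..r}" "l \<in> {1..r}"
 have "(node k = node l) = (k = l)" "(node k = node l + 1 \<or> node l = node k + 1) = (k = l + 1 \<or> l = k + 1)"
 proof -
  consider "node k = k" "node l = l" | "node k = r + 1 - k" "node l = r + 1 - l"
   unfolding node_def by (cases "s = 1") simp_all
  then show "(node k = node l) = (k = l)" "(node k = node l + 1 \<or> node l = node k + 1) = (k = l + 1 \<or> l = k + 1)"
   using kl unfolding atLeastAtMost_iff by (cases; arith)+
 qed
 then show ?thesis unfolding root_root[OF node_range[OF kl(1)] node_range[OF kl(2)]] by (simp only:)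
qed

lemma node_fund: "k \<in> {1..r} ==> wform r (simple_root (node k)) (fund_weight r s) = (if k = 1 then 1 else 0)"
proof -
 assume k: "k \<in> {1..r}"
 have "(node k = s) = (k = 1)"
 proof (cases "s = 1")
  case True
  then have "node k = k" unfolding node_def by (rule if_P)
  then show ?thesis by (simp only: True)
 next
  case False
  then have "node k = r + 1 - k" unfolding node_def by (rule if_not_P)
  then have n: "node k = r + 1 - k" .
  have sr: "s = r" using s False by simp
  show ?thesis using k unfolding n atLeastAtMost_iff unfolding sr by arith
 qed
 then show ?thesis unfolding root_fund_weight[OF node_range[OF k] s_range] by (simp only:)
qed

primrec chain :: "nat \<Rightarrow> complex^'n" where
 "chain 0 = hwv"
| "chain (Suc k) = repF V (node (Suc k)) *v chain k"

primrec chain_weight :: "nat \<Rightarrow> weight" where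
 "chain_weight 0 = fund_weight r s"
| "chain_weight (Suc k) = (%i. chain_weight k i - simple_root (node (Suc k)) i)"

lemma chain_K: "k \<le> r ==> K_weight q r V (chain_weight k) (chain k)"
proof (induction k)
 case (Suc k)
 then show ?case using K_weight_F[OF q_pos V_module, of "chain_weight k" "chain k" "node (Suc k)"]
   node_range[of "Suc k"] by simp
qed (simp add: hwv')

lemma chain_pairing: "k \<le> r ==> l \<in> {1..r} ==>
  wform r (simple_root (node l)) (chain_weight k) = (if l = k + 1 then 1 else if l = k then - 1 else 0)"
proof (induction k)
 case 0
 then show ?case using node_fund[of l] by simp
next
 case (Suc k)
 then show ?case using node_roots[of l "Suc k"] by (auto simp: wform_diff_right)
qed

lemma chain_height: "k \<le> r ==> wform r (chain_weight k) (two_rho r) = real r - 2 * real k"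
proof (induction k)
 case 0
 have "real s * (real r + 1 - real s) = real r" using s by auto
 then show ?case using s_range by (simp add: fund_two_rho)
next
 case (Suc k)
 then show ?case using node_range[of "Suc k"] by (simp add: wform_diff_left root_two_rho)
qed

lemma height_hwv: "wform r (fund_weight r s) (two_rho r) = real r"
 using chain_height[of 0] by simp

lemma qnumber_simps: "qnumber q 1 = 1" "qnumber q 0 = 0" "qnumber q (- 1) = - 1"
proof -
 have ne: "q - q powr - 1 \<noteq> 0"
 proof -
  have "q * q < 1 * 1" using q_pos by (intro mult_strict_mono) auto
  then show ?thesis using q_pos by (simp add: powr_minus field_simps)
 qed
 show "qnumber q 1 = 1" "qnumber q 0 = 0" using ne q_pos by (simp_all add: qnumber_def)
 have "q powr - 1 - q powr (- (- 1)) = - (q - q powr - 1)" using q_pos by simp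
 then have "qnumber q (- 1) = - ((q - q powr - 1) / (q - q powr - 1))"
  unfolding qnumber_def by (simp only: minus_divide_left)
 then show "qnumber q (- 1) = - 1" using ne by simp
qed

lemma chain_structure:
 "k \<le> r ==> chain k \<noteq> 0 \<and>
  (\<forall>l\<in>{1..r}. repE V (node l) *v chain k = (if l = k then chain (k - 1) else 0)) \<and>
  (\<forall>l\<in>{1..r}. l \<noteq> k + 1 \<longrightarrow> repF V (node l) *v chain k = 0)"
proof (induction k rule: less_induct)
 case (less k0)
 show ?case
 proof (cases k0)
  case 0
  have "repF V (node l) *v hwv = 0" if l: "l \<in> {1..r}" "l \<noteq> 1" for l
  proof (rule singular_zero)
   show "K_weight q r V (%k. fund_weight r s k - simple_root (node l) k) (repF V (node l) *v hwv)"
    by (rule K_weight_F[OF q_pos V_module hwv'(1) node_range[OF l(1)]])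
   show "repE V i *v (repF V (node l) *v hwv) = 0" if i: "i \<in> {1..r}" for i
    unfolding E_F[OF q_pos V_module hwv'(1) i node_range[OF l(1)]] hwv'(3)[OF i]
    using node_fund[OF l(1)] l(2) by (auto simp: qnumber_simps)
   show "wform r (%k. fund_weight r s k - simple_root (node l) k) (two_rho r) < wform r (fund_weight r s) (two_rho r)"
    using root_two_rho[OF node_range[OF l(1)]] by (simp add: wform_diff_left)
  qed
  moreover have "repE V (node l) *v hwv = 0" if "l \<in> {1..r}" for l
   by (rule hwv'(3)[OF node_range[OF that]])
  ultimately show ?thesis using 0 hwv'(2) by auto
 next
  case (Suc k)
  have k: "k \<le> r" "Suc k \<in> {1..r}" using less.prems Suc by auto
  have Sk: "Suc k \<le> r" using k by simp
  have IHE: "repE V (node l) *v chain k = (if l = k then chain (k - 1) else 0)" if "l \<in> {1..r}" for l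
   using less.IH[of k] Suc k(1) that by simp
  have IHF: "repF V (node l) *v chain k = 0" if "l \<in> {1..r}" "l \<noteq> k + 1" for l
   using less.IH[of k] Suc k(1) that by simp
  have eq: "node l = node l' \<longleftrightarrow> l = l'" if "l \<in> {1..r}" "l' \<in> {1..r}" for l l'
   using node_node[OF that(1)] node_node[OF that(2)] by metis
  have FE: "repF V (node (Suc k)) *v (repE V (node l) *v chain k) = 0" if l: "l \<in> {1..r}" for l
  proof (cases "l = k")
   case True
   obtain k' where k': "k = Suc k'" using True l by (cases k) auto
   then have "repF V (node (Suc k)) *v chain k' = 0"
    using less.IH[of k'] Suc k by simp
   then show ?thesis unfolding IHE[OF l] using True k' by simp
  next
   case False
   then show ?thesis unfolding IHE[OF l] by simp
  qed
  have E: "repE V (node l) *v chain (Suc k) = (if l = Suc k then chain k else 0)" if l: "l \<in> {1..r}" for l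
   unfolding chain.simps E_F[OF q_pos V_module chain_K[OF k(1)] node_range[OF l] node_range[OF k(2)]] FE[OF l] eq[OF l k(2)]
   using chain_pairing[OF k(1) l] by (auto simp: qnumber_simps)
  have nz: "chain (Suc k) \<noteq> 0"
  proof
   assume "chain (Suc k) = 0"
   then have "chain k = 0" using E[OF k(2)] by simp
   then show False using less.IH[of k] Suc k(1) by simp
  qed
  have F: "repF V (node l) *v chain (Suc k) = 0" if l: "l \<in> {1..r}" "l \<noteq> Suc k + 1" for l
  proof (rule singular_zero)
   show "K_weight q r V (%i. chain_weight (Suc k) i - simple_root (node l) i) (repF V (node l) *v chain (Suc k))"
    by (rule K_weight_F[OF q_pos V_module chain_K[OF Sk] node_range[OF l(1)]])
   show "repE V i *v (repF V (node l) *v chain (Suc k)) = 0" if i: "i \<in> {1..r}" for i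
   proof -
    define j where "j = node i"
    have j: "j \<in> {1..r}" "i = node j" using i node_node[OF i] node_range[OF i] by (auto simp: j_def)
    have "repE V (node j) *v (repF V (node l) *v chain (Suc k)) = 0"
     unfolding E_F[OF q_pos V_module chain_K[OF Sk] node_range[OF j(1)] node_range[OF l(1)]] eq[OF j(1) l(1)] E[OF j(1)]
      chain_pairing[OF Sk j(1)]
     using l IHF[OF l(1)] by (auto simp: qnumber_simps)
    then show ?thesis by (simp add: j(2))
   qed
   show "wform r (%i. chain_weight (Suc k) i - simple_root (node l) i) (two_rho r) < wform r (fund_weight r s) (two_rho r)"
    using root_two_rho[OF node_range[OF l(1)]] chain_height[OF Sk] height_hwv by (simp add: wform_diff_left del: chain_weight.simps)
  qed
  show ?thesis unfolding Suc using nz E F by auto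
 qed
qed

lemma chain_index: "\<exists>j. chain k $ j \<noteq> 0" if "k \<le> r"
 using chain_structure[OF that] by (auto simp: vec_eq_iff)

definition index :: "nat \<Rightarrow> 'n" where
 "index k = (SOME j. chain k $ j \<noteq> 0)"

lemma index: "k \<le> r ==> chain k $ index k \<noteq> 0"
 unfolding index_def by (rule someI_ex[OF chain_index])

lemma index_unique:
 assumes "k \<le> r" "k' \<le> r" "chain k $ j \<noteq> 0" "chain k' $ j \<noteq> 0"
 shows "k = k'"
proof -
 have eq: "wform r (simple_root (node l)) (chain_weight k) = wform r (simple_root (node l)) (chain_weight k')" if "l \<in> {1..r}" for l
  using coordinate_weight[OF chain_K[OF assms(1)] assms(3) node_range[OF that]]
   coordinate_weight[OF chain_K[OF assms(2)] assms(4) node_range[OF that]] by simp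
 have "\<not> k < k'" using eq[of "k + 1"] assms(1,2) by (auto simp: chain_pairing split: if_splits)
 moreover have "\<not> k' < k" using eq[of "k' + 1"] assms(1,2) by (auto simp: chain_pairing split: if_splits)
 ultimately show ?thesis by simp
qed

lemma index_bij: "bij_betw index {0..r} UNIV"
proof -
 have inj: "inj_on index {0..r}"
  by (rule inj_onI) (metis atLeastAtMost_iff index index_unique)
 then have "card (index ` {0..r}) = CARD('n)" by (simp add: card_image card_index)
 then have "index ` {0..r} = UNIV" by (intro card_subset_eq) auto
 then show ?thesis using inj by (simp add: bij_betw_def)
qed

lemma chain_zero: "k \<le> r ==> j \<noteq> index k ==> chain k $ j = 0"
proof (rule ccontr)
 assume k: "k \<le> r" and j: "j \<noteq> index k" and nz: "chain k $ j \<noteq> 0"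
 have "j \<in> index ` {0..r}" using index_bij by (simp add: bij_betw_def)
 then obtain k' where "j = index k'" "k' \<in> {0..r}" by (rule imageE)
 then have k': "k' \<le> r" "j = index k'" by simp_all
 then have "k = k'" using index_unique[OF k k'(1) nz] index[OF k'(1)] by simp
 then show False using j k' by simp
qed

definition coeff0 :: "nat \<Rightarrow> complex" where
 "coeff0 k = chain k $ index k"

lemma coeff0_nonzero: "k \<le> r ==> coeff0 k \<noteq> 0"
 by (simp add: coeff0_def index)

lemma axis_index: "k \<le> r ==> axis (index k) 1 = (1 / coeff0 k) *s chain k"
 using coeff0_nonzero[of k] chain_zero[of k] by (auto simp: vec_eq_iff axis_def coeff0_def)

lemma chain_axis: "k \<le> r ==> chain k = coeff0 k *s axis (index k) 1"
 using chain_zero[of k] by (auto simp: vec_eq_iff axis_def coeff0_def)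

definition pos :: "'n \<Rightarrow> nat" where
 "pos j = Suc (inv_into {0..r} index j)"

lemma pos_index: "k \<le> r ==> pos (index k) = Suc k"
 using index_bij by (simp add: pos_def bij_betw_def inv_into_f_f)

lemma index_pos: "index (pos j - 1) = j" "1 \<le> pos j" "pos j \<le> r + 1"
proof -
 have j: "j \<in> index ` {0..r}" using index_bij by (simp add: bij_betw_def)
 show "index (pos j - 1) = j" using f_inv_into_f[OF j] by (simp add: pos_def)
 show "1 \<le> pos j" "pos j \<le> r + 1" using inv_into_into[OF j] by (auto simp: pos_def)
qed

lemma pos_bij: "bij_betw pos UNIV {1..r + 1}"
 by (rule bij_betw_byWitness[where f' = "%k. index (k - 1)"])
  (use index_pos pos_index in \<open>auto simp: Suc_le_eq\<close>)

lemma weight_pairing: "i \<in> {1..r} ==> wform r (simple_root i) (lam j) = wform r (simple_root i) (chain_weight (pos j - 1))"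
proof -
 assume i: "i \<in> {1..r}"
 have k: "pos j - 1 \<le> r" using index_pos(3)[of j] by simp
 show ?thesis by (rule coordinate_weight[OF chain_K[OF k] _ i]) (use index[OF k] index_pos(1) in simp)
qed

lemma weight_two_rho: "wform r (lam j) (two_rho r) = real (r + 2) - 2 * real (pos j)"
proof -
 have "wform r (lam j) (two_rho r) = wform r (chain_weight (pos j - 1)) (two_rho r)"
  unfolding wform_two_rho by (intro sum.cong refl) (simp add: weight_pairing)
 also have "\<dots> = real (r + 2) - 2 * real (pos j)"
  using index_pos(2,3)[of j] by (subst chain_height) (auto simp: of_nat_diff)
 finally show ?thesis .
qed

abbreviation "Q \<equiv> complex_of_real q"

lemma V_gens:
 assumes k: "k < r"
 shows "unit_gens V (node (Suc k)) (%j. if j = index k then Q else if j = index (Suc k) then 1 / Q else 1)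
  (index k) (index (Suc k)) (coeff0 k / coeff0 (Suc k))"
proof -
 have kr: "k \<le> r" "Suc k \<le> r" "Suc k \<in> {1..r}" using k by auto
 have nz: "coeff0 k \<noteq> 0" "coeff0 (Suc k) \<noteq> 0" using coeff0_nonzero kr by auto
 have neq: "index k \<noteq> index (Suc k)" using pos_index[of k] pos_index[of "Suc k"] kr by auto
 have col: "A $ i $ index k' = (1 / coeff0 k') * (A *v chain k') $ i" if "k' \<le> r" for A :: "complex^'n^'n" and i k'
 proof -
  have "A $ i $ index k' = (A *v axis (index k') 1) $ i" by (simp add: mult_vec_axis)
  then show ?thesis unfolding axis_index[OF that] by (simp add: vector_scalar_commute)
 qed
 have ex: "\<exists>k'\<le>r. j = index k'" for j
 proof -
  have "j \<in> index ` {0..r}" using index_bij by (simp add: bij_betw_def)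
  then obtain k' where "j = index k'" "k' \<in> {0..r}" by (rule imageE)
  then have "k' \<le> r \<and> j = index k'" by simp
  then show ?thesis ..
 qed
 have inj: "index k1 = index k2 \<longleftrightarrow> k1 = k2" if "k1 \<le> r" "k2 \<le> r" for k1 k2
 proof
  assume "index k1 = index k2"
  then have "Suc k1 = Suc k2" using pos_index[OF that(1)] pos_index[OF that(2)] by (simp only:)
  then show "k1 = k2" by simp
 qed simp
 have K: "repK V (node (Suc k)) = diag_matrix (%j. if j = index k then Q else if j = index (Suc k) then 1 / Q else 1)"
  unfolding K_diag[OF node_range[OF kr(3)]]
 proof (rule arg_cong[where f = diag_matrix], rule ext)
  fix j
  obtain k' where k': "k' \<le> r" "j = index k'" using ex by blast
  have "wform r (simple_root (node (Suc k))) (lam j) = (if k' = k then 1 else if k' = Suc k then - 1 else 0)"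
   using weight_pairing[OF node_range[OF kr(3)], of j] chain_pairing[OF k'(1) kr(3)] k' pos_index[OF k'(1)] by auto
  then show "qpow q (wform r (simple_root (node (Suc k))) (lam j)) = (if j = index k then Q else if j = index (Suc k) then 1 / Q else 1)"
   using k' kr inj q_pos by (auto simp: qpow_minus qpow_zero qpow_nat[of q 1, simplified])
 qed
 have E: "repE V (node (Suc k)) = unit_matrix (index k) (index (Suc k)) (coeff0 k / coeff0 (Suc k))"
 proof -
  have "repE V (node (Suc k)) $ i $ j = (if i = index k \<and> j = index (Suc k) then coeff0 k / coeff0 (Suc k) else 0)" for i j
  proof -
   obtain k' where k': "k' \<le> r" "j = index k'" using ex by blast
   have e: "repE V (node (Suc k)) *v chain k' = (if Suc k = k' then chain (k' - 1) else 0)"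
    using chain_structure[OF k'(1)] kr(3) by blast
   show ?thesis unfolding k'(2) col[OF k'(1)] e using inj[OF k'(1) kr(2)]
    by (auto simp: chain_axis[OF kr(1)] axis_def)
  qed
  then show ?thesis by (simp add: unit_matrix_def vec_eq_iff)
 qed
 have F: "repF V (node (Suc k)) = unit_matrix (index (Suc k)) (index k) (1 / (coeff0 k / coeff0 (Suc k)))"
 proof -
  have "repF V (node (Suc k)) $ i $ j = (if i = index (Suc k) \<and> j = index k then 1 / (coeff0 k / coeff0 (Suc k)) else 0)" for i j
  proof -
   obtain k' where k': "k' \<le> r" "j = index k'" using ex by blast
   have f: "repF V (node (Suc k)) *v chain k' = (if k' = k then chain (Suc k) else 0)"
    using chain_structure[OF k'(1)] kr(3) by auto
   show ?thesis unfolding k'(2) col[OF k'(1)] f using inj[OF k'(1) kr(1)]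
    by (auto simp: chain_axis[OF kr(2)] axis_def simp del: chain.simps)
  qed
  then show ?thesis by (simp add: unit_matrix_def vec_eq_iff)
 qed
 show ?thesis using K E F nz neq q_pos by (auto simp: unit_gens_def)
qed

text \<open>
 The vectors obtained from the highest weight vector by applying the lowering operators once in order, from the
 node \<open>s\<close> to the other end of the diagram, are nonzero; every other lowering vanishes, since it would give a
 singular vector and hence a proper submodule. They lie in different weight spaces, so each is a multiple of
 a basis vector.
\<close>

theorem V_chain: "chain_module Q r node pos (%p. coeff0 (p - 1) / coeff0 p) V"
 unfolding chain_module_def
proof (intro conjI allI impI pos_bij node_bij)
 fix u d assume ud: "pos d = Suc (pos u)"
 define k where "k = pos u - 1"
 have k: "k < r" "pos u = Suc k" using ud index_pos(2)[of u] index_pos(3)[of d] by (auto simp: k_def)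
 have eq: "index k = u" "index (Suc k) = d" using index_pos(1)[of u] index_pos(1)[of d] ud k by auto
 show "unit_gens V (node (pos u)) (%j. if j = u then Q else if j = d then 1 / Q else 1) u d (coeff0 (pos u - 1) / coeff0 (pos u))"
  using V_gens[OF k(1), unfolded eq] k(2) by simp
qed

end

section \<open>The braidings in coordinates\<close>

lemma chain_extreme_vectors:
 assumes X: "chain_module Q r node pos a X" and i: "i \<in> {1..r}"
 shows "pos x = 1 ==> repE X i *v axis x 1 = 0" "pos x = r + 1 ==> repF X i *v axis x 1 = 0"
proof -
 have "i \<in> node ` {1..r}" using X i by (simp add: chain_module_def bij_betw_def)
 then obtain k where k: "i = node k" "k \<in> {1..r}" by (rule imageE)
 obtain u d where "pos u = k" "pos d = Suc k" by (rule chain_posE[OF chain_bij[OF X] k(2)])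
 then have ud: "pos d = Suc (pos u)" "pos u = k" by auto
 note g = chain_gens[OF X ud(1)]
 have rng: "pos u \<in> {1..r + 1}" "pos d \<in> {1..r + 1}" using chain_bij[OF X] by (auto simp: bij_betw_def)
 have E: "repE X i = unit_matrix u d (a k)" and F: "repF X i = unit_matrix d u (1 / a k)"
  using g unfolding k(1) ud(2) unit_gens_def by simp_all
 show "repE X i *v axis x 1 = 0" if "pos x = 1"
 proof -
  have "x \<noteq> d" using that ud rng by auto
  then show ?thesis by (simp add: E F mult_vec_unit vec_eq_iff axis_def)
 qed
 show "repF X i *v axis x 1 = 0" if "pos x = r + 1"
 proof -
  have "x \<noteq> u" using that ud rng by auto
  then show ?thesis by (simp add: E F mult_vec_unit vec_eq_iff axis_def)
 qed
qed

context quantum_projective_space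
begin

definition tw :: complex where
 "tw = qpow q (- 1 / real (r + 1))"

abbreviation "rpos \<equiv> %j. r + 2 - pos j"

lemma tw_nonzero: "tw \<noteq> 0" using q_pos by (simp add: tw_def qpow_nonzero)

lemma Q_nonzero: "Q \<noteq> 0" using q_pos by simp

sublocale ordered_basis pos r Q tw
 by (intro ordered_basis.intro pos_bij Q_nonzero tw_nonzero)

lemma par_w: "par_w = 1 - 1 / real (r + 1)"
 unfolding par_w_def by (rule fund_norm[OF s r])

lemma par_m: "par_m = real r"
 unfolding par_m_def by (rule height_hwv)

lemma par_a: "par_a = 2"
 unfolding par_a_def using s_range by (simp add: root_root)

lemma qpow_w: "qpow q par_w = tw * Q"
proof -
 have "qpow q par_w = qpow q (- 1 / real (r + 1)) * qpow q (real 1)"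
  using q_pos by (simp add: par_w qpow_add[symmetric])
 then show ?thesis using q_pos by (simp only: tw_def qpow_nat power_one_right)
qed

lemma qpow_m: "qpow q par_m = Q ^ r"
 unfolding par_m by (rule qpow_nat[OF q_pos(1)])

lemma qpow_a: "qpow q par_a = Q ^ 2"
 unfolding par_a using qpow_nat[OF q_pos(1), of 2] by simp

lemma weight_qpow: "qpow q (wform r (lam k) (two_rho r)) = wt k" "qpow q (- wform r (lam k) (two_rho r)) = 1 / wt k"
proof -
 have "qpow q (real (r + 2) - 2 * real (pos k)) = qpow q (real (r + 2)) * qpow q (- real (2 * pos k))"
  using q_pos by (simp add: qpow_add[symmetric])
 also have "\<dots> = wt k" unfolding wt_def qpow_minus[OF q_pos(1)] qpow_nat[OF q_pos(1)] by simp
 finally show 1: "qpow q (wform r (lam k) (two_rho r)) = wt k" by (simp only: weight_two_rho)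
 show "qpow q (- wform r (lam k) (two_rho r)) = 1 / wt k"
  unfolding qpow_minus[OF q_pos(1)] 1 ..
qed

lemma dual_K: "i \<in> {1..r} ==> repK (dual_rep V) i = diag_matrix (%j. qpow q (- wform r (simple_root i) (lam j)))"
proof -
 assume i: "i \<in> {1..r}"
 have "matrix_inv (repK V i) = diag_matrix (%j. 1 / qpow q (wform r (simple_root i) (lam j)))"
  unfolding K_diag[OF i] by (rule diag_matrix_inv) (simp add: qpow_nonzero q_pos)
 then show ?thesis
  by (simp add: dual_rep_def qpow_minus[OF q_pos(1)]) (simp add: diag_matrix_def transpose_def vec_eq_iff)
qed

lemma diag_axis: "diag_matrix c *v axis x 1 = c x *s axis x 1"
 by (auto simp: mult_vec_diag vec_eq_iff axis_def)

lemma axis_nonzero: "axis x (1 :: complex) \<noteq> 0"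
 by (auto simp: vec_eq_iff axis_def)

lemma node_cover: "i \<in> {1..r} ==> \<exists>l\<in>{1..r}. i = node l"
 using node_node[of i] node_range[of i] by metis

lemma longest_pairing:
 assumes "i \<in> {1..r}"
 shows "wform r (simple_root i) (longest_act r (fund_weight r s)) = wform r (simple_root i) (chain_weight r)"
proof -
 obtain l where l: "l \<in> {1..r}" "i = node l" using node_cover[OF assms] by blast
 have 1: "wform r (simple_root i) (chain_weight r) = (if l = r then - 1 else 0)"
  unfolding l(2) chain_pairing[OF order_refl l(1)] using l(1) by auto
 have i': "r + 1 - i \<in> {1..r}" using assms by auto
 have "wform r (simple_root i) (longest_act r (fund_weight r s)) =
   fund_weight r s (r + 1 - i + 1) - fund_weight r s (r + 1 - i)"
  using assms by (simp add: wform_simple_root longest_act_def Suc_diff_le)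
 also have "\<dots> = - wform r (simple_root (r + 1 - i)) (fund_weight r s)"
  using i' by (simp only: wform_simple_root)
 also have "\<dots> = (if r + 1 - i = s then - 1 else 0)"
  by (simp only: root_fund_weight[OF i' s_range] minus_zero split: if_split) simp
 also have "(r + 1 - i = s) = (l = r)"
 proof (cases "s = 1")
  case True
  then have "node l = l" unfolding node_def by (rule if_P)
  then show ?thesis unfolding l(2) True using l(1) by auto
 next
  case False
  then have n: "node l = r + 1 - l" unfolding node_def by (rule if_not_P)
  have "s = r" using s False by simp
  then show ?thesis unfolding l(2) n using l(1) by auto
 qed
 finally show ?thesis unfolding 1 .
qed

definition first where "first = index 0"
definition final where "final = index r"

lemma first_final: "pos first = 1" "pos final = r + 1" "first \<noteq> final"
proof -
 show "pos first = 1" "pos final = r + 1" by (simp_all add: first_def final_def pos_index)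
 then show "first \<noteq> final" using r by auto
qed

lemma dual_chain_V: "chain_module Q r (%k. node (r + 1 - k)) rpos
  (%k. - (coeff0 (r + 1 - k - 1) / coeff0 (r + 1 - k) * Q)) (dual_rep V)"
 by (rule dual_chain[OF V_chain Q_nonzero])

lemma V_highest: "highest_weight_vector q r V (fund_weight r s) (axis first 1)"
 unfolding highest_weight_vector_def weight_vector_def
proof (intro conjI ballI axis_nonzero)
 fix i assume i: "i \<in> {1..r}"
 show "repK V i *v axis first 1 = qpow q (wform r (simple_root i) (fund_weight r s)) *s axis first 1"
  using weight_pairing[OF i, of first] first_final by (simp add: K_diag[OF i] diag_axis)
 show "repE V i *v axis first 1 = 0" by (rule chain_extreme_vectors(1)[OF V_chain i first_final(1)])
qed

lemma V_lowest: "lowest_weight_vector q r V (longest_act r (fund_weight r s)) (axis final 1)"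
 unfolding lowest_weight_vector_def weight_vector_def
proof (intro conjI ballI axis_nonzero)
 fix i assume i: "i \<in> {1..r}"
 show "repK V i *v axis final 1 = qpow q (wform r (simple_root i) (longest_act r (fund_weight r s))) *s axis final 1"
  using weight_pairing[OF i, of final] first_final by (simp add: K_diag[OF i] diag_axis longest_pairing[OF i])
 show "repF V i *v axis final 1 = 0" by (rule chain_extreme_vectors(2)[OF V_chain i first_final(2)])
qed

lemma wform_uminus: "wform r x (%k. - y k) = - wform r x y" "wform r (%k. - x k) y = - wform r x y"
 by (simp_all add: wform_def sum_negf)

lemma wform_commute: "wform r x y = wform r y x"
 by (simp add: wform_def mult.commute)

lemma longest_dual: "k \<in> {1..r + 1} ==> longest_act r dual_weight k = - fund_weight r s k"
 by (auto simp: longest_act_def dual_weight_def)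

lemma wform_longest_dual: "wform r x (longest_act r dual_weight) = - wform r x (fund_weight r s)"
 unfolding wform_def sum_negf[symmetric] by (intro sum.cong) (auto simp: longest_dual)

lemma D_highest: "highest_weight_vector q r (dual_rep V) dual_weight (axis final 1)"
 unfolding highest_weight_vector_def weight_vector_def
proof (intro conjI ballI axis_nonzero)
 fix i assume i: "i \<in> {1..r}"
 show "repK (dual_rep V) i *v axis final 1 = qpow q (wform r (simple_root i) dual_weight) *s axis final 1"
  using weight_pairing[OF i, of final] first_final
  by (simp add: dual_K[OF i] diag_axis dual_weight_def wform_uminus longest_pairing[OF i])
 show "repE (dual_rep V) i *v axis final 1 = 0"
  by (rule chain_extreme_vectors(1)[OF dual_chain_V i]) (simp add: first_final)
qed

lemma D_lowest: "lowest_weight_vector q r (dual_rep V) (longest_act r dual_weight) (axis first 1)"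
 unfolding lowest_weight_vector_def weight_vector_def
proof (intro conjI ballI axis_nonzero)
 fix i assume i: "i \<in> {1..r}"
 show "repK (dual_rep V) i *v axis first 1 = qpow q (wform r (simple_root i) (longest_act r dual_weight)) *s axis first 1"
  using weight_pairing[OF i, of first] first_final
  by (simp add: dual_K[OF i] diag_axis wform_longest_dual)
 show "repF (dual_rep V) i *v axis first 1 = 0"
  by (rule chain_extreme_vectors(2)[OF dual_chain_V i]) (simp add: first_final)
qed

lemma R_VV_eq: "R_VV = VV"
 unfolding R_VV_def
proof (rule braiding_eqI[OF V_chain V_chain braid_same_hom[OF V_chain Q_nonzero] first_final(1,2) V_highest V_lowest])
 fix p show "VV $ p $ (first, final) = (if p = (final, first) then qpow q (wform r (fund_weight r s) (longest_act r (fund_weight r s))) else 0)"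
  unfolding fund_longest[OF s r] tw_def[symmetric] using first_final
  by (cases p) (auto simp: braid_same_entry)
qed

lemma R_DD_eq: "R_DD = DD"
 unfolding R_DD_def
proof (rule braiding_eqI[OF dual_chain_V dual_chain_V braid_same_hom[OF dual_chain_V Q_nonzero] _ _ D_highest D_lowest])
 show "rpos final = 1" "rpos first = r + 1" using first_final by simp_all
 have "wform r dual_weight (longest_act r dual_weight) = - 1 / real (r + 1)"
  unfolding wform_longest_dual using fund_longest[OF s r]
  by (simp only: dual_weight_def wform_uminus minus_minus wform_commute[of "longest_act r (fund_weight r s)"])
 then show "DD $ p $ (final, first) = (if p = (first, final) then qpow q (wform r dual_weight (longest_act r dual_weight)) else 0)" for p
  unfolding tw_def[symmetric] using first_final
  by (cases p) (auto simp: braid_same_entry tw_def)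
qed

lemma R_VD_eq: "R_VD = VD"
 unfolding R_VD_def
proof (rule braiding_eqI[OF V_chain dual_chain_V braid_dual_hom[OF V_chain Q_nonzero tw_nonzero] first_final(1) _ V_highest D_lowest])
 show "rpos first = r + 1" using first_final by simp
 have "wform r (fund_weight r s) (longest_act r dual_weight) = - par_w"
  unfolding wform_longest_dual par_w_def ..
 then have "qpow q (wform r (fund_weight r s) (longest_act r dual_weight)) = 1 / (tw * Q)"
  using q_pos by (simp add: qpow_minus qpow_w)
 then show "VD $ p $ (first, first) = (if p = (first, first) then qpow q (wform r (fund_weight r s) (longest_act r dual_weight)) else 0)" for p
  using first_final pos_range(1)[of "fst p"] by (cases p) (auto simp: braid_dual_entry)
qed

lemma R_inverses: "matrix_inv R_VV = VVi" "matrix_inv R_DD = DDi" "matrix_inv R_VD = VDi"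
 unfolding R_VV_eq R_DD_eq R_VD_eq by (rule matrix_inv_eqI, rule VV_inverse VD_inverse)+

sublocale dual_braiding VV VD DD VDi VVi DDi wt "tw * Q * Q ^ r" "tw * Q" "Q ^ r" "tw * (Q - 1 / Q)"
 by (rule dual_braiding)

subsection \<open>Operators on families, evaluated on functionals\<close>

definition fam_eval :: "('m \<Rightarrow> complex) \<Rightarrow> nat \<Rightarrow> ('n list \<Rightarrow> 'm) \<Rightarrow> 'n legs \<Rightarrow> complex" where
 "fam_eval \<phi> L x e = \<phi> (x (legs_list L e))"

end

locale family_functional = quantum_projective_space q r s V lam + cspace M
 for q r s and V :: "('n::finite) uq_rep" and lam and M :: "(complex, 'm, 'z) module_scheme" (structure) +
 fixes \<phi> :: "'m \<Rightarrow> complex"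
 assumes functional: "functional M \<phi>"
begin

definition closed_family :: "nat \<Rightarrow> ('n list \<Rightarrow> 'm) \<Rightarrow> bool" where
 "closed_family L x \<longleftrightarrow> (\<forall>is. length is = L \<longrightarrow> x is \<in> carrier M)"

lemma closed_on_legs: "closed_family L x ==> closed_family L (on_legs M A n x)"
 unfolding closed_family_def by (auto intro!: on_legs_closed)

lemma eval_on_legs: "closed_family L x ==> n + 2 \<le> L ==>
  fam_eval \<phi> L (on_legs M A (n + 1) x) = leg_op A n (fam_eval \<phi> L x)"
 unfolding fam_eval_def closed_family_def by (rule ext) (simp add: on_legs_functional[OF functional])

lemma eval_S123: "closed_family L x ==> 3 \<le> L ==> fam_eval \<phi> L (S123 M x) = S 0 (fam_eval \<phi> L x)"
 unfolding S123_def R_inverses unfolding R_VV_eq R_VD_eq S_def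
 using eval_on_legs[of L _ 0] eval_on_legs[of L _ 1]
 by (simp add: closed_on_legs numeral_2_eq_2)

lemma eval_S123_inv: "closed_family L x ==> 3 \<le> L ==> fam_eval \<phi> L (S123_inv M x) = S_inv 0 (fam_eval \<phi> L x)"
 unfolding S123_inv_def R_inverses unfolding R_VD_eq S_inv_def
 using eval_on_legs[of L _ 0] eval_on_legs[of L _ 1]
 by (simp add: closed_on_legs numeral_2_eq_2)

lemma eval_S234: "closed_family L x ==> 4 \<le> L ==> fam_eval \<phi> L (S234' M x) = St 0 (fam_eval \<phi> L x)"
 unfolding S234'_def R_inverses unfolding R_VD_eq St_def
 using eval_on_legs[of L _ 1] eval_on_legs[of L _ 2]
 by (simp add: closed_on_legs numeral_2_eq_2 numeral_3_eq_3)

lemma closed_S: "closed_family L x ==> closed_family L (S123 M x)" "closed_family L x ==> closed_family L (S123_inv M x)"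
 "closed_family L x ==> closed_family L (S234' M x)" "closed_family L x ==> closed_family L (S234'_inv M x)"
 "closed_family L x ==> closed_family L (T1234 M x)"
 by (simp_all add: S123_def S123_inv_def S234'_def S234'_inv_def T1234_def closed_on_legs)

lemma eval_T1234: "closed_family L x ==> 4 \<le> L ==> fam_eval \<phi> L (T1234 M x) = S 0 (St 0 (fam_eval \<phi> L x))"
 by (simp add: T1234_def eval_S123 eval_S234 closed_S)

lemma eval_E: "closed_family (L + 2) x ==> n \<le> L ==> fam_eval \<phi> L (E_ev M (n + 1) x) = ev n (fam_eval \<phi> (L + 2) x)"
 unfolding fam_eval_def closed_family_def E_ev_def
 by (rule ext) (simp only: Suc_eq_plus1[symmetric], rule contract_functional[OF functional], auto)

lemma eval_E': "closed_family (L + 2) x ==> n \<le> L ==> fam_eval \<phi> L (E_ev' M (n + 1) x) = ev' n (fam_eval \<phi> (L + 2) x)"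
 unfolding fam_eval_def closed_family_def E_ev'_def weight_qpow
 by (rule ext) (simp only: Suc_eq_plus1[symmetric], rule contract_functional[OF functional], auto)

lemma closed_E: "closed_family (L + 2) x ==> n \<le> L + 1 ==> closed_family L (E_ev M n x)"
 "closed_family (L + 2) x ==> n \<le> L + 1 ==> closed_family L (E_ev' M n x)"
 unfolding closed_family_def E_ev_def E_ev'_def by (auto intro!: contract_closed)

lemma eval_C: "closed_family L x ==> n \<le> L ==> fam_eval \<phi> (L + 2) (C_coev M (n + 1) x) = coev n (fam_eval \<phi> L x)"
 unfolding fam_eval_def closed_family_def C_coev_def
 by (rule ext) (simp only: Suc_eq_plus1[symmetric], rule insert_functional[OF functional], auto)

lemma eval_C': "closed_family L x ==> n \<le> L ==> fam_eval \<phi> (L + 2) (C_coev' M (n + 1) x) = coev' n (fam_eval \<phi> L x)"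
 unfolding fam_eval_def closed_family_def C_coev'_def weight_qpow
 by (rule ext) (simp only: Suc_eq_plus1[symmetric], rule insert_functional[OF functional], auto)

lemma closed_C: "closed_family L x ==> 1 \<le> n ==> n \<le> L + 1 ==> closed_family (L + 2) (C_coev M n x)"
 "closed_family L x ==> 1 \<le> n ==> n \<le> L + 1 ==> closed_family (L + 2) (C_coev' M n x)"
 unfolding closed_family_def C_coev_def C_coev'_def by (auto intro!: insert_closed)

end

section \<open>The free algebra and its quotient\<close>

lemma free_alg_simps [simp]:
 "carrier free_alg = UNIV" "x \<otimes>\<^bsub>free_alg\<^esub> y = x * y" "\<one>\<^bsub>free_alg\<^esub> = 1" "\<zero>\<^bsub>free_alg\<^esub> = 0"
 "x \<oplus>\<^bsub>free_alg\<^esub> y = x + y" "c \<odot>\<^bsub>free_alg\<^esub> x = Poly_Mapping.single 0 c * x"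
 by (simp_all add: free_alg_def)

lemma scalar_central: "x * Poly_Mapping.single 0 c = Poly_Mapping.single 0 c * x"
 for x :: "'k::monoid_add \<Rightarrow>\<^sub>0 complex"
proof -
 have "(\<Sum>k\<in>A. Poly_Mapping.single k (f k)) * Poly_Mapping.single 0 c =
   Poly_Mapping.single 0 c * (\<Sum>k\<in>A. Poly_Mapping.single k (f k))" for A :: "'k set" and f :: "'k \<Rightarrow> complex"
  by (simp add: sum_distrib_left sum_distrib_right mult_single mult.commute)
 from this[where A = "Poly_Mapping.keys x" and f = "Poly_Mapping.lookup x"] show ?thesis
  by (simp only: poly_mapping_as_sum)
qed

lemma free_alg_calgebra: "calgebra (free_alg :: (complex, 'n falg) module)"
proof (rule calgebra.intro)
 have ab: "abelian_group (free_alg :: (complex, 'n falg) module)"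
 proof (rule abelian_groupI)
  fix x :: "'n falg" show "\<exists>y\<in>carrier free_alg. y \<oplus>\<^bsub>free_alg\<^esub> x = \<zero>\<^bsub>free_alg\<^esub>"
   by (intro bexI[of _ "- x"]) auto
 qed (auto simp: ac_simps)
 show "ring (free_alg :: (complex, 'n falg) module)"
  by (rule ringI[OF ab]) (auto simp: algebra_simps intro!: monoid.intro)
 show "module complex_field (free_alg :: (complex, 'n falg) module)"
  by (rule moduleI[OF cring_complex_field ab])
   (auto simp: algebra_simps single_add mult_single mult.assoc[symmetric])
qed (auto simp: scalar_central)

context quantum_projective_space
begin

sublocale falg: calgebra free_alg by (rule free_alg_calgebra)

sublocale rel_ideal: ideal alg_ideal free_alg
 unfolding alg_ideal_def by (rule falg.B.genideal_ideal) simp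

definition proj :: "'n falg \<Rightarrow> 'n alg" where
 "proj x = alg_ideal +>\<^bsub>free_alg\<^esub> x"

lemma alg_simps:
 "carrier alg = range proj" "proj x \<otimes>\<^bsub>alg\<^esub> proj y = proj (x * y)" "\<one>\<^bsub>alg\<^esub> = proj 1" "\<zero>\<^bsub>alg\<^esub> = proj 0"
 "proj x \<oplus>\<^bsub>alg\<^esub> proj y = proj (x + y)" "c \<odot>\<^bsub>alg\<^esub> proj x = proj (Poly_Mapping.single 0 c * x)"
proof -
 have m: "proj x \<otimes>\<^bsub>free_alg Quot alg_ideal\<^esub> proj y = proj (x * y)" for x y
  using rel_ideal.rcoset_mult_add[of x y] by (simp add: FactRing_def proj_def)
 show "carrier alg = range proj"
  by (auto simp: alg_def quotient_alg_def ring.defs module.defs FactRing_def A_RCOSETS_def' proj_def)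
 show "proj x \<otimes>\<^bsub>alg\<^esub> proj y = proj (x * y)" "c \<odot>\<^bsub>alg\<^esub> proj x = proj (Poly_Mapping.single 0 c * x)"
  using m by (simp_all add: alg_def quotient_alg_def ring.defs module.defs) (simp add: proj_def[symmetric])
 show "\<one>\<^bsub>alg\<^esub> = proj 1"
  by (simp add: alg_def quotient_alg_def ring.defs module.defs FactRing_def proj_def)
 show "\<zero>\<^bsub>alg\<^esub> = proj 0"
  using rel_ideal.a_rcos_const[of 0] rel_ideal.zero_closed
  by (simp add: alg_def quotient_alg_def ring.defs module.defs FactRing_def proj_def)
 show "proj x \<oplus>\<^bsub>alg\<^esub> proj y = proj (x + y)"
  using rel_ideal.a_rcos_sum[of x y]
  by (simp add: alg_def quotient_alg_def ring.defs module.defs FactRing_def proj_def)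
qed

lemma alg_calgebra: "calgebra alg"
proof (rule calgebra.intro)
 have ab: "abelian_group alg"
 proof (rule abelian_groupI)
  fix x assume "x \<in> carrier alg"
  then obtain y where "x = proj y" by (auto simp: alg_simps)
  then show "\<exists>y\<in>carrier alg. y \<oplus>\<^bsub>alg\<^esub> x = \<zero>\<^bsub>alg\<^esub>"
   by (intro bexI[of _ "proj (- y)"]) (auto simp: alg_simps)
 qed (auto simp: alg_simps ac_simps)
 show "ring alg"
  by (rule ringI[OF ab]) (auto simp: alg_simps algebra_simps intro!: monoid.intro)
 show "module complex_field alg"
  by (rule moduleI[OF cring_complex_field ab])
   (auto simp: alg_simps algebra_simps single_add mult_single mult.assoc[symmetric])
qed (auto simp: alg_simps scalar_central)

sublocale alg: calgebra alg by (rule alg_calgebra)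

lemma proj_linear: "clinear_map free_alg alg proj"
 by (auto simp: clinear_map_def alg_simps)

lemma proj_relation: "x \<in> alg_relations ==> proj x = \<zero>\<^bsub>alg\<^esub>"
proof -
 assume "x \<in> alg_relations"
 then have "x \<in> alg_ideal" unfolding alg_ideal_def
  using falg.B.genideal_self[of alg_relations] by auto
 then show ?thesis using rel_ideal.a_rcos_const[of x] rel_ideal.a_rcos_const[of 0] rel_ideal.zero_closed
  by (simp add: alg_simps proj_def)
qed

lemma P_proj: "P is = proj (fam2 free_gen is)"
 by (simp add: P_def fam2_def proj_def)

lemma P_closed [simp]: "P is \<in> carrier alg"
 by (simp add: P_proj alg_simps)

lemma legs4: "legs_list 4 e = [e 0, e 1, e 2, e 3]" and legs2: "legs_list 2 e = [e 0, e 1]" and legs0: "legs_list 0 e = []"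
 and legs3: "legs_list 3 e = [e 0, e 1, e 2]"
 by (simp_all add: legs_list_def upt_rec numeral_2_eq_2 numeral_3_eq_3)

lemma falg_functional:
 assumes "functional alg \<phi>"
 shows "family_functional q r s V lam free_alg (%x. \<phi> (proj x))"
 by (intro family_functional.intro family_functional_axioms.intro quantum_projective_space_axioms
   falg.Bv.cspace_axioms functional_compose[OF proj_linear assms])

lemma PP_eval:
 assumes "functional alg \<phi>"
 shows "S 0 (%e. \<phi> (P [e 0, e 1] \<otimes>\<^bsub>alg\<^esub> P [e 2, e 3])) = (%e. tw * Q * \<phi> (P [e 0, e 1] \<otimes>\<^bsub>alg\<^esub> P [e 2, e 3]))"
  "St 0 (%e. \<phi> (P [e 0, e 1] \<otimes>\<^bsub>alg\<^esub> P [e 2, e 3])) = (%e. 1 / (tw * Q) * \<phi> (P [e 0, e 1] \<otimes>\<^bsub>alg\<^esub> P [e 2, e 3]))"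
  "(\<Sum>k\<in>UNIV. wt k * \<phi> (P [k, k])) = Q ^ r * \<phi> \<one>\<^bsub>alg\<^esub>"
proof -
 interpret f: family_functional q r s V lam free_alg "%x. \<phi> (proj x)" by (rule falg_functional[OF assms])
 let ?p = "fam2 free_gen" let ?pp = "fam_prod (*) ?p ?p"
 have cl: "f.closed_family L x" for L x by (simp add: f.closed_family_def)
 have pp: "fam_eval (%x. \<phi> (proj x)) 4 ?pp = (%e. \<phi> (P [e 0, e 1] \<otimes>\<^bsub>alg\<^esub> P [e 2, e 3]))"
  by (rule ext) (simp add: fam_eval_def legs4 fam_prod_def P_proj alg_simps fam2_def numeral_2_eq_2)
 have z: "\<phi> (proj x) = 0" if "x \<in> alg_relations" for x
  using proj_relation[OF that] alg.Bv.functional_zero[OF assms] by simp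
 have m: "\<phi> (proj (x \<ominus>\<^bsub>free_alg\<^esub> c \<odot>\<^bsub>free_alg\<^esub> y)) = \<phi> (proj x) - c * \<phi> (proj y)" for x y :: "'n falg" and c
  using falg.Bv.functional_minus[OF f.functional, of x "c \<odot>\<^bsub>free_alg\<^esub> y"] falg.Bv.functional_smult[OF f.functional, of y c] by simp
 have "S 0 (fam_eval (%x. \<phi> (proj x)) 4 ?pp) = (%e. tw * Q * fam_eval (%x. \<phi> (proj x)) 4 ?pp e)"
 proof
  fix e
  have "fam_diff free_alg (S123 free_alg ?pp) (fam_smult free_alg (qpow q par_w) ?pp) (legs_list 4 e) \<in> alg_relations"
   unfolding alg_relations_def Let_def using length_legs_list by blast
  from z[OF this] have "\<phi> (proj (S123 free_alg ?pp (legs_list 4 e))) = tw * Q * \<phi> (proj (?pp (legs_list 4 e)))"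
   unfolding fam_diff_def fam_smult_def m qpow_w by simp
  then show "S 0 (fam_eval (%x. \<phi> (proj x)) 4 ?pp) e = tw * Q * fam_eval (%x. \<phi> (proj x)) 4 ?pp e"
   unfolding f.eval_S123[OF cl, of 4 ?pp, symmetric, simplified] by (simp add: fam_eval_def)
 qed
 then show "S 0 (%e. \<phi> (P [e 0, e 1] \<otimes>\<^bsub>alg\<^esub> P [e 2, e 3])) = (%e. tw * Q * \<phi> (P [e 0, e 1] \<otimes>\<^bsub>alg\<^esub> P [e 2, e 3]))"
  unfolding pp .
 have "St 0 (fam_eval (%x. \<phi> (proj x)) 4 ?pp) = (%e. 1 / (tw * Q) * fam_eval (%x. \<phi> (proj x)) 4 ?pp e)"
 proof
  fix e
  have "fam_diff free_alg (S234' free_alg ?pp) (fam_smult free_alg (qpow q (- par_w)) ?pp) (legs_list 4 e) \<in> alg_relations"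
   unfolding alg_relations_def Let_def using length_legs_list by blast
  from z[OF this] have "\<phi> (proj (S234' free_alg ?pp (legs_list 4 e))) = 1 / (tw * Q) * \<phi> (proj (?pp (legs_list 4 e)))"
   unfolding fam_diff_def fam_smult_def m qpow_minus[OF q_pos(1)] qpow_w by simp
  then show "St 0 (fam_eval (%x. \<phi> (proj x)) 4 ?pp) e = 1 / (tw * Q) * fam_eval (%x. \<phi> (proj x)) 4 ?pp e"
   unfolding f.eval_S234[OF cl, of 4 ?pp, symmetric, simplified] by (simp add: fam_eval_def)
 qed
 then show "St 0 (%e. \<phi> (P [e 0, e 1] \<otimes>\<^bsub>alg\<^esub> P [e 2, e 3])) = (%e. 1 / (tw * Q) * \<phi> (P [e 0, e 1] \<otimes>\<^bsub>alg\<^esub> P [e 2, e 3]))"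
  unfolding pp .
 have "E_ev' free_alg 1 ?p [] \<ominus>\<^bsub>free_alg\<^esub> qpow q par_m \<odot>\<^bsub>free_alg\<^esub> \<one>\<^bsub>free_alg\<^esub> \<in> alg_relations"
  unfolding alg_relations_def Let_def by blast
 from z[OF this] have 1: "\<phi> (proj (E_ev' free_alg 1 ?p [])) = Q ^ r * \<phi> \<one>\<^bsub>alg\<^esub>"
  unfolding m qpow_m by (simp add: alg_simps)
 have "fam_eval (%x. \<phi> (proj x)) 0 (E_ev' free_alg (0 + 1) ?p) e = ev' 0 (fam_eval (%x. \<phi> (proj x)) (0 + 2) ?p) e" for e
  by (rule fun_cong[OF f.eval_E'[OF cl]]) simp
 from this[of undefined] 1 show "(\<Sum>k\<in>UNIV. wt k * \<phi> (P [k, k])) = Q ^ r * \<phi> \<one>\<^bsub>alg\<^esub>"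
  by (simp add: fam_eval_def legs0 legs2 leg_contract_def P_proj fam2_def double_leg_def)
qed

end

section \<open>The bimodule of one-forms\<close>

lemma left_span_submodule:
 assumes "cspace M" "G \<subseteq> carrier M" and "\<And>b x. b \<in> carrier B ==> x \<in> carrier M ==> lact M b x \<in> carrier M"
 shows "submodule (left_span B M G) complex_field M" "G \<subseteq> left_span B M G"
  "b \<in> carrier B ==> x \<in> left_span B M G ==> lact M b x \<in> left_span B M G"
proof -
 interpret cspace M by fact
 have c: "submodule (carrier M) complex_field M" by (rule carrier_is_submodule)
 show "G \<subseteq> left_span B M G" by (auto simp: left_span_def)
 show "b \<in> carrier B ==> x \<in> left_span B M G ==> lact M b x \<in> left_span B M G"
  by (auto simp: left_span_def)
 show "submodule (left_span B M G) complex_field M"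
 proof (rule submoduleI')
  show "left_span B M G \<subseteq> carrier M"
   using c assms(2,3) unfolding left_span_def by (intro Inter_lower) auto
 qed (auto simp: left_span_def dest: submoduleD)
qed

lemma (in bimodule) bimod_span_subbimodule:
 assumes "G \<subseteq> carrier M"
 shows "subbimodule B M (bimod_span B M G)" "G \<subseteq> bimod_span B M G"
proof -
 show "G \<subseteq> bimod_span B M G" by (auto simp: bimod_span_def)
 have c: "submodule (carrier M) complex_field M" by (rule M.carrier_is_submodule)
 have "submodule (bimod_span B M G) complex_field M"
 proof (rule M.submoduleI')
  show "bimod_span B M G \<subseteq> carrier M"
   using c assms unfolding bimod_span_def by (intro Inter_lower) auto
 qed (auto simp: bimod_span_def dest: M.submoduleD)
 then show "subbimodule B M (bimod_span B M G)"
  by (intro subbimodule.intro subbimodule_axioms.intro bimodule_axioms) (auto simp: bimod_span_def)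
qed

lemma direct_sum_alg_bimodule:
 assumes "alg_bimodule B M" "alg_bimodule B N"
 shows "alg_bimodule B (direct_sum M N)"
proof -
 interpret M: alg_bimodule B M by fact
 interpret N: alg_bimodule B N by fact
 interpret Mv: cspace M by (rule cspace.intro) (rule M.vector_space)
 interpret Nv: cspace N by (rule cspace.intro) (rule N.vector_space)
 have ab: "abelian_group (direct_sum M N)"
 proof (rule abelian_groupI)
  fix x assume "x \<in> carrier (direct_sum M N)"
  then show "\<exists>y\<in>carrier (direct_sum M N). y \<oplus>\<^bsub>direct_sum M N\<^esub> x = \<zero>\<^bsub>direct_sum M N\<^esub>"
   by (intro bexI[of _ "(\<ominus>\<^bsub>M\<^esub> fst x, \<ominus>\<^bsub>N\<^esub> snd x)"]) (auto simp: direct_sum_def Mv.l_neg Nv.l_neg)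
 qed (auto simp: direct_sum_def Mv.a_ac Nv.a_ac)
 have "module complex_field (direct_sum M N)"
  by (rule moduleI[OF cring_complex_field ab])
   (auto simp: direct_sum_def Mv.sm_add Nv.sm_add Mv.sm_distr Nv.sm_distr Mv.sm_assoc Nv.sm_assoc)
 then show ?thesis
  by (intro alg_bimodule.intro)
   (auto simp: direct_sum_def M.closed N.closed M.add_alg N.add_alg M.add_mod N.add_mod M.scalar N.scalar M.assoc N.assoc)
qed

context calgebra
begin

lemma free_left_module_simps [simp]:
 "carrier (free_left_module B) = {f. \<forall>k. f k \<in> carrier B}" "\<zero>\<^bsub>free_left_module B\<^esub> = (%k. \<zero>)"
 "f \<oplus>\<^bsub>free_left_module B\<^esub> g = (%k. f k \<oplus> g k)" "c \<odot>\<^bsub>free_left_module B\<^esub> f = (%k. c \<odot> f k)"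
 "lact (free_left_module B) b f = (%k. b \<otimes> f k)"
 by (simp_all add: free_left_module_def)

lemma free_left_module_cspace: "cspace (free_left_module B :: ('b, 'x::finite \<Rightarrow> 'b) bimod)"
proof (rule cspace.intro)
 have ab: "abelian_group (free_left_module B :: ('b, 'x::finite \<Rightarrow> 'b) bimod)"
 proof (rule abelian_groupI)
  fix x :: "'x \<Rightarrow> 'b" assume "x \<in> carrier (free_left_module B)"
  then show "\<exists>y\<in>carrier (free_left_module B). y \<oplus>\<^bsub>free_left_module B\<^esub> x = \<zero>\<^bsub>free_left_module B\<^esub>"
   by (intro bexI[of _ "%k. \<ominus> x k"]) (auto simp: Bv.l_neg)
 qed (auto simp: Bv.a_ac)
 show "module complex_field (free_left_module B :: ('b, 'x::finite \<Rightarrow> 'b) bimod)"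
  by (rule moduleI[OF cring_complex_field ab]) (auto simp: Bv.sm_add Bv.sm_distr Bv.sm_assoc)
qed

end

text \<open>
 The modules of \<open>(1,0)\<close>- and \<open>(0,1)\<close>-forms are both quotients of the same free left module; they are treated
 together, for an arbitrary set \<open>G\<close> of relations.
\<close>

locale left_quotient = quantum_projective_space q r s V lam
 for q r s and V :: "('n::finite) uq_rep" and lam +
 fixes G :: "('n \<times> 'n \<Rightarrow> 'n alg) set"
 assumes G_closed: "G \<subseteq> carrier free_forms"
begin

definition "N = left_span alg free_forms G"
definition "L = quot_bimod free_forms N"
definition "gen is = N +>\<^bsub>free_forms\<^esub> free_dp is"

sublocale ff: cspace "free_forms" by (rule alg.free_left_module_cspace)

lemma free_lact_closed: "b \<in> carrier alg ==> x \<in> carrier free_forms ==> lact free_forms b x \<in> carrier free_forms"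
 by auto

lemma N_facts:
 "submodule N complex_field free_forms" "G \<subseteq> N"
 "b \<in> carrier alg ==> x \<in> N ==> lact free_forms b x \<in> N"
 unfolding N_def
 by (rule left_span_submodule[OF ff.cspace_axioms G_closed free_lact_closed]; assumption)+

sublocale csubspace free_forms N
 by (intro csubspace.intro ff.cspace_axioms csubspace_axioms.intro N_facts)

sublocale L: cspace L unfolding L_def by (rule quot_cspace)

lemma free_dp_closed: "free_dp is \<in> carrier free_forms"
 by (auto simp: free_dp_def fam2_def free_generator_def)

lemma gen_closed [simp]: "gen is \<in> carrier L"
 unfolding gen_def L_def by (rule quot_closed[OF free_dp_closed])

lemma L_lact: "b \<in> carrier alg ==> x \<in> carrier free_forms ==>
  lact L b (N +>\<^bsub>free_forms\<^esub> x) = N +>\<^bsub>free_forms\<^esub> lact free_forms b x"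
 unfolding L_def by (rule quot_lact[OF _ _ N_facts(3)]) (auto simp: alg.B.r_distr)

lemma coset_functional: "functional L \<psi> ==> functional free_forms (%x. \<psi> (N +>\<^bsub>free_forms\<^esub> x))"
 by (rule functional_compose[OF quot_linear[folded L_def]])

lemma functional_relation: "functional L \<psi> ==> x \<in> G ==> \<psi> (N +>\<^bsub>free_forms\<^esub> x) = 0"
proof -
 assume p: "functional L \<psi>" and x: "x \<in> G"
 have xN: "x \<in> N" "x \<in> carrier free_forms" using N_facts(2) x G_closed by auto
 have "x \<ominus>\<^bsub>free_forms\<^esub> \<zero>\<^bsub>free_forms\<^esub> = x"
  using xN(2) by (simp add: ff.minus_sm del: alg.free_left_module_simps)
 then have "N +>\<^bsub>free_forms\<^esub> x = N +>\<^bsub>free_forms\<^esub> \<zero>\<^bsub>free_forms\<^esub>"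
  using coset_eq_iff[OF xN(2), of "\<zero>\<^bsub>free_forms\<^esub>"] xN(1) by (simp del: alg.free_left_module_simps)
 then show ?thesis using L.functional_zero[OF p] quot_zero[folded L_def] by (simp del: alg.free_left_module_simps)
qed

lemma quotient_induct [consumes 1, case_names zero gen add]:
 assumes "x \<in> carrier L" and z: "R \<zero>\<^bsub>L\<^esub>"
  and g: "\<And>b i j. b \<in> carrier alg ==> R (lact L b (gen [i, j]))"
  and a: "\<And>x y. x \<in> carrier L ==> y \<in> carrier L ==> R x ==> R y ==> R (x \<oplus>\<^bsub>L\<^esub> y)"
 shows "R x"
proof -
 obtain f where f: "f \<in> carrier free_forms" "x = N +>\<^bsub>free_forms\<^esub> f"
  using assms(1) unfolding L_def quot_carrier by blast
 have part: "(%k. if k \<in> A then f k else \<zero>\<^bsub>alg\<^esub>) \<in> carrier free_forms" for A using f(1) by auto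
 have "R (N +>\<^bsub>free_forms\<^esub> (%k. if k \<in> A then f k else \<zero>\<^bsub>alg\<^esub>))" if "finite A" for A
  using that
 proof (induction A rule: finite_induct)
  case empty
  then show ?case using z quot_zero[folded L_def] by simp
 next
  case (insert k A)
  obtain i j where k: "k = (i, j)" by (cases k)
  have e: "(%l. if l \<in> insert k A then f l else \<zero>\<^bsub>alg\<^esub>) =
    lact free_forms (f k) (free_dp [i, j]) \<oplus>\<^bsub>free_forms\<^esub> (%l. if l \<in> A then f l else \<zero>\<^bsub>alg\<^esub>)"
   using f(1) insert(2) by (auto simp: free_dp_def fam2_def free_generator_def k fun_eq_iff)
  have fk: "f k \<in> carrier alg" using f(1) unfolding k by simp
  have "N +>\<^bsub>free_forms\<^esub> (%l. if l \<in> insert k A then f l else \<zero>\<^bsub>alg\<^esub>) =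
    lact L (f k) (gen [i, j]) \<oplus>\<^bsub>L\<^esub> (N +>\<^bsub>free_forms\<^esub> (%l. if l \<in> A then f l else \<zero>\<^bsub>alg\<^esub>))"
   unfolding e gen_def L_lact[OF fk free_dp_closed]
   unfolding L_def by (rule quot_add[symmetric, OF free_lact_closed[OF fk free_dp_closed] part])
  moreover have "lact L (f k) (gen [i, j]) \<in> carrier L"
   unfolding gen_def L_lact[OF fk free_dp_closed] unfolding L_def
   by (rule quot_closed[OF free_lact_closed[OF fk free_dp_closed]])
  moreover have "N +>\<^bsub>free_forms\<^esub> (%l. if l \<in> A then f l else \<zero>\<^bsub>alg\<^esub>) \<in> carrier L"
   unfolding L_def by (rule quot_closed[OF part])
  ultimately show ?case using a g[OF fk] insert.IH by presburger
 qed
 from this[of UNIV] show ?thesis using f(2) by simp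
qed

text \<open>Relations between the products \<open>p\<^sup>i\<^sup>j x\<^sup>k\<^sup>l\<close>, evaluated under a functional.\<close>

definition "pgen \<psi> e = \<psi> (lact L (P [e 0, e 1]) (gen [e 2, e 3]))" for \<psi> :: "'n form1 \<Rightarrow> complex" and e :: "'n legs"

abbreviation "pdp \<equiv> fam_prod (lact free_forms) P free_dp"

lemma pdp_closed: "pdp is \<in> carrier free_forms"
 unfolding fam_prod_def by (rule free_lact_closed[OF P_closed free_dp_closed])

lemma relation_family_functional:
 "functional L \<psi> ==> family_functional q r s V lam free_forms (%x. \<psi> (N +>\<^bsub>free_forms\<^esub> x))"
 by (intro family_functional.intro family_functional_axioms.intro quantum_projective_space_axioms
   ff.cspace_axioms coset_functional)

lemma P_take: "P (take 2 [a, b, c, d]) = P [a, b]" "gen (drop 2 [a, b, c, d]) = gen [c, d]"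
 "free_dp (drop 2 [a, b, c, d]) = free_dp [c, d]" for a b c d :: 'n
 by simp_all

lemma pdp_eval: "fam_eval (%x. \<psi> (N +>\<^bsub>free_forms\<^esub> x)) 4 pdp = pgen \<psi>"
proof (rule ext)
 fix e :: "'n legs"
 show "fam_eval (%x. \<psi> (N +>\<^bsub>free_forms\<^esub> x)) 4 pdp e = pgen \<psi> e"
  unfolding fam_eval_def pgen_def legs4 fam_prod_def P_take gen_def L_lact[OF P_closed free_dp_closed] ..
qed

lemma relation_minus:
 assumes "functional L \<psi>" "x \<in> carrier free_forms" "y \<in> carrier free_forms" "x \<ominus>\<^bsub>free_forms\<^esub> c \<odot>\<^bsub>free_forms\<^esub> y \<in> G"
 shows "\<psi> (N +>\<^bsub>free_forms\<^esub> x) = c * \<psi> (N +>\<^bsub>free_forms\<^esub> y)"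
proof -
 note p = coset_functional[OF assms(1)]
 have "c \<odot>\<^bsub>free_forms\<^esub> y \<in> carrier free_forms" by (rule ff.sm_closed[OF assms(3)])
 from ff.functional_minus[OF p assms(2) this] ff.functional_smult[OF p assms(3)] functional_relation[OF assms(1,4)]
 show ?thesis by (simp del: alg.free_left_module_simps)
qed

lemma relation_S:
 assumes p: "functional L \<psi>"
  and "\<And>is. length is = 4 ==> fam_diff free_forms (S123 free_forms pdp) (fam_smult free_forms c pdp) is \<in> G"
 shows "S 0 (pgen \<psi>) = (%e. c * pgen \<psi> e)"
proof
 interpret f: family_functional q r s V lam free_forms "%x. \<psi> (N +>\<^bsub>free_forms\<^esub> x)"
  by (rule relation_family_functional[OF p])
 have cl: "f.closed_family 4 pdp" unfolding f.closed_family_def using pdp_closed by blast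
 fix e
 have c': "S123 free_forms pdp (legs_list 4 e) \<in> carrier free_forms"
  using f.closed_S(1)[OF cl] length_legs_list unfolding f.closed_family_def by blast
 show "S 0 (pgen \<psi>) e = c * pgen \<psi> e"
  unfolding pdp_eval[symmetric] f.eval_S123[OF cl, symmetric, simplified] fam_eval_def
  by (rule relation_minus[OF p c' pdp_closed])
   (use assms(2)[of "legs_list 4 e"] in \<open>simp only: fam_diff_def fam_smult_def length_legs_list\<close>)
qed

lemma relation_St:
 assumes p: "functional L \<psi>"
  and "\<And>is. length is = 4 ==> fam_diff free_forms (S234' free_forms pdp) (fam_smult free_forms c pdp) is \<in> G"
 shows "St 0 (pgen \<psi>) = (%e. c * pgen \<psi> e)"
proof
 interpret f: family_functional q r s V lam free_forms "%x. \<psi> (N +>\<^bsub>free_forms\<^esub> x)"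
  by (rule relation_family_functional[OF p])
 have cl: "f.closed_family 4 pdp" unfolding f.closed_family_def using pdp_closed by blast
 fix e
 have c': "S234' free_forms pdp (legs_list 4 e) \<in> carrier free_forms"
  using f.closed_S(3)[OF cl] length_legs_list unfolding f.closed_family_def by blast
 show "St 0 (pgen \<psi>) e = c * pgen \<psi> e"
  unfolding pdp_eval[symmetric] f.eval_S234[OF cl, symmetric, simplified] fam_eval_def
  by (rule relation_minus[OF p c' pdp_closed])
   (use assms(2)[of "legs_list 4 e"] in \<open>simp only: fam_diff_def fam_smult_def length_legs_list\<close>)
qed

lemma relation_trace:
 assumes p: "functional L \<psi>" and "E_ev' free_forms 1 free_dp [] \<in> G"
 shows "(\<Sum>k\<in>UNIV. wt k * \<psi> (gen [k, k])) = 0"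
proof -
 interpret f: family_functional q r s V lam free_forms "%x. \<psi> (N +>\<^bsub>free_forms\<^esub> x)"
  by (rule relation_family_functional[OF p])
 have cl: "f.closed_family (0 + 2) free_dp" unfolding f.closed_family_def using free_dp_closed by blast
 have "fam_eval (%x. \<psi> (N +>\<^bsub>free_forms\<^esub> x)) 0 (E_ev' free_forms (0 + 1) free_dp) e =
   ev' 0 (fam_eval (%x. \<psi> (N +>\<^bsub>free_forms\<^esub> x)) (0 + 2) free_dp) e" for e
  by (rule fun_cong[OF f.eval_E'[OF cl]]) simp
 from this[of undefined, unfolded fam_eval_def add_0 legs0 legs2] functional_relation[OF assms] show ?thesis
  by (simp add: leg_contract_def double_leg_def gen_def)
qed

end

context quantum_projective_space
begin

definition plus_gens :: "('n \<times> 'n \<Rightarrow> 'n alg) set" where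
 "plus_gens = (let pdp = fam_prod (lact free_forms) P free_dp in
  {fam_diff free_forms (S234' free_forms pdp) (fam_smult free_forms (qpow q (- par_w)) pdp) is | is. length is = 4} \<union>
  {E_ev' free_forms 1 free_dp []})"

definition minus_gens :: "('n \<times> 'n \<Rightarrow> 'n alg) set" where
 "minus_gens = (let pdp = fam_prod (lact free_forms) P free_dp in
  {fam_diff free_forms (S123 free_forms pdp) (fam_smult free_forms (qpow q par_w) pdp) is | is. length is = 4} \<union>
  {E_ev' free_forms 1 free_dp []})"

lemma gens_closed: "plus_gens \<subseteq> carrier free_forms" "minus_gens \<subseteq> carrier free_forms"
proof -
 interpret ff: cspace free_forms by (rule alg.free_left_module_cspace)
 interpret f: family_functional q r s V lam free_forms "%_. 0"
  by (intro family_functional.intro family_functional_axioms.intro quantum_projective_space_axioms ff.cspace_axioms)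
   (simp add: functional_def)
 let ?pdp = "fam_prod (lact free_forms) P free_dp"
 have dp: "free_dp is \<in> carrier free_forms" for "is" by (auto simp: free_dp_def fam2_def free_generator_def)
 have pdp: "?pdp is \<in> carrier free_forms" for "is" using dp[of "drop 2 is"] by (auto simp: fam_prod_def)
 have cl: "f.closed_family 4 ?pdp" "f.closed_family (0 + 2) free_dp" unfolding f.closed_family_def using pdp dp by blast+
 have c: "S123 free_forms ?pdp is \<in> carrier free_forms" "S234' free_forms ?pdp is \<in> carrier free_forms" if "length is = 4" for "is"
  using f.closed_S(1,3)[OF cl(1)] that unfolding f.closed_family_def by blast+
 have d: "fam_diff free_forms F (fam_smult free_forms c ?pdp) is \<in> carrier free_forms"
  if "F is \<in> carrier free_forms" for F c "is"
  unfolding fam_diff_def fam_smult_def by (intro ff.minus_closed ff.sm_closed that pdp)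
 have e: "E_ev' free_forms 1 free_dp [] \<in> carrier free_forms"
  using f.closed_E(2)[OF cl(2), of 1] unfolding f.closed_family_def by simp
 show "plus_gens \<subseteq> carrier free_forms" "minus_gens \<subseteq> carrier free_forms"
  unfolding plus_gens_def minus_gens_def Let_def using c d e by blast+
qed

sublocale plus: left_quotient q r s V lam plus_gens
 rewrites "left_quotient.L q r s V lam plus_gens = left_plus" and "left_quotient.gen q r s V lam plus_gens = dP_plus"
proof -
 show p: "left_quotient q r s V lam plus_gens"
  by (intro left_quotient.intro left_quotient_axioms.intro quantum_projective_space_axioms gens_closed)
 have "left_quotient.N q r s V lam plus_gens = plus_relations"
  unfolding left_quotient.N_def[OF p] unfolding plus_relations_def plus_gens_def ..
 then show "left_quotient.L q r s V lam plus_gens = left_plus" "left_quotient.gen q r s V lam plus_gens = dP_plus"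
  by (simp_all add: left_quotient.L_def[OF p] left_plus_def left_quotient.gen_def[OF p] dP_plus_def fun_eq_iff)
qed

sublocale minus: left_quotient q r s V lam minus_gens
 rewrites "left_quotient.L q r s V lam minus_gens = left_minus" and "left_quotient.gen q r s V lam minus_gens = dP_minus"
proof -
 show p: "left_quotient q r s V lam minus_gens"
  by (intro left_quotient.intro left_quotient_axioms.intro quantum_projective_space_axioms gens_closed)
 have "left_quotient.N q r s V lam minus_gens = minus_relations"
  unfolding left_quotient.N_def[OF p] unfolding minus_relations_def minus_gens_def ..
 then show "left_quotient.L q r s V lam minus_gens = left_minus" "left_quotient.gen q r s V lam minus_gens = dP_minus"
  by (simp_all add: left_quotient.L_def[OF p] left_minus_def left_quotient.gen_def[OF p] dP_minus_def fun_eq_iff)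
qed

end

context quantum_projective_space
begin

lemmas contract_simps = leg_contract_def double_leg_def

text \<open>
 The contraction \<open>E'\<^sub>1\<^sub>2\<close> turns \<open>S\<close> into a multiple of \<open>E\<^sub>2\<^sub>3\<close>. So for families fixed by \<open>S\<close> up to the scalar of the relations,
 the matrix product is a multiple of the trace of the first factor. The companion lemma uses \<open>E\<^sub>2\<^sub>3\<close>, \<open>\<tilde>S\<close>
 and the trace of the second factor in the same way.
\<close>

lemma symmetric_product:
 assumes "S 0 f = (%e. tw * Q * f e)"
 shows "ev 1 f e = ev' 0 f e / Q ^ r"
proof -
 have "tw * Q * ev' 0 f e = tw * Q * Q ^ r * ev 1 f e"
  using fun_cong[OF ev'_S[of 0 f], of e] unfolding assms leg_contract_smult by simp
 then show ?thesis using Q_nonzero tw_nonzero by (simp add: field_simps)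
qed

lemma skew_product:
 assumes "St 0 f = (%e. 1 / (tw * Q) * f e)"
 shows "ev 1 f e = ev' 2 f e / Q ^ r"
proof -
 have "1 / (tw * Q) * ev 1 f e = ev' 2 f e / (tw * Q * Q ^ r)"
  using fun_cong[OF ev_St[of 0 f], of e] unfolding assms leg_contract_smult by (simp add: numeral_2_eq_2)
 then show ?thesis using Q_nonzero tw_nonzero by (simp add: field_simps)
qed

lemma weights_nonzero [simp]: "wt k \<noteq> 0"
 using Q_nonzero by (simp add: wt_def)

text \<open>The products with \<open>p\<close> below all follow from the symmetry of \<open>p p\<close>, \<open>p \<partial>p\<close>, \<open>p \<bar>\<partial>p\<close> and from the traces of the factors.\<close>

lemma P_P:
 assumes "functional alg \<phi>"
 shows "(\<Sum>k\<in>UNIV. \<phi> (P [a, k] \<otimes>\<^bsub>alg\<^esub> P [k, b])) = \<phi> (P [a, b])"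
proof -
 have "functional alg (%x. \<phi> (x \<otimes>\<^bsub>alg\<^esub> P [a, b]))"
  by (rule functional_compose[OF _ assms, of alg]) (auto simp: clinear_map_def alg.B.l_distr alg.smult_mult_left)
 from PP_eval(3)[OF this] have t: "(\<Sum>k\<in>UNIV. wt k * \<phi> (P [k, k] \<otimes>\<^bsub>alg\<^esub> P [a, b])) = Q ^ r * \<phi> (P [a, b])"
  by simp
 define e :: "'n legs" where "e = (%i. if i = 0 then a else b)"
 from symmetric_product[OF PP_eval(1)[OF assms], of e] t show ?thesis
  using Q_nonzero by (simp add: contract_simps e_def)
qed

end

context hk_calculus
begin

abbreviation "Lp \<equiv> left_plus\<lparr>ract := rp\<rparr>"
abbreviation "Lm \<equiv> left_minus\<lparr>ract := rm\<rparr>"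

sublocale Lp: bimodule alg Lp by (intro bimodule.intro alg_calgebra bimodule_plus)
sublocale Lm: bimodule alg Lm by (intro bimodule.intro alg_calgebra bimodule_minus)
sublocale Om: bimodule alg Om
 unfolding Om_def by (intro bimodule.intro alg_calgebra direct_sum_alg_bimodule bimodule_plus bimodule_minus)

lemma Om_simps:
 "carrier Om = carrier left_plus \<times> carrier left_minus" "\<zero>\<^bsub>Om\<^esub> = (\<zero>\<^bsub>left_plus\<^esub>, \<zero>\<^bsub>left_minus\<^esub>)"
 "x \<oplus>\<^bsub>Om\<^esub> y = (fst x \<oplus>\<^bsub>left_plus\<^esub> fst y, snd x \<oplus>\<^bsub>left_minus\<^esub> snd y)"
 "c \<odot>\<^bsub>Om\<^esub> x = (c \<odot>\<^bsub>left_plus\<^esub> fst x, c \<odot>\<^bsub>left_minus\<^esub> snd x)"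
 "lact Om b x = (lact left_plus b (fst x), lact left_minus b (snd x))"
 "ract Om x b = (rp (fst x) b, rm (snd x) b)"
 by (simp_all add: Om_def direct_sum_def)

lemma zero_acts [simp]:
 "b \<in> carrier alg ==> lact left_plus b \<zero>\<^bsub>left_plus\<^esub> = \<zero>\<^bsub>left_plus\<^esub>"
 "b \<in> carrier alg ==> lact left_minus b \<zero>\<^bsub>left_minus\<^esub> = \<zero>\<^bsub>left_minus\<^esub>"
 "b \<in> carrier alg ==> rp \<zero>\<^bsub>left_plus\<^esub> b = \<zero>\<^bsub>left_plus\<^esub>"
 "b \<in> carrier alg ==> rm \<zero>\<^bsub>left_minus\<^esub> b = \<zero>\<^bsub>left_minus\<^esub>"
 using Lp.l_zero[of b] Lm.l_zero[of b] Lp.r_zero[of b] Lm.r_zero[of b] by simp_all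

lemma in_plus_linear: "clinear_map left_plus Om (%x. (x, \<zero>\<^bsub>left_minus\<^esub>))"
 and in_minus_linear: "clinear_map left_minus Om (%x. (\<zero>\<^bsub>left_plus\<^esub>, x))"
 by (auto simp: clinear_map_def Om_simps)

lemma dP_closed [simp]: "dP is \<in> carrier Om" and dbarP_closed [simp]: "dbarP is \<in> carrier Om"
 by (simp_all add: dP_def dbarP_def Om_simps)

definition "pdP \<phi> e = \<phi> (lact Om (P [e 0, e 1]) (dP [e 2, e 3]))" for \<phi> :: "'n form \<Rightarrow> complex" and e :: "'n legs"
definition "pdbarP \<phi> e = \<phi> (lact Om (P [e 0, e 1]) (dbarP [e 2, e 3]))" for \<phi> :: "'n form \<Rightarrow> complex" and e :: "'n legs"
definition "dPp \<phi> e = \<phi> (ract Om (dP [e 0, e 1]) (P [e 2, e 3]))" for \<phi> :: "'n form \<Rightarrow> complex" and e :: "'n legs"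
definition "dbarPp \<phi> e = \<phi> (ract Om (dbarP [e 0, e 1]) (P [e 2, e 3]))" for \<phi> :: "'n form \<Rightarrow> complex" and e :: "'n legs"

lemma pgen_plus: "plus.pgen (%x. \<phi> (x, \<zero>\<^bsub>left_minus\<^esub>)) = pdP \<phi>"
 by (rule ext) (simp add: plus.pgen_def pdP_def Om_simps dP_def)

lemma pgen_minus: "minus.pgen (%x. \<phi> (\<zero>\<^bsub>left_plus\<^esub>, x)) = pdbarP \<phi>"
 by (rule ext) (simp add: minus.pgen_def pdbarP_def Om_simps dbarP_def)

context
 fixes \<phi> assumes \<phi>: "functional Om \<phi>"
begin

lemma functional_plus: "functional left_plus (%x. \<phi> (x, \<zero>\<^bsub>left_minus\<^esub>))"
 by (rule functional_compose[OF in_plus_linear \<phi>])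

lemma functional_minus': "functional left_minus (%x. \<phi> (\<zero>\<^bsub>left_plus\<^esub>, x))"
 by (rule functional_compose[OF in_minus_linear \<phi>])

lemma St_pdP: "St 0 (pdP \<phi>) = (%e. 1 / (tw * Q) * pdP \<phi> e)"
 unfolding pgen_plus[symmetric]
proof (rule plus.relation_St[OF functional_plus])
 fix "is" :: "'n list" assume "length is = 4"
 moreover have "1 / (tw * Q) = qpow q (- par_w)" by (simp only: qpow_minus[OF q_pos(1)] qpow_w)
 ultimately show "fam_diff free_forms (S234' free_forms plus.pdp) (fam_smult free_forms (1 / (tw * Q)) plus.pdp) is \<in> plus_gens"
  unfolding plus_gens_def Let_def by auto
qed

lemma S_pdbarP: "S 0 (pdbarP \<phi>) = (%e. tw * Q * pdbarP \<phi> e)"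
 unfolding pgen_minus[symmetric]
proof (rule minus.relation_S[OF functional_minus'])
 fix "is" :: "'n list" assume "length is = 4"
 then show "fam_diff free_forms (S123 free_forms minus.pdp) (fam_smult free_forms (tw * Q) minus.pdp) is \<in> minus_gens"
  unfolding minus_gens_def Let_def qpow_w by auto
qed

lemma trace_dP: "(\<Sum>k\<in>UNIV. wt k * \<phi> (dP [k, k])) = 0"
 using plus.relation_trace[OF functional_plus] by (simp add: plus_gens_def dP_def Let_def)

lemma trace_dbarP: "(\<Sum>k\<in>UNIV. wt k * \<phi> (dbarP [k, k])) = 0"
 using minus.relation_trace[OF functional_minus'] by (simp add: minus_gens_def dbarP_def Let_def)

lemma dPp_eq: "dPp \<phi> = (%e. Q ^ 2 * S 0 (St 0 (pdP \<phi>)) e)"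
proof
 fix e
 let ?\<psi> = "%x. \<phi> (x, \<zero>\<^bsub>left_minus\<^esub>)" and ?F = "fam_prod (lact left_plus) P dP_plus"
 interpret f: family_functional q r s V lam left_plus ?\<psi>
  by (intro family_functional.intro family_functional_axioms.intro quantum_projective_space_axioms
    plus.L.cspace_axioms functional_plus)
 have cF: "?F is \<in> carrier left_plus" for "is" using Lp.l_closed[of "P (take 2 is)" "dP_plus (drop 2 is)"] by (simp add: fam_prod_def)
 have cl: "f.closed_family 4 ?F" unfolding f.closed_family_def using cF by blast
 have F: "fam_eval ?\<psi> 4 ?F = pdP \<phi>"
  by (rule ext) (simp add: fam_eval_def legs4 fam_prod_def pdP_def dP_def Om_simps)
 have c: "T1234 left_plus ?F (legs_list 4 e) \<in> carrier left_plus"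
  using f.closed_S(5)[OF cl] length_legs_list unfolding f.closed_family_def by blast
 have "dPp \<phi> e = ?\<psi> (fam_prod rp dP_plus P (legs_list 4 e))"
  by (simp add: legs4 fam_prod_def dPp_def dP_def Om_simps)
 also have "\<dots> = Q ^ 2 * ?\<psi> (T1234 left_plus ?F (legs_list 4 e))"
  using plus.L.functional_smult[OF functional_plus c]
  by (simp only: right_plus[OF length_legs_list] fam_smult_def qpow_a)
 also have "?\<psi> (T1234 left_plus ?F (legs_list 4 e)) = S 0 (St 0 (pdP \<phi>)) e"
  using fun_cong[OF f.eval_T1234[OF cl], of e] unfolding F by (simp add: fam_eval_def)
 finally show "dPp \<phi> e = Q ^ 2 * S 0 (St 0 (pdP \<phi>)) e" .
qed

lemma dbarPp_eq: "dbarPp \<phi> = (%e. 1 / Q ^ 2 * S 0 (St 0 (pdbarP \<phi>)) e)"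
proof
 fix e
 let ?\<psi> = "%x. \<phi> (\<zero>\<^bsub>left_plus\<^esub>, x)" and ?F = "fam_prod (lact left_minus) P dP_minus"
 interpret f: family_functional q r s V lam left_minus ?\<psi>
  by (intro family_functional.intro family_functional_axioms.intro quantum_projective_space_axioms
    minus.L.cspace_axioms functional_minus')
 have cF: "?F is \<in> carrier left_minus" for "is" using Lm.l_closed[of "P (take 2 is)" "dP_minus (drop 2 is)"] by (simp add: fam_prod_def)
 have cl: "f.closed_family 4 ?F" unfolding f.closed_family_def using cF by blast
 have F: "fam_eval ?\<psi> 4 ?F = pdbarP \<phi>"
  by (rule ext) (simp add: fam_eval_def legs4 fam_prod_def pdbarP_def dbarP_def Om_simps)
 have c: "T1234 left_minus ?F (legs_list 4 e) \<in> carrier left_minus"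
  using f.closed_S(5)[OF cl] length_legs_list unfolding f.closed_family_def by blast
 have "dbarPp \<phi> e = ?\<psi> (fam_prod rm dP_minus P (legs_list 4 e))"
  by (simp add: legs4 fam_prod_def dbarPp_def dbarP_def Om_simps)
 also have "\<dots> = 1 / Q ^ 2 * ?\<psi> (T1234 left_minus ?F (legs_list 4 e))"
  using minus.L.functional_smult[OF functional_minus' c]
  by (simp only: right_minus[OF length_legs_list] fam_smult_def qpow_minus[OF q_pos(1)] qpow_a)
 also have "?\<psi> (T1234 left_minus ?F (legs_list 4 e)) = S 0 (St 0 (pdbarP \<phi>)) e"
  using fun_cong[OF f.eval_T1234[OF cl], of e] unfolding F by (simp add: fam_eval_def)
 finally show "dbarPp \<phi> e = 1 / Q ^ 2 * S 0 (St 0 (pdbarP \<phi>)) e" .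
qed

lemma S_pdP: "S 0 (pdP \<phi>) = (%e. tw * Q / Q ^ 2 * dPp \<phi> e)"
 unfolding dPp_eq St_pdP S_smult using Q_nonzero tw_nonzero by (simp add: fun_eq_iff)

lemma S_dbarPp: "S 0 (dbarPp \<phi>) = (%e. tw * Q * dbarPp \<phi> e)"
 unfolding dbarPp_eq S_smult S_St S_pdbarP St_smult by (simp add: fun_eq_iff)

end

lemma P_dP:
 assumes "functional Om \<phi>"
 shows "(\<Sum>k\<in>UNIV. \<phi> (lact Om (P [a, k]) (dP [k, b]))) = 0"
proof -
 define e :: "'n legs" where "e = (%i. if i = 0 then a else b)"
 have "functional Om (%x. \<phi> (lact Om (P [a, b]) x))"
  by (rule functional_compose[OF Om.l_linear assms]) simp
 from trace_dP[OF this] skew_product[OF St_pdP[OF assms], of e] show ?thesis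
  by (simp add: contract_simps e_def pdP_def)
qed

lemma P_dbarP:
 assumes "functional Om \<phi>"
 shows "(\<Sum>k\<in>UNIV. \<phi> (lact Om (P [a, k]) (dbarP [k, b]))) = \<phi> (dbarP [a, b])"
proof -
 define e :: "'n legs" where "e = (%i. if i = 0 then a else b)"
 have "functional alg (%x. \<phi> (lact Om x (dbarP [a, b])))"
  by (rule functional_compose[OF Om.l_linear' assms]) simp
 from PP_eval(3)[OF this] symmetric_product[OF S_pdbarP[OF assms], of e] show ?thesis
  using Q_nonzero by (simp add: contract_simps e_def pdbarP_def)
qed

definition "delO b = (del b, \<zero>\<^bsub>left_minus\<^esub>)"
definition "delbarO b = (\<zero>\<^bsub>left_plus\<^esub>, delbar b)"

lemma del_facts:
 "clinear_map alg Om delO" "clinear_map alg Om delbarO"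
 "a \<in> carrier alg ==> b \<in> carrier alg ==> delO (a \<otimes>\<^bsub>alg\<^esub> b) = ract Om (delO a) b \<oplus>\<^bsub>Om\<^esub> lact Om a (delO b)"
 "a \<in> carrier alg ==> b \<in> carrier alg ==> delbarO (a \<otimes>\<^bsub>alg\<^esub> b) = ract Om (delbarO a) b \<oplus>\<^bsub>Om\<^esub> lact Om a (delbarO b)"
 "length is = 2 ==> delO (P is) = dP is" "length is = 2 ==> delbarO (P is) = dbarP is"
 "b \<in> carrier alg ==> d0 b = delO b \<oplus>\<^bsub>Om\<^esub> delbarO b"
proof -
 have d: "clinear_map alg Lp del" "clinear_map alg Lm delbar"
  using del(1) delbar(1) by (auto simp: derivation_into_def)
 have dc: "del b \<in> carrier left_plus" "delbar b \<in> carrier left_minus" if "b \<in> carrier alg" for b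
  using clinear_mapD(1)[OF d(1) that] clinear_mapD(1)[OF d(2) that] by simp_all
 have z: "\<zero>\<^bsub>left_plus\<^esub> \<in> carrier left_plus" "\<zero>\<^bsub>left_minus\<^esub> \<in> carrier left_minus" by simp_all
 show "clinear_map alg Om delO"
  using clinear_mapD[OF d(1)] by (auto simp: clinear_map_def Om_simps delO_def)
 show "clinear_map alg Om delbarO"
  using clinear_mapD[OF d(2)] by (auto simp: clinear_map_def Om_simps delbarO_def)
 show "delO (a \<otimes>\<^bsub>alg\<^esub> b) = ract Om (delO a) b \<oplus>\<^bsub>Om\<^esub> lact Om a (delO b)"
  if "a \<in> carrier alg" "b \<in> carrier alg" for a b
  using del(1) that by (simp add: derivation_into_def Om_simps delO_def)
 show "delbarO (a \<otimes>\<^bsub>alg\<^esub> b) = ract Om (delbarO a) b \<oplus>\<^bsub>Om\<^esub> lact Om a (delbarO b)"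
  if "a \<in> carrier alg" "b \<in> carrier alg" for a b
  using delbar(1) that by (simp add: derivation_into_def Om_simps delbarO_def)
 show "length is = 2 ==> delO (P is) = dP is" "length is = 2 ==> delbarO (P is) = dbarP is"
  by (simp_all add: delO_def delbarO_def dP_def dbarP_def del delbar)
 show "b \<in> carrier alg ==> d0 b = delO b \<oplus>\<^bsub>Om\<^esub> delbarO b"
  using dc[of b] by (simp add: d0_def delO_def delbarO_def Om_simps)
qed

lemma d0_linear: "clinear_map alg Om d0"
 using clinear_mapD[OF del_facts(1)] clinear_mapD[OF del_facts(2)]
 by (auto simp: clinear_map_def del_facts(7) Om.M.sm_distr Om.M.a_ac)

lemma d0_closed [simp]: "b \<in> carrier alg ==> d0 b \<in> carrier Om"
 by (rule clinear_mapD(1)[OF d0_linear])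

lemma d0_P: "d0 (P [i, j]) = dP [i, j] \<oplus>\<^bsub>Om\<^esub> dbarP [i, j]"
 by (simp add: del_facts)

lemma d0_mult:
 assumes "a \<in> carrier alg" "b \<in> carrier alg"
 shows "d0 (a \<otimes>\<^bsub>alg\<^esub> b) = ract Om (d0 a) b \<oplus>\<^bsub>Om\<^esub> lact Om a (d0 b)"
proof -
 have c: "delO x \<in> carrier Om" "delbarO x \<in> carrier Om" if "x \<in> carrier alg" for x
  using clinear_mapD(1)[OF del_facts(1) that] clinear_mapD(1)[OF del_facts(2) that] by simp_all
 show ?thesis using assms c[of a] c[of b]
  by (simp add: del_facts(3,4,7) Om.add_mod Om.M.a_ac)
qed

text \<open>The products in the other order follow by applying \<open>\<partial>\<close> and \<open>\<bar>\<partial>\<close> to \<open>p \<cdot> p = p\<close>.\<close>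

lemma dP_P:
 assumes \<phi>: "functional Om \<phi>"
 shows "(\<Sum>k\<in>UNIV. \<phi> (ract Om (dP [a, k]) (P [k, b]))) = \<phi> (dP [a, b])"
proof -
 have "(\<Sum>k\<in>UNIV. \<phi> (delO (P [a, k] \<otimes>\<^bsub>alg\<^esub> P [k, b]))) = \<phi> (delO (P [a, b]))"
  by (rule P_P[OF functional_compose[OF del_facts(1) \<phi>]])
 then show ?thesis using P_dP[OF \<phi>, of a b]
  by (simp add: del_facts Om.M.functional_add[OF \<phi>] sum.distrib)
qed

lemma dbarP_P:
 assumes \<phi>: "functional Om \<phi>"
 shows "(\<Sum>k\<in>UNIV. \<phi> (ract Om (dbarP [a, k]) (P [k, b]))) = 0"
proof -
 have "(\<Sum>k\<in>UNIV. \<phi> (delbarO (P [a, k] \<otimes>\<^bsub>alg\<^esub> P [k, b]))) = \<phi> (delbarO (P [a, b]))"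
  by (rule P_P[OF functional_compose[OF del_facts(2) \<phi>]])
 then show ?thesis using P_dbarP[OF \<phi>, of a b]
  by (simp add: del_facts Om.M.functional_add[OF \<phi>] sum.distrib)
qed

lemma form_induct [consumes 1, case_names plus minus add]:
 assumes "x \<in> carrier Om"
  and p: "\<And>b i j. b \<in> carrier alg ==> R (lact Om b (dP [i, j]))"
  and m: "\<And>b i j. b \<in> carrier alg ==> R (lact Om b (dbarP [i, j]))"
  and a: "\<And>x y. x \<in> carrier Om ==> y \<in> carrier Om ==> R x ==> R y ==> R (x \<oplus>\<^bsub>Om\<^esub> y)"
 shows "R x"
proof -
 have b0: "\<zero>\<^bsub>alg\<^esub> \<in> carrier alg" by simp
 have "lact Om \<zero>\<^bsub>alg\<^esub> (dP [i, j]) = \<zero>\<^bsub>Om\<^esub>" for i j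
  using clinear_zero[OF alg.Bv.cspace_axioms Om.M.cspace_axioms Om.l_linear'[OF dP_closed]] .
 then have z: "R \<zero>\<^bsub>Om\<^esub>" using p[OF b0] by metis
 have "R (y, \<zero>\<^bsub>left_minus\<^esub>)" if "y \<in> carrier left_plus" for y
  using that
 proof (induction y rule: plus.quotient_induct)
  case zero then show ?case using z by (simp add: Om_simps)
 next
  case (gen b i j) then show ?case using p[of b i j] by (simp add: Om_simps dP_def)
 next
  case (add u v) then show ?case using a[OF _ _ add(3,4)] by (simp add: Om_simps)
 qed
 moreover have "R (\<zero>\<^bsub>left_plus\<^esub>, y)" if "y \<in> carrier left_minus" for y
  using that
 proof (induction y rule: minus.quotient_induct)
  case zero then show ?case using z by (simp add: Om_simps)
 next
  case (gen b i j) then show ?case using m[of b i j] by (simp add: Om_simps dbarP_def)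
 next
  case (add u v) then show ?case using a[OF _ _ add(3,4)] by (simp add: Om_simps)
 qed
 moreover obtain u v where uv: "x = (u, v)" "u \<in> carrier left_plus" "v \<in> carrier left_minus"
  using assms(1) by (auto simp: Om_simps)
 ultimately show ?thesis using a[of "(u, \<zero>\<^bsub>left_minus\<^esub>)" "(\<zero>\<^bsub>left_plus\<^esub>, v)"] by (simp add: Om_simps)
qed

end

section \<open>Forms of degree two and the exterior derivative\<close>

lemma clinear_add:
 assumes "cspace N" "clinear_map M N f" "clinear_map M N g"
 shows "clinear_map M N (%x. f x \<oplus>\<^bsub>N\<^esub> g x)"
proof -
 interpret cspace N by fact
 show ?thesis using assms(2,3) by (auto simp: clinear_map_def Pi_iff sm_distr a_ac)
qed

lemma clinear_diff:
 assumes "cspace N" "clinear_map M N f" "clinear_map M N g"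
 shows "clinear_map M N (%x. f x \<ominus>\<^bsub>N\<^esub> g x)"
proof -
 interpret cspace N by fact
 show ?thesis using assms(2,3) by (auto simp: clinear_map_def Pi_iff minus_sm sm_distr sm_assoc a_ac mult.commute)
qed

lemma bimodule_mapD:
 assumes "bimodule_map B M N f"
 shows "clinear_map M N f" "b \<in> carrier B ==> x \<in> carrier M ==> f (lact M b x) = lact N b (f x)"
  "b \<in> carrier B ==> x \<in> carrier M ==> f (ract M x b) = ract N (f x) b"
 using assms by (auto simp: bimodule_map_def)

lemma (in bimodule_pair) tensor_linear_eqI:
 assumes "clinear_map MN X f" "clinear_map MN X g"
  and "\<And>x y. x \<in> carrier M ==> y \<in> carrier N ==> f (ten x y) = g (ten x y)" and "t \<in> carrier MN"
 shows "f t = g t"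
 using assms(4)
 by (induction t rule: tensor_induct) (simp_all add: assms(3) clinear_mapD(2)[OF assms(1)] clinear_mapD(2)[OF assms(2)])

context hk_calculus
begin

sublocale OO: bimodule_pair alg Om Om
 rewrites "tensor alg Om Om = OmOm" and "tens alg Om Om = tt"
proof -
 show "bimodule_pair alg Om Om" by (intro bimodule_pair.intro Om.bimodule_axioms)
qed (simp_all add: OmOm_def tt_def)

sublocale OmOm: bimodule alg OmOm by (rule OO.tensor_bimodule)

lemma tt_closed [simp, intro]: "x \<in> carrier Om ==> y \<in> carrier Om ==> tt x y \<in> carrier OmOm"
 by (rule OO.ten_closed)

lemma universal_gens_closed:
 "{(\<Oplus>\<^bsub>OmOm\<^esub>i\<in>{..<k}. tt (d0 (u i)) (d0 (v i))) | (k :: nat) u v.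
    u \<in> {..<k} \<rightarrow> carrier alg \<and> v \<in> {..<k} \<rightarrow> carrier alg \<and>
    (\<Oplus>\<^bsub>Om\<^esub>i\<in>{..<k}. lact Om (u i) (d0 (v i))) = \<zero>\<^bsub>Om\<^esub>} \<subseteq> carrier OmOm"
 by (auto intro!: OO.MN.finsum_closed tt_closed d0_closed)

sublocale U: subbimodule alg OmOm universal_relations
 rewrites "quot_bimod OmOm universal_relations = Om2"
proof -
 show "subbimodule alg OmOm universal_relations"
  unfolding universal_relations_def by (rule OmOm.bimod_span_subbimodule(1)[OF universal_gens_closed])
qed (simp add: Om2_def)

sublocale Om2: bimodule alg Om2
 by (intro bimodule.intro alg_calgebra U.quot_alg_bimodule)

lemma wedge_proj_linear: "clinear_map OmOm Om2 wedge_proj"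
 unfolding wedge_proj_def by (rule U.quot_linear)

lemma wedge_proj_acts:
 "b \<in> carrier alg ==> t \<in> carrier OmOm ==> wedge_proj (lact OmOm b t) = lact Om2 b (wedge_proj t)"
 "b \<in> carrier alg ==> t \<in> carrier OmOm ==> wedge_proj (ract OmOm t b) = ract Om2 (wedge_proj t) b"
 by (simp_all add: wedge_proj_def U.quot_l U.quot_r)

lemma wedge_linear:
 "y \<in> carrier Om ==> clinear_map Om Om2 (%x. wedge x y)" "x \<in> carrier Om ==> clinear_map Om Om2 (wedge x)"
 unfolding wedge_def
 by (rule clinear_compose[OF OO.ten_linear_left wedge_proj_linear], assumption)
  (rule clinear_compose[OF OO.ten_linear_right wedge_proj_linear])

lemma wedge_closed [simp]: "x \<in> carrier Om ==> y \<in> carrier Om ==> wedge x y \<in> carrier Om2"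
 by (rule clinear_mapD(1)[OF wedge_linear(2)])

lemma wedge_acts:
 assumes "x \<in> carrier Om" "y \<in> carrier Om" "b \<in> carrier alg"
 shows "wedge (lact Om b x) y = lact Om2 b (wedge x y)" "wedge x (ract Om y b) = ract Om2 (wedge x y) b"
  "wedge (ract Om x b) y = wedge x (lact Om b y)"
proof -
 have "tt (lact Om b x) y = lact OmOm b (tt x y)" "tt x (ract Om y b) = ract OmOm (tt x y) b"
  using assms by (simp_all add: OO.lact_ten OO.ract_ten)
 then show "wedge (lact Om b x) y = lact Om2 b (wedge x y)" "wedge x (ract Om y b) = ract Om2 (wedge x y) b"
  using assms by (simp_all add: wedge_def wedge_proj_acts)
 show "wedge (ract Om x b) y = wedge x (lact Om b y)"
  using assms by (simp add: wedge_def OO.ten_balanced)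
qed

lemmas wedge_add_left = clinear_mapD(2)[OF wedge_linear(1)]
lemmas wedge_add_right = clinear_mapD(2)[OF wedge_linear(2)]

text \<open>
 The exterior derivative is defined by a choice of a presentation \<open>\<Sum> u\<^sub>i dv\<^sub>i\<close>. As a relation it is linear, the value at
 zero is zero by the relations of the universal calculus, and every form has a presentation because
 \<open>\<bar>\<partial>p = p \<cdot> dp\<close> and \<open>\<partial>p = dp - \<bar>\<partial>p\<close>. Hence it is a linear map.
\<close>

definition represents :: "'n form \<Rightarrow> 'n form2 \<Rightarrow> bool" where
 "represents \<omega> y \<longleftrightarrow> (\<exists>(k :: nat) u v.
  u \<in> {..<k} \<rightarrow> carrier alg \<and> v \<in> {..<k} \<rightarrow> carrier alg \<and>
  \<omega> = (\<Oplus>\<^bsub>Om\<^esub>i\<in>{..<k}. lact Om (u i) (d0 (v i))) \<and>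
  y = (\<Oplus>\<^bsub>Om2\<^esub>i\<in>{..<k}. wedge (d0 (u i)) (d0 (v i))))"

lemma represents_closed: "represents \<omega> y ==> \<omega> \<in> carrier Om" "represents \<omega> y ==> y \<in> carrier Om2"
 unfolding represents_def
 by (auto intro!: Om.M.finsum_closed Om2.M.finsum_closed Om.l_closed wedge_closed d0_closed)

lemma represents_zero: "represents \<zero>\<^bsub>Om\<^esub> \<zero>\<^bsub>Om2\<^esub>"
 unfolding represents_def by (rule exI[of _ 0]) auto

lemma represents_snoc:
 assumes "represents \<omega> y" "a \<in> carrier alg" "b \<in> carrier alg"
 shows "represents (\<omega> \<oplus>\<^bsub>Om\<^esub> lact Om a (d0 b)) (y \<oplus>\<^bsub>Om2\<^esub> wedge (d0 a) (d0 b))"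
proof -
 obtain k u v where k: "u \<in> {..<k::nat} \<rightarrow> carrier alg" "v \<in> {..<k} \<rightarrow> carrier alg"
  "\<omega> = (\<Oplus>\<^bsub>Om\<^esub>i\<in>{..<k}. lact Om (u i) (d0 (v i)))" "y = (\<Oplus>\<^bsub>Om2\<^esub>i\<in>{..<k}. wedge (d0 (u i)) (d0 (v i)))"
  using assms(1) unfolding represents_def by blast
 note c = represents_closed[OF assms(1)]
 let ?u = "u(k := a)" and ?v = "v(k := b)"
 have m: "?u i \<in> carrier alg" "?v i \<in> carrier alg" if "i \<in> {..<Suc k}" for i
  using that k(1,2) assms(2,3) by (auto simp: Pi_iff)
 have "(\<Oplus>\<^bsub>Om\<^esub>i\<in>{..<k}. lact Om (?u i) (d0 (?v i))) = \<omega>" unfolding k(3)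
  by (rule Om.M.finsum_cong') (use k(1,2) in \<open>auto simp: Pi_iff\<close>)
 moreover have "(\<Oplus>\<^bsub>Om\<^esub>i\<in>insert k {..<k}. lact Om (?u i) (d0 (?v i))) =
   lact Om (?u k) (d0 (?v k)) \<oplus>\<^bsub>Om\<^esub> (\<Oplus>\<^bsub>Om\<^esub>i\<in>{..<k}. lact Om (?u i) (d0 (?v i)))"
  by (rule Om.M.finsum_insert) (use m in \<open>auto simp: lessThan_Suc Pi_iff simp del: fun_upd_apply\<close>)
 ultimately have 1: "\<omega> \<oplus>\<^bsub>Om\<^esub> lact Om a (d0 b) = (\<Oplus>\<^bsub>Om\<^esub>i\<in>{..<Suc k}. lact Om (?u i) (d0 (?v i)))"
  using c assms by (simp add: lessThan_Suc Om.M.a_comm)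
 have "(\<Oplus>\<^bsub>Om2\<^esub>i\<in>{..<k}. wedge (d0 (?u i)) (d0 (?v i))) = y" unfolding k(4)
  by (rule Om2.M.finsum_cong') (use k(1,2) in \<open>auto simp: Pi_iff\<close>)
 moreover have "(\<Oplus>\<^bsub>Om2\<^esub>i\<in>insert k {..<k}. wedge (d0 (?u i)) (d0 (?v i))) =
   wedge (d0 (?u k)) (d0 (?v k)) \<oplus>\<^bsub>Om2\<^esub> (\<Oplus>\<^bsub>Om2\<^esub>i\<in>{..<k}. wedge (d0 (?u i)) (d0 (?v i)))"
  by (rule Om2.M.finsum_insert) (use m in \<open>auto simp: lessThan_Suc Pi_iff simp del: fun_upd_apply\<close>)
 ultimately have 2: "y \<oplus>\<^bsub>Om2\<^esub> wedge (d0 a) (d0 b) = (\<Oplus>\<^bsub>Om2\<^esub>i\<in>{..<Suc k}. wedge (d0 (?u i)) (d0 (?v i)))"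
  using c assms by (simp add: lessThan_Suc Om2.M.a_comm)
 have 3: "?u \<in> {..<Suc k} \<rightarrow> carrier alg" "?v \<in> {..<Suc k} \<rightarrow> carrier alg"
  by (rule Pi_I, erule m)+
 show ?thesis unfolding represents_def
  by (rule exI[of _ "Suc k"], rule exI[of _ ?u], rule exI[of _ ?v], intro conjI, rule 3, rule 3, rule 1, rule 2)
qed

text \<open>An induction principle: the represented pairs are the sums of the elementary ones.\<close>

lemma represents_induct [consumes 1, case_names zero snoc]:
 assumes "represents \<omega> y" and z: "R \<zero>\<^bsub>Om\<^esub> \<zero>\<^bsub>Om2\<^esub>"
  and s: "\<And>\<omega> y a b. represents \<omega> y ==> R \<omega> y ==> a \<in> carrier alg ==> b \<in> carrier alg ==>
   R (\<omega> \<oplus>\<^bsub>Om\<^esub> lact Om a (d0 b)) (y \<oplus>\<^bsub>Om2\<^esub> wedge (d0 a) (d0 b))"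
 shows "R \<omega> y"
proof -
 obtain k u v where k: "u \<in> {..<k::nat} \<rightarrow> carrier alg" "v \<in> {..<k} \<rightarrow> carrier alg"
  "\<omega> = (\<Oplus>\<^bsub>Om\<^esub>i\<in>{..<k}. lact Om (u i) (d0 (v i)))" "y = (\<Oplus>\<^bsub>Om2\<^esub>i\<in>{..<k}. wedge (d0 (u i)) (d0 (v i)))"
  using assms(1) unfolding represents_def by blast
 have "n \<le> k ==> represents (\<Oplus>\<^bsub>Om\<^esub>i\<in>{..<n}. lact Om (u i) (d0 (v i))) (\<Oplus>\<^bsub>Om2\<^esub>i\<in>{..<n}. wedge (d0 (u i)) (d0 (v i))) \<and>
   R (\<Oplus>\<^bsub>Om\<^esub>i\<in>{..<n}. lact Om (u i) (d0 (v i))) (\<Oplus>\<^bsub>Om2\<^esub>i\<in>{..<n}. wedge (d0 (u i)) (d0 (v i)))" for n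
 proof (induction n)
  case 0
  then show ?case using z represents_zero by simp
 next
  case (Suc n)
  then have m: "u i \<in> carrier alg" "v i \<in> carrier alg" if "i \<le> n" for i using that k(1,2) by (auto simp: Pi_iff)
  let ?o = "\<Oplus>\<^bsub>Om\<^esub>i\<in>{..<n}. lact Om (u i) (d0 (v i))" and ?y = "\<Oplus>\<^bsub>Om2\<^esub>i\<in>{..<n}. wedge (d0 (u i)) (d0 (v i))"
  from Suc have IH: "represents ?o ?y" "R ?o ?y" by auto
  note c = represents_closed[OF IH(1)]
  have "(\<Oplus>\<^bsub>Om\<^esub>i\<in>insert n {..<n}. lact Om (u i) (d0 (v i))) = lact Om (u n) (d0 (v n)) \<oplus>\<^bsub>Om\<^esub> ?o"
   by (rule Om.M.finsum_insert) (use m in \<open>auto simp: Pi_iff\<close>)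
  then have 1: "(\<Oplus>\<^bsub>Om\<^esub>i\<in>{..<Suc n}. lact Om (u i) (d0 (v i))) = ?o \<oplus>\<^bsub>Om\<^esub> lact Om (u n) (d0 (v n))"
   using c m by (simp add: lessThan_Suc Om.M.a_comm)
  have "(\<Oplus>\<^bsub>Om2\<^esub>i\<in>insert n {..<n}. wedge (d0 (u i)) (d0 (v i))) = wedge (d0 (u n)) (d0 (v n)) \<oplus>\<^bsub>Om2\<^esub> ?y"
   by (rule Om2.M.finsum_insert) (use m in \<open>auto simp: Pi_iff\<close>)
  then have 2: "(\<Oplus>\<^bsub>Om2\<^esub>i\<in>{..<Suc n}. wedge (d0 (u i)) (d0 (v i))) = ?y \<oplus>\<^bsub>Om2\<^esub> wedge (d0 (u n)) (d0 (v n))"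
   using c m by (simp add: lessThan_Suc Om2.M.a_comm)
  show ?case unfolding 1 2 using represents_snoc[OF IH(1), of "u n" "v n"] s[OF IH, of "u n" "v n"] m by simp
 qed
 from this[of k] k(3,4) show ?thesis by simp
qed

lemma represents_gen: "a \<in> carrier alg ==> b \<in> carrier alg ==> represents (lact Om a (d0 b)) (wedge (d0 a) (d0 b))"
 using represents_snoc[OF represents_zero, of a b] by simp

lemma represents_add:
 assumes "represents \<omega> y" "represents \<omega>' y'"
 shows "represents (\<omega> \<oplus>\<^bsub>Om\<^esub> \<omega>') (y \<oplus>\<^bsub>Om2\<^esub> y')"
 using assms(2)
proof (induction rule: represents_induct)
 case zero
 then show ?case using assms(1) represents_closed[OF assms(1)] by simp
next
 case (snoc \<omega>' y' a b)
 then show ?case using represents_snoc[OF snoc(4,2,3)] represents_closed[OF assms(1)] snoc(2,3) represents_closed[OF snoc(1)]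
  by (simp add: Om.M.a_assoc Om2.M.a_assoc)
qed

lemma represents_smult:
 assumes "represents \<omega> y"
 shows "represents (c \<odot>\<^bsub>Om\<^esub> \<omega>) (c \<odot>\<^bsub>Om2\<^esub> y)"
 using assms
proof (induction rule: represents_induct)
 case zero
 then show ?case using represents_zero by simp
next
 case (snoc \<omega> y a b)
 have "d0 (c \<odot>\<^bsub>alg\<^esub> a) = c \<odot>\<^bsub>Om\<^esub> d0 a" by (rule clinear_mapD(3)[OF d0_linear snoc(2)])
 then have "wedge (d0 (c \<odot>\<^bsub>alg\<^esub> a)) (d0 b) = c \<odot>\<^bsub>Om2\<^esub> wedge (d0 a) (d0 b)"
  using snoc(2,3) by (simp add: clinear_mapD(3)[OF wedge_linear(1)])
 moreover have "lact Om (c \<odot>\<^bsub>alg\<^esub> a) (d0 b) = c \<odot>\<^bsub>Om\<^esub> lact Om a (d0 b)" using snoc(2,3) by (simp add: Om.l_smult)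
 ultimately show ?case using represents_snoc[OF snoc(4), of "c \<odot>\<^bsub>alg\<^esub> a" b] snoc(2,3) represents_closed[OF snoc(1)]
  by (simp add: Om.M.sm_distr Om2.M.sm_distr)
qed

lemma represents_zero_unique:
 assumes "represents \<zero>\<^bsub>Om\<^esub> y"
 shows "y = \<zero>\<^bsub>Om2\<^esub>"
proof -
 obtain k u v where k: "u \<in> {..<k::nat} \<rightarrow> carrier alg" "v \<in> {..<k} \<rightarrow> carrier alg"
  "\<zero>\<^bsub>Om\<^esub> = (\<Oplus>\<^bsub>Om\<^esub>i\<in>{..<k}. lact Om (u i) (d0 (v i)))" "y = (\<Oplus>\<^bsub>Om2\<^esub>i\<in>{..<k}. wedge (d0 (u i)) (d0 (v i)))"
  using assms(1) unfolding represents_def by blast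
 let ?t = "\<Oplus>\<^bsub>OmOm\<^esub>i\<in>{..<k}. tt (d0 (u i)) (d0 (v i))"
 have "?t \<in> universal_relations"
  using OmOm.bimod_span_subbimodule(2)[OF universal_gens_closed] k(1,2) k(3)[symmetric]
  unfolding universal_relations_def by blast
 moreover have tc: "?t \<in> carrier OmOm" using k(1,2) by (intro OO.MN.finsum_closed) (auto simp: Pi_iff)
 moreover have "y = wedge_proj ?t"
  unfolding k(4) wedge_def
  by (rule clinear_finsum[OF OO.MN.cspace_axioms Om2.M.cspace_axioms wedge_proj_linear, symmetric]) (use k(1,2) in \<open>auto simp: Pi_iff\<close>)
 ultimately have "y = wedge_proj \<zero>\<^bsub>OmOm\<^esub>"
  unfolding wedge_proj_def by (simp add: U.coset_eq_iff OO.MN.minus_sm)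
 then show ?thesis
  using clinear_zero[OF OO.MN.cspace_axioms Om2.M.cspace_axioms wedge_proj_linear] by simp
qed

lemma d1_eqI:
 assumes "represents \<omega> y"
 shows "d1 \<omega> = y"
 unfolding d1_def represents_def[symmetric]
proof (rule the_equality[where P = "represents \<omega>", OF assms])
 fix z assume "represents \<omega> z"
 note r = this represents_closed[OF this] represents_closed[OF assms]
 have "represents (\<omega> \<oplus>\<^bsub>Om\<^esub> (- 1) \<odot>\<^bsub>Om\<^esub> \<omega>) (z \<oplus>\<^bsub>Om2\<^esub> (- 1) \<odot>\<^bsub>Om2\<^esub> y)"
  by (intro represents_add represents_smult r assms)
 moreover have "\<omega> \<oplus>\<^bsub>Om\<^esub> (- 1) \<odot>\<^bsub>Om\<^esub> \<omega> = \<zero>\<^bsub>Om\<^esub>" using r by (simp add: Om.M.sm_minus_one Om.M.r_neg)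
 ultimately have "z \<oplus>\<^bsub>Om2\<^esub> (- 1) \<odot>\<^bsub>Om2\<^esub> y = \<zero>\<^bsub>Om2\<^esub>" using represents_zero_unique by metis
 then show "z = y" using r by (simp add: Om2.M.minus_sm[symmetric] Om2.M.minus_eq_zero)
qed

lemma represents_finsum:
 assumes "finite A" "\<And>k. k \<in> A ==> \<exists>y. represents (f k) y"
 shows "\<exists>y. represents (\<Oplus>\<^bsub>Om\<^esub>k\<in>A. f k) y"
 using assms
proof (induction A rule: finite_induct)
 case empty
 then show ?case using represents_zero by auto
next
 case (insert k A)
 have c: "f j \<in> carrier Om" if "j \<in> insert k A" for j using insert(4)[OF that] represents_closed by blast
 have "(\<Oplus>\<^bsub>Om\<^esub>k\<in>insert k A. f k) = f k \<oplus>\<^bsub>Om\<^esub> (\<Oplus>\<^bsub>Om\<^esub>k\<in>A. f k)"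
  by (rule Om.M.finsum_insert) (use insert(1,2) c in auto)
 moreover obtain y y' where "represents (f k) y" "represents (\<Oplus>\<^bsub>Om\<^esub>k\<in>A. f k) y'"
  using insert(3,4) by blast
 ultimately show ?case using represents_add by metis
qed

lemma dbarP_expand: 
 assumes b: "b \<in> carrier alg"
 shows "lact Om b (dbarP [i, j]) = (\<Oplus>\<^bsub>Om\<^esub>k\<in>UNIV. lact Om (b \<otimes>\<^bsub>alg\<^esub> P [i, k]) (d0 (P [k, j])))"
proof (rule Om.M.functional_eqI)
 fix \<phi> assume \<phi>: "functional Om \<phi>"
 have \<psi>: "functional Om (%x. \<phi> (lact Om b x))" by (rule functional_compose[OF Om.l_linear[OF b] \<phi>])
 show "\<phi> (lact Om b (dbarP [i, j])) = \<phi> (\<Oplus>\<^bsub>Om\<^esub>k\<in>UNIV. lact Om (b \<otimes>\<^bsub>alg\<^esub> P [i, k]) (d0 (P [k, j])))"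
  using P_dbarP[OF \<psi>, of i j] P_dP[OF \<psi>, of i j] b
  by (simp add: Om.M.functional_finsum[OF \<phi>] d0_P Om.add_mod Om.assoc Om.M.functional_add[OF \<phi>] sum.distrib)
qed (use b in auto)

lemma represents_ex: "\<omega> \<in> carrier Om ==> \<exists>y. represents \<omega> y"
proof (induction \<omega> rule: form_induct)
 case (minus b i j)
 have "\<exists>y. represents (lact Om (b \<otimes>\<^bsub>alg\<^esub> P [i, k]) (d0 (P [k, j]))) y" for k
  by (rule exI, rule represents_gen) (use minus in auto)
 then show ?case unfolding dbarP_expand[OF minus] by (intro represents_finsum) auto
next
 case (plus b i j)
 let ?m = "lact Om b (dbarP [i, j])"
 have "\<exists>y. represents (lact Om (b \<otimes>\<^bsub>alg\<^esub> P [i, k]) (d0 (P [k, j]))) y" for k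
  by (rule exI, rule represents_gen) (use plus in auto)
 then have "\<exists>y. represents ?m y" unfolding dbarP_expand[OF plus] by (intro represents_finsum) auto
 then obtain y where y: "represents ?m y" ..
 have "represents (lact Om b (d0 (P [i, j])) \<oplus>\<^bsub>Om\<^esub> (- 1) \<odot>\<^bsub>Om\<^esub> ?m) (wedge (d0 b) (d0 (P [i, j])) \<oplus>\<^bsub>Om2\<^esub> (- 1) \<odot>\<^bsub>Om2\<^esub> y)"
  by (intro represents_add represents_smult y represents_gen plus) simp
 moreover have "lact Om b (d0 (P [i, j])) \<oplus>\<^bsub>Om\<^esub> (- 1) \<odot>\<^bsub>Om\<^esub> ?m = lact Om b (dP [i, j])"
  using plus by (simp add: d0_P Om.add_mod Om.M.a_assoc Om.M.sm_minus_one Om.M.r_neg)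
 ultimately show ?case by auto
next
 case (add x y)
 then show ?case using represents_add by blast
qed

lemma d1_represents: "\<omega> \<in> carrier Om ==> represents \<omega> (d1 \<omega>)"
 using represents_ex[of \<omega>] d1_eqI by metis

lemma d1_gen: "a \<in> carrier alg ==> b \<in> carrier alg ==> d1 (lact Om a (d0 b)) = wedge (d0 a) (d0 b)"
 by (rule d1_eqI[OF represents_gen])

lemma d1_linear: "clinear_map Om Om2 d1"
proof -
 have "d1 (x \<oplus>\<^bsub>Om\<^esub> y) = d1 x \<oplus>\<^bsub>Om2\<^esub> d1 y" if "x \<in> carrier Om" "y \<in> carrier Om" for x y
  by (rule d1_eqI[OF represents_add[OF d1_represents[OF that(1)] d1_represents[OF that(2)]]])
 moreover have "d1 (c \<odot>\<^bsub>Om\<^esub> x) = c \<odot>\<^bsub>Om2\<^esub> d1 x" if "x \<in> carrier Om" for c x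
  by (rule d1_eqI[OF represents_smult[OF d1_represents[OF that]]])
 ultimately show ?thesis using represents_closed(2)[OF d1_represents] by (auto simp: clinear_map_def)
qed

lemma exact_induct [consumes 1, case_names zero add]:
 assumes "x \<in> carrier Om" and z: "R \<zero>\<^bsub>Om\<^esub>"
  and a: "\<And>x a b. x \<in> carrier Om ==> R x ==> a \<in> carrier alg ==> b \<in> carrier alg ==> R (x \<oplus>\<^bsub>Om\<^esub> lact Om a (d0 b))"
 shows "R x"
 using d1_represents[OF assms(1)]
 by (induction rule: represents_induct) (auto intro: z a represents_closed)

lemma d0_one: "d0 \<one>\<^bsub>alg\<^esub> = \<zero>\<^bsub>Om\<^esub>"
proof -
 have c: "d0 \<one>\<^bsub>alg\<^esub> \<in> carrier Om" by simp
 have "d0 \<one>\<^bsub>alg\<^esub> = d0 \<one>\<^bsub>alg\<^esub> \<oplus>\<^bsub>Om\<^esub> d0 \<one>\<^bsub>alg\<^esub>"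
  using d0_mult[of "\<one>\<^bsub>alg\<^esub>" "\<one>\<^bsub>alg\<^esub>"] by simp
 then show ?thesis using c by (metis Om.M.add.l_cancel_one')
qed

lemma d1_d0: "b \<in> carrier alg ==> d1 (d0 b) = \<zero>\<^bsub>Om2\<^esub>"
 using d1_gen[of "\<one>\<^bsub>alg\<^esub>" b] clinear_zero[OF Om.M.cspace_axioms Om2.M.cspace_axioms wedge_linear(1), of "d0 b"]
 by (simp add: d0_one)

lemmas d1_closed [simp] = clinear_mapD(1)[OF d1_linear]

lemma d1_lact:
 assumes b: "b \<in> carrier alg" and x: "x \<in> carrier Om"
 shows "d1 (lact Om b x) = wedge (d0 b) x \<oplus>\<^bsub>Om2\<^esub> lact Om2 b (d1 x)"
 using x
proof (induction x rule: exact_induct)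
 case zero
 have z: "d1 \<zero>\<^bsub>Om\<^esub> = \<zero>\<^bsub>Om2\<^esub>" "wedge (d0 b) \<zero>\<^bsub>Om\<^esub> = \<zero>\<^bsub>Om2\<^esub>"
  using clinear_zero[OF Om.M.cspace_axioms Om2.M.cspace_axioms d1_linear]
   clinear_zero[OF Om.M.cspace_axioms Om2.M.cspace_axioms wedge_linear(2)] b by auto
 then show ?case using b by simp
next
 case (add x a c)
 have "d1 (lact Om b (lact Om a (d0 c))) = wedge (d0 (b \<otimes>\<^bsub>alg\<^esub> a)) (d0 c)"
  using add b by (simp add: Om.assoc(1)[symmetric] d1_gen)
 also have "\<dots> = wedge (d0 b) (lact Om a (d0 c)) \<oplus>\<^bsub>Om2\<^esub> lact Om2 b (wedge (d0 a) (d0 c))"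
  using add b by (simp add: d0_mult wedge_add_left wedge_acts)
 finally show ?case
  using add b by (simp add: Om.add_mod clinear_mapD(2)[OF d1_linear] wedge_add_right Om2.add_mod d1_gen Om2.M.a_ac)
qed

text \<open>On \<open>a dc\<close>, both sides are found from the Leibniz rule for \<open>d(c b)\<close>.\<close>

lemma d1_ract:
 assumes b: "b \<in> carrier alg" and x: "x \<in> carrier Om"
 shows "d1 (ract Om x b) = ract Om2 (d1 x) b \<ominus>\<^bsub>Om2\<^esub> wedge x (d0 b)"
 using x
proof (induction x rule: exact_induct)
 case zero
 have z: "d1 \<zero>\<^bsub>Om\<^esub> = \<zero>\<^bsub>Om2\<^esub>" "wedge \<zero>\<^bsub>Om\<^esub> (d0 b) = \<zero>\<^bsub>Om2\<^esub>"
  using clinear_zero[OF Om.M.cspace_axioms Om2.M.cspace_axioms d1_linear]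
   clinear_zero[OF Om.M.cspace_axioms Om2.M.cspace_axioms wedge_linear(1)] b by auto
 then show ?case using b by (simp add: Om2.M.minus_sm)
next
 case (add x a c)
 note D = clinear_mapD(2,3)[OF d1_linear]
 let ?w = "wedge (d0 a)"
 have e: "lact Om a (d0 (c \<otimes>\<^bsub>alg\<^esub> b)) = ract Om (lact Om a (d0 c)) b \<oplus>\<^bsub>Om\<^esub> lact Om (a \<otimes>\<^bsub>alg\<^esub> c) (d0 b)"
  using add b by (simp add: d0_mult Om.add_mod Om.assoc)
 have s1: "d1 (ract Om (lact Om a (d0 c)) b) \<oplus>\<^bsub>Om2\<^esub> d1 (lact Om (a \<otimes>\<^bsub>alg\<^esub> c) (d0 b)) = ?w (d0 (c \<otimes>\<^bsub>alg\<^esub> b))"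
  using arg_cong[OF e, of d1] add b by (simp add: D d1_gen del: Om.assoc)
 have s2: "d1 (lact Om (a \<otimes>\<^bsub>alg\<^esub> c) (d0 b)) = ?w (lact Om c (d0 b)) \<oplus>\<^bsub>Om2\<^esub> wedge (lact Om a (d0 c)) (d0 b)"
  using add b by (simp add: d1_gen d0_mult wedge_add_left wedge_acts)
 have s3: "?w (d0 (c \<otimes>\<^bsub>alg\<^esub> b)) = ract Om2 (?w (d0 c)) b \<oplus>\<^bsub>Om2\<^esub> ?w (lact Om c (d0 b))"
  using add b by (simp add: d0_mult wedge_add_right wedge_acts)
 have "d1 (ract Om (lact Om a (d0 c)) b) = ract Om2 (?w (d0 c)) b \<ominus>\<^bsub>Om2\<^esub> wedge (lact Om a (d0 c)) (d0 b)"
 proof (rule Om2.M.functional_eqI)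
  fix \<phi> assume \<phi>: "functional Om2 \<phi>"
  note f = Om2.M.functional_add[OF \<phi>] Om2.M.functional_minus[OF \<phi>]
  show "\<phi> (d1 (ract Om (lact Om a (d0 c)) b)) = \<phi> (ract Om2 (?w (d0 c)) b \<ominus>\<^bsub>Om2\<^esub> wedge (lact Om a (d0 c)) (d0 b))"
   using arg_cong[OF s1, of \<phi>] arg_cong[OF s2, of \<phi>] arg_cong[OF s3, of \<phi>] add b by (simp add: f eq_diff_eq)
 qed (use add b in auto)
 then show ?case
  using add b by (simp add: Om.add_mod D wedge_add_left Om2.add_mod d1_gen Om2.M.minus_sm Om2.M.sm_distr Om2.M.a_ac)
qed

end

section \<open>Curvature and contraction maps\<close>

lemma clinear_cong:
 assumes "cspace A" "\<And>a. a \<in> carrier A ==> f a = g a" "clinear_map A X g"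
 shows "clinear_map A X f"
proof -
 interpret cspace A by fact
 show ?thesis using assms(3) by (auto simp: clinear_map_def assms(2) Pi_iff)
qed

text \<open>Maps induced from balanced maps depend linearly on parameters on which the latter depend linearly.\<close>

lemma (in bimodule_pair) tensor_lift_parameter:
 assumes A: "cspace A" and X: "cspace X" and f: "\<And>a. a \<in> carrier A ==> balanced_map B M N X (f a)"
  and lin: "\<And>x y. x \<in> carrier M ==> y \<in> carrier N ==> clinear_map A X (%a. f a x y)"
  and t: "t \<in> carrier MN"
 shows "clinear_map A X (%a. tensor_lift X (f a) t)"
 using t
proof (induction t rule: tensor_induct)
 case (ten x y)
 show ?case by (rule clinear_cong[OF A _ lin[OF ten]]) (simp add: balanced_map.lift_ten[OF f] ten)
next
 case (add u v)
 show ?case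
  by (rule clinear_cong[OF A _ clinear_add[OF X add(3,4)]])
   (simp add: clinear_mapD(2)[OF balanced_map.lift_linear[OF f]] add)
qed

context hk_calculus
begin

lemma balanced_OO:
 assumes "balanced_map alg Om Om X f"
 shows "x \<in> carrier Om ==> y \<in> carrier Om ==> tensor_lift X f (tt x y) = f x y"
  "clinear_map OmOm X (tensor_lift X f)"
 using balanced_map.lift_ten[OF assms] balanced_map.lift_linear[OF assms] by (simp_all add: tt_def OmOm_def)

abbreviation "ten2 \<equiv> tens alg Om2 Om"
abbreviation "ten3 \<equiv> tens alg OmOm Om"
abbreviation "OmOmOm \<equiv> tensor alg OmOm Om"

sublocale W: bimodule_pair alg Om2 Om
 rewrites "tensor alg Om2 Om = Om2Om"
proof -
 show "bimodule_pair alg Om2 Om" by (intro bimodule_pair.intro Om.bimodule_axioms Om2.bimodule_axioms)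
qed (simp add: Om2Om_def)

sublocale Om2Om: bimodule alg Om2Om by (rule W.tensor_bimodule)

sublocale T: bimodule_pair alg OmOm Om by (intro bimodule_pair.intro Om.bimodule_axioms OmOm.bimodule_axioms)

sublocale OmOmOm: bimodule alg OmOmOm by (rule T.tensor_bimodule)

lemma balanced_W:
 assumes "balanced_map alg Om2 Om X f"
 shows "x \<in> carrier Om2 ==> y \<in> carrier Om ==> tensor_lift X f (ten2 x y) = f x y"
  "clinear_map Om2Om X (tensor_lift X f)"
 using balanced_map.lift_ten[OF assms] balanced_map.lift_linear[OF assms] by (simp_all add: Om2Om_def)

lemma wedge_left_map:
 assumes "\<omega> \<in> carrier Om"
 shows "balanced_map alg Om Om Om2Om (%\<eta> \<zeta>. ten2 (wedge \<omega> \<eta>) \<zeta>)"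
proof (intro balanced_map.intro balanced_map_axioms.intro OO.bimodule_pair_axioms W.MN.cspace_axioms)
 show "y \<in> carrier Om ==> clinear_map Om Om2Om (%x. ten2 (wedge \<omega> x) y)" for y
  by (rule clinear_compose[OF wedge_linear(2)[OF assms] W.ten_linear_left])
 show "x \<in> carrier Om ==> clinear_map Om Om2Om (ten2 (wedge \<omega> x))" for x
  using assms by (intro W.ten_linear_right) simp
 show "x \<in> carrier Om ==> b \<in> carrier alg ==> y \<in> carrier Om ==>
   ten2 (wedge \<omega> (ract Om x b)) y = ten2 (wedge \<omega> x) (lact Om b y)" for x b y
  using assms by (simp add: wedge_acts W.ten_balanced)
qed

lemma wedge_left_tt: "\<omega> \<in> carrier Om ==> x \<in> carrier Om ==> y \<in> carrier Om ==> wedge_left \<omega> (tt x y) = ten2 (wedge \<omega> x) y"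
 unfolding wedge_left_def by (rule balanced_OO(1)[OF wedge_left_map])

lemma wedge_left_linear:
 "\<omega> \<in> carrier Om ==> clinear_map OmOm Om2Om (wedge_left \<omega>)"
 "t \<in> carrier OmOm ==> clinear_map Om Om2Om (%\<omega>. wedge_left \<omega> t)"
proof -
 show "\<omega> \<in> carrier Om ==> clinear_map OmOm Om2Om (wedge_left \<omega>)"
  unfolding wedge_left_def by (rule balanced_OO(2)[OF wedge_left_map])
 show "t \<in> carrier OmOm ==> clinear_map Om Om2Om (%\<omega>. wedge_left \<omega> t)"
  unfolding wedge_left_def
  by (rule OO.tensor_lift_parameter[OF Om.M.cspace_axioms W.MN.cspace_axioms wedge_left_map])
   (auto intro: clinear_compose[OF wedge_linear(1) W.ten_linear_left])
qed

lemmas wedge_left_closed [simp] = clinear_mapD(1)[OF wedge_left_linear(1)]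

lemma wedge_left_acts:
 assumes "\<omega> \<in> carrier Om" "b \<in> carrier alg" "t \<in> carrier OmOm"
 shows "wedge_left (ract Om \<omega> b) t = wedge_left \<omega> (lact OmOm b t)"
  "wedge_left (lact Om b \<omega>) t = lact Om2Om b (wedge_left \<omega> t)"
proof -
 show "wedge_left (ract Om \<omega> b) t = wedge_left \<omega> (lact OmOm b t)"
  by (rule OO.tensor_linear_eqI[OF wedge_left_linear(1) clinear_compose[OF OmOm.l_linear wedge_left_linear(1)]])
   (use assms in \<open>simp_all add: wedge_left_tt OO.lact_ten wedge_acts\<close>)
 show "wedge_left (lact Om b \<omega>) t = lact Om2Om b (wedge_left \<omega> t)"
  by (rule OO.tensor_linear_eqI[OF wedge_left_linear(1) clinear_compose[OF wedge_left_linear(1) Om2Om.l_linear]])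
   (use assms in \<open>simp_all add: wedge_left_tt wedge_acts W.lact_ten\<close>)
qed

end

locale quantum_levi_civita = hk_calculus q r s V lam rp rm del delbar
 for q :: real and r s :: nat and V :: "('n::finite) uq_rep" and lam :: "'n \<Rightarrow> weight"
  and rp rm :: "'n form1 \<Rightarrow> 'n alg \<Rightarrow> 'n form1" and del delbar :: "'n alg \<Rightarrow> 'n form1" +
 fixes ip :: "'n form_form \<Rightarrow> 'n alg" and nabla :: "'n form \<Rightarrow> 'n form_form"
  and \<sigma> :: "'n form_form \<Rightarrow> 'n form_form" and sw :: "'n form2 \<Rightarrow> 'n form_form" and cpm cmp :: complex
 assumes inverse_metric: "inverse_metric ip" and levi_civita: "levi_civita nabla"
  and braiding: "generalized_braiding \<sigma>" and splitting: "splitting_map \<sigma> cpm cmp sw"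
begin

lemma ip_linear: "clinear_map OmOm alg ip"
 and ip_acts: "b \<in> carrier alg ==> t \<in> carrier OmOm ==> ip (lact OmOm b t) = b \<otimes>\<^bsub>alg\<^esub> ip t"
  "b \<in> carrier alg ==> t \<in> carrier OmOm ==> ip (ract OmOm t b) = ip t \<otimes>\<^bsub>alg\<^esub> b"
 using inverse_metric unfolding inverse_metric_def bimodule_map_def
 by (simp_all add: clinear_map_def regular_bimod_def)

lemmas ip_closed [simp] = clinear_mapD(1)[OF ip_linear]

lemma nabla_linear: "clinear_map Om OmOm nabla"
 and nabla_lact: "b \<in> carrier alg ==> \<omega> \<in> carrier Om ==>
  nabla (lact Om b \<omega>) = tt (d0 b) \<omega> \<oplus>\<^bsub>OmOm\<^esub> lact OmOm b (nabla \<omega>)"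
 using levi_civita unfolding levi_civita_def by blast+

lemmas nabla_closed [simp] = clinear_mapD(1)[OF nabla_linear]

lemma sigma_map: "bimodule_map alg OmOm OmOm \<sigma>" and sw_map: "bimodule_map alg Om2 OmOm sw"
 using braiding splitting unfolding generalized_braiding_def splitting_map_def by blast+

lemmas sigma_linear = bimodule_mapD(1)[OF sigma_map] and sw_linear = bimodule_mapD(1)[OF sw_map]
lemmas sigma_closed [simp] = clinear_mapD(1)[OF sigma_linear] and sw_closed [simp] = clinear_mapD(1)[OF sw_linear]

subsection \<open>The curvature\<close>

definition curv :: "'n form_form \<Rightarrow> 'n form2_form" where
 "curv = tensor_lift Om2Om (%\<eta> \<zeta>. ten2 (d1 \<eta>) \<zeta> \<ominus>\<^bsub>Om2Om\<^esub> wedge_left \<eta> (nabla \<zeta>))"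

text \<open>
 Moving \<open>b\<close> through the tensor sign changes the first term by \<open>x \<and> db \<otimes> y\<close>, as \<open>d(x b) = dx b - x \<and> db\<close>, and the second by
 the same amount, by the Leibniz rule of the connection.
\<close>

lemma curv_map: "balanced_map alg Om Om Om2Om (%\<eta> \<zeta>. ten2 (d1 \<eta>) \<zeta> \<ominus>\<^bsub>Om2Om\<^esub> wedge_left \<eta> (nabla \<zeta>))"
proof (intro balanced_map.intro balanced_map_axioms.intro OO.bimodule_pair_axioms W.MN.cspace_axioms)
 show "y \<in> carrier Om ==> clinear_map Om Om2Om (%x. ten2 (d1 x) y \<ominus>\<^bsub>Om2Om\<^esub> wedge_left x (nabla y))" for y
  by (rule clinear_diff[OF W.MN.cspace_axioms clinear_compose[OF d1_linear W.ten_linear_left] wedge_left_linear(2)]) auto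
 show "x \<in> carrier Om ==> clinear_map Om Om2Om (%y. ten2 (d1 x) y \<ominus>\<^bsub>Om2Om\<^esub> wedge_left x (nabla y))" for x
  by (rule clinear_diff[OF W.MN.cspace_axioms W.ten_linear_right clinear_compose[OF nabla_linear wedge_left_linear(1)]]) auto
 fix x b y assume a: "x \<in> carrier Om" "b \<in> carrier alg" "y \<in> carrier Om"
 have c: "ten2 (d1 x) (lact Om b y) \<in> carrier Om2Om" "ten2 (wedge x (d0 b)) y \<in> carrier Om2Om"
  "wedge_left x (lact OmOm b (nabla y)) \<in> carrier Om2Om" using a by auto
 have "ten2 (ract Om2 (d1 x) b \<ominus>\<^bsub>Om2\<^esub> wedge x (d0 b)) y = ten2 (d1 x) (lact Om b y) \<ominus>\<^bsub>Om2Om\<^esub> ten2 (wedge x (d0 b)) y"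
  using a by (simp add: clinear_minus[OF Om2.M.cspace_axioms W.MN.cspace_axioms W.ten_linear_left] W.ten_balanced)
 then show "ten2 (d1 (ract Om x b)) y \<ominus>\<^bsub>Om2Om\<^esub> wedge_left (ract Om x b) (nabla y) =
   ten2 (d1 x) (lact Om b y) \<ominus>\<^bsub>Om2Om\<^esub> wedge_left x (nabla (lact Om b y))"
  using a c by (simp add: d1_ract wedge_left_acts nabla_lact clinear_mapD(2)[OF wedge_left_linear(1)] wedge_left_tt
    W.MN.minus_sm W.MN.sm_distr W.MN.a_ac)
qed

lemma curv_tt: "x \<in> carrier Om ==> y \<in> carrier Om ==> curv (tt x y) = ten2 (d1 x) y \<ominus>\<^bsub>Om2Om\<^esub> wedge_left x (nabla y)"
 unfolding curv_def by (rule balanced_OO(1)[OF curv_map])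

lemma curv_linear: "clinear_map OmOm Om2Om curv"
 unfolding curv_def by (rule balanced_OO(2)[OF curv_map])

lemmas curv_closed [simp] = clinear_mapD(1)[OF curv_linear]

lemma curv_lact:
 assumes b: "b \<in> carrier alg" and t: "t \<in> carrier OmOm"
 shows "curv (lact OmOm b t) = wedge_left (d0 b) t \<oplus>\<^bsub>Om2Om\<^esub> lact Om2Om b (curv t)"
proof (rule OO.tensor_linear_eqI[OF clinear_compose[OF OmOm.l_linear curv_linear]
   clinear_add[OF W.MN.cspace_axioms wedge_left_linear(1) clinear_compose[OF curv_linear Om2Om.l_linear]]])
 fix x y assume a: "x \<in> carrier Om" "y \<in> carrier Om"
 have c: "ten2 (lact Om2 b (d1 x)) y \<in> carrier Om2Om" "lact Om2Om b (wedge_left x (nabla y)) \<in> carrier Om2Om" using a b by auto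
 show "curv (lact OmOm b (tt x y)) = wedge_left (d0 b) (tt x y) \<oplus>\<^bsub>Om2Om\<^esub> lact Om2Om b (curv (tt x y))"
  using a b c by (simp add: OO.lact_ten curv_tt wedge_left_tt d1_lact wedge_left_acts W.ten_add_left W.lact_ten
    W.MN.minus_sm W.MN.a_assoc Om2Om.add_mod Om2Om.l_smult)
qed (use b t in auto)

lemma riemann_curv: "riemann nabla \<omega> = curv (nabla \<omega>)"
 unfolding riemann_def curv_def ..

lemma riemann_linear: "clinear_map Om Om2Om (riemann nabla)"
 unfolding riemann_curv[abs_def] by (rule clinear_compose[OF nabla_linear curv_linear])

lemmas riemann_closed [simp] = clinear_mapD(1)[OF riemann_linear]

text \<open>
 Left linearity is needed to apply \<open>id \<otimes> R\<close> to the metric. The terms with a derivative of \<open>b\<close> cancel as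
 \<open>d(db) = 0\<close>.
\<close>

lemma riemann_lact:
 assumes b: "b \<in> carrier alg" and x: "x \<in> carrier Om"
 shows "riemann nabla (lact Om b x) = lact Om2Om b (riemann nabla x)"
proof -
 have c: "lact Om2Om b (curv (nabla x)) \<in> carrier Om2Om" "wedge_left (d0 b) (nabla x) \<in> carrier Om2Om" using b x by auto
 have z: "ten2 \<zero>\<^bsub>Om2\<^esub> x = \<zero>\<^bsub>Om2Om\<^esub>" using x by simp
 show ?thesis using b x c
  by (simp add: riemann_curv nabla_lact clinear_mapD(2)[OF curv_linear] curv_tt curv_lact d1_d0 z
    W.MN.minus_sm W.MN.sm_minus_one W.MN.a_assoc[symmetric] W.MN.l_neg)
qed

subsection \<open>Contractions\<close>

definition contr :: "'n form \<Rightarrow> 'n form \<Rightarrow> 'n form_form \<Rightarrow> 'n form_form" where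
 "contr \<omega> \<xi> = tensor_lift OmOm (%\<eta> \<zeta>. lact OmOm (ip (tt \<omega> \<eta>)) (tt \<zeta> \<xi>))"

lemma contr_map:
 assumes "\<omega> \<in> carrier Om" "\<xi> \<in> carrier Om"
 shows "balanced_map alg Om Om OmOm (%\<eta> \<zeta>. lact OmOm (ip (tt \<omega> \<eta>)) (tt \<zeta> \<xi>))"
proof (intro balanced_map.intro balanced_map_axioms.intro OO.bimodule_pair_axioms OO.MN.cspace_axioms)
 show "y \<in> carrier Om ==> clinear_map Om OmOm (%x. lact OmOm (ip (tt \<omega> x)) (tt y \<xi>))" for y
  by (rule clinear_compose[OF clinear_compose[OF OO.ten_linear_right[OF assms(1)] ip_linear] OmOm.l_linear'])
   (use assms in auto)
 show "x \<in> carrier Om ==> clinear_map Om OmOm (%y. lact OmOm (ip (tt \<omega> x)) (tt y \<xi>))" for x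
  by (rule clinear_compose[OF OO.ten_linear_left[OF assms(2)] OmOm.l_linear]) (use assms in auto)
 fix x b y assume a: "x \<in> carrier Om" "b \<in> carrier alg" "y \<in> carrier Om"
 have "tt \<omega> (ract Om x b) = ract OmOm (tt \<omega> x) b" using a assms by (simp add: OO.ract_ten)
 then show "lact OmOm (ip (tt \<omega> (ract Om x b))) (tt y \<xi>) = lact OmOm (ip (tt \<omega> x)) (tt (lact Om b y) \<xi>)"
  using a assms by (simp add: ip_acts OmOm.assoc OO.lact_ten Om.assoc)
qed

lemma contr_tt: "[|\<omega> \<in> carrier Om; \<xi> \<in> carrier Om; x \<in> carrier Om; y \<in> carrier Om|] ==>
  contr \<omega> \<xi> (tt x y) = lact OmOm (ip (tt \<omega> x)) (tt y \<xi>)"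
 unfolding contr_def by (rule balanced_OO(1)[OF contr_map])

lemma contr_linear:
 "\<omega> \<in> carrier Om ==> \<xi> \<in> carrier Om ==> clinear_map OmOm OmOm (contr \<omega> \<xi>)"
 "\<omega> \<in> carrier Om ==> t \<in> carrier OmOm ==> clinear_map Om OmOm (%\<xi>. contr \<omega> \<xi> t)"
 "\<xi> \<in> carrier Om ==> t \<in> carrier OmOm ==> clinear_map Om OmOm (%\<omega>. contr \<omega> \<xi> t)"
proof -
 show "\<omega> \<in> carrier Om ==> \<xi> \<in> carrier Om ==> clinear_map OmOm OmOm (contr \<omega> \<xi>)"
  unfolding contr_def by (rule balanced_OO(2)[OF contr_map])
 show "\<omega> \<in> carrier Om ==> t \<in> carrier OmOm ==> clinear_map Om OmOm (%\<xi>. contr \<omega> \<xi> t)"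
  unfolding contr_def
  by (rule OO.tensor_lift_parameter[OF Om.M.cspace_axioms OO.MN.cspace_axioms contr_map])
   (auto intro!: clinear_compose[OF OO.ten_linear_right OmOm.l_linear])
 show "\<xi> \<in> carrier Om ==> t \<in> carrier OmOm ==> clinear_map Om OmOm (%\<omega>. contr \<omega> \<xi> t)"
  unfolding contr_def
  by (rule OO.tensor_lift_parameter[OF Om.M.cspace_axioms OO.MN.cspace_axioms contr_map])
   (auto intro!: clinear_compose[OF clinear_compose[OF OO.ten_linear_left ip_linear] OmOm.l_linear'])
qed

lemmas contr_closed [simp] = clinear_mapD(1)[OF contr_linear(1)]

lemma contr_acts:
 assumes "\<omega> \<in> carrier Om" "\<xi> \<in> carrier Om" "b \<in> carrier alg" "t \<in> carrier OmOm"
 shows "contr \<omega> \<xi> (ract OmOm t b) = contr \<omega> (lact Om b \<xi>) t"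
  "contr \<omega> \<xi> (lact OmOm b t) = contr (ract Om \<omega> b) \<xi> t"
  "contr (lact Om b \<omega>) \<xi> t = lact OmOm b (contr \<omega> \<xi> t)"
proof -
 show "contr \<omega> \<xi> (ract OmOm t b) = contr \<omega> (lact Om b \<xi>) t"
 proof (rule OO.tensor_linear_eqI[OF clinear_compose[OF OmOm.r_linear contr_linear(1)] contr_linear(1)])
  fix x y assume a: "x \<in> carrier Om" "y \<in> carrier Om"
  have "ract OmOm (tt x y) b = tt x (ract Om y b)" using a assms by (simp add: OO.ract_ten)
  then show "contr \<omega> \<xi> (ract OmOm (tt x y) b) = contr \<omega> (lact Om b \<xi>) (tt x y)"
   using a assms by (simp add: contr_tt OO.ten_balanced)
 qed (use assms in auto)
 show "contr \<omega> \<xi> (lact OmOm b t) = contr (ract Om \<omega> b) \<xi> t"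
 proof (rule OO.tensor_linear_eqI[OF clinear_compose[OF OmOm.l_linear contr_linear(1)] contr_linear(1)])
  fix x y assume a: "x \<in> carrier Om" "y \<in> carrier Om"
  have "lact OmOm b (tt x y) = tt (lact Om b x) y" using a assms by (simp add: OO.lact_ten)
  then show "contr \<omega> \<xi> (lact OmOm b (tt x y)) = contr (ract Om \<omega> b) \<xi> (tt x y)"
   using a assms by (simp add: contr_tt OO.ten_balanced)
 qed (use assms in auto)
 show "contr (lact Om b \<omega>) \<xi> t = lact OmOm b (contr \<omega> \<xi> t)"
 proof (rule OO.tensor_linear_eqI[OF contr_linear(1) clinear_compose[OF contr_linear(1) OmOm.l_linear]])
  fix x y assume a: "x \<in> carrier Om" "y \<in> carrier Om"
  have "tt (lact Om b \<omega>) x = lact OmOm b (tt \<omega> x)" using a assms by (simp add: OO.lact_ten)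
  then show "contr (lact Om b \<omega>) \<xi> (tt x y) = lact OmOm b (contr \<omega> \<xi> (tt x y))"
   using a assms by (simp add: contr_tt ip_acts OmOm.assoc)
 qed (use assms in auto)
qed

text \<open>
 \<open>hmap \<omega> R\<close> is the element of \<open>\<Omega> \<otimes> \<Omega>\<close> that \<open>\<omega> \<otimes> R\<close> contributes to the Ricci tensor, and \<open>contr \<omega> \<xi> t\<close> the one for a splitting
 \<open>t\<close> of the two-form in \<open>R\<close>. Both are balanced in \<open>\<omega>\<close>, so scalars from the metric can be moved across.
\<close>

definition hmap :: "'n form \<Rightarrow> 'n form2_form \<Rightarrow> 'n form_form" where
 "hmap \<omega> = tensor_lift OmOm (%x \<xi>. contr \<omega> \<xi> (sw x))"

lemma hmap_map:
 assumes "\<omega> \<in> carrier Om"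
 shows "balanced_map alg Om2 Om OmOm (%x \<xi>. contr \<omega> \<xi> (sw x))"
proof (intro balanced_map.intro balanced_map_axioms.intro W.bimodule_pair_axioms OO.MN.cspace_axioms)
 show "y \<in> carrier Om ==> clinear_map Om2 OmOm (%x. contr \<omega> y (sw x))" for y
  by (rule clinear_compose[OF sw_linear contr_linear(1)[OF assms]])
 show "x \<in> carrier Om2 ==> clinear_map Om OmOm (%\<xi>. contr \<omega> \<xi> (sw x))" for x
  by (rule contr_linear(2)[OF assms]) simp
 show "x \<in> carrier Om2 ==> b \<in> carrier alg ==> y \<in> carrier Om ==>
   contr \<omega> y (sw (ract Om2 x b)) = contr \<omega> (lact Om b y) (sw x)" for x b y
  using assms by (simp add: bimodule_mapD(3)[OF sw_map] contr_acts)
qed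

lemma hmap_ten: "\<omega> \<in> carrier Om ==> x \<in> carrier Om2 ==> \<xi> \<in> carrier Om ==> hmap \<omega> (ten2 x \<xi>) = contr \<omega> \<xi> (sw x)"
 unfolding hmap_def by (rule balanced_W(1)[OF hmap_map])

lemma hmap_linear:
 "\<omega> \<in> carrier Om ==> clinear_map Om2Om OmOm (hmap \<omega>)"
 "R \<in> carrier Om2Om ==> clinear_map Om OmOm (%\<omega>. hmap \<omega> R)"
proof -
 show "\<omega> \<in> carrier Om ==> clinear_map Om2Om OmOm (hmap \<omega>)"
  unfolding hmap_def by (rule balanced_W(2)[OF hmap_map])
 show "R \<in> carrier Om2Om ==> clinear_map Om OmOm (%\<omega>. hmap \<omega> R)"
  unfolding hmap_def
  by (rule W.tensor_lift_parameter[OF Om.M.cspace_axioms OO.MN.cspace_axioms hmap_map])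
   (auto intro!: contr_linear(3))
qed

lemmas hmap_closed [simp] = clinear_mapD(1)[OF hmap_linear(1)]

lemma hmap_ract:
 assumes "\<omega> \<in> carrier Om" "b \<in> carrier alg" "R \<in> carrier Om2Om"
 shows "hmap (ract Om \<omega> b) R = hmap \<omega> (lact Om2Om b R)"
 by (rule W.tensor_linear_eqI[OF hmap_linear(1) clinear_compose[OF Om2Om.l_linear hmap_linear(1)]])
  (use assms in \<open>simp_all add: hmap_ten W.lact_ten bimodule_mapD(2)[OF sw_map] contr_acts\<close>)

text \<open>The composite of the three maps in the Ricci tensor on an elementary tensor.\<close>

definition ricci_map :: "'n form_form \<Rightarrow> 'n form_form" where
 "ricci_map t = metric_id_id ip (id_split_id sw (id_riemann nabla t))"

lemma ricci_map:
 shows "clinear_map OmOm OmOm ricci_map"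
  and "x \<in> carrier Om ==> y \<in> carrier Om ==> ricci_map (tt x y) = hmap x (riemann nabla y)"
proof -
 interpret P4: bimodule_pair alg Om Om2Om by (intro bimodule_pair.intro Om.bimodule_axioms Om2Om.bimodule_axioms)
 interpret P5: bimodule_pair alg Om OmOmOm by (intro bimodule_pair.intro Om.bimodule_axioms OmOmOm.bimodule_axioms)
 have b1: "balanced_map alg Om Om (tensor alg Om Om2Om) (%\<omega> \<eta>. tens alg Om Om2Om \<omega> (riemann nabla \<eta>))"
 proof (intro balanced_map.intro balanced_map_axioms.intro OO.bimodule_pair_axioms P4.MN.cspace_axioms)
  show "y \<in> carrier Om ==> clinear_map Om (tensor alg Om Om2Om) (%x. tens alg Om Om2Om x (riemann nabla y))" for y
   by (rule P4.ten_linear_left) simp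
  show "x \<in> carrier Om ==> clinear_map Om (tensor alg Om Om2Om) (%y. tens alg Om Om2Om x (riemann nabla y))" for x
   by (rule clinear_compose[OF riemann_linear P4.ten_linear_right])
 qed (simp add: riemann_lact P4.ten_balanced)
 define Sp where "Sp = tensor_lift OmOmOm (%x \<xi>. ten3 (sw x) \<xi>)"
 have b2: "balanced_map alg Om2 Om OmOmOm (%x \<xi>. ten3 (sw x) \<xi>)"
 proof (intro balanced_map.intro balanced_map_axioms.intro W.bimodule_pair_axioms T.MN.cspace_axioms)
  show "y \<in> carrier Om ==> clinear_map Om2 OmOmOm (%x. ten3 (sw x) y)" for y
   by (rule clinear_compose[OF sw_linear T.ten_linear_left])
  show "x \<in> carrier Om2 ==> clinear_map Om OmOmOm (ten3 (sw x))" for x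
   by (rule T.ten_linear_right) simp
 qed (simp add: bimodule_mapD(3)[OF sw_map] T.ten_balanced)
 note Sp_ten = balanced_W(1)[OF b2, folded Sp_def] and Sp_linear = balanced_W(2)[OF b2, folded Sp_def]
 have Sp_lact: "Sp (lact Om2Om b t) = lact OmOmOm b (Sp t)" if "b \<in> carrier alg" "t \<in> carrier Om2Om" for b t
  by (rule W.tensor_linear_eqI[OF clinear_compose[OF Om2Om.l_linear Sp_linear] clinear_compose[OF Sp_linear OmOmOm.l_linear]])
   (use that in \<open>simp_all add: W.lact_ten Sp_ten bimodule_mapD(2)[OF sw_map] T.lact_ten\<close>)
 have b3: "balanced_map alg Om Om2Om (tensor alg Om OmOmOm) (%\<omega> t. tens alg Om OmOmOm \<omega> (Sp t))"
 proof (intro balanced_map.intro balanced_map_axioms.intro P4.bimodule_pair_axioms P5.MN.cspace_axioms)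
  show "y \<in> carrier Om2Om ==> clinear_map Om (tensor alg Om OmOmOm) (%x. tens alg Om OmOmOm x (Sp y))" for y
   by (rule P5.ten_linear_left) (rule clinear_mapD(1)[OF Sp_linear])
  show "x \<in> carrier Om ==> clinear_map Om2Om (tensor alg Om OmOmOm) (%y. tens alg Om OmOmOm x (Sp y))" for x
   by (rule clinear_compose[OF Sp_linear P5.ten_linear_right])
 qed (simp add: Sp_lact P5.ten_balanced clinear_mapD(1)[OF Sp_linear])
 have s: "id_split_id sw = tensor_lift (tensor alg Om OmOmOm) (%\<omega> t. tens alg Om OmOmOm \<omega> (Sp t))"
  by (simp add: id_split_id_def Sp_def Let_def)
 define M where "M = (%\<omega>. tensor_lift OmOm (%t \<xi>. contr \<omega> \<xi> t))"
 have b4: "balanced_map alg OmOm Om OmOm (%t \<xi>. contr \<omega> \<xi> t)" if w: "\<omega> \<in> carrier Om" for \<omega>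
 proof (intro balanced_map.intro balanced_map_axioms.intro T.bimodule_pair_axioms OO.MN.cspace_axioms)
 qed (use w in \<open>auto simp: contr_acts intro: contr_linear(1,2)\<close>)
 have M_ten: "M \<omega> (ten3 t \<xi>) = contr \<omega> \<xi> t" if "\<omega> \<in> carrier Om" "t \<in> carrier OmOm" "\<xi> \<in> carrier Om" for \<omega> t \<xi>
  unfolding M_def by (rule balanced_map.lift_ten[OF b4[OF that(1)] that(2,3)])
 have M_linear: "clinear_map OmOmOm OmOm (M \<omega>)" if "\<omega> \<in> carrier Om" for \<omega>
  unfolding M_def by (rule balanced_map.lift_linear[OF b4[OF that]])
 have b5: "balanced_map alg Om OmOmOm OmOm M"
 proof (intro balanced_map.intro balanced_map_axioms.intro P5.bimodule_pair_axioms OO.MN.cspace_axioms)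
  show "y \<in> carrier OmOmOm ==> clinear_map Om OmOm (%x. M x y)" for y
   unfolding M_def
   by (rule T.tensor_lift_parameter[OF Om.M.cspace_axioms OO.MN.cspace_axioms b4]) (auto intro: contr_linear(3))
  show "x \<in> carrier Om ==> clinear_map OmOmOm OmOm (M x)" for x by (rule M_linear)
  fix x b y assume a: "x \<in> carrier Om" "b \<in> carrier alg" "y \<in> carrier OmOmOm"
  show "M (ract Om x b) y = M x (lact OmOmOm b y)"
   by (rule T.tensor_linear_eqI[OF M_linear clinear_compose[OF OmOmOm.l_linear M_linear]])
    (use a in \<open>simp_all add: M_ten T.lact_ten contr_acts\<close>)
 qed
 have m: "metric_id_id ip = tensor_lift OmOm M"
  by (simp add: metric_id_id_def M_def contr_def)
 note l1 = balanced_OO[OF b1, folded id_riemann_def] and l3 = balanced_map.lift_ten[OF b3, folded s] balanced_map.lift_linear[OF b3, folded s]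
  and l5 = balanced_map.lift_ten[OF b5, folded m] balanced_map.lift_linear[OF b5, folded m]
 show "clinear_map OmOm OmOm ricci_map"
  unfolding ricci_map_def[abs_def] by (rule clinear_compose[OF clinear_compose[OF l1(2) l3(2)] l5(2)])
 assume a: "x \<in> carrier Om" "y \<in> carrier Om"
 have "ricci_map (tt x y) = M x (Sp (riemann nabla y))"
  using a by (simp add: ricci_map_def l1 l3 l5 clinear_mapD(1)[OF Sp_linear])
 also have "\<dots> = hmap x (riemann nabla y)"
  by (rule W.tensor_linear_eqI[OF clinear_compose[OF Sp_linear M_linear] hmap_linear(1)])
   (use a in \<open>simp_all add: Sp_ten M_ten hmap_ten\<close>)
 finally show "ricci_map (tt x y) = hmap x (riemann nabla y)" .
qed

end

section \<open>The structure maps on generators\<close>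

context quantum_projective_space
begin

definition two :: "'n \<Rightarrow> 'n \<Rightarrow> 'n legs" where "two a b = (%i. if i = 0 then a else b)"
definition four :: "'n \<Rightarrow> 'n \<Rightarrow> 'n \<Rightarrow> 'n \<Rightarrow> 'n legs" where
 "four a b c d = (%i. if i = 0 then a else if i = 1 then b else if i = 2 then c else d)"

lemma two_simps [simp]: "two a b 0 = a" "two a b 1 = b" "two a b (Suc 0) = b"
 by (simp_all add: two_def)

lemma four_simps [simp]: "four a b c d 0 = a" "four a b c d 1 = b" "four a b c d (Suc 0) = b" "four a b c d 2 = c" "four a b c d 3 = d"
 by (simp_all add: four_def)

lemma weight_sum_sym: "(\<Sum>k\<in>UNIV. wt k) = (\<Sum>k\<in>UNIV. 1 / wt k)"
proof -
 define rev where "rev k = index (r + 1 - pos k)" for k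
 have p: "pos (rev k) = r + 2 - pos k" for k
  using index_pos(2,3)[of k] unfolding rev_def by (subst pos_index) auto
 have rr: "rev (rev k) = k" for k
 proof -
  have "r + 1 - (r + 2 - pos k) = pos k - 1" using index_pos(2,3)[of k] by arith
  then show ?thesis unfolding rev_def[of "rev k"] p using index_pos(1)[of k] by (simp only:)
 qed
 have e: "1 / wt (rev k) = wt k" for k
 proof -
  have "2 * (r + 2 - pos k) + 2 * pos k = (r + 2) + (r + 2)" using index_pos(3)[of k] by arith
  then have "Q ^ (2 * (r + 2 - pos k)) * Q ^ (2 * pos k) = Q ^ (r + 2) * Q ^ (r + 2)" by (simp only: power_add[symmetric])
  then show ?thesis unfolding wt_def p using Q_nonzero by (simp only: divide_divide_eq_right divide_simps mult_1 power_eq_0_iff) simp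
 qed
 show ?thesis by (rule sum.reindex_bij_witness[of UNIV rev rev]) (simp_all add: rr e)
qed

lemma coev_eval: "coev n f e = (if e n = e (Suc n) then f (drop_legs e n) else 0)"
 "coev' n f e = (if e n = e (Suc n) then f (drop_legs e n) / wt (e n) else 0)"
 by (simp_all add: leg_insert_def)

text \<open>\<open>E\<^sub>2\<^sub>3 T\<close> only involves the symmetric operator and a trace.\<close>

lemma product_T: "ev 1 (S 0 (St 0 f)) e = ev' 2 (S 0 f) e / (tw * Q * Q ^ r)"
 using fun_cong[OF ev_St[of 0 "S 0 f"], of e] by (simp add: S_St[of 0 f] numeral_2_eq_2)

lemma product_T_symmetric:
 assumes "S 0 f = (%e. tw * Q * f e)"
 shows "ev 1 (S 0 (St 0 f)) e = ev' 2 f e / Q ^ r"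
 unfolding product_T assms leg_contract_smult using Q_nonzero tw_nonzero by (simp add: field_simps)

end

context hk_calculus
begin

lemma OmOm_family:
 assumes "functional OmOm \<phi>"
 shows "family_functional q r s V lam OmOm \<phi>"
 by (intro family_functional.intro family_functional_axioms.intro quantum_projective_space_axioms OO.MN.cspace_axioms assms)

lemma alg_family:
 assumes "functional alg \<phi>"
 shows "family_functional q r s V lam alg \<phi>"
 by (intro family_functional.intro family_functional_axioms.intro quantum_projective_space_axioms alg.Bv.cspace_axioms assms)

lemma fam_eval_tt:
 "fam_eval \<phi> 4 (fam_prod tt dP dP) = (%e. \<phi> (tt (dP [e 0, e 1]) (dP [e 2, e 3])))"
 "fam_eval \<phi> 4 (fam_prod tt dP dbarP) = (%e. \<phi> (tt (dP [e 0, e 1]) (dbarP [e 2, e 3])))"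
 "fam_eval \<phi> 4 (fam_prod tt dbarP dP) = (%e. \<phi> (tt (dbarP [e 0, e 1]) (dP [e 2, e 3])))"
 "fam_eval \<phi> 4 (fam_prod tt dbarP dbarP) = (%e. \<phi> (tt (dbarP [e 0, e 1]) (dbarP [e 2, e 3])))"
 by (rule ext, simp add: fam_eval_def legs4 fam_prod_def)+

lemma tt_families_closed:
 "fam_prod tt dP dP is \<in> carrier OmOm" "fam_prod tt dP dbarP is \<in> carrier OmOm"
 "fam_prod tt dbarP dP is \<in> carrier OmOm" "fam_prod tt dbarP dbarP is \<in> carrier OmOm"
 by (auto simp: fam_prod_def)

lemma g_eval:
 assumes \<phi>: "functional OmOm \<phi>"
 shows "\<phi> g_pm = (\<Sum>i\<in>UNIV. wt i * (\<Sum>k\<in>UNIV. \<phi> (tt (dP [i, k]) (dbarP [k, i]))))"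
  "\<phi> g_mp = (\<Sum>i\<in>UNIV. wt i * (\<Sum>k\<in>UNIV. \<phi> (tt (dbarP [i, k]) (dP [k, i]))))"
  "g_pm \<in> carrier OmOm" "g_mp \<in> carrier OmOm"
proof -
 interpret f: family_functional q r s V lam OmOm \<phi> by (rule OmOm_family[OF \<phi>])
 have ee: "\<phi> (E_ev' OmOm 1 (E_ev OmOm 2 F) []) = ev' 0 (ev 1 (fam_eval \<phi> 4 F)) e"
  "E_ev' OmOm 1 (E_ev OmOm 2 F) [] \<in> carrier OmOm" if c: "f.closed_family 4 F" for F e
 proof -
  have c4: "f.closed_family (2 + 2) F" using c by simp
  have c2: "f.closed_family (0 + 2) (E_ev OmOm 2 F)" unfolding add_0 by (rule f.closed_E(1)[OF c4]) simp
  have 1: "fam_eval \<phi> 0 (E_ev' OmOm (0 + 1) (E_ev OmOm 2 F)) = ev' 0 (fam_eval \<phi> (0 + 2) (E_ev OmOm 2 F))"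
   by (rule f.eval_E'[OF c2]) simp
  have 2: "fam_eval \<phi> 2 (E_ev OmOm (1 + 1) F) = ev 1 (fam_eval \<phi> (2 + 2) F)"
   by (rule f.eval_E[OF c4]) simp
  have inner: "fam_eval \<phi> 2 (E_ev OmOm 2 F) = ev 1 (fam_eval \<phi> 4 F)" using 2 unfolding one_add_one by simp
  show "\<phi> (E_ev' OmOm 1 (E_ev OmOm 2 F) []) = ev' 0 (ev 1 (fam_eval \<phi> 4 F)) e"
   using fun_cong[OF 1, of e] unfolding add_0 inner by (simp add: fam_eval_def legs0)
  show "E_ev' OmOm 1 (E_ev OmOm 2 F) [] \<in> carrier OmOm"
   using f.closed_E(2)[OF c2, of 1] unfolding f.closed_family_def by simp
 qed
 have cl: "f.closed_family 4 (fam_prod tt dP dbarP)" "f.closed_family 4 (fam_prod tt dbarP dP)"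
  unfolding f.closed_family_def using tt_families_closed by blast+
 show "\<phi> g_pm = (\<Sum>i\<in>UNIV. wt i * (\<Sum>k\<in>UNIV. \<phi> (tt (dP [i, k]) (dbarP [k, i]))))"
  unfolding g_pm_def ee(1)[OF cl(1), of undefined] fam_eval_tt by (simp add: contract_simps)
 show "\<phi> g_mp = (\<Sum>i\<in>UNIV. wt i * (\<Sum>k\<in>UNIV. \<phi> (tt (dbarP [i, k]) (dP [k, i]))))"
  unfolding g_mp_def ee(1)[OF cl(2), of undefined] fam_eval_tt by (simp add: contract_simps)
 show "g_pm \<in> carrier OmOm" "g_mp \<in> carrier OmOm"
  unfolding g_pm_def g_mp_def by (rule ee(2)[OF cl(1)], rule ee(2)[OF cl(2)])
qed

lemma g_closed [simp]: "g_pm \<in> carrier OmOm" "g_mp \<in> carrier OmOm"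
proof -
 have "functional OmOm (%_. 0)" by (simp add: functional_def)
 from g_eval(3,4)[OF this] show "g_pm \<in> carrier OmOm" "g_mp \<in> carrier OmOm" .
qed

lemma tt_functional: "functional OmOm \<theta> ==> y \<in> carrier Om ==> functional Om (%x. \<theta> (tt x y))"
 "functional OmOm \<theta> ==> y \<in> carrier Om ==> functional Om (%x. \<theta> (tt y x))"
 by (rule functional_compose[OF OO.ten_linear_left], assumption+)
  (rule functional_compose[OF OO.ten_linear_right], assumption+)

text \<open>\<open>\<partial>p \<otimes> \<partial>p\<close> and \<open>\<bar>\<partial>p \<otimes> \<bar>\<partial>p\<close> vanish when their inner legs are contracted: a factor \<open>p\<close> can be
 moved through the tensor sign to the side where it annihilates.\<close>

lemma dP_dP:
 assumes "functional OmOm \<theta>"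
 shows "(\<Sum>k\<in>UNIV. \<theta> (tt (dP [a, k]) (dP [k, b]))) = 0"
proof -
 have "\<theta> (tt (dP [a, k]) (dP [k, b])) = (\<Sum>l\<in>UNIV. \<theta> (tt (dP [a, l]) (lact Om (P [l, k]) (dP [k, b]))))" for k
  using dP_P[OF tt_functional(1)[OF assms dP_closed], of a k "[k, b]"] by (simp add: OO.ten_balanced)
 then have "(\<Sum>k\<in>UNIV. \<theta> (tt (dP [a, k]) (dP [k, b]))) = (\<Sum>l\<in>UNIV. \<Sum>k\<in>UNIV. \<theta> (tt (dP [a, l]) (lact Om (P [l, k]) (dP [k, b]))))"
  by (simp only:) (rule sum.swap)
 also have "\<dots> = 0" using P_dP[OF tt_functional(2)[OF assms dP_closed]] by simp
 finally show ?thesis .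
qed

lemma dbarP_dbarP:
 assumes "functional OmOm \<theta>"
 shows "(\<Sum>k\<in>UNIV. \<theta> (tt (dbarP [a, k]) (dbarP [k, b]))) = 0"
proof -
 have "\<theta> (tt (dbarP [a, k]) (dbarP [k, b])) = (\<Sum>l\<in>UNIV. \<theta> (tt (ract Om (dbarP [a, k]) (P [k, l])) (dbarP [l, b])))" for k
  using P_dbarP[OF tt_functional(2)[OF assms dbarP_closed], of "[a, k]" k b] by (simp add: OO.ten_balanced)
 then have "(\<Sum>k\<in>UNIV. \<theta> (tt (dbarP [a, k]) (dbarP [k, b]))) = (\<Sum>l\<in>UNIV. \<Sum>k\<in>UNIV. \<theta> (tt (ract Om (dbarP [a, k]) (P [k, l])) (dbarP [l, b])))"
  by (simp only:) (rule sum.swap)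
 also have "\<dots> = 0" using dbarP_P[OF tt_functional(1)[OF assms dbarP_closed]] by simp
 finally show ?thesis .
qed

text \<open>The family \<open>\<bar>\<partial>p p \<partial>p\<close> is symmetric in its first legs, so its trace and its product agree after \<open>S\<close>.\<close>

lemma dbarP_dP:
 assumes \<theta>: "functional OmOm \<theta>"
 shows "(\<Sum>k\<in>UNIV. \<theta> (tt (dbarP [a, k]) (dP [k, b]))) = \<theta> (ract OmOm g_mp (P [a, b])) / Q ^ r"
proof -
 define Y where "Y e = \<theta> (tt (dbarP [e 0, e 1]) (lact Om (P [e 2, e 3]) (dP [e 4, e 5])))" for e :: "'n legs"
 have S0: "S 0 Y e = tw * Q * Y e" for e
 proof -
  have f: "functional Om (%x. \<theta> (tt x (dP [e 4, e 5])))" by (rule tt_functional(1)[OF \<theta>]) simp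
  have "S 0 Y e = S 0 (dbarPp (%x. \<theta> (tt x (dP [e 4, e 5])))) e"
   by (simp add: S_def leg_op_def Y_def dbarPp_def OO.ten_balanced)
  also have "\<dots> = tw * Q * Y e" unfolding S_dbarPp[OF f] by (simp add: Y_def dbarPp_def OO.ten_balanced)
  finally show ?thesis .
 qed
 have S2: "S 2 Y e = tw * Q / Q ^ 2 * \<theta> (tt (dbarP [e 0, e 1]) (ract Om (dP [e 2, e 3]) (P [e 4, e 5])))" for e
 proof -
  have f: "functional Om (%x. \<theta> (tt (dbarP [e 0, e 1]) x))" by (rule tt_functional(2)[OF \<theta>]) simp
  have "S 2 Y e = S 0 (pdP (%x. \<theta> (tt (dbarP [e 0, e 1]) x))) (%i. e (i + 2))"
   by (simp add: S_def leg_op_def Y_def pdP_def eval_nat_numeral)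
  also have "\<dots> = tw * Q / Q ^ 2 * \<theta> (tt (dbarP [e 0, e 1]) (ract Om (dP [e 2, e 3]) (P [e 4, e 5])))"
   unfolding S_pdP[OF f] by (simp add: dPp_def eval_nat_numeral)
  finally show ?thesis .
 qed
 have r: "functional OmOm (%t. \<theta> (ract OmOm t (P [a, b])))"
  by (rule functional_compose[OF OmOm.r_linear \<theta>]) simp
 have sw: "ract OmOm (tt x y) (P [i, j]) = tt x (ract Om y (P [i, j]))" if "x \<in> carrier Om" "y \<in> carrier Om" for x y i j
  using that by (simp add: OO.ract_ten)
 have "ev' 0 (ev 1 (S 2 Y)) (two a b) = tw * Q / Q ^ 2 * \<theta> (ract OmOm g_mp (P [a, b]))"
  unfolding g_eval(2)[OF r] leg_contract_def S2
  by (simp add: double_leg_def sw sum_distrib_left mult_ac)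
 moreover have "ev 1 (ev 1 (S 2 Y)) (two a b) = tw * Q / Q ^ 2 * (\<Sum>k\<in>UNIV. \<theta> (tt (dbarP [a, k]) (dP [k, b])))"
 proof -
  have "ev 1 (ev 1 (S 2 Y)) (two a b) =
    tw * Q / Q ^ 2 * (\<Sum>l\<in>UNIV. \<Sum>k\<in>UNIV. \<theta> (tt (dbarP [a, k]) (ract Om (dP [k, l]) (P [l, b]))))"
   unfolding leg_contract_def S2 by (simp add: double_leg_def sum_distrib_left)
  also have "(\<Sum>l\<in>UNIV. \<Sum>k\<in>UNIV. \<theta> (tt (dbarP [a, k]) (ract Om (dP [k, l]) (P [l, b])))) =
    (\<Sum>k\<in>UNIV. \<theta> (tt (dbarP [a, k]) (dP [k, b])))"
   using dP_P[OF tt_functional(2)[OF \<theta> dbarP_closed]] by (subst sum.swap) simp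
  finally show ?thesis .
 qed
 moreover have "ev' 0 (ev 1 (S 2 Y)) (two a b) = Q ^ r * ev 1 (ev 1 (S 2 Y)) (two a b)"
  by (rule trace_eq_product) (simp add: fun_eq_iff S0)
 ultimately show ?thesis using Q_nonzero tw_nonzero by (simp add: field_simps)
qed

text \<open>Both values come from \<open>\<bar>\<partial>p = p \<cdot> dp\<close> and \<open>d(dp) = 0\<close>.\<close>

lemma d1_dbarP:
 assumes "functional Om2 \<phi>"
 shows "\<phi> (d1 (dbarP [a, b])) = (\<Sum>k\<in>UNIV. \<phi> (wedge (d0 (P [a, k])) (d0 (P [k, b]))))"
  "\<phi> (d1 (dP [a, b])) = - (\<Sum>k\<in>UNIV. \<phi> (wedge (d0 (P [a, k])) (d0 (P [k, b]))))"
proof -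
 have f: "functional Om (%x. \<phi> (d1 x))" by (rule functional_compose[OF d1_linear assms])
 have "(\<Sum>k\<in>UNIV. \<phi> (d1 (lact Om (P [a, k]) (d0 (P [k, b]))))) = \<phi> (d1 (dbarP [a, b]))"
  using P_dP[OF f, of a b] P_dbarP[OF f, of a b]
  by (simp add: d0_P Om.add_mod Om.M.functional_add[OF f] sum.distrib)
 then show 1: "\<phi> (d1 (dbarP [a, b])) = (\<Sum>k\<in>UNIV. \<phi> (wedge (d0 (P [a, k])) (d0 (P [k, b]))))"
  by (simp add: d1_gen)
 have "\<phi> (d1 (dP [a, b])) + \<phi> (d1 (dbarP [a, b])) = \<phi> (d1 (d0 (P [a, b])))"
  using Om.M.functional_add[OF f, of "dP [a, b]" "dbarP [a, b]"] by (simp add: d0_P)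
 then show "\<phi> (d1 (dP [a, b])) = - (\<Sum>k\<in>UNIV. \<phi> (wedge (d0 (P [a, k])) (d0 (P [k, b]))))"
  using Om2.M.functional_zero[OF assms] by (simp add: 1 d1_d0 eq_neg_iff_add_eq_0)
qed

end

context quantum_levi_civita
begin

lemma ip_functional: "functional alg \<phi> ==> functional OmOm (%t. \<phi> (ip t))"
 by (rule functional_compose[OF ip_linear])

lemma ip_gens:
 "ip (tt (dP [i, j]) (dP [k, l])) = \<zero>\<^bsub>alg\<^esub>" "ip (tt (dbarP [i, j]) (dbarP [k, l])) = \<zero>\<^bsub>alg\<^esub>"
 "ip (tt (dP [i, j]) (dbarP [k, l])) = fam_diff alg (fam_smult alg (qpow q par_a * qpow q (- par_w - par_m)) (S123 alg (C_coev alg 3 P)))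
     (fam_smult alg (qpow q par_a * qpow q (- par_m)) PP) [i, j, k, l]"
 "ip (tt (dbarP [i, j]) (dP [k, l])) = fam_diff alg (C_coev' alg 2 P) (fam_smult alg (qpow q (- par_m)) PP) [i, j, k, l]"
proof -
 have l: "length [i, j, k, l] = 4" by simp
 note d = inverse_metric[unfolded inverse_metric_def, THEN conjunct2, rule_format, OF l]
 show "ip (tt (dP [i, j]) (dP [k, l])) = \<zero>\<^bsub>alg\<^esub>" "ip (tt (dbarP [i, j]) (dbarP [k, l])) = \<zero>\<^bsub>alg\<^esub>"
  using d by (simp_all add: fam_prod_def)
 show "ip (tt (dP [i, j]) (dbarP [k, l])) = fam_diff alg (fam_smult alg (qpow q par_a * qpow q (- par_w - par_m)) (S123 alg (C_coev alg 3 P)))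
     (fam_smult alg (qpow q par_a * qpow q (- par_m)) PP) [i, j, k, l]"
  using d[THEN conjunct2, THEN conjunct2, THEN conjunct1] unfolding fam_prod_def by simp
 show "ip (tt (dbarP [i, j]) (dP [k, l])) = fam_diff alg (C_coev' alg 2 P) (fam_smult alg (qpow q (- par_m)) PP) [i, j, k, l]"
  using d[THEN conjunct2, THEN conjunct2, THEN conjunct2] unfolding fam_prod_def by simp
qed

lemma ip_values:
 assumes \<phi>: "functional alg \<phi>"
 shows "\<phi> (ip (tt (dP [e 0, e 1]) (dbarP [e 2, e 3]))) =
  Q ^ 2 / (tw * Q * Q ^ r) * S 0 (coev 2 (%e. \<phi> (P [e 0, e 1]))) e - Q ^ 2 / Q ^ r * \<phi> (P [e 0, e 1] \<otimes>\<^bsub>alg\<^esub> P [e 2, e 3])"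
  "\<phi> (ip (tt (dbarP [e 0, e 1]) (dP [e 2, e 3]))) =
  coev' 1 (%e. \<phi> (P [e 0, e 1])) e - 1 / Q ^ r * \<phi> (P [e 0, e 1] \<otimes>\<^bsub>alg\<^esub> P [e 2, e 3])"
proof -
 interpret f: family_functional q r s V lam alg \<phi> by (rule alg_family[OF \<phi>])
 have cP: "f.closed_family 2 P" unfolding f.closed_family_def by simp
 have e2: "fam_eval \<phi> 2 P = (%e. \<phi> (P [e 0, e 1]))" by (rule ext) (simp add: fam_eval_def legs2)
 have cC: "f.closed_family 4 (C_coev alg 3 P)" "f.closed_family 4 (C_coev' alg 2 P)"
  using f.closed_C(1)[OF cP, of 3] f.closed_C(2)[OF cP, of 2] by simp_all
 have eC: "fam_eval \<phi> 4 (C_coev alg 3 P) = coev 2 (%e. \<phi> (P [e 0, e 1]))"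
  using f.eval_C[OF cP, of 2] unfolding e2 by simp
 have eC': "fam_eval \<phi> 4 (C_coev' alg 2 P) = coev' 1 (%e. \<phi> (P [e 0, e 1]))"
  using f.eval_C'[OF cP, of 1] unfolding e2 by (simp add: numeral_2_eq_2[symmetric])
 have PPc: "PP [e 0, e 1, e 2, e 3] = P [e 0, e 1] \<otimes>\<^bsub>alg\<^esub> P [e 2, e 3]" by (simp add: PP_def fam_prod_def)
 have c1: "S123 alg (C_coev alg 3 P) [e 0, e 1, e 2, e 3] \<in> carrier alg" "C_coev' alg 2 P [e 0, e 1, e 2, e 3] \<in> carrier alg"
  using f.closed_S(1)[OF cC(1)] cC(2) unfolding f.closed_family_def by simp_all
 have "\<phi> (S123 alg (C_coev alg 3 P) [e 0, e 1, e 2, e 3]) = S 0 (coev 2 (%e. \<phi> (P [e 0, e 1]))) e"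
  using fun_cong[OF f.eval_S123[OF cC(1)], of e] unfolding eC by (simp add: fam_eval_def legs4)
 moreover have "qpow q (- par_w - par_m) = 1 / (tw * Q * Q ^ r)"
  using qpow_minus[OF q_pos(1), of "par_w + par_m"] by (simp add: qpow_add[OF q_pos(1)] qpow_w qpow_m)
 ultimately show "\<phi> (ip (tt (dP [e 0, e 1]) (dbarP [e 2, e 3]))) =
  Q ^ 2 / (tw * Q * Q ^ r) * S 0 (coev 2 (%e. \<phi> (P [e 0, e 1]))) e - Q ^ 2 / Q ^ r * \<phi> (P [e 0, e 1] \<otimes>\<^bsub>alg\<^esub> P [e 2, e 3])"
  unfolding ip_gens fam_diff_def fam_smult_def PPc using c1
  by (simp add: alg.Bv.functional_minus[OF \<phi>] alg.Bv.functional_smult[OF \<phi>] qpow_a qpow_m qpow_minus[OF q_pos(1)])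
 have "\<phi> (C_coev' alg 2 P [e 0, e 1, e 2, e 3]) = coev' 1 (%e. \<phi> (P [e 0, e 1])) e"
  using fun_cong[OF eC', of e] by (simp add: fam_eval_def legs4)
 then show "\<phi> (ip (tt (dbarP [e 0, e 1]) (dP [e 2, e 3]))) =
  coev' 1 (%e. \<phi> (P [e 0, e 1])) e - 1 / Q ^ r * \<phi> (P [e 0, e 1] \<otimes>\<^bsub>alg\<^esub> P [e 2, e 3])"
  unfolding ip_gens fam_diff_def fam_smult_def PPc using c1
  by (simp add: alg.Bv.functional_minus[OF \<phi>] alg.Bv.functional_smult[OF \<phi>] qpow_m qpow_minus[OF q_pos(1)])
qed

lemma nabla_values:
 assumes \<phi>: "functional OmOm \<phi>"
 shows "\<phi> (nabla (dP [e 0, e 1])) = Q ^ 2 * ev 1 (S 0 (St 0 (%e. \<phi> (tt (dbarP [e 0, e 1]) (dP [e 2, e 3]))))) e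
   - Q ^ 2 / Q ^ r * \<phi> (lact OmOm (P [e 0, e 1]) g_mp)"
  "\<phi> (nabla (dbarP [a, b])) = (\<Sum>k\<in>UNIV. \<phi> (tt (dP [a, k]) (dbarP [k, b]))) - 1 / Q ^ r * \<phi> (lact OmOm (P [a, b]) g_pm)"
proof -
 interpret f: family_functional q r s V lam OmOm \<phi> by (rule OmOm_family[OF \<phi>])
 have l: "length [i, j] = 2" for i j :: 'n by simp
 note n = levi_civita[unfolded levi_civita_def, THEN conjunct2, THEN conjunct2, rule_format, OF l]
 have cl: "f.closed_family (2 + 2) (fam_prod tt dP dbarP)" "f.closed_family 4 (fam_prod tt dbarP dP)"
  unfolding f.closed_family_def using tt_families_closed by blast+
 have cT: "f.closed_family (2 + 2) (T1234 OmOm (fam_prod tt dbarP dP))" using f.closed_S(5)[OF cl(2)] by simp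
 have cE: "E_ev OmOm 2 (T1234 OmOm (fam_prod tt dbarP dP)) [i, j] \<in> carrier OmOm"
  "E_ev OmOm 2 (fam_prod tt dP dbarP) [i, j] \<in> carrier OmOm" for i j
  using f.closed_E(1)[OF cT, of 2] f.closed_E(1)[OF cl(1), of 2] unfolding f.closed_family_def by simp_all
 have "fam_eval \<phi> 2 (E_ev OmOm (1 + 1) (T1234 OmOm (fam_prod tt dbarP dP))) = ev 1 (fam_eval \<phi> (2 + 2) (T1234 OmOm (fam_prod tt dbarP dP)))"
  by (rule f.eval_E[OF cT]) simp
 then have "fam_eval \<phi> 2 (E_ev OmOm 2 (T1234 OmOm (fam_prod tt dbarP dP))) = ev 1 (fam_eval \<phi> 4 (T1234 OmOm (fam_prod tt dbarP dP)))" unfolding one_add_one by simp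
 from fun_cong[OF this, of e]
 have "\<phi> (E_ev OmOm 2 (T1234 OmOm (fam_prod tt dbarP dP)) [e 0, e 1]) = ev 1 (S 0 (St 0 (%e. \<phi> (tt (dbarP [e 0, e 1]) (dP [e 2, e 3]))))) e"
  unfolding f.eval_T1234[OF cl(2) order_refl] fam_eval_tt by (simp add: fam_eval_def legs2)
 then show "\<phi> (nabla (dP [e 0, e 1])) = Q ^ 2 * ev 1 (S 0 (St 0 (%e. \<phi> (tt (dbarP [e 0, e 1]) (dP [e 2, e 3]))))) e
   - Q ^ 2 / Q ^ r * \<phi> (lact OmOm (P [e 0, e 1]) g_mp)"
  unfolding n(1)[THEN conjunct1] fam_diff_def fam_smult_def P_g_def using cE
  by (simp add: OO.MN.functional_minus[OF \<phi>] OO.MN.functional_smult[OF \<phi>] qpow_a qpow_m qpow_minus[OF q_pos(1)])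
 have "fam_eval \<phi> 2 (E_ev OmOm (1 + 1) (fam_prod tt dP dbarP)) = ev 1 (fam_eval \<phi> (2 + 2) (fam_prod tt dP dbarP))"
  by (rule f.eval_E[OF cl(1)]) simp
 then have "fam_eval \<phi> 2 (E_ev OmOm 2 (fam_prod tt dP dbarP)) (two a b) = ev 1 (fam_eval \<phi> 4 (fam_prod tt dP dbarP)) (two a b)" unfolding one_add_one by simp
 then have "\<phi> (E_ev OmOm 2 (fam_prod tt dP dbarP) [a, b]) = (\<Sum>k\<in>UNIV. \<phi> (tt (dP [a, k]) (dbarP [k, b])))"
  unfolding fam_eval_tt by (simp add: fam_eval_def legs2 contract_simps)
 then show "\<phi> (nabla (dbarP [a, b])) = (\<Sum>k\<in>UNIV. \<phi> (tt (dP [a, k]) (dbarP [k, b]))) - 1 / Q ^ r * \<phi> (lact OmOm (P [a, b]) g_pm)"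
  unfolding n(1)[THEN conjunct2] fam_diff_def fam_smult_def P_g_def using cE
  by (simp add: OO.MN.functional_minus[OF \<phi>] OO.MN.functional_smult[OF \<phi>] qpow_m qpow_minus[OF q_pos(1)])
qed

lemma sigma_values:
 assumes \<phi>: "functional OmOm \<phi>"
 shows "\<phi> (\<sigma> (tt (dP [e 0, e 1]) (dP [e 2, e 3]))) = Q ^ 2 * S 0 (St 0 (%e. \<phi> (tt (dP [e 0, e 1]) (dP [e 2, e 3])))) e"
  "\<phi> (\<sigma> (tt (dbarP [e 0, e 1]) (dbarP [e 2, e 3]))) = 1 / Q ^ 2 * S 0 (St 0 (%e. \<phi> (tt (dbarP [e 0, e 1]) (dbarP [e 2, e 3])))) e"
  "\<phi> (\<sigma> (tt (dP [e 0, e 1]) (dbarP [e 2, e 3]))) =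
   qpow q (2 * par_a - 2 * par_w) * S 0 (leg_op VD 1 (leg_op DD 2 (leg_op VDi 1 (%e. \<phi> (tt (dbarP [e 0, e 1]) (dP [e 2, e 3])))))) e
   + (1 - Q ^ 2) * Q ^ 2 / Q ^ r * \<phi> (ract OmOm (lact OmOm (P [e 0, e 1]) g_mp) (P [e 2, e 3]))"
  "\<phi> (\<sigma> (tt (dbarP [e 0, e 1]) (dP [e 2, e 3]))) =
   (tw * Q) ^ 2 / Q ^ 4 * S_inv 0 (St 0 (%e. \<phi> (tt (dP [e 0, e 1]) (dbarP [e 2, e 3])))) e
   + (1 - 1 / Q ^ 2) / Q ^ r * \<phi> (ract OmOm (lact OmOm (P [e 0, e 1]) g_pm) (P [e 2, e 3]))"
proof -
 interpret f: family_functional q r s V lam OmOm \<phi> by (rule OmOm_family[OF \<phi>])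
 have l: "length [e 0, e 1, e 2, e 3] = 4" by simp
 note n = braiding[unfolded generalized_braiding_def, THEN conjunct2, rule_format, OF l]
 have cl: "f.closed_family 4 (fam_prod tt dP dP)" "f.closed_family 4 (fam_prod tt dbarP dbarP)"
  "f.closed_family 4 (fam_prod tt dP dbarP)" "f.closed_family 4 (fam_prod tt dbarP dP)"
  unfolding f.closed_family_def using tt_families_closed by blast+
 have at: "F [e 0, e 1, e 2, e 3] = F (legs_list 4 e)" for F :: "'n list \<Rightarrow> 'z" by (simp add: legs4)
 have ev: "\<phi> (F [e 0, e 1, e 2, e 3]) = fam_eval \<phi> 4 F e" for F by (simp add: fam_eval_def legs4)
 have cc: "F [e 0, e 1, e 2, e 3] \<in> carrier OmOm" if "f.closed_family 4 F" for F
  using that unfolding f.closed_family_def by simp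
 note fn = OO.MN.functional_add[OF \<phi>] OO.MN.functional_smult[OF \<phi>]
 have pt: "fam_prod tt x y [e 0, e 1, e 2, e 3] = tt (x [e 0, e 1]) (y [e 2, e 3])" for x y by (simp add: fam_prod_def)
 have pg: "P_g_P x [e 0, e 1, e 2, e 3] = ract OmOm (lact OmOm (P [e 0, e 1]) x) (P [e 2, e 3])" for x
  by (simp add: P_g_P_def P_g_def fam_prod_def)
 note cS = f.closed_S
 have St_inv: "fam_eval \<phi> 4 (S234'_inv OmOm F) = leg_op VD 1 (leg_op DD 2 (leg_op VDi 1 (fam_eval \<phi> 4 F)))"
  if "f.closed_family 4 F" for F
  unfolding S234'_inv_def R_inverses unfolding R_VD_eq R_DD_eq
  using f.eval_on_legs[of 4 _ 1] f.eval_on_legs[of 4 _ 2] that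
  by (simp add: f.closed_on_legs numeral_2_eq_2 numeral_3_eq_3)
 have S4: "fam_eval \<phi> 4 (S123 OmOm F) = S 0 (fam_eval \<phi> 4 F)" "fam_eval \<phi> 4 (S123_inv OmOm F) = S_inv 0 (fam_eval \<phi> 4 F)"
  "fam_eval \<phi> 4 (S234' OmOm F) = St 0 (fam_eval \<phi> 4 F)" if "f.closed_family 4 F" for F
  using f.eval_S123[OF that] f.eval_S123_inv[OF that] f.eval_S234[OF that] by simp_all
 have sq: "qpow q (2 * x) = qpow q x ^ 2" for x
  using qpow_add[OF q_pos(1), of x x] by (simp add: power2_eq_square)
 have wa: "qpow q (2 * par_w - 2 * par_a) = (tw * Q) ^ 2 / Q ^ 4"
  using qpow_add[OF q_pos(1), of "2 * par_w" "- (2 * par_a)"]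
  unfolding qpow_minus[OF q_pos(1)] sq qpow_w qpow_a by (simp add: power_mult[symmetric])
 have ma: "qpow q (- par_a) = 1 / Q ^ 2" "qpow q (- par_m) = 1 / Q ^ r"
  by (simp_all only: qpow_minus[OF q_pos(1)] qpow_a qpow_m)
 show "\<phi> (\<sigma> (tt (dP [e 0, e 1]) (dP [e 2, e 3]))) = Q ^ 2 * S 0 (St 0 (%e. \<phi> (tt (dP [e 0, e 1]) (dP [e 2, e 3])))) e"
  using n[THEN conjunct1] unfolding pt fam_smult_def qpow_a
  by (simp only: fn cc[OF cS(1)[OF cS(3)[OF cl(1)]]] ev S4[OF cS(3)[OF cl(1)]] S4[OF cl(1)] fam_eval_tt)
 show "\<phi> (\<sigma> (tt (dbarP [e 0, e 1]) (dbarP [e 2, e 3]))) = 1 / Q ^ 2 * S 0 (St 0 (%e. \<phi> (tt (dbarP [e 0, e 1]) (dbarP [e 2, e 3])))) e"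
  using n[THEN conjunct2, THEN conjunct1] unfolding pt fam_smult_def ma
  by (simp only: fn cc[OF cS(1)[OF cS(3)[OF cl(2)]]] ev S4[OF cS(3)[OF cl(2)]] S4[OF cl(2)] fam_eval_tt)
 have g: "ract OmOm (lact OmOm (P [e 0, e 1]) g_mp) (P [e 2, e 3]) \<in> carrier OmOm"
  "ract OmOm (lact OmOm (P [e 0, e 1]) g_pm) (P [e 2, e 3]) \<in> carrier OmOm" by simp_all
 show "\<phi> (\<sigma> (tt (dP [e 0, e 1]) (dbarP [e 2, e 3]))) =
   qpow q (2 * par_a - 2 * par_w) * S 0 (leg_op VD 1 (leg_op DD 2 (leg_op VDi 1 (%e. \<phi> (tt (dbarP [e 0, e 1]) (dP [e 2, e 3])))))) e
   + (1 - Q ^ 2) * Q ^ 2 / Q ^ r * \<phi> (ract OmOm (lact OmOm (P [e 0, e 1]) g_mp) (P [e 2, e 3]))"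
  using n[THEN conjunct2, THEN conjunct2, THEN conjunct1] unfolding pt fam_smult_def fam_add_def pg ma qpow_a
  by (simp only: fn cc[OF cS(1)[OF cS(4)[OF cl(4)]]] OO.MN.sm_closed g ev S4[OF cS(4)[OF cl(4)]] St_inv[OF cl(4)] fam_eval_tt) simp
 show "\<phi> (\<sigma> (tt (dbarP [e 0, e 1]) (dP [e 2, e 3]))) =
   (tw * Q) ^ 2 / Q ^ 4 * S_inv 0 (St 0 (%e. \<phi> (tt (dP [e 0, e 1]) (dbarP [e 2, e 3])))) e
   + (1 - 1 / Q ^ 2) / Q ^ r * \<phi> (ract OmOm (lact OmOm (P [e 0, e 1]) g_pm) (P [e 2, e 3]))"
  using n[THEN conjunct2, THEN conjunct2, THEN conjunct2] unfolding pt fam_smult_def fam_add_def pg ma wa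
  by (simp only: fn cc[OF cS(2)[OF cS(3)[OF cl(3)]]] OO.MN.sm_closed g ev S4[OF cS(3)[OF cl(3)]] S4[OF cl(3)] fam_eval_tt) simp
qed

end

section \<open>Vanishing contractions\<close>

context quantum_levi_civita
begin

lemma plus_carrier: "Om_plus \<subseteq> carrier Om" "Om_minus \<subseteq> carrier Om"
 by (auto simp: Om_plus_def Om_minus_def Om_simps)

lemma plus_ract: "\<omega> \<in> Om_plus ==> b \<in> carrier alg ==> ract Om \<omega> b \<in> Om_plus"
 using Lp.r_closed by (auto simp: Om_plus_def Om_simps)

lemma minus_ract: "\<omega> \<in> Om_minus ==> b \<in> carrier alg ==> ract Om \<omega> b \<in> Om_minus"
 using Lm.r_closed by (auto simp: Om_minus_def Om_simps)

lemma gens_in [simp]: "dP is \<in> Om_plus" "dbarP is \<in> Om_minus"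
 by (simp_all add: Om_plus_def Om_minus_def dP_def dbarP_def)

lemma plus_induct [consumes 1, case_names zero gen add]:
 assumes "\<omega> \<in> Om_plus" and z: "R \<zero>\<^bsub>Om\<^esub>" and g: "\<And>b i j. b \<in> carrier alg ==> R (lact Om b (dP [i, j]))"
  and a: "\<And>x y. x \<in> carrier Om ==> y \<in> carrier Om ==> R x ==> R y ==> R (x \<oplus>\<^bsub>Om\<^esub> y)"
 shows "R \<omega>"
proof -
 obtain y where y: "\<omega> = (y, \<zero>\<^bsub>left_minus\<^esub>)" "y \<in> carrier left_plus" using assms(1) by (auto simp: Om_plus_def)
 have "R (y, \<zero>\<^bsub>left_minus\<^esub>)" using y(2)
 proof (induction y rule: plus.quotient_induct)
  case zero then show ?case using z by (simp add: Om_simps)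
 next
  case (gen b i j) then show ?case using g[of b i j] by (simp add: Om_simps dP_def)
 next
  case (add u v) then show ?case using a[OF _ _ add(3,4)] by (simp add: Om_simps)
 qed
 then show ?thesis using y by simp
qed

lemma minus_induct [consumes 1, case_names zero gen add]:
 assumes "\<omega> \<in> Om_minus" and z: "R \<zero>\<^bsub>Om\<^esub>" and g: "\<And>b i j. b \<in> carrier alg ==> R (lact Om b (dbarP [i, j]))"
  and a: "\<And>x y. x \<in> carrier Om ==> y \<in> carrier Om ==> R x ==> R y ==> R (x \<oplus>\<^bsub>Om\<^esub> y)"
 shows "R \<omega>"
proof -
 obtain y where y: "\<omega> = (\<zero>\<^bsub>left_plus\<^esub>, y)" "y \<in> carrier left_minus" using assms(1) by (auto simp: Om_minus_def)
 have "R (\<zero>\<^bsub>left_plus\<^esub>, y)" using y(2)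
 proof (induction y rule: minus.quotient_induct)
  case zero then show ?case using z by (simp add: Om_simps)
 next
  case (gen b i j) then show ?case using g[of b i j] by (simp add: Om_simps dbarP_def)
 next
  case (add u v) then show ?case using a[OF _ _ add(3,4)] by (simp add: Om_simps)
 qed
 then show ?thesis using y by simp
qed

lemma ip_tt_linear: "y \<in> carrier Om ==> clinear_map Om alg (%x. ip (tt x y))"
 "y \<in> carrier Om ==> clinear_map Om alg (%x. ip (tt y x))"
 by (rule clinear_compose[OF OO.ten_linear_left ip_linear], assumption)
  (rule clinear_compose[OF OO.ten_linear_right ip_linear], assumption)

text \<open>
 Forms of equal type are orthogonal. The left argument is an arbitrary form of its type because the braiding
 produces factors such as \<open>\<partial>p p\<close>.
\<close>

lemma ip_plus: "\<omega> \<in> Om_plus ==> ip (tt \<omega> (dP [k, l])) = \<zero>\<^bsub>alg\<^esub>"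
proof (induction \<omega> rule: plus_induct)
 case zero
 show ?case by (rule clinear_zero[OF Om.M.cspace_axioms alg.Bv.cspace_axioms ip_tt_linear(1)]) simp
next
 case (gen b i j)
 have "tt (lact Om b (dP [i, j])) (dP [k, l]) = lact OmOm b (tt (dP [i, j]) (dP [k, l]))"
  using gen by (simp add: OO.lact_ten)
 then show ?case using gen by (simp add: ip_acts ip_gens)
next
 case (add x y)
 then show ?case by (simp add: clinear_mapD(2)[OF ip_tt_linear(1)])
qed

lemma ip_minus: "\<omega> \<in> Om_minus ==> ip (tt \<omega> (dbarP [k, l])) = \<zero>\<^bsub>alg\<^esub>"
proof (induction \<omega> rule: minus_induct)
 case zero
 show ?case by (rule clinear_zero[OF Om.M.cspace_axioms alg.Bv.cspace_axioms ip_tt_linear(1)]) simp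
next
 case (gen b i j)
 have "tt (lact Om b (dbarP [i, j])) (dbarP [k, l]) = lact OmOm b (tt (dbarP [i, j]) (dbarP [k, l]))"
  using gen by (simp add: OO.lact_ten)
 then show ?case using gen by (simp add: ip_acts ip_gens)
next
 case (add x y)
 then show ?case by (simp add: clinear_mapD(2)[OF ip_tt_linear(1)])
qed

lemma lact_zero: "t \<in> carrier OmOm ==> lact OmOm \<zero>\<^bsub>alg\<^esub> t = \<zero>\<^bsub>OmOm\<^esub>"
 by (rule clinear_zero[OF alg.Bv.cspace_axioms OO.MN.cspace_axioms OmOm.l_linear'])

lemma contr_functional: "functional OmOm \<phi> ==> \<omega> \<in> carrier Om ==> \<xi> \<in> carrier Om ==> functional OmOm (%t. \<phi> (contr \<omega> \<xi> t))"
 by (rule functional_compose[OF contr_linear(1)])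

lemma contr_plus:
 assumes "\<omega> \<in> Om_plus" "\<xi> \<in> carrier Om" "y \<in> carrier Om"
 shows "contr \<omega> \<xi> (tt (dP [k, l]) y) = \<zero>\<^bsub>OmOm\<^esub>"
 using assms subsetD[OF plus_carrier(1) assms(1)] by (simp add: contr_tt ip_plus lact_zero)

lemma contr_minus:
 assumes "\<omega> \<in> Om_minus" "\<xi> \<in> carrier Om" "y \<in> carrier Om"
 shows "contr \<omega> \<xi> (tt (dbarP [k, l]) y) = \<zero>\<^bsub>OmOm\<^esub>"
 using assms subsetD[OF plus_carrier(2) assms(1)] by (simp add: contr_tt ip_minus lact_zero)

lemma leg_op_null [simp]: "leg_op A n (%e. 0) = (%e. 0)"
 by (simp add: leg_op_def fun_eq_iff)

lemma S_null [simp]: "S n (%e. 0) = (%e. 0)" "St n (%e. 0) = (%e. 0)" "S_inv n (%e. 0) = (%e. 0)"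
 by (simp_all add: S_def St_def S_inv_def)

lemma contr_g_plus:
 assumes "\<omega> \<in> Om_plus" "\<xi> \<in> carrier Om" "functional OmOm \<phi>"
 shows "\<phi> (contr \<omega> \<xi> g_pm) = 0"
proof -
 have w: "\<omega> \<in> carrier Om" using assms(1) plus_carrier by auto
 show ?thesis unfolding g_eval(1)[OF contr_functional[OF assms(3) w assms(2)]]
  using assms by (simp add: contr_plus OO.MN.functional_zero)
qed

lemma contr_g_minus:
 assumes "\<omega> \<in> Om_minus" "\<xi> \<in> carrier Om" "functional OmOm \<phi>"
 shows "\<phi> (contr \<omega> \<xi> g_mp) = 0"
proof -
 have w: "\<omega> \<in> carrier Om" using assms(1) plus_carrier by auto
 show ?thesis unfolding g_eval(2)[OF contr_functional[OF assms(3) w assms(2)]]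
  using assms by (simp add: contr_minus OO.MN.functional_zero)
qed

lemma contr_PgP:
 assumes "\<omega> \<in> carrier Om" "\<xi> \<in> carrier Om" "t \<in> carrier OmOm"
 shows "contr \<omega> \<xi> (ract OmOm (lact OmOm (P is) t) (P js)) = contr (ract Om \<omega> (P is)) (lact Om (P js) \<xi>) t"
 using assms by (simp add: contr_acts)

text \<open>The braiding keeps the parts of the tensor product that are killed by contraction with \<open>\<Omega>\<^sub>+\<close>
 or with \<open>\<Omega>\<^sub>-\<close> from the left.\<close>

lemma contr_sigma_plus:
 assumes w: "\<omega> \<in> Om_plus" and x: "\<xi> \<in> carrier Om"
 shows "contr \<omega> \<xi> (\<sigma> (tt (dP [i, j]) (dP [k, l]))) = \<zero>\<^bsub>OmOm\<^esub>"
  "contr \<omega> \<xi> (\<sigma> (tt (dbarP [i, j]) (dP [k, l]))) = \<zero>\<^bsub>OmOm\<^esub>"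
proof -
 have wc: "\<omega> \<in> carrier Om" using w plus_carrier by auto
 show "contr \<omega> \<xi> (\<sigma> (tt (dP [i, j]) (dP [k, l]))) = \<zero>\<^bsub>OmOm\<^esub>"
 proof (rule OO.MN.functional_eqI)
  fix \<phi> assume p: "functional OmOm \<phi>"
  show "\<phi> (contr \<omega> \<xi> (\<sigma> (tt (dP [i, j]) (dP [k, l])))) = \<phi> \<zero>\<^bsub>OmOm\<^esub>"
   using sigma_values(1)[OF contr_functional[OF p wc x], of "four i j k l"] w x
   by (simp add: contr_plus OO.MN.functional_zero[OF p])
 qed (use wc x in auto)
 show "contr \<omega> \<xi> (\<sigma> (tt (dbarP [i, j]) (dP [k, l]))) = \<zero>\<^bsub>OmOm\<^esub>"
 proof (rule OO.MN.functional_eqI)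
  fix \<phi> assume p: "functional OmOm \<phi>"
  show "\<phi> (contr \<omega> \<xi> (\<sigma> (tt (dbarP [i, j]) (dP [k, l])))) = \<phi> \<zero>\<^bsub>OmOm\<^esub>"
   using sigma_values(4)[OF contr_functional[OF p wc x], of "four i j k l"] w x
   by (simp add: contr_plus OO.MN.functional_zero[OF p] contr_PgP wc contr_g_plus[OF plus_ract _ p])
 qed (use wc x in auto)
qed

lemma contr_sigma_minus:
 assumes w: "\<omega> \<in> Om_minus" and x: "\<xi> \<in> carrier Om"
 shows "contr \<omega> \<xi> (\<sigma> (tt (dbarP [i, j]) (dbarP [k, l]))) = \<zero>\<^bsub>OmOm\<^esub>"
  "contr \<omega> \<xi> (\<sigma> (tt (dP [i, j]) (dbarP [k, l]))) = \<zero>\<^bsub>OmOm\<^esub>"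
proof -
 have wc: "\<omega> \<in> carrier Om" using w plus_carrier by auto
 show "contr \<omega> \<xi> (\<sigma> (tt (dbarP [i, j]) (dbarP [k, l]))) = \<zero>\<^bsub>OmOm\<^esub>"
 proof (rule OO.MN.functional_eqI)
  fix \<phi> assume p: "functional OmOm \<phi>"
  show "\<phi> (contr \<omega> \<xi> (\<sigma> (tt (dbarP [i, j]) (dbarP [k, l])))) = \<phi> \<zero>\<^bsub>OmOm\<^esub>"
   using sigma_values(2)[OF contr_functional[OF p wc x], of "four i j k l"] w x
   by (simp add: contr_minus OO.MN.functional_zero[OF p])
 qed (use wc x in auto)
 show "contr \<omega> \<xi> (\<sigma> (tt (dP [i, j]) (dbarP [k, l]))) = \<zero>\<^bsub>OmOm\<^esub>"
 proof (rule OO.MN.functional_eqI)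
  fix \<phi> assume p: "functional OmOm \<phi>"
  show "\<phi> (contr \<omega> \<xi> (\<sigma> (tt (dP [i, j]) (dbarP [k, l])))) = \<phi> \<zero>\<^bsub>OmOm\<^esub>"
   using sigma_values(3)[OF contr_functional[OF p wc x], of "four i j k l"] w x
   by (simp add: contr_minus OO.MN.functional_zero[OF p] contr_PgP wc contr_g_minus[OF minus_ract _ p])
 qed (use wc x in auto)
qed

lemma sw_values:
 "sw (wedge (dP is) (dP js)) = (1 / (1 + qpow q (- par_a))) \<odot>\<^bsub>OmOm\<^esub>
   (tt (dP is) (dP js) \<ominus>\<^bsub>OmOm\<^esub> qpow q (- par_a) \<odot>\<^bsub>OmOm\<^esub> \<sigma> (tt (dP is) (dP js)))"
 "sw (wedge (dbarP is) (dbarP js)) = (1 / (1 + qpow q par_a)) \<odot>\<^bsub>OmOm\<^esub>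
   (tt (dbarP is) (dbarP js) \<ominus>\<^bsub>OmOm\<^esub> qpow q par_a \<odot>\<^bsub>OmOm\<^esub> \<sigma> (tt (dbarP is) (dbarP js)))"
 "sw (wedge (dP is) (dbarP js)) = cpm \<odot>\<^bsub>OmOm\<^esub> tt (dP is) (dbarP js) \<ominus>\<^bsub>OmOm\<^esub> cmp \<odot>\<^bsub>OmOm\<^esub> \<sigma> (tt (dP is) (dbarP js))"
 "sw (wedge (dbarP is) (dP js)) = cmp \<odot>\<^bsub>OmOm\<^esub> tt (dbarP is) (dP js) \<ominus>\<^bsub>OmOm\<^esub> cpm \<odot>\<^bsub>OmOm\<^esub> \<sigma> (tt (dbarP is) (dP js))"
 using splitting unfolding splitting_map_def by simp_all

lemma contr_sw:
 assumes "functional OmOm \<phi>" "\<omega> \<in> carrier Om" "\<xi> \<in> carrier Om" "u \<in> carrier OmOm" "t \<in> carrier OmOm"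
 shows "\<phi> (contr \<omega> \<xi> (a \<odot>\<^bsub>OmOm\<^esub> u \<ominus>\<^bsub>OmOm\<^esub> b \<odot>\<^bsub>OmOm\<^esub> t)) = a * \<phi> (contr \<omega> \<xi> u) - b * \<phi> (contr \<omega> \<xi> t)"
  "\<phi> (contr \<omega> \<xi> (a \<odot>\<^bsub>OmOm\<^esub> (u \<ominus>\<^bsub>OmOm\<^esub> b \<odot>\<^bsub>OmOm\<^esub> t))) = a * (\<phi> (contr \<omega> \<xi> u) - b * \<phi> (contr \<omega> \<xi> t))"
 using assms OO.MN.functional_minus[OF contr_functional[OF assms(1-3)]] OO.MN.functional_smult[OF contr_functional[OF assms(1-3)]]
 by simp_all

text \<open>The scalar obtained by contracting \<open>\<omega> \<otimes> R\<close> completely.\<close>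

definition full :: "('n alg \<Rightarrow> complex) \<Rightarrow> 'n form \<Rightarrow> 'n form2_form \<Rightarrow> complex" where
 "full \<phi> \<omega> R = \<phi> (ip (hmap \<omega> R))"

context
 fixes \<phi> assumes \<phi>: "functional alg \<phi>"
begin

lemma ipf: "functional OmOm (%t. \<phi> (ip t))" by (rule ip_functional[OF \<phi>])

lemma full_functional:
 "\<omega> \<in> carrier Om ==> functional Om2Om (full \<phi> \<omega>)" "R \<in> carrier Om2Om ==> functional Om (%\<omega>. full \<phi> \<omega> R)"
 unfolding full_def using functional_compose[OF hmap_linear(1) ipf] functional_compose[OF hmap_linear(2) ipf] by auto

lemma full_ten: "\<omega> \<in> carrier Om ==> x \<in> carrier Om2 ==> \<xi> \<in> carrier Om ==> full \<phi> \<omega> (ten2 x \<xi>) = \<phi> (ip (contr \<omega> \<xi> (sw x)))"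
 by (simp add: full_def hmap_ten)

lemma phi_contr: "[|\<omega> \<in> carrier Om; \<xi> \<in> carrier Om; x \<in> carrier Om; y \<in> carrier Om|] ==>
  \<phi> (ip (contr \<omega> \<xi> (tt x y))) = \<phi> (ip (tt \<omega> x) \<otimes>\<^bsub>alg\<^esub> ip (tt y \<xi>))"
 by (simp add: contr_tt ip_acts)

text \<open>
 Of the two summands of the splitting map, only one survives on each type: in the other, the factor next
 to \<open>\<omega>\<close> has the type of \<open>\<omega>\<close>. The exception is \<open>\<bar>\<partial>p \<and> \<partial>p\<close> paired with \<open>\<Omega>\<^sub>-\<close>, where the braided term remains.
\<close>

lemma full_plus:
 assumes w: "\<omega> \<in> Om_plus" and x: "\<xi> \<in> carrier Om"
 shows "full \<phi> \<omega> (ten2 (wedge (dP [i, j]) (dP [k, l])) \<xi>) = 0"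
  "full \<phi> \<omega> (ten2 (wedge (dbarP [i, j]) (dP [k, l])) \<xi>) = cmp * \<phi> (ip (tt \<omega> (dbarP [i, j])) \<otimes>\<^bsub>alg\<^esub> ip (tt (dP [k, l]) \<xi>))"
proof -
 have wc: "\<omega> \<in> carrier Om" using w plus_carrier by auto
 note z = OO.MN.functional_zero[OF ipf]
 show "full \<phi> \<omega> (ten2 (wedge (dP [i, j]) (dP [k, l])) \<xi>) = 0"
  using wc w x by (simp add: full_ten sw_values contr_sw[OF ipf] contr_plus contr_sigma_plus z)
 show "full \<phi> \<omega> (ten2 (wedge (dbarP [i, j]) (dP [k, l])) \<xi>) = cmp * \<phi> (ip (tt \<omega> (dbarP [i, j])) \<otimes>\<^bsub>alg\<^esub> ip (tt (dP [k, l]) \<xi>))"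
  using wc w x by (simp add: full_ten sw_values contr_sw[OF ipf] phi_contr contr_sigma_plus z)
qed

lemma full_minus:
 assumes w: "\<omega> \<in> Om_minus" and x: "\<xi> \<in> carrier Om"
 shows "full \<phi> \<omega> (ten2 (wedge (dbarP [i, j]) (dbarP [k, l])) \<xi>) = 0"
  "full \<phi> \<omega> (ten2 (wedge (dP [i, j]) (dbarP [k, l])) \<xi>) = cpm * \<phi> (ip (tt \<omega> (dP [i, j])) \<otimes>\<^bsub>alg\<^esub> ip (tt (dbarP [k, l]) \<xi>))"
  "full \<phi> \<omega> (ten2 (wedge (dbarP [i, j]) (dP [k, l])) \<xi>) = - cpm * \<phi> (ip (contr \<omega> \<xi> (\<sigma> (tt (dbarP [i, j]) (dP [k, l])))))"
proof -
 have wc: "\<omega> \<in> carrier Om" using w plus_carrier by auto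
 note z = OO.MN.functional_zero[OF ipf]
 show "full \<phi> \<omega> (ten2 (wedge (dbarP [i, j]) (dbarP [k, l])) \<xi>) = 0"
  using wc w x by (simp add: full_ten sw_values contr_sw[OF ipf] contr_minus contr_sigma_minus z)
 show "full \<phi> \<omega> (ten2 (wedge (dP [i, j]) (dbarP [k, l])) \<xi>) = cpm * \<phi> (ip (tt \<omega> (dP [i, j])) \<otimes>\<^bsub>alg\<^esub> ip (tt (dbarP [k, l]) \<xi>))"
  using wc w x by (simp add: full_ten sw_values contr_sw[OF ipf] phi_contr contr_sigma_minus z)
 show "full \<phi> \<omega> (ten2 (wedge (dbarP [i, j]) (dP [k, l])) \<xi>) = - cpm * \<phi> (ip (contr \<omega> \<xi> (\<sigma> (tt (dbarP [i, j]) (dP [k, l])))))"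
  using wc w x by (simp add: full_ten sw_values contr_sw[OF ipf] contr_minus z)
qed

end

end

section \<open>The scalar curvature\<close>

context quantum_projective_space
begin

lemma four_Suc [simp]: "four a b c d (Suc (Suc 0)) = c" "four a b c d (Suc (Suc (Suc 0))) = d"
 by (simp_all add: four_def)

definition glue :: "'n \<Rightarrow> 'n \<Rightarrow> 'n legs \<Rightarrow> 'n legs" where
 "glue a b x = (%n. if n = 0 then a else if n = 1 then b else x (n - 2))"

lemma glue_simps [simp]: "glue a b x 0 = a" "glue a b x (Suc 0) = b" "glue a b x (Suc (Suc n)) = x n"
 "glue a b x 1 = b" "glue a b x 2 = x 0" "glue a b x 3 = x (Suc 0)" "glue a b x 4 = x 2" "glue a b x 5 = x 3"
 by (simp_all add: glue_def eval_nat_numeral)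

lemma glue_op: "leg_op A n (%x. F (glue a b x)) = (%y. leg_op A (n + 2) F (glue a b y))"
proof
 fix y
 have u: "(glue a b y)(Suc (Suc n) := k, Suc (Suc (Suc n)) := l) = glue a b (y(n := k, Suc n := l))" for k l
  by (rule ext) (auto simp: glue_def)
 show "leg_op A n (%x. F (glue a b x)) y = leg_op A (n + 2) F (glue a b y)"
  by (simp add: leg_op_def u)
qed

lemma glue_contract: "leg_contract c n (%x. F (glue a b x)) = (%y. leg_contract c (n + 2) F (glue a b y))"
proof
 fix y
 have u: "double_leg (glue a b y) (Suc (Suc n)) k = glue a b (double_leg y n k)" for k
  by (rule ext) (auto simp: glue_def double_leg_def)
 show "leg_contract c n (%x. F (glue a b x)) y = leg_contract c (n + 2) F (glue a b y)"
  by (simp add: leg_contract_def u)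
qed

definition prodT :: "('n legs \<Rightarrow> complex) \<Rightarrow> 'n legs \<Rightarrow> complex" where
 "prodT f = ev 1 (S 0 (St 0 f))"

lemma prodT_glue: "prodT (%x. F (glue a b x)) y = ev 3 (S 2 (St 2 F)) (glue a b y)"
 by (simp add: prodT_def S_def St_def glue_op glue_contract eval_nat_numeral)

lemma prodT_diff: "prodT (%x. f x - g x) e = prodT f e - prodT g e"
 and prodT_add: "prodT (%x. f x + g x) e = prodT f e + prodT g e"
 and prodT_smult: "prodT (%x. c * f x) e = c * prodT f e"
 and prodT_zero: "prodT (%x. 0) e = 0"
 using fun_cong[OF leg_contract_smult[of "%_. 1" 1 0 "%_. 0"], of e]
 by (simp_all add: prodT_def S_def St_def leg_op_diff leg_op_add leg_op_smult leg_contract_diff leg_contract_add leg_contract_smult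
   leg_op_smult[where c = 0, simplified])

lemma trace_prodT: "ev' 0 (ev 1 (ev 3 (S 2 (St 2 (coev' 1 f))))) e = ev' 0 (ev' 2 f) e"
proof -
 have 1: "ev 3 (St 2 g) = (%e. 1 / (tw * Q * Q ^ r) * ev' 4 g e)" for g
  using ev_St[of 2 g] by (simp add: eval_nat_numeral)
 have 2: "ev 1 (ev' 4 g) = ev' 2 (ev 1 g)" for g
  using contract_contract[of 1 2 "%_. 1" wt g] by simp
 have 3: "ev 1 (S 2 (coev' 1 f)) = (%e. tw * Q * Q ^ r * f e)"
  using ev_S_coev'[of 1 f] by (simp add: numeral_2_eq_2)
 show ?thesis
  unfolding S_St[of 2] 1 leg_contract_smult 2 3 using Q_nonzero tw_nonzero by (simp add: leg_contract_smult)
qed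

end

context quantum_levi_civita
begin

lemma mult_functional:
 assumes "functional alg \<phi>" "x \<in> carrier alg"
 shows "functional alg (%b. \<phi> (x \<otimes>\<^bsub>alg\<^esub> b))" "functional alg (%b. \<phi> (b \<otimes>\<^bsub>alg\<^esub> x))"
 by (rule functional_compose[OF _ assms(1), of alg],
   use assms(2) in \<open>auto simp: clinear_map_def alg.B.l_distr alg.B.r_distr alg.smult_mult_left alg.smult_mult_right\<close>)+

lemma lact_functional: "functional Om \<theta> ==> m \<in> carrier Om ==> functional alg (%b. \<theta> (lact Om b m))"
 by (rule functional_compose[OF Om.l_linear'])

subsection \<open>Rows of the inverse metric\<close>

text \<open>
 Contracting a row of the inverse metric with a form of the same type as its second entry: the term \<open>p p\<close> of the metric is evaluated by
 \<open>p \<cdot> \<partial>p = 0\<close> or \<open>p \<cdot> \<bar>\<partial>p = \<bar>\<partial>p\<close>, the other term by the zigzag identity.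
\<close>

lemma metric_row_minus:
 assumes th: "functional Om \<theta>"
 shows "(\<Sum>y\<in>UNIV. \<theta> (lact Om (ip (tt (dbarP [i, k]) (dP [x, y]))) (dbarP [y, z]))) =
  (if k = x then 1 / wt k * \<theta> (dbarP [i, z]) else 0) - 1 / Q ^ r * \<theta> (lact Om (P [i, k]) (dbarP [x, z]))"
proof -
 have "\<theta> (lact Om (ip (tt (dbarP [i, k]) (dP [x, y]))) (dbarP [y, z])) =
   (if k = x then 1 / wt k * \<theta> (lact Om (P [i, y]) (dbarP [y, z])) else 0) -
   1 / Q ^ r * \<theta> (lact Om (P [i, k]) (lact Om (P [x, y]) (dbarP [y, z])))" for y
  using ip_values(2)[OF lact_functional[OF th dbarP_closed], of "four i k x y" "[y, z]"]
  by (simp add: coev_eval drop_legs_def Om.assoc cong: if_cong)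
 moreover have "functional Om (%m. \<theta> (lact Om (P [i, k]) m))" by (rule functional_compose[OF Om.l_linear th]) simp
 ultimately show ?thesis
  using P_dbarP[OF th, of i z] P_dbarP[of "%m. \<theta> (lact Om (P [i, k]) m)" x z]
  by (simp add: sum_subtractf sum_divide_distrib[symmetric] sum_distrib_left[symmetric])
qed

lemma metric_row_plus:
 assumes th: "functional Om \<theta>"
 shows "(\<Sum>l\<in>UNIV. \<theta> (lact Om (ip (tt (dP [i, j]) (dbarP [k, l]))) (dP [l, a]))) =
  1 / Q ^ r * \<theta> (ract Om (dP [i, j]) (P [k, a]))"
proof -
 define G where "G = coev 2 (pdP \<theta>)"
 define e where "e = four i j k a"
 have 1: "\<theta> (lact Om (ip (tt (dP [i, j]) (dbarP [k, l]))) (dP [l, a])) =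
   Q ^ 2 / (tw * Q * Q ^ r) * S 0 G (double_leg e 3 l) -
   Q ^ 2 / Q ^ r * \<theta> (lact Om (P [i, j]) (lact Om (P [k, l]) (dP [l, a])))" for l
 proof -
  have "S 0 (coev 2 (%e. \<theta> (lact Om (P [e 0, e 1]) (dP [l, a])))) (four i j k l) = S 0 G (double_leg e 3 l)"
   by (simp add: S_def leg_op_def G_def coev_eval drop_legs_def double_leg_def e_def pdP_def four_def cong: if_cong)
  then show ?thesis
   using ip_values(1)[OF lact_functional[OF th dP_closed], of "four i j k l" "[l, a]"]
   by (simp add: Om.assoc)
 qed
 have f: "functional Om (%m. \<theta> (lact Om (P [i, j]) m))" by (rule functional_compose[OF Om.l_linear th]) simp
 have "(\<Sum>l\<in>UNIV. S 0 G (double_leg e 3 l)) = ev 3 (S 0 G) e"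
  by (simp add: leg_contract_def)
 also have "ev 3 (S 0 G) = S 0 (ev 3 G)"
  by (simp add: S_def contract_op_left)
 also have "ev 3 G = pdP \<theta>"
  using contract_insert_zigzag[of "%_. 1" 2 "%_. 1" "pdP \<theta>"] by (simp add: G_def eval_nat_numeral)
 also have "S 0 (pdP \<theta>) e = tw * Q / Q ^ 2 * \<theta> (ract Om (dP [i, j]) (P [k, a]))"
  unfolding S_pdP[OF th] by (simp add: dPp_def e_def)
 finally have s: "(\<Sum>l\<in>UNIV. S 0 G (double_leg e 3 l)) = tw * Q / Q ^ 2 * \<theta> (ract Om (dP [i, j]) (P [k, a]))" .
 have "(\<Sum>l\<in>UNIV. \<theta> (lact Om (ip (tt (dP [i, j]) (dbarP [k, l]))) (dP [l, a]))) =
   Q ^ 2 / (tw * Q * Q ^ r) * (\<Sum>l\<in>UNIV. S 0 G (double_leg e 3 l)) -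
   Q ^ 2 / Q ^ r * (\<Sum>l\<in>UNIV. \<theta> (lact Om (P [i, j]) (lact Om (P [k, l]) (dP [l, a]))))"
  unfolding 1 sum_subtractf sum_distrib_left ..
 then show ?thesis unfolding s P_dP[OF f] using Q_nonzero tw_nonzero by (simp add: field_simps)
qed

text \<open>This is the inverse property of the metric, restricted to \<open>\<Omega>\<^sub>-\<close>.\<close>

lemma contr_g_minus_id:
 assumes "\<omega> \<in> Om_minus" and x: "\<xi> \<in> carrier Om" and ph: "functional OmOm \<phi>"
 shows "\<phi> (contr \<omega> \<xi> g_pm) = \<phi> (tt \<omega> \<xi>)"
proof -
 have "contr \<omega> \<xi> g_pm = tt \<omega> \<xi>" using assms(1)
 proof (induction \<omega> rule: minus_induct)
  case zero
  show ?case using clinear_zero[OF Om.M.cspace_axioms OO.MN.cspace_axioms contr_linear(3)[OF x g_closed(1)]] x by simp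
 next
  case (gen b i j)
  have "contr (dbarP [i, j]) \<xi> g_pm = tt (dbarP [i, j]) \<xi>"
  proof (rule OO.MN.functional_eqI)
   fix \<theta> assume th: "functional OmOm \<theta>"
   have f: "functional Om (%m. \<theta> (tt m \<xi>))" by (rule tt_functional(1)[OF th x])
   have f': "functional Om (%m. \<theta> (tt (lact Om (P [i, j]) m) \<xi>))" by (rule functional_compose[OF Om.l_linear f]) simp
   have "\<theta> (contr (dbarP [i, j]) \<xi> g_pm) =
     (\<Sum>l\<in>UNIV. wt l * (\<Sum>k\<in>UNIV. \<theta> (tt (lact Om (ip (tt (dbarP [i, j]) (dP [l, k]))) (dbarP [k, l])) \<xi>)))"
    unfolding g_eval(1)[OF contr_functional[OF th dbarP_closed x]] using x by (simp add: contr_tt OO.lact_ten)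
   also have "\<dots> = (\<Sum>l\<in>UNIV. (if j = l then \<theta> (tt (dbarP [i, l]) \<xi>) else 0) - wt l / Q ^ r * \<theta> (tt (lact Om (P [i, j]) (dbarP [l, l])) \<xi>))"
    unfolding metric_row_minus[OF f] by (intro sum.cong refl) (simp add: algebra_simps)
   also have "\<dots> = \<theta> (tt (dbarP [i, j]) \<xi>) - (\<Sum>l\<in>UNIV. wt l * \<theta> (tt (lact Om (P [i, j]) (dbarP [l, l])) \<xi>)) / Q ^ r"
    by (simp add: sum_subtractf sum_divide_distrib)
   finally show "\<theta> (contr (dbarP [i, j]) \<xi> g_pm) = \<theta> (tt (dbarP [i, j]) \<xi>)"
    unfolding trace_dbarP[OF f'] by simp
  qed (use x in auto)
  then show ?case using gen x by (simp add: contr_acts OO.lact_ten)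
 next
  case (add u v)
  then show ?case using x by (simp add: clinear_mapD(2)[OF contr_linear(3)] OO.ten_add_left)
 qed
 then show ?thesis by simp
qed

subsection \<open>Total contractions of the metric\<close>

definition W :: complex where "W = (\<Sum>k\<in>UNIV. 1 / wt k)"

lemma trace_product:
 assumes \<phi>: "functional alg \<phi>"
 shows "(\<Sum>i\<in>UNIV. wt i * (\<Sum>k\<in>UNIV. \<phi> (P [i, k] \<otimes>\<^bsub>alg\<^esub> P [k, i]))) = Q ^ r * \<phi> \<one>\<^bsub>alg\<^esub>"
 unfolding P_P[OF \<phi>] by (rule PP_eval(3)[OF \<phi>])

lemma ip_g_mp:
 assumes \<phi>: "functional alg \<phi>"
 shows "\<phi> (ip g_mp) = (W * Q ^ r - 1) * \<phi> \<one>\<^bsub>alg\<^esub>"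
proof -
 have "\<phi> (ip g_mp) = (\<Sum>i\<in>UNIV. wt i * (\<Sum>k\<in>UNIV. \<phi> (P [i, i]) / wt k - 1 / Q ^ r * \<phi> (P [i, k] \<otimes>\<^bsub>alg\<^esub> P [k, i])))"
  unfolding g_eval(2)[OF ip_functional[OF \<phi>]]
 proof (intro sum.cong refl arg_cong2[where f = "(*)"])
  fix i k
  show "\<phi> (ip (tt (dbarP [i, k]) (dP [k, i]))) = \<phi> (P [i, i]) / wt k - 1 / Q ^ r * \<phi> (P [i, k] \<otimes>\<^bsub>alg\<^esub> P [k, i])"
   using ip_values(2)[OF \<phi>, of "four i k k i"] by (simp add: coev_eval drop_legs_def cong: if_cong)
 qed
 also have "\<dots> = (\<Sum>i\<in>UNIV. wt i * \<phi> (P [i, i]) * W) - 1 / Q ^ r * (\<Sum>i\<in>UNIV. wt i * (\<Sum>k\<in>UNIV. \<phi> (P [i, k] \<otimes>\<^bsub>alg\<^esub> P [k, i])))"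
  by (simp add: W_def sum_subtractf sum_distrib_left right_diff_distrib sum_divide_distrib mult_ac)
 also have "\<dots> = (W * Q ^ r - 1) * \<phi> \<one>\<^bsub>alg\<^esub>"
  unfolding trace_product[OF \<phi>] sum_distrib_right[symmetric] PP_eval(3)[OF \<phi>] using Q_nonzero by (simp add: algebra_simps)
 finally show ?thesis .
qed

text \<open>
 The trace of \<open>S\<close> applied to a coevaluation is reached through the Hecke relation, since \<open>E'\<^sub>1\<^sub>2 S\<close> is known but
 \<open>E\<^sub>2\<^sub>3 S\<close> is not.
\<close>

lemma ip_g_pm:
 assumes \<phi>: "functional alg \<phi>"
 shows "\<phi> (ip g_pm) = (W / Q ^ r - 1) * \<phi> \<one>\<^bsub>alg\<^esub>"
proof -
 define f where "f = coev 2 (%e. \<phi> (P [e 0, e 1]))"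
 define t where "t = tw * Q * (tw * Q) - tw * (Q - 1 / Q) * (tw * Q)"
 have t: "t = tw ^ 2" unfolding t_def using Q_nonzero by (simp add: field_simps power2_eq_square)
 have f1: "ev 1 f e = \<phi> (P [e 0, e 1])" for e
  by (simp add: f_def leg_contract_def coev_eval double_leg_def drop_legs_def if_distrib cong: if_cong)
 have f0: "ev' 0 f e = (if e 0 = e 1 then Q ^ r * \<phi> \<one>\<^bsub>alg\<^esub> else 0)" for e
  using PP_eval(3)[OF \<phi>] by (simp add: f_def leg_contract_def coev_eval double_leg_def drop_legs_def)
 have h: "ev' 0 (S 0 (S 0 f)) e = tw * Q * Q ^ r * ev 1 (S 0 f) e" for e
  by (simp add: ev'_S)
 have k: "tw * Q * Q ^ r * ev 1 (S 0 f) e = tw * (Q - 1 / Q) * (tw * Q * Q ^ r) * ev 1 f e + t * ev' 0 f e" for e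
  using h[of e, symmetric] unfolding S_hecke leg_contract_add leg_contract_smult ev'_S t_def
  by (simp only: mult.assoc One_nat_def)
 have "tw * Q * Q ^ r * ev 1 (S 0 f) e = tw * Q * Q ^ r *
   (tw * (Q - 1 / Q) * \<phi> (P [e 0, e 1]) + (if e 0 = e 1 then tw / Q * \<phi> \<one>\<^bsub>alg\<^esub> else 0))" for e
  unfolding k f1 f0 t using Q_nonzero by (simp add: field_simps power2_eq_square)
 then have s: "ev 1 (S 0 f) e = tw * (Q - 1 / Q) * \<phi> (P [e 0, e 1]) + (if e 0 = e 1 then tw / Q * \<phi> \<one>\<^bsub>alg\<^esub> else 0)" for e
  using Q_nonzero tw_nonzero by simp
 have "\<phi> (ip g_pm) = (\<Sum>i\<in>UNIV. wt i * (\<Sum>k\<in>UNIV. Q ^ 2 / (tw * Q * Q ^ r) * S 0 f (double_leg (two i i) 1 k) -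
   Q ^ 2 / Q ^ r * \<phi> (P [i, k] \<otimes>\<^bsub>alg\<^esub> P [k, i])))"
  unfolding g_eval(1)[OF ip_functional[OF \<phi>]]
 proof (intro sum.cong refl arg_cong2[where f = "(*)"])
  fix i k
  show "\<phi> (ip (tt (dP [i, k]) (dbarP [k, i]))) = Q ^ 2 / (tw * Q * Q ^ r) * S 0 f (double_leg (two i i) 1 k) -
    Q ^ 2 / Q ^ r * \<phi> (P [i, k] \<otimes>\<^bsub>alg\<^esub> P [k, i])"
   using ip_values(1)[OF \<phi>, of "double_leg (two i i) 1 k"] unfolding f_def by (simp add: double_leg_def two_def)
 qed
 also have "\<dots> = Q ^ 2 / (tw * Q * Q ^ r) * (\<Sum>i\<in>UNIV. wt i * ev 1 (S 0 f) (two i i)) -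
   Q ^ 2 / Q ^ r * (\<Sum>i\<in>UNIV. wt i * (\<Sum>k\<in>UNIV. \<phi> (P [i, k] \<otimes>\<^bsub>alg\<^esub> P [k, i])))"
  by (simp add: leg_contract_def sum_subtractf sum_distrib_left right_diff_distrib mult_ac)
 also have "(\<Sum>i\<in>UNIV. wt i * ev 1 (S 0 f) (two i i)) = tw * (Q - 1 / Q) * (\<Sum>i\<in>UNIV. wt i * \<phi> (P [i, i])) + tw / Q * \<phi> \<one>\<^bsub>alg\<^esub> * (\<Sum>i\<in>UNIV. wt i)"
  unfolding s by (simp add: sum.distrib distrib_left sum_distrib_left sum_divide_distrib mult_ac)
 also have "(\<Sum>i\<in>UNIV. wt i) = W" unfolding W_def by (rule weight_sum_sym)
 finally show ?thesis
  unfolding trace_product[OF \<phi>] PP_eval(3)[OF \<phi>] using Q_nonzero tw_nonzero by (simp add: field_simps power2_eq_square)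
qed

lemma prodT_ip:
 assumes th: "functional alg \<theta>"
 shows "prodT (%e. \<theta> (ip (tt (dbarP [e 0, e 1]) (dP [e 2, e 3])))) e =
  (if e 0 = e 1 then Q ^ r * \<theta> \<one>\<^bsub>alg\<^esub> else 0) - \<theta> (P [e 0, e 1]) / Q ^ r"
proof -
 let ?p = "%e. \<theta> (P [e 0, e 1])" and ?pp = "%e. \<theta> (P [e 0, e 1] \<otimes>\<^bsub>alg\<^esub> P [e 2, e 3])"
 have "prodT (%e. \<theta> (ip (tt (dbarP [e 0, e 1]) (dP [e 2, e 3])))) e = prodT (coev' 1 ?p) e - 1 / Q ^ r * prodT ?pp e"
  unfolding ip_values(2)[OF th] prodT_diff prodT_smult ..
 moreover have "prodT (coev' 1 ?p) e = (if e 0 = e 1 then Q ^ r * \<theta> \<one>\<^bsub>alg\<^esub> else 0)"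
 proof -
  have "ev' 2 (S 0 (coev' 1 ?p)) = (%e. tw * Q * Q ^ r * coev 0 (ev' 0 ?p) e)"
   using ev'_S_coev'[of 0 ?p] by (simp add: numeral_2_eq_2)
  then show ?thesis
   unfolding prodT_def product_T using Q_nonzero tw_nonzero PP_eval(3)[OF th]
   by (simp add: coev_eval leg_contract_def double_leg_def)
 qed
 moreover have "prodT ?pp e = \<theta> (P [e 0, e 1])"
  unfolding prodT_def product_T_symmetric[OF PP_eval(1)[OF th]]
  using PP_eval(3)[OF mult_functional(1)[OF th P_closed], of "[e 0, e 1]"] Q_nonzero
  by (simp add: leg_contract_def double_leg_def)
 ultimately show ?thesis by simp
qed

end

context quantum_levi_civita
begin

lemma ten2_functional: "functional Om2Om \<psi> ==> \<xi> \<in> carrier Om ==> functional Om2 (%x. \<psi> (ten2 x \<xi>))"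
 by (rule functional_compose[OF W.ten_linear_left])

lemma wedge_left_functional:
 "functional Om2Om \<psi> ==> x \<in> carrier Om ==> functional OmOm (%t. \<psi> (wedge_left x t))"
 "functional Om2Om \<psi> ==> t \<in> carrier OmOm ==> functional Om (%x. \<psi> (wedge_left x t))"
 by (rule functional_compose[OF wedge_left_linear(1)], assumption+)
  (rule functional_compose[OF wedge_left_linear(2)], assumption+)

lemma curv_functional: "functional Om2Om \<psi> ==> functional OmOm (%t. \<psi> (curv t))"
 by (rule functional_compose[OF curv_linear])

lemma wedge_dP_dP:
 assumes "functional Om2Om \<psi>" "\<xi> \<in> carrier Om"
 shows "(\<Sum>k\<in>UNIV. \<psi> (ten2 (wedge (dP [a, k]) (dP [k, b])) \<xi>)) = 0"
 unfolding wedge_def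
 by (rule dP_dP[OF functional_compose[OF wedge_proj_linear ten2_functional[OF assms]]])

lemma wedge_dbarP_dbarP:
 assumes "functional Om2Om \<psi>" "x \<in> carrier Om"
 shows "(\<Sum>k\<in>UNIV. \<psi> (ten2 (wedge x (dbarP [a, k])) (dbarP [k, b]))) = 0"
 using dbarP_dbarP[OF wedge_left_functional(1)[OF assms], of a b] assms(2) by (simp add: wedge_left_tt)

lemma split_wedge:
 assumes p: "functional Om2Om \<psi>" and x: "x \<in> carrier Om" "\<xi> \<in> carrier Om"
 shows "\<psi> (ten2 (wedge x (d0 (P [i, j]))) \<xi>) = \<psi> (ten2 (wedge x (dP [i, j])) \<xi>) + \<psi> (ten2 (wedge x (dbarP [i, j])) \<xi>)"
  "\<psi> (ten2 (wedge (d0 (P [i, j])) x) \<xi>) = \<psi> (ten2 (wedge (dP [i, j]) x) \<xi>) + \<psi> (ten2 (wedge (dbarP [i, j]) x) \<xi>)"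
 using x by (simp_all add: d0_P wedge_add_right wedge_add_left W.ten_add_left W.MN.functional_add[OF p])

lemma curv_lact_functional:
 assumes "functional Om2Om \<psi>" "t \<in> carrier OmOm"
 shows "\<psi> (curv (lact OmOm (P is) t)) = \<psi> (wedge_left (d0 (P is)) t) + \<psi> (lact Om2Om (P is) (curv t))"
 using assms(2) by (simp add: curv_lact W.MN.functional_add[OF assms(1)])

context
 fixes \<phi> assumes \<phi>: "functional alg \<phi>"
begin

text \<open>
 Here the curvature of \<open>\<bar>\<partial>p\<close> is paired with \<open>\<Omega>\<^sub>+\<close>. Only products \<open>\<bar>\<partial>p \<and> \<partial>p\<close> contribute: \<open>\<partial>p \<and> \<partial>p\<close> is killed by orthogonality,
 and factors \<open>\<bar>\<partial>p\<close> next to the last leg cancel by \<open>\<bar>\<partial>p \<cdot> \<bar>\<partial>p = 0\<close>. The last term vanishes later, after summation,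
 because the trace of \<open>\<partial>p\<close> is zero.
\<close>

lemma full_riemann_dbarP:
 assumes w: "\<omega> \<in> Om_plus"
 shows "full \<phi> \<omega> (riemann nabla (dbarP [a, b])) =
  - cmp * (\<Sum>c\<in>UNIV. \<Sum>d\<in>UNIV. \<phi> (ip (tt \<omega> (dbarP [a, d])) \<otimes>\<^bsub>alg\<^esub> ip (tt (dP [d, c]) (dbarP [c, b]))))
  - cmp / Q ^ r * \<phi> (ip (tt \<omega> (dbarP [a, b])) \<otimes>\<^bsub>alg\<^esub> ip g_pm)
  - 1 / Q ^ r * full \<phi> \<omega> (lact Om2Om (P [a, b]) (curv g_pm))"
proof -
 have wc: "\<omega> \<in> carrier Om" using w plus_carrier by auto
 define \<psi> where "\<psi> = full \<phi> \<omega>"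
 have p: "functional Om2Om \<psi>" unfolding \<psi>_def by (rule full_functional(1)[OF \<phi> wc])
 note F = full_plus[OF \<phi> w, folded \<psi>_def]
 let ?A = "%c d. \<phi> (ip (tt \<omega> (dbarP [a, d])) \<otimes>\<^bsub>alg\<^esub> ip (tt (dP [d, c]) (dbarP [c, b])))"
 let ?Z = "%c d. \<psi> (ten2 (wedge (d0 (P [a, d])) (dbarP [d, c])) (dbarP [c, b]))"
 have d1: "\<psi> (ten2 (d1 (dP [a, c])) (dbarP [c, b])) = - (\<Sum>d\<in>UNIV. cmp * ?A c d + ?Z c d)" for c
  unfolding d1_dbarP(2)[OF ten2_functional[OF p dbarP_closed]]
  by (simp add: split_wedge(1)[OF p]) (simp add: split_wedge(2)[OF p] F)
 have Z: "(\<Sum>c\<in>UNIV. \<Sum>d\<in>UNIV. ?Z c d) = 0"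
  by (subst sum.swap) (simp add: wedge_dbarP_dbarP[OF p])
 have n1: "\<psi> (wedge_left (dP [a, c]) (nabla (dbarP [c, b]))) = - (1 / Q ^ r * \<psi> (wedge_left (ract Om (dP [a, c]) (P [c, b])) g_pm))" for c
  unfolding nabla_values(2)[OF wedge_left_functional(1)[OF p dP_closed]]
  by (simp add: wedge_left_tt F wedge_left_acts)
 have n2: "(\<Sum>c\<in>UNIV. \<psi> (wedge_left (dP [a, c]) (nabla (dbarP [c, b])))) = 0"
 proof -
  have "(\<Sum>c\<in>UNIV. \<psi> (wedge_left (ract Om (dP [a, c]) (P [c, b])) g_pm)) = \<psi> (wedge_left (dP [a, b]) g_pm)"
   by (rule dP_P[OF wedge_left_functional(2)[OF p g_closed(1)]])
  also have "\<dots> = 0"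
   unfolding g_eval(1)[OF wedge_left_functional(1)[OF p dP_closed]] by (simp add: wedge_left_tt F)
  finally show ?thesis unfolding n1 sum_negf sum_distrib_left[symmetric] by simp
 qed
 have g: "\<psi> (wedge_left (d0 (P [a, b])) g_pm) = cmp * \<phi> (ip (tt \<omega> (dbarP [a, b])) \<otimes>\<^bsub>alg\<^esub> ip g_pm)"
 proof -
  have c: "ip (tt \<omega> (dbarP [a, b])) \<in> carrier alg" using wc by simp
  have d0c: "d0 (P [a, b]) \<in> carrier Om" by simp
  show ?thesis
   unfolding g_eval(1)[OF wedge_left_functional(1)[OF p d0c]] g_eval(1)[OF ip_functional[OF mult_functional(1)[OF \<phi> c]]]
   by (simp add: wedge_left_tt split_wedge(2)[OF p] F sum_distrib_left mult_ac)
 qed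
 have "\<psi> (curv (tt (dP [a, c]) (dbarP [c, b]))) =
   \<psi> (ten2 (d1 (dP [a, c])) (dbarP [c, b])) - \<psi> (wedge_left (dP [a, c]) (nabla (dbarP [c, b])))" for c
  by (simp add: curv_tt W.MN.functional_minus[OF p])
 then have "(\<Sum>c\<in>UNIV. \<psi> (curv (tt (dP [a, c]) (dbarP [c, b])))) = - (\<Sum>c\<in>UNIV. \<Sum>d\<in>UNIV. cmp * ?A c d)"
  using n2 Z by (simp add: sum_subtractf d1 sum_negf sum.distrib)
 then show ?thesis
  unfolding \<psi>_def[symmetric] riemann_curv nabla_values(2)[OF curv_functional[OF p]]
   curv_lact_functional[OF p g_closed(1)] g
  by (simp add: sum_distrib_left sum_negf algebra_simps)
qed

lemma scalar_plus:
 "(\<Sum>i\<in>UNIV. wt i * (\<Sum>k\<in>UNIV. full \<phi> (dP [i, k]) (riemann nabla (dbarP [k, i])))) =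
  - cmp / Q ^ r * \<phi> (ip g_pm) - cmp / Q ^ r * \<phi> (ip g_pm \<otimes>\<^bsub>alg\<^esub> ip g_pm)"
proof -
 let ?q = "%i k c. \<Sum>d\<in>UNIV. \<phi> (ip (tt (dP [i, k]) (dbarP [k, d])) \<otimes>\<^bsub>alg\<^esub> ip (tt (dP [d, c]) (dbarP [c, i])))"
 have row: "(\<Sum>k\<in>UNIV. \<Sum>c\<in>UNIV. ?q i k c) = 1 / Q ^ r * (\<Sum>c\<in>UNIV. \<phi> (ip (tt (dP [i, c]) (dbarP [c, i]))))" for i
 proof -
  have f: "functional Om (%m. \<phi> (ip (tt m (dbarP [c, i]))))" for c
   by (rule tt_functional(1)[OF ip_functional[OF \<phi>] dbarP_closed])
  have e: "ip x \<otimes>\<^bsub>alg\<^esub> ip (tt (dP [d, c]) (dbarP [c, i])) = ip (tt (lact Om (ip x) (dP [d, c])) (dbarP [c, i]))"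
   if "x \<in> carrier OmOm" for x d c
  proof -
   have "tt (lact Om (ip x) (dP [d, c])) (dbarP [c, i]) = lact OmOm (ip x) (tt (dP [d, c]) (dbarP [c, i]))"
    using that by (simp add: OO.lact_ten)
   then show ?thesis using that by (simp add: ip_acts)
  qed
  have "?q i k c = 1 / Q ^ r * \<phi> (ip (tt (ract Om (dP [i, k]) (P [k, c])) (dbarP [c, i])))" for k c
   using metric_row_plus[OF f, of i k k c] by (simp add: e)
  then have "(\<Sum>k\<in>UNIV. \<Sum>c\<in>UNIV. ?q i k c) =
    1 / Q ^ r * (\<Sum>c\<in>UNIV. \<Sum>k\<in>UNIV. \<phi> (ip (tt (ract Om (dP [i, k]) (P [k, c])) (dbarP [c, i]))))"
   by (simp only: sum_distrib_left[symmetric]) (subst sum.swap, rule refl)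
  then show ?thesis unfolding dP_P[OF f] .
 qed
 have C: "(\<Sum>i\<in>UNIV. wt i * (\<Sum>k\<in>UNIV. full \<phi> (dP [i, k]) (lact Om2Om (P [k, i]) (curv g_pm)))) = 0"
 proof -
  have f: "functional Om (%\<omega>. full \<phi> \<omega> (curv g_pm))" by (rule full_functional(2)[OF \<phi>]) simp
  have "full \<phi> (dP [i, k]) (lact Om2Om (P [k, i]) (curv g_pm)) = full \<phi> (ract Om (dP [i, k]) (P [k, i])) (curv g_pm)" for i k
   by (simp add: full_def hmap_ract)
  then show ?thesis using dP_P[OF f] trace_dP[OF f] by simp
 qed
 have gc: "ip g_pm \<in> carrier alg" by simp
 have "(\<Sum>i\<in>UNIV. wt i * (\<Sum>k\<in>UNIV. full \<phi> (dP [i, k]) (riemann nabla (dbarP [k, i])))) =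
  - cmp * (\<Sum>i\<in>UNIV. wt i * (\<Sum>k\<in>UNIV. \<Sum>c\<in>UNIV. ?q i k c))
  - cmp / Q ^ r * (\<Sum>i\<in>UNIV. wt i * (\<Sum>k\<in>UNIV. \<phi> (ip (tt (dP [i, k]) (dbarP [k, i])) \<otimes>\<^bsub>alg\<^esub> ip g_pm)))
  - 1 / Q ^ r * (\<Sum>i\<in>UNIV. wt i * (\<Sum>k\<in>UNIV. full \<phi> (dP [i, k]) (lact Om2Om (P [k, i]) (curv g_pm))))"
  unfolding full_riemann_dbarP[OF gens_in(1)]
  by (simp only: sum_subtractf right_diff_distrib sum_distrib_left mult_ac)
 then show ?thesis
  unfolding row C g_eval(1)[OF ip_functional[OF mult_functional(2)[OF \<phi> gc]], symmetric] g_eval(1)[OF ip_functional[OF \<phi>]]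
  by (simp add: sum_distrib_left mult_ac)
qed

definition "firstA \<omega> x = (\<Sum>y\<in>UNIV. \<phi> (ip (tt \<omega> (dP [x 0, y])) \<otimes>\<^bsub>alg\<^esub> ip (tt (dbarP [y, x 1]) (dP [x 2, x 3]))))" for x :: "'n legs"
definition "firstB \<omega> x = (\<Sum>y\<in>UNIV. \<phi> (ip (contr \<omega> (dP [x 2, x 3]) (\<sigma> (tt (dbarP [x 0, y]) (dP [y, x 1]))))))" for x :: "'n legs"

text \<open>
 Here the curvature of \<open>\<partial>p\<close> is paired with \<open>\<Omega>\<^sub>-\<close>. The connection term \<open>\<bar>\<partial>p \<and> \<nabla>\<partial>p\<close> drops out: its part with two factors \<open>\<bar>\<partial>p\<close> is
 orthogonal to \<open>\<Omega>\<^sub>-\<close>, and \<open>E\<^sub>2\<^sub>3 T\<close> maps \<open>\<bar>\<partial>p p\<close> to \<open>\<bar>\<partial>p\<close>, which reduces its other part to the same situation.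
\<close>

lemma full_riemann_dP:
 assumes w: "\<omega> \<in> Om_minus"
 shows "full \<phi> \<omega> (riemann nabla (dP [e 0, e 1])) =
  Q ^ 2 * cpm * prodT (firstA \<omega>) e - Q ^ 2 * cpm * prodT (firstB \<omega>) e
  - Q ^ 2 / Q ^ r * (cpm * \<phi> (ip (tt \<omega> (dP [e 0, e 1])) \<otimes>\<^bsub>alg\<^esub> ip g_mp))
  - Q ^ 2 / Q ^ r * full \<phi> \<omega> (lact Om2Om (P [e 0, e 1]) (curv g_mp))"
proof -
 have wc: "\<omega> \<in> carrier Om" using w plus_carrier by auto
 define \<psi> where "\<psi> = full \<phi> \<omega>"
 have p: "functional Om2Om \<psi>" unfolding \<psi>_def by (rule full_functional(1)[OF \<phi> wc])
 note F = full_minus[OF \<phi> w, folded \<psi>_def]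
 define \<theta> where "\<theta> x = \<psi> (wedge_left x g_mp)" for x
 have th: "functional Om \<theta>" unfolding \<theta>_def by (rule wedge_left_functional(2)[OF p g_closed(2)])
 have th0: "\<theta> (dbarP [i, j]) = 0" for i j
  unfolding \<theta>_def g_eval(2)[OF wedge_left_functional(1)[OF p dbarP_closed]] by (simp add: wedge_left_tt F)
 have d1: "\<psi> (ten2 (d1 (dbarP [x 0, x 1])) (dP [x 2, x 3])) = cpm * firstA \<omega> x - cpm * firstB \<omega> x" for x :: "'n legs"
  unfolding d1_dbarP(1)[OF ten2_functional[OF p dP_closed]] firstA_def firstB_def
  using wedge_dP_dP[OF p dP_closed, of "x 0" "x 1" "[x 2, x 3]"]
  by (simp add: split_wedge(1)[OF p]) (simp add: split_wedge(2)[OF p] F sum.distrib sum_subtractf sum_negf sum_distrib_left[symmetric])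
 have n1: "\<psi> (wedge_left (dbarP [x 0, x 1]) (nabla (dP [x 2, x 3]))) = - (Q ^ 2 / Q ^ r * dbarPp \<theta> x)" for x :: "'n legs"
 proof -
  have z: "(%e. \<psi> (wedge_left (dbarP [x 0, x 1]) (tt (dbarP [e 0, e 1]) (dP [e 2, e 3])))) = (%e :: 'n legs. 0)"
   by (simp add: wedge_left_tt F)
  show ?thesis
   using nabla_values(1)[OF wedge_left_functional(1)[OF p dbarP_closed], of "[x 0, x 1]" "two (x 2) (x 3)"]
   unfolding z prodT_def[symmetric] prodT_zero
   by (simp add: \<theta>_def dbarPp_def wedge_left_acts)
 qed
 have th1: "prodT (dbarPp \<theta>) e = 0"
  unfolding prodT_def product_T_symmetric[OF S_dbarPp[OF th]]
  using PP_eval(3)[OF functional_compose[OF Om.r_linear'[OF dbarP_closed] th], of "[e 0, e 1]"]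
  by (simp add: leg_contract_def double_leg_def dbarPp_def th0)
 have pT: "prodT (%x. \<psi> (curv (tt (dbarP [x 0, x 1]) (dP [x 2, x 3])))) e = cpm * prodT (firstA \<omega>) e - cpm * prodT (firstB \<omega>) e"
 proof -
  have "(%x. \<psi> (curv (tt (dbarP [x 0, x 1]) (dP [x 2, x 3])))) =
    (%x. (cpm * firstA \<omega> x - cpm * firstB \<omega> x) + Q ^ 2 / Q ^ r * dbarPp \<theta> x)"
   by (rule ext) (simp add: curv_tt W.MN.functional_minus[OF p] d1[simplified] n1[simplified])
  then show ?thesis by (simp only: prodT_add prodT_diff prodT_smult th1) simp
 qed
 have g: "\<psi> (wedge_left (d0 (P [e 0, e 1])) g_mp) = cpm * \<phi> (ip (tt \<omega> (dP [e 0, e 1])) \<otimes>\<^bsub>alg\<^esub> ip g_mp)"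
 proof -
  have c: "ip (tt \<omega> (dP [e 0, e 1])) \<in> carrier alg" using wc by simp
  have d0c: "d0 (P [e 0, e 1]) \<in> carrier Om" by simp
  show ?thesis
   unfolding g_eval(2)[OF wedge_left_functional(1)[OF p d0c]] g_eval(2)[OF ip_functional[OF mult_functional(1)[OF \<phi> c]]]
   by (simp add: wedge_left_tt split_wedge(2)[OF p] F sum_distrib_left mult_ac)
 qed
 show ?thesis
  unfolding \<psi>_def[symmetric] riemann_curv nabla_values(1)[OF curv_functional[OF p]] prodT_def[symmetric]
   curv_lact_functional[OF p g_closed(2)] pT g
  by (simp add: algebra_simps)
qed

end

end

context quantum_levi_civita
begin

lemma sigma_functional: "functional OmOm \<theta> ==> functional OmOm (%t. \<theta> (\<sigma> t))"
 by (rule functional_compose[OF sigma_linear])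

lemma prodT_pdP:
 assumes "functional Om \<theta>"
 shows "prodT (pdP \<theta>) e = \<theta> (dP [e 0, e 1]) / Q ^ 2"
proof -
 have "Q ^ 2 * prodT (pdP \<theta>) e = ev 1 (dPp \<theta>) e"
  unfolding dPp_eq[OF assms] leg_contract_smult prodT_def ..
 also have "\<dots> = \<theta> (dP [e 0, e 1])"
  using dP_P[OF assms, of "e 0" "e 1"] by (simp add: leg_contract_def double_leg_def dPp_def)
 finally show ?thesis using Q_nonzero by (simp add: field_simps)
qed

context
 fixes \<phi> assumes \<phi>: "functional alg \<phi>"
begin

text \<open>
 Up to the map \<open>contr \<omega> \<xi>\<close>, the braiding exchanges \<open>g\<^sub>-\<^sub>+\<close> and \<open>g\<^sub>+\<^sub>-\<close>. The leading term of the braiding gives the fraction \<open>q\<^sup>-\<^sup>a\<close> of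
 \<open>g\<^sub>+\<^sub>-\<close>, by the Hecke relation and the vanishing traces; the correction \<open>p g\<^sub>+\<^sub>- p\<close> supplies the fraction \<open>1 - q\<^sup>-\<^sup>a\<close>.
\<close>

lemma contr_sigma_g:
 assumes w: "\<omega> \<in> Om_minus" and x: "\<xi> \<in> carrier Om"
 shows "\<phi> (ip (contr \<omega> \<xi> (\<sigma> g_mp))) = \<phi> (ip (tt \<omega> \<xi>))"
proof -
 have wc: "\<omega> \<in> carrier Om" using w plus_carrier by auto
 have pf: "functional OmOm (%t. \<phi> (ip t))" by (rule ip_functional[OF \<phi>])
 define \<theta> where "\<theta> t = \<phi> (ip (contr \<omega> \<xi> t))" for t
 have th: "functional OmOm \<theta>" unfolding \<theta>_def by (rule contr_functional[OF pf wc x])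
 define H where "H e = \<theta> (tt (dP [e 0, e 1]) (dbarP [e 2, e 3]))" for e :: "'n legs"
 define e0 :: "'n legs" where "e0 = (%_. undefined)"
 let ?z = "tw * (Q - 1 / Q)"
 have t: "tw * Q * (tw * Q) - ?z * (tw * Q) = tw ^ 2" using Q_nonzero by (simp add: field_simps power2_eq_square)
 have inv: "S_inv 0 H = (%e. 1 / tw ^ 2 * (S 0 H e - ?z * H e))"
  using S_inv_eq[of 0 H] unfolding t using tw_nonzero by (simp add: fun_eq_iff field_simps)
 have H0: "ev' 0 (ev' 2 H) e0 = 0"
 proof -
  have "(\<Sum>k\<in>UNIV. wt k * \<theta> (tt (dP [a, a]) (dbarP [k, k]))) = 0" for a
   by (rule trace_dbarP[OF tt_functional(2)[OF th dP_closed]])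
  then show ?thesis by (simp add: leg_contract_def double_leg_def H_def)
 qed
 have H1: "ev' 0 (ev 1 H) e0 = \<theta> g_pm"
  unfolding g_eval(1)[OF th] by (simp add: leg_contract_def double_leg_def H_def)
 have H2: "ev' 0 (ev' 2 (S 0 H)) e0 = tw * Q * Q ^ r * \<theta> g_pm"
 proof -
  have "ev' 0 (ev' 2 (S 0 H)) = ev' 0 (ev' 0 (S 0 H))"
   using contract_contract[of 0 0 wt wt "S 0 H"] by (simp add: numeral_2_eq_2)
  then show ?thesis unfolding ev'_S leg_contract_smult using H1 by simp
 qed
 have "ev' 0 (ev 1 (S_inv 0 (St 0 H))) e0 = 1 / (tw * Q * Q ^ r) * ev' 0 (ev' 2 (S_inv 0 H)) e0"
 proof -
  have "ev 1 (St 0 (S_inv 0 H)) = (%e. 1 / (tw * Q * Q ^ r) * ev' 2 (S_inv 0 H) e)"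
   using ev_St[of 0 "S_inv 0 H"] by (simp add: numeral_2_eq_2)
  then show ?thesis unfolding S_inv_St by (simp only: leg_contract_smult)
 qed
 also have "\<dots> = 1 / tw ^ 2 * \<theta> g_pm"
  unfolding inv leg_contract_smult leg_contract_diff H0 H2 using Q_nonzero tw_nonzero by simp
 finally have first: "ev' 0 (ev 1 (S_inv 0 (St 0 H))) e0 = 1 / tw ^ 2 * \<theta> g_pm" .
 have second: "(\<Sum>a\<in>UNIV. wt a * (\<Sum>b\<in>UNIV. \<theta> (ract OmOm (lact OmOm (P [a, b]) g_pm) (P [b, a])))) = Q ^ r * \<phi> (ip (tt \<omega> \<xi>))"
 proof -
  have "\<theta> (ract OmOm (lact OmOm (P [a, b]) g_pm) (P [b, a])) = \<phi> (ip (tt (ract Om \<omega> (P [a, b] \<otimes>\<^bsub>alg\<^esub> P [b, a])) \<xi>))" for a b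
   unfolding \<theta>_def contr_PgP[OF wc x g_closed(1)]
   using contr_g_minus_id[OF minus_ract[OF w P_closed, of "[a, b]"] Om.l_closed[OF P_closed x, of "[b, a]"] pf] wc x
   by (simp add: Om.assoc OO.ten_balanced)
  moreover have "functional alg (%b. \<phi> (ip (tt (ract Om \<omega> b) \<xi>)))"
   by (rule functional_compose[OF Om.r_linear'[OF wc] tt_functional(1)[OF pf x]])
  ultimately show ?thesis using trace_product[of "%b. \<phi> (ip (tt (ract Om \<omega> b) \<xi>))"] wc by simp
 qed
 have "\<theta> (\<sigma> g_mp) = (\<Sum>a\<in>UNIV. wt a * (\<Sum>b\<in>UNIV.
   (tw * Q) ^ 2 / Q ^ 4 * S_inv 0 (St 0 H) (double_leg (double_leg e0 0 a) 1 b) +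
   (1 - 1 / Q ^ 2) / Q ^ r * \<theta> (ract OmOm (lact OmOm (P [a, b]) g_pm) (P [b, a]))))"
  unfolding g_eval(2)[OF sigma_functional[OF th]]
 proof (intro sum.cong refl arg_cong2[where f = "(*)"])
  fix a b
  show "\<theta> (\<sigma> (tt (dbarP [a, b]) (dP [b, a]))) = (tw * Q) ^ 2 / Q ^ 4 * S_inv 0 (St 0 H) (double_leg (double_leg e0 0 a) 1 b) +
   (1 - 1 / Q ^ 2) / Q ^ r * \<theta> (ract OmOm (lact OmOm (P [a, b]) g_pm) (P [b, a]))"
   using sigma_values(4)[OF th, of "double_leg (double_leg e0 0 a) 1 b", folded H_def] by (simp add: double_leg_def H_def[abs_def])
 qed
 also have "\<dots> = (tw * Q) ^ 2 / Q ^ 4 * ev' 0 (ev 1 (S_inv 0 (St 0 H))) e0 +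
   (1 - 1 / Q ^ 2) / Q ^ r * (\<Sum>a\<in>UNIV. wt a * (\<Sum>b\<in>UNIV. \<theta> (ract OmOm (lact OmOm (P [a, b]) g_pm) (P [b, a]))))"
  by (simp add: leg_contract_def sum.distrib sum_distrib_left distrib_left mult_ac)
 also have "\<dots> = \<phi> (ip (tt \<omega> \<xi>))"
  unfolding first second using contr_g_minus_id[OF w x pf] Q_nonzero tw_nonzero
  by (simp add: \<theta>_def field_simps power2_eq_square power4_eq_xxxx)
 finally show ?thesis unfolding \<theta>_def .
qed

lemma prodT_firstB:
 assumes w: "\<omega> \<in> Om_minus"
 shows "prodT (firstB \<phi> \<omega>) e = 1 / (Q ^ r * Q ^ 2) * \<phi> (ip (tt \<omega> (dP [e 0, e 1])))"
proof -
 have wc: "\<omega> \<in> carrier Om" using w plus_carrier by auto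
 have pf: "functional OmOm (%t. \<phi> (ip t))" by (rule ip_functional[OF \<phi>])
 define \<theta> where "\<theta> \<xi> = \<phi> (ip (contr \<omega> \<xi> (\<sigma> g_mp)))" for \<xi>
 have th: "functional Om \<theta>"
  unfolding \<theta>_def by (rule functional_compose[OF contr_linear(2)[OF wc] pf]) simp
 have "firstB \<phi> \<omega> = (%x. 1 / Q ^ r * pdP \<theta> x)"
 proof
  fix x :: "'n legs"
  have "functional OmOm (%t. \<phi> (ip (contr \<omega> (dP [x 2, x 3]) (\<sigma> t))))"
   by (rule sigma_functional[OF contr_functional[OF pf wc dP_closed]])
  from dbarP_dP[OF this, of "x 0" "x 1"] show "firstB \<phi> \<omega> x = 1 / Q ^ r * pdP \<theta> x"
   using wc by (simp add: firstB_def[OF \<phi>] pdP_def \<theta>_def bimodule_mapD(3)[OF sigma_map] contr_acts)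
 qed
 then have "prodT (firstB \<phi> \<omega>) e = 1 / Q ^ r * (\<theta> (dP [e 0, e 1]) / Q ^ 2)"
  by (simp only: prodT_smult prodT_pdP[OF th])
 then show ?thesis unfolding \<theta>_def contr_sigma_g[OF w dP_closed] by simp
qed

text \<open>
 The row identity splits the products of inverse metrics in two parts. In the part with a coevaluation the operator
 \<open>E\<^sub>2\<^sub>3 T\<close> can be removed, and a product of two vanishing traces remains.
\<close>

lemma sum_firstA:
 "(\<Sum>i\<in>UNIV. wt i * (\<Sum>k\<in>UNIV. prodT (firstA \<phi> (dbarP [i, k])) (glue k i e0))) =
  - (1 / Q ^ r * (Q ^ r * Q ^ r - 1)) * \<phi> \<one>\<^bsub>alg\<^esub>"
proof -
 define h where "h e = \<phi> (ip (tt (dbarP [e 0, e 1]) (dP [e 2, e 3])))" for e :: "'n legs"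
 have A: "firstA \<phi> (dbarP [i, k]) = (%x. coev' 1 h (glue i k x) -
   1 / Q ^ r * \<phi> (P [i, k] \<otimes>\<^bsub>alg\<^esub> ip (tt (dbarP [x 0, x 1]) (dP [x 2, x 3]))))" for i k
 proof
  fix x :: "'n legs"
  have f: "functional Om (%m. \<phi> (ip (tt m (dP [x 2, x 3]))))"
   by (rule tt_functional(1)[OF ip_functional[OF \<phi>] dP_closed])
  have l: "b \<otimes>\<^bsub>alg\<^esub> ip (tt m (dP [x 2, x 3])) = ip (tt (lact Om b m) (dP [x 2, x 3]))"
   if "b \<in> carrier alg" "m \<in> carrier Om" for b m
  proof -
   have "tt (lact Om b m) (dP [x 2, x 3]) = lact OmOm b (tt m (dP [x 2, x 3]))" using that by (simp add: OO.lact_ten)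
   then show ?thesis using that by (simp add: ip_acts)
  qed
  have "coev' 1 h (glue i k x) = (if k = x 0 then 1 / wt k * \<phi> (ip (tt (dbarP [i, x 1]) (dP [x 2, x 3]))) else 0)"
   by (simp add: coev_eval drop_legs_def h_def cong: if_cong)
  then show "firstA \<phi> (dbarP [i, k]) x = coev' 1 h (glue i k x) -
   1 / Q ^ r * \<phi> (P [i, k] \<otimes>\<^bsub>alg\<^esub> ip (tt (dbarP [x 0, x 1]) (dP [x 2, x 3])))"
   using metric_row_minus[OF f, of i k "x 0" "x 1"] by (simp add: firstA_def[OF \<phi>] l)
 qed
 have dl: "double_leg (double_leg e0 0 i) (Suc 0) k = glue i k (glue k i e0)" for i k
  by (rule ext) (auto simp: double_leg_def glue_def)
 have p: "prodT (firstA \<phi> (dbarP [i, k])) (glue k i e0) = ev 3 (S 2 (St 2 (coev' 1 h))) (double_leg (double_leg e0 0 i) (Suc 0) k) -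
   1 / Q ^ r * ((if k = i then Q ^ r * \<phi> (P [i, k]) else 0) - \<phi> (P [i, k] \<otimes>\<^bsub>alg\<^esub> P [k, i]) / Q ^ r)" for i k
  unfolding A prodT_diff prodT_smult prodT_glue prodT_ip[OF mult_functional(1)[OF \<phi> P_closed]] dl by simp
 have z: "ev' 0 (ev' 2 h) e0 = 0"
 proof -
  have "(\<Sum>k\<in>UNIV. wt k * \<phi> (ip (tt (dbarP [a, a]) (dP [k, k])))) = 0" for a
   by (rule trace_dP[OF tt_functional(2)[OF ip_functional[OF \<phi>] dbarP_closed]])
  then show ?thesis by (simp add: leg_contract_def double_leg_def h_def)
 qed
 have "(\<Sum>i\<in>UNIV. wt i * (\<Sum>k\<in>UNIV. prodT (firstA \<phi> (dbarP [i, k])) (glue k i e0))) =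
   ev' 0 (ev 1 (ev 3 (S 2 (St 2 (coev' 1 h))))) e0 -
   1 / Q ^ r * (\<Sum>i\<in>UNIV. wt i * (\<Sum>k\<in>UNIV. if k = i then Q ^ r * \<phi> (P [i, k]) else 0)) +
   1 / Q ^ r * (1 / Q ^ r) * (\<Sum>i\<in>UNIV. wt i * (\<Sum>k\<in>UNIV. \<phi> (P [i, k] \<otimes>\<^bsub>alg\<^esub> P [k, i])))"
 proof -
  have "ev' 0 (ev 1 (ev 3 (S 2 (St 2 (coev' 1 h))))) e0 =
    (\<Sum>i\<in>UNIV. wt i * (\<Sum>k\<in>UNIV. ev 3 (S 2 (St 2 (coev' 1 h))) (double_leg (double_leg e0 0 i) (Suc 0) k)))"
   by (simp add: leg_contract_def[of _ 0] leg_contract_def[of _ "Suc 0"])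
  then show ?thesis unfolding p
   by (simp only: sum_subtractf sum.distrib right_diff_distrib sum_distrib_left sum_divide_distrib) (simp add: sum_distrib_left mult_ac)
 qed
 also have "\<dots> = - (1 / Q ^ r * (Q ^ r * Q ^ r - 1)) * \<phi> \<one>\<^bsub>alg\<^esub>"
 proof -
  have "(\<Sum>i\<in>UNIV. wt i * (\<Sum>k\<in>UNIV. if k = i then Q ^ r * \<phi> (P [i, k]) else 0)) = Q ^ r * (Q ^ r * \<phi> \<one>\<^bsub>alg\<^esub>)"
   unfolding PP_eval(3)[OF \<phi>, symmetric] by (simp add: sum_distrib_left mult_ac)
  then show ?thesis
   unfolding trace_prodT z trace_product[OF \<phi>] using Q_nonzero by (simp add: field_simps)
 qed
 finally show ?thesis .
qed

lemma scalar_minus: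
 "(\<Sum>i\<in>UNIV. wt i * (\<Sum>k\<in>UNIV. full \<phi> (dbarP [i, k]) (riemann nabla (dP [k, i])))) =
  - (Q ^ 2 * cpm * (1 / Q ^ r * (Q ^ r * Q ^ r - 1)) * \<phi> \<one>\<^bsub>alg\<^esub>)
  - cpm / Q ^ r * \<phi> (ip g_mp) - Q ^ 2 / Q ^ r * cpm * \<phi> (ip g_mp \<otimes>\<^bsub>alg\<^esub> ip g_mp)"
proof -
 define e0 :: "'n legs" where "e0 = (%_. undefined)"
 have C: "(\<Sum>k\<in>UNIV. full \<phi> (dbarP [i, k]) (lact Om2Om (P [k, i]) (curv g_mp))) = 0" for i
 proof -
  have f: "functional Om (%\<omega>. full \<phi> \<omega> (curv g_mp))" by (rule full_functional(2)[OF \<phi>]) simp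
  have "full \<phi> (dbarP [i, k]) (lact Om2Om (P [k, i]) (curv g_mp)) = full \<phi> (ract Om (dbarP [i, k]) (P [k, i])) (curv g_mp)" for k
   by (simp add: full_def hmap_ract)
  then show ?thesis using dbarP_P[OF f] by simp
 qed
 have gc: "ip g_mp \<in> carrier alg" by simp
 have r: "full \<phi> (dbarP [i, k]) (riemann nabla (dP [k, i])) =
   Q ^ 2 * cpm * prodT (firstA \<phi> (dbarP [i, k])) (glue k i e0)
   - cpm / Q ^ r * \<phi> (ip (tt (dbarP [i, k]) (dP [k, i])))
   - Q ^ 2 / Q ^ r * cpm * \<phi> (ip (tt (dbarP [i, k]) (dP [k, i])) \<otimes>\<^bsub>alg\<^esub> ip g_mp)
   - Q ^ 2 / Q ^ r * full \<phi> (dbarP [i, k]) (lact Om2Om (P [k, i]) (curv g_mp))" for i k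
 proof -
  have e: "Q ^ 2 * cpm * (1 / (Q ^ r * Q ^ 2) * z) = cpm / Q ^ r * z" for z using Q_nonzero by (simp add: field_simps)
  show ?thesis
   using full_riemann_dP[OF \<phi> gens_in(2), of "[i, k]" "glue k i e0"]
   unfolding prodT_firstB[OF gens_in(2)] glue_simps e by (simp only: mult.assoc)
 qed
 have "(\<Sum>i\<in>UNIV. wt i * (\<Sum>k\<in>UNIV. full \<phi> (dbarP [i, k]) (riemann nabla (dP [k, i])))) =
   Q ^ 2 * cpm * (\<Sum>i\<in>UNIV. wt i * (\<Sum>k\<in>UNIV. prodT (firstA \<phi> (dbarP [i, k])) (glue k i e0)))
   - cpm / Q ^ r * (\<Sum>i\<in>UNIV. wt i * (\<Sum>k\<in>UNIV. \<phi> (ip (tt (dbarP [i, k]) (dP [k, i])))))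
   - Q ^ 2 / Q ^ r * cpm * (\<Sum>i\<in>UNIV. wt i * (\<Sum>k\<in>UNIV. \<phi> (ip (tt (dbarP [i, k]) (dP [k, i])) \<otimes>\<^bsub>alg\<^esub> ip g_mp)))
   - Q ^ 2 / Q ^ r * (\<Sum>i\<in>UNIV. wt i * (\<Sum>k\<in>UNIV. full \<phi> (dbarP [i, k]) (lact Om2Om (P [k, i]) (curv g_mp))))"
  unfolding r by (simp only: sum_subtractf right_diff_distrib sum_distrib_left mult_ac)
 then show ?thesis
  unfolding C sum_firstA g_eval(2)[OF ip_functional[OF mult_functional(2)[OF \<phi> gc]], symmetric] g_eval(2)[OF ip_functional[OF \<phi>], symmetric]
  by simp
qed

lemma scal_functional:
 "\<phi> (scal ip nabla sw) =
  (- cmp / Q ^ r * ((W / Q ^ r - 1) + (W / Q ^ r - 1) * (W / Q ^ r - 1))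
  - cpm * (Q ^ 2 * (1 / Q ^ r * (Q ^ r * Q ^ r - 1)) + 1 / Q ^ r * (W * Q ^ r - 1)
    + Q ^ 2 / Q ^ r * ((W * Q ^ r - 1) * (W * Q ^ r - 1)))) * \<phi> \<one>\<^bsub>alg\<^esub>"
proof -
 have rf: "functional OmOm (%t. \<phi> (ip (ricci_map t)))"
  by (rule functional_compose[OF ricci_map(1) ip_functional[OF \<phi>]])
 have "\<phi> (scal ip nabla sw) = \<phi> (ip (ricci_map metric))"
  by (simp add: scal_def ricci_def ricci_map_def)
 also have "\<dots> = \<phi> (ip (ricci_map g_pm)) + \<phi> (ip (ricci_map g_mp))"
  unfolding metric_def using OO.MN.functional_add[OF rf g_closed] .
 also have "\<dots> = (\<Sum>i\<in>UNIV. wt i * (\<Sum>k\<in>UNIV. full \<phi> (dP [i, k]) (riemann nabla (dbarP [k, i])))) +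
   (\<Sum>i\<in>UNIV. wt i * (\<Sum>k\<in>UNIV. full \<phi> (dbarP [i, k]) (riemann nabla (dP [k, i]))))"
  unfolding g_eval(1,2)[OF rf] by (simp add: ricci_map(2) full_def)
 finally have s: "\<phi> (scal ip nabla sw) = \<dots>" .
 have gc: "ip g_pm \<in> carrier alg" "ip g_mp \<in> carrier alg" by simp_all
 have collect: "- c1 / X * (g1 * p) - c1 / X * (g1 * (g1 * p)) + (- (Z * c2 * K * p) - c2 / X * (g2 * p) - Z / X * c2 * (g2 * (g2 * p))) =
   (- c1 / X * (g1 + g1 * g1) - c2 * (Z * K + 1 / X * g2 + Z / X * (g2 * g2))) * p" for c1 c2 g1 g2 X K Z p :: complex
  by (simp add: algebra_simps add_divide_distrib diff_divide_distrib)
 have m: "\<phi> (ip g_pm \<otimes>\<^bsub>alg\<^esub> ip g_pm) = (W / Q ^ r - 1) * ((W / Q ^ r - 1) * \<phi> \<one>\<^bsub>alg\<^esub>)"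
  "\<phi> (ip g_mp \<otimes>\<^bsub>alg\<^esub> ip g_mp) = (W * Q ^ r - 1) * ((W * Q ^ r - 1) * \<phi> \<one>\<^bsub>alg\<^esub>)"
  using ip_g_pm[OF mult_functional(2)[OF \<phi> gc(1)]] ip_g_mp[OF mult_functional(2)[OF \<phi> gc(2)]]
  by (simp_all add: ip_g_pm[OF \<phi>] ip_g_mp[OF \<phi>])
 show ?thesis
  unfolding s scalar_plus[OF \<phi>] scalar_minus m ip_g_pm[OF \<phi>] ip_g_mp[OF \<phi>]
  by (rule collect)
qed

end

text \<open>The closed form of the quantum dimension turns the sum of the two contributions into a product.\<close>

lemma scalar_identity:
 fixes X Q cp cm W :: complex
 assumes X: "X \<noteq> 0" and Q: "Q \<noteq> 0" "Q * Q \<noteq> 1" and d: "1 + Q ^ 2 * (X * X) \<noteq> 0"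
  and cp: "cp = 1 / (1 + Q ^ 2 * (X * X))" and cm: "cm = 1 / (1 + 1 / (Q ^ 2 * (X * X)))"
  and W: "W * (Q * Q - 1) = X * Q ^ 2 - 1 / X"
 shows "- cm / X * ((W / X - 1) + (W / X - 1) * (W / X - 1))
  - cp * (Q ^ 2 * (1 / X * (X * X - 1)) + 1 / X * (W * X - 1) + Q ^ 2 / X * ((W * X - 1) * (W * X - 1))) =
  - (Q / X) * ((X - 1 / X) / (Q - 1 / Q)) * ((X * Q - 1 / (X * Q)) / (Q - 1 / Q))"
proof -
 define u where "u = Q * Q"
 have u: "u \<noteq> 1" "u \<noteq> 0" using Q by (simp_all add: u_def)
 define D where "D = 1 + u * (X * X)"
 have D: "D \<noteq> 0" using d by (simp add: D_def u_def power2_eq_square)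
 have W': "W = (X * X * u - 1) / (X * (u - 1))"
  using W X u by (simp add: u_def[symmetric] power2_eq_square field_simps)
 have gp: "W / X - 1 = (X * X - 1) / (X * X * (u - 1))" "W * X - 1 = u * (X * X - 1) / (u - 1)"
  unfolding W' using X u by (simp_all add: field_simps)
 have cp': "cp = 1 / D" and cm': "cm = u * (X * X) / D"
  unfolding cp cm using X u D unfolding D_def by (simp_all add: u_def[symmetric] power2_eq_square field_simps)
 have r: "- (Q / X) * ((X - 1 / X) / (Q - 1 / Q)) * ((X * Q - 1 / (X * Q)) / (Q - 1 / Q)) =
   - ((X * X - 1) * (X * X * u - 1) * u) / (X * X * X * (u - 1) * (u - 1))"
 proof -
  have "Q - 1 / Q = (u - 1) / Q" "X - 1 / X = (X * X - 1) / X" "X * Q - 1 / (X * Q) = (X * X * u - 1) / (X * Q)"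
   using Q X by (simp_all add: u_def field_simps)
  moreover have "- (Q / X) * ((A / X) / (v / Q)) * ((B / (X * Q)) / (v / Q)) = - (A * B * (Q * Q)) / (X * X * X * v * v)"
   for A B v
   using Q X by (cases "v = 0") (simp_all add: field_simps)
  ultimately show ?thesis unfolding u_def[symmetric] by simp
 qed
 show ?thesis
  unfolding r gp cp' cm' power2_eq_square u_def[symmetric] using X u D
  by (simp add: divide_simps) (simp add: D_def algebra_simps)
qed

end

theorem corollary6p7:
 fixes q :: real and r s :: nat
  and V :: "('n::finite) uq_rep" and lam :: "'n \<Rightarrow> weight"
  and rp rm :: "'n form1 \<Rightarrow> 'n alg \<Rightarrow> 'n form1"
  and del delbar :: "'n alg \<Rightarrow> 'n form1"
  and ip :: "'n form_form \<Rightarrow> 'n alg"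
  and nabla :: "'n form \<Rightarrow> 'n form_form"
  and \<sigma> :: "'n form_form \<Rightarrow> 'n form_form"
  and sw :: "'n form2 \<Rightarrow> 'n form_form"
  and cpm cmp :: complex
 assumes "hk_calculus q r s V lam rp rm del delbar"
  and "hk_calculus.inverse_metric q r s V lam rp rm ip"
  and "hk_calculus.levi_civita q r s V lam rp rm del delbar nabla"
  and "hk_calculus.generalized_braiding q r s V lam rp rm \<sigma>"
  and "cpm = 1 / (1 + qpow q (wform r (simple_root s) (simple_root s))
            * qpow q (2 * wform r (fund_weight r s) (two_rho r)))"
  and "cmp = 1 / (1 + qpow q (- wform r (simple_root s) (simple_root s))
            * qpow q (- 2 * wform r (fund_weight r s) (two_rho r)))"
  and "hk_calculus.splitting_map q r s V lam rp rm del delbar \<sigma> cpm cmp sw"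
 shows "hk_calculus.scal q r s V lam rp rm del delbar ip nabla sw
  = complex_of_real (- (q powr (- real r + 1)) * qnumber q (real r) * qnumber q (real r + 1))
    \<odot>\<^bsub>quantum_projective_space.alg q r s V lam\<^esub> \<one>\<^bsub>quantum_projective_space.alg q r s V lam\<^esub>"
proof -
 interpret quantum_levi_civita q r s V lam rp rm del delbar ip nabla \<sigma> sw cpm cmp
  by (intro quantum_levi_civita.intro quantum_levi_civita_axioms.intro assms)
 let ?X = "Q ^ r"
 define c where "c = - (q powr (- real r + 1)) * qnumber q (real r) * qnumber q (real r + 1)"
 have X: "?X \<noteq> 0" using Q_nonzero by simp
 have Q1: "Q * Q \<noteq> 1"
 proof -
  have "q * q < 1" using q_pos mult_strict_mono[of q 1 q 1] by simp
  then have "complex_of_real (q * q) \<noteq> 1" unfolding of_real_eq_1_iff by simp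
  then show ?thesis by simp
 qed
 have d: "1 + Q ^ 2 * (?X * ?X) \<noteq> 0"
 proof -
  have "0 < 1 + q ^ 2 * (q ^ r * q ^ r)" using q_pos by (simp add: add_pos_pos)
  moreover have "1 + Q ^ 2 * (?X * ?X) = complex_of_real (1 + q ^ 2 * (q ^ r * q ^ r))" by simp
  ultimately show ?thesis by (simp only: of_real_eq_0_iff)
 qed
 have sq: "qpow q (2 * x) = qpow q x * qpow q x" for x
  using qpow_add[OF q_pos(1), of x x] by simp
 have cp: "cpm = 1 / (1 + Q ^ 2 * (?X * ?X))"
  unfolding assms(5) par_a_def[symmetric] par_m_def[symmetric] sq qpow_a qpow_m ..
 have neg: "- 2 * x = - (2 * x)" for x :: real by simp
 have cm: "cmp = 1 / (1 + 1 / (Q ^ 2 * (?X * ?X)))"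
  unfolding assms(6) par_a_def[symmetric] par_m_def[symmetric] neg qpow_minus[OF q_pos(1)] sq qpow_a qpow_m by simp
 have W: "W * (Q * Q - 1) = ?X * Q ^ 2 - 1 / ?X"
  unfolding W_def weight_sum using Q_nonzero by (simp add: power_add power2_eq_square)
 have pr: "q powr real n = q ^ n" "q powr - real n = 1 / q ^ n" for n
  using q_pos by (simp_all add: powr_realpow powr_minus divide_inverse)
 have p0: "q powr (- real r + 1) = q / q ^ r"
 proof -
  have "- real r + 1 = 1 - real r" by simp
  then show ?thesis using q_pos pr(1)[of r] powr_diff[of q 1 "real r"] by simp
 qed
 have p1: "q powr (real r + 1) = q ^ r * q" "q powr (- (real r + 1)) = 1 / (q ^ r * q)" "q powr - 1 = 1 / q"
  using q_pos pr(1)[of r] pr(2)[of r] pr(1)[of "Suc r"] pr(2)[of "Suc r"]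
  by (simp_all add: powr_add powr_minus divide_inverse add.commute)
 have c: "complex_of_real c = - (Q / ?X) * ((?X - 1 / ?X) / (Q - 1 / Q)) * ((?X * Q - 1 / (?X * Q)) / (Q - 1 / Q))"
  unfolding c_def qnumber_def p0 p1 pr by simp
 have "scal ip nabla sw = complex_of_real c \<odot>\<^bsub>alg\<^esub> \<one>\<^bsub>alg\<^esub>"
 proof (rule alg.Bv.functional_eqI)
  have "metric \<in> carrier OmOm" unfolding metric_def by simp
  then show "scal ip nabla sw \<in> carrier alg"
   using clinear_mapD(1)[OF ricci_map(1)] by (simp add: scal_def ricci_def ricci_map_def)
  fix \<phi> assume \<phi>: "functional alg \<phi>"
  show "\<phi> (scal ip nabla sw) = \<phi> (complex_of_real c \<odot>\<^bsub>alg\<^esub> \<one>\<^bsub>alg\<^esub>)"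
   unfolding scal_functional[OF \<phi>] scalar_identity[OF X Q_nonzero Q1 d cp cm W] c[symmetric]
   by (simp add: alg.Bv.functional_smult[OF \<phi>])
 qed simp
 then show ?thesis unfolding c_def .
qed

end
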